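(* Let $T\in\mathbf{M}_n(\mathbb{R}^n)$ be a top-dimensional Ambrosio–Kirchheim metric current, i.e. an $n$-dimensional metric current in $\mathbb{R}^n$. Then its mass measure $\|T\|$ is absolutely continuous with respect to the Lebesgue measure $\mathscr{L}^n$.
   Context: Ambrosio–Kirchheim metric currents. Let $E$ be a complete metric space (here $E=\mathbb{R}^n$ with the Euclidean distance) and $k\ge 1$. Let $\mathcal{D}^k(E)$ be the set of $(k+1)$-tuples $(f,\pi_1,\ldots,\pi_k)$ of Lipschitz real-valued functions on $E$ with $f$ bounded. A $k$-dimensional metric current $T\in\mathbf{M}_k(E)$ is a function $T:\mathcal{D}^k(E)\to\mathbb{R}$, written $T(f\,d\pi_1\wedge\cdots\wedge d\pi_k):=T(f,\pi_1,\ldots,\pi_k)$, such that: (i) (multilinearity) $T$ is linear in each of $f,\pi_1,\ldots,\pi_k$; (ii) (continuity) $\lim_{i\to\infty}T(f,\pi_1^i,\ldots,\pi_k^i)=T(f,\pi_1,\ldots,\pi_k)$ whenever, for each $m=1,\dots,k$, $\pi_m^i\to\pi_m$ pointwise in $E$ as $i\to\infty$ with $\sup_{i}\mathrm{Lip}(\pi_m^i)<\infty$; (iii) (locality) $T(f,\pi_1,\ldots,\pi_k)=0$ if for some $m\in\{1,\ldots,k\}$ the function $\pi_m$ is constant on a neighbourhood of $\{f\neq 0\}$; (iv) (finite mass) there exists a finite positive Borel measure $\nu$ on $E$ such that $$|T(f,\pi_1,\ldots,\pi_k)|\leq\prod_{m=1}^k\mathrm{Lip}(\pi_m)\int_E|f|\,d\nu\qquad\text{for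 all }(f,\pi_1,\ldots,\pi_k)\in\mathcal{D}^k(E).$$ The minimal measure $\nu$ satisfying (iv) exists; it is called the mass of $T$ and denoted $\|T\|$. $\mathrm{Lip}(\pi)$ denotes the Lipschitz constant of $\pi$. *)

theory Defs
  imports "HOL-Analysis.Analysis"
begin

definition lipschitz :: "('a::metric_space \<Rightarrow> real) \<Rightarrow> bool" where
  "lipschitz f \<longleftrightarrow> (\<exists>L. L-lipschitz_on UNIV f)"

definition Lip :: "('a::metric_space \<Rightarrow> real) \<Rightarrow> real" where
  "Lip f = Inf {L. L-lipschitz_on UNIV f}"

(* The tuple (f, \<pi>\<^sub>1, ..., \<pi>\<^sub>k) is encoded as a function f and a list \<pi> of length k;
   list positions start at 0, so \<pi>\<^sub>m is \<pi> ! (m - 1). *)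
definition metric_forms :: "nat \<Rightarrow> (('a::metric_space \<Rightarrow> real) \<times> ('a \<Rightarrow> real) list) set" where
  "metric_forms k = {(f, \<pi>). bounded (range f) \<and> lipschitz f \<and>
     length \<pi> = k \<and> (\<forall>p\<in>set \<pi>. lipschitz p)}"

(* A functional T is a total function, but only its values on metric_forms k matter:
   every condition below is restricted to that set. *)
type_synonym 'a metric_functional = "('a \<Rightarrow> real) \<Rightarrow> ('a \<Rightarrow> real) list \<Rightarrow> real"

definition multilinear_forms :: "nat \<Rightarrow> 'a::metric_space metric_functional \<Rightarrow> bool" where
  "multilinear_forms k T \<longleftrightarrow>
     (\<forall>f g \<pi> a b. (f, \<pi>) \<in> metric_forms k \<longrightarrow> (g, \<pi>) \<in> metric_forms k \<longrightarrow>
        T (\<lambda>x. a * f x + b * g x) \<pi> = a * T f \<pi> + b * T g \<pi>) \<and>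
     (\<forall>f \<pi> m p q a b. (f, \<pi>) \<in> metric_forms k \<longrightarrow> m < k \<longrightarrow> lipschitz p \<longrightarrow> lipschitz q \<longrightarrow>
        T f (\<pi>[m := \<lambda>x. a * p x + b * q x]) = a * T f (\<pi>[m := p]) + b * T f (\<pi>[m := q]))"

definition continuous_forms :: "nat \<Rightarrow> 'a::metric_space metric_functional \<Rightarrow> bool" where
  "continuous_forms k T \<longleftrightarrow>
     (\<forall>f \<pi> \<pi>s. (f, \<pi>) \<in> metric_forms k \<longrightarrow> (\<forall>i::nat. (f, \<pi>s i) \<in> metric_forms k) \<longrightarrow>
        (\<forall>m<k. (\<forall>x. (\<lambda>i. (\<pi>s i ! m) x) \<longlonglongrightarrow> (\<pi> ! m) x) \<and>
               bdd_above (range (\<lambda>i. Lip (\<pi>s i ! m)))) \<longrightarrow>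
        (\<lambda>i. T f (\<pi>s i)) \<longlonglongrightarrow> T f \<pi>)"

definition local_forms :: "nat \<Rightarrow> 'a::metric_space metric_functional \<Rightarrow> bool" where
  "local_forms k T \<longleftrightarrow>
     (\<forall>f \<pi>. (f, \<pi>) \<in> metric_forms k \<longrightarrow>
        (\<exists>m<k. \<exists>U. open U \<and> {x. f x \<noteq> 0} \<subseteq> U \<and> (\<pi> ! m) constant_on U) \<longrightarrow>
        T f \<pi> = 0)"

definition mass_bound :: "nat \<Rightarrow> 'a::metric_space metric_functional \<Rightarrow> 'a measure \<Rightarrow> bool" where
  "mass_bound k T \<nu> \<longleftrightarrow> sets \<nu> = sets borel \<and> finite_measure \<nu> \<and>
     (\<forall>(f, \<pi>)\<in>metric_forms k. \<bar>T f \<pi>\<bar> \<le> (\<Prod>m<k. Lip (\<pi> ! m)) * (\<integral>x. \<bar>f x\<bar> \<partial>\<nu>))"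

definition metric_current :: "nat \<Rightarrow> 'a::complete_space metric_functional \<Rightarrow> bool" where
  "metric_current k T \<longleftrightarrow> 1 \<le> k \<and> multilinear_forms k T \<and> continuous_forms k T \<and>
     local_forms k T \<and> (\<exists>\<nu>. mass_bound k T \<nu>)"

(* On measures with the same sigma-algebra, the library's order on type measure is the setwise
   one (lemma le_measure), so this is the least measure admissible in the finite mass axiom. *)
definition current_mass :: "nat \<Rightarrow> 'a::complete_space metric_functional \<Rightarrow> 'a measure" where
  "current_mass k T = (LEAST \<nu>. mass_bound k T \<nu>)"

end

theory Submission
  imports Defs "HOL-Analysis.Analysis" "HOL-Library.Groups_Big_Fun"
begin

text \<open>
  A current extends to forms whose first entry is a bounded Borel function; the extension is
  alternating in the remaining entries and obeys the chain rule for functions with Lipschitz partial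
  derivatives. Suppose that, with a permutation of the coordinate functions in the remaining entries,
  it has a sign and does not vanish on a Lebesgue null set \<open>P\<close>, and let \<open>\<mu>\<close> be the measure that it
  induces on \<open>P\<close>. There are vector fields \<open>W\<close> with bounded derivatives, arbitrarily small supremum
  and \<open>\<integral> div W d\<mu> \<ge> \<mu>(P) / 4\<close>. By the chain rule this integral is the sum of the values obtained by
  replacing one coordinate function by the corresponding component of \<open>W\<close>, and by continuity these
  values tend to 0 as \<open>W\<close> does. Hence the current vanishes on null sets, for coordinate functions and,
  by approximation with splines, for all Lipschitz functions. So the restriction of the mass to the
  complement of a null set is still admissible in the finite mass axiom, and minimality gives the claim.

  The field \<open>W\<close> is built on a fine lattice. As \<open>\<mu>\<close> is singular, most of it lies on dyadic blocks of high
  density, whose total volume is small. If \<open>h\<close> is the indicator of a neighbourhood of these blocks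
  and \<open>\<alpha> \<psi> - \<Delta> \<psi> = h\<close>, then \<open>v = - \<nabla> \<psi>\<close> has divergence \<open>h - \<alpha> \<psi> \<ge> 1/2\<close> on them. The energy
  identity bounds the second differences of \<open>\<psi>\<close> in mean square; a stopping-time form of the maximal
  inequality and the mean value inequality for solutions make this bound pointwise outside a set of
  small \<open>\<mu>\<close>-measure, and a Lipschitz extension followed by spline interpolation turns \<open>v\<close> into \<open>W\<close>.
\<close>

subsection \<open>Finite differences on the integer lattice\<close>

text \<open>The continuity axiom controls a perturbed slot only along sequences with bounded
  Lipschitz constants, so the derivative bound of \<open>W\<close> must not depend on how small
  \<open>W\<close> is. It comes from a weak-type estimate: local means of the squared Hessian of
  \<psi> exceed A^2 only on a set of volume of order energy / A^2. Volume turns into \<mu>-mass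
  because scales are stopped at the largest dyadic block above the density threshold: at every
  larger scale the density is at most 2^n times the threshold. The energy is at most a constant
  times mass / threshold, the threshold cancels, and a fraction of order A^-2 of the mass is lost.
  Off the good set the divergence is only known to be of size A, which costs A * A^-2 and is beaten
  by a large fixed \<open>A\<close>; a loss of order 1/A would not do. The zero-order term with
  \<alpha> = 4^-p0 screens at distance 2^p0 and bounds \<psi> by 4^p0 in every dimension. On a
  lattice the energy identity and the interior estimates are finite summations by parts; splines
  then interpolate because their partial derivatives are exactly splines of the lattice
  differences.\<close>

definition unit_step :: "'n \<Rightarrow> int ^ 'n" where
  "unit_step i = axis i 1"

definition fdiff :: "'n \<Rightarrow> (int ^ 'n \<Rightarrow> real) \<Rightarrow> int ^ 'n \<Rightarrow> real" where
  "fdiff i u z = u (z + unit_step i) - u z"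

definition bdiff :: "'n \<Rightarrow> (int ^ 'n \<Rightarrow> real) \<Rightarrow> int ^ 'n \<Rightarrow> real" where
  "bdiff i u z = u z - u (z - unit_step i)"

definition neighbour_sum :: "(int ^ 'n \<Rightarrow> real) \<Rightarrow> int ^ 'n \<Rightarrow> real" where
  "neighbour_sum u z = (\<Sum>i\<in>UNIV. u (z + unit_step i) + u (z - unit_step i))"

definition laplace :: "(int ^ 'n \<Rightarrow> real) \<Rightarrow> int ^ 'n \<Rightarrow> real" where
  "laplace u z = neighbour_sum u z - 2 * real CARD('n) * u z"

text \<open>\<open>Sum_any\<close> is 0 by default on a function with infinite support, so finite
  support is the side condition under which it behaves like a sum.\<close>

abbreviation fsupp :: "('a \<Rightarrow> real) \<Rightarrow> bool" where
  "fsupp u \<equiv> finite {z. u z \<noteq> 0}"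

lemma unit_step_nth [simp]: "unit_step i $ j = (if j = i then 1 else 0)"
  by (simp add: unit_step_def axis_def)

lemma fsupp_shift: "fsupp u \<Longrightarrow> fsupp (\<lambda>z. u (z + a :: 'a :: ab_group_add))"
  using finite_vimageI[of "{z. u z \<noteq> 0}" "\<lambda>z. z + a"] by (simp add: vimage_def)

lemma fsupp_shift_minus: "fsupp u \<Longrightarrow> fsupp (\<lambda>z. u (z - a :: 'a :: ab_group_add))"
  using fsupp_shift[of u "-a"] by simp

lemma fsupp_add: "fsupp u \<Longrightarrow> fsupp v \<Longrightarrow> fsupp (\<lambda>z. u z + v z)"
  by (rule finite_subset[of _ "{z. u z \<noteq> 0} \<union> {z. v z \<noteq> 0}"]) auto

lemma fsupp_diff: "fsupp u \<Longrightarrow> fsupp v \<Longrightarrow> fsupp (\<lambda>z. u z - v z)"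
  by (rule finite_subset[of _ "{z. u z \<noteq> 0} \<union> {z. v z \<noteq> 0}"]) auto

lemma fsupp_mult1: "fsupp u \<Longrightarrow> fsupp (\<lambda>z. u z * v z)"
  by (rule finite_subset[of _ "{z. u z \<noteq> 0}"]) auto

lemma fsupp_mult2: "fsupp v \<Longrightarrow> fsupp (\<lambda>z. u z * v z)"
  by (rule finite_subset[of _ "{z. v z \<noteq> 0}"]) auto

lemma fsupp_power2: "fsupp u \<Longrightarrow> fsupp (\<lambda>z. (u z)\<^sup>2)"
  by (rule finite_subset[of _ "{z. u z \<noteq> 0}"]) auto

lemma fsupp_divide: "fsupp u \<Longrightarrow> fsupp (\<lambda>z. u z / c)"
  by (rule finite_subset[of _ "{z. u z \<noteq> 0}"]) auto

lemma fsupp_sum: "(\<And>i. i \<in> I \<Longrightarrow> fsupp (u i)) \<Longrightarrow> fsupp (\<lambda>z. \<Sum>i\<in>I. u i z)"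
proof (induction I rule: infinite_finite_induct)
  case (insert i I)
  then show ?case using fsupp_add[of "u i" "\<lambda>z. \<Sum>i\<in>I. u i z"] by simp
qed auto

lemma fsupp_fdiff: "fsupp u \<Longrightarrow> fsupp (fdiff i u)"
  using fsupp_diff[OF fsupp_shift] unfolding fdiff_def by blast

lemma fsupp_bdiff: "fsupp u \<Longrightarrow> fsupp (bdiff i u)"
  using fsupp_diff[OF _ fsupp_shift_minus] unfolding bdiff_def by blast

lemma fsupp_neighbour_sum: "fsupp u \<Longrightarrow> fsupp (neighbour_sum u)"
  unfolding neighbour_sum_def
  by (intro fsupp_sum fsupp_add fsupp_shift fsupp_shift_minus)

lemma fsupp_laplace: "fsupp u \<Longrightarrow> fsupp (laplace u)"
  unfolding laplace_def
  by (intro fsupp_diff fsupp_neighbour_sum fsupp_mult2)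

lemma Sum_any_shift: "Sum_any (\<lambda>z. f (z + a :: 'a :: ab_group_add)) = (Sum_any f :: real)"
  by (rule Sum_any.reindex_cong[symmetric, of "\<lambda>z. z + a"])
     (auto simp: bij_def inj_def o_def surj_def intro: exI[of _ "_ - a"])

lemma Sum_any_add: "fsupp f \<Longrightarrow> fsupp g \<Longrightarrow> Sum_any (\<lambda>z. f z + g z) = Sum_any f + Sum_any g"
  by (rule Sum_any.distrib)

lemma Sum_any_scale: "Sum_any (\<lambda>z. c * f z) = c * (Sum_any f :: real)"
  by (cases "c = 0") (auto simp: Sum_any.expand_set sum_distrib_left)

lemma Sum_any_diff:
  assumes "fsupp f" "fsupp g"
  shows "Sum_any (\<lambda>z. f z - g z) = Sum_any f - Sum_any g"
  using Sum_any_add[OF assms(1), of "\<lambda>z. - 1 * g z"] assms(2) Sum_any_scale[of "-1" g] by simp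

lemma Sum_any_sum:
  assumes "finite I" "\<And>i. i \<in> I \<Longrightarrow> fsupp (u i)"
  shows "Sum_any (\<lambda>z. \<Sum>i\<in>I. u i z) = (\<Sum>i\<in>I. Sum_any (u i))"
  using assms
proof (induction I)
  case (insert i I)
  then show ?case using Sum_any_add[of "u i" "\<lambda>z. \<Sum>i\<in>I. u i z"] fsupp_sum[of I u] by simp
qed simp

lemma Sum_any_mono:
  assumes "fsupp f" "fsupp g" "\<And>z. f z \<le> g z"
  shows "Sum_any f \<le> Sum_any g"
proof -
  let ?S = "{z. f z \<noteq> 0} \<union> {z. g z \<noteq> 0}"
  have "Sum_any f = sum f ?S" "Sum_any g = sum g ?S"
    using assms(1,2) by (auto intro!: Sum_any.expand_superset)
  then show ?thesis using assms(3) by (simp add: sum_mono)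
qed

lemma sum_le_Sum_any:
  assumes "fsupp f" "\<And>z. 0 \<le> f z" "finite B"
  shows "sum f B \<le> Sum_any f"
proof -
  have "sum f B \<le> sum f ({z. f z \<noteq> 0} \<union> B)" using assms by (intro sum_mono2) auto
  also have "\<dots> = Sum_any f" using assms by (intro Sum_any.expand_superset[symmetric]) auto
  finally show ?thesis .
qed

lemma Sum_any_nonneg: "(\<And>z. 0 \<le> f z) \<Longrightarrow> 0 \<le> (Sum_any f :: real)"
  by (simp add: Sum_any.expand_set sum_nonneg)

text \<open>Summation by parts: minus the backward difference is the adjoint of the forward one. One
  finitely supported factor is enough, so a cutoff can be tested against functions with infinite
  support.\<close>

lemma Sum_any_fdiff_mult:
  assumes "fsupp f"
  shows "Sum_any (\<lambda>z. fdiff i f z * g z) = - Sum_any (\<lambda>z. f z * bdiff i g z)"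
proof -
  have fs: "fsupp (\<lambda>z. f z * g z)" "fsupp (\<lambda>z. f z * g (z - unit_step i))"
    using assms by (auto intro!: fsupp_mult1)
  have "Sum_any (\<lambda>z. fdiff i f z * g z)
      = Sum_any (\<lambda>z. f (z + unit_step i) * g (z + unit_step i - unit_step i) - f z * g z)"
    by (simp add: fdiff_def algebra_simps)
  also have "\<dots> = Sum_any (\<lambda>z. f z * g (z - unit_step i)) - Sum_any (\<lambda>z. f z * g z)"
    using Sum_any_diff[OF fsupp_shift[OF fs(2), of "unit_step i"] fs(1)]
      Sum_any_shift[of "\<lambda>z. f z * g (z - unit_step i)" "unit_step i"] by simp
  also have "\<dots> = - Sum_any (\<lambda>z. f z * bdiff i g z)"
    using Sum_any_diff[OF fs] by (simp add: bdiff_def algebra_simps)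
  finally show ?thesis .
qed

lemma Sum_any_bdiff_mult:
  assumes "fsupp f"
  shows "Sum_any (\<lambda>z. bdiff i f z * g z) = - Sum_any (\<lambda>z. f z * fdiff i g z)"
proof -
  have fs: "fsupp (\<lambda>z. f z * g z)" "fsupp (\<lambda>z. f z * g (z + unit_step i))"
    using assms by (auto intro!: fsupp_mult1)
  have "Sum_any (\<lambda>z. bdiff i f z * g z)
      = Sum_any (\<lambda>z. f z * g z - f (z - unit_step i) * g (z - unit_step i + unit_step i))"
    by (simp add: bdiff_def algebra_simps)
  also have "\<dots> = Sum_any (\<lambda>z. f z * g z) - Sum_any (\<lambda>z. f z * g (z + unit_step i))"
    using Sum_any_diff[OF fs(1) fsupp_shift_minus[OF fs(2), of "unit_step i"]]
      Sum_any_shift[of "\<lambda>z. f z * g (z + unit_step i)" "- unit_step i"] by simp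
  also have "\<dots> = - Sum_any (\<lambda>z. f z * fdiff i g z)"
    using Sum_any_diff[OF fs(2,1)] by (simp add: fdiff_def algebra_simps)
  finally show ?thesis .
qed

lemma bdiff_fdiff_commute: "bdiff i (fdiff j u) = fdiff j (bdiff i u)"
  by (auto simp: fdiff_def bdiff_def algebra_simps)

lemma laplace_eq: "laplace u z = (\<Sum>i\<in>UNIV. fdiff i (bdiff i u) z)"
  by (simp add: laplace_def neighbour_sum_def fdiff_def bdiff_def sum_subtractf sum.distrib algebra_simps)

text \<open>The discrete form of the identity between the integrals of |D^2 w|^2 and (\<Delta> w)^2.
  Differences commute, so two summations by parts exchange the indices, and finite support leaves no
  boundary terms. Mixing forward and backward differences makes the trace exactly
  \<open>laplace\<close>.\<close>

lemma Sum_any_hessian: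
  fixes w :: "int ^ 'n \<Rightarrow> real"
  assumes "fsupp w"
  shows "Sum_any (\<lambda>z. \<Sum>i\<in>UNIV. \<Sum>j\<in>UNIV. (fdiff j (bdiff i w) z)\<^sup>2) = Sum_any (\<lambda>z. (laplace w z)\<^sup>2)"
proof -
  have key: "Sum_any (\<lambda>z. (fdiff j (bdiff i w) z)\<^sup>2)
      = Sum_any (\<lambda>z. fdiff i (bdiff i w) z * fdiff j (bdiff j w) z)" for i j
  proof -
    define G where "G = fdiff j (bdiff j w)"
    have fG: "fsupp G" unfolding G_def by (intro fsupp_fdiff fsupp_bdiff assms)
    have "Sum_any (\<lambda>z. (fdiff j (bdiff i w) z)\<^sup>2)
        = Sum_any (\<lambda>z. fdiff j (bdiff i w) z * fdiff j (bdiff i w) z)"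
      by (simp add: power2_eq_square)
    also have "\<dots> = - Sum_any (\<lambda>z. bdiff i w z * bdiff i G z)"
      using Sum_any_fdiff_mult[OF fsupp_bdiff[OF assms]]
      by (simp add: G_def bdiff_fdiff_commute) (simp add: bdiff_def fdiff_def algebra_simps)
    also have "\<dots> = - Sum_any (\<lambda>z. bdiff i G z * bdiff i w z)" by (simp add: mult.commute)
    also have "\<dots> = Sum_any (\<lambda>z. G z * fdiff i (bdiff i w) z)"
      using Sum_any_bdiff_mult[OF fG] by simp
    finally show ?thesis by (simp add: G_def mult.commute)
  qed
  have fs: "fsupp (\<lambda>z. (fdiff j (bdiff i w) z)\<^sup>2)"
     "fsupp (\<lambda>z. fdiff i (bdiff i w) z * fdiff j (bdiff j w) z)" for i j
    by (auto intro!: fsupp_power2 fsupp_mult1 fsupp_fdiff fsupp_bdiff assms)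
  have "Sum_any (\<lambda>z. \<Sum>i\<in>UNIV. \<Sum>j\<in>UNIV. (fdiff j (bdiff i w) z)\<^sup>2)
     = (\<Sum>i\<in>UNIV. \<Sum>j\<in>UNIV. Sum_any (\<lambda>z. (fdiff j (bdiff i w) z)\<^sup>2))"
    using fs by (simp add: Sum_any_sum fsupp_sum)
  also have "\<dots> = Sum_any (\<lambda>z. \<Sum>i\<in>UNIV. \<Sum>j\<in>UNIV. fdiff i (bdiff i w) z * fdiff j (bdiff j w) z)"
    using fs unfolding key by (simp add: Sum_any_sum fsupp_sum)
  also have "\<dots> = Sum_any (\<lambda>z. (laplace w z)\<^sup>2)"
    by (simp add: laplace_eq power2_eq_square sum_product)
  finally show ?thesis .
qed

lemma Sum_any_laplace_nonpos:
  assumes "fsupp w"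
  shows "Sum_any (\<lambda>z. w z * laplace w z) \<le> 0"
proof -
  have "Sum_any (\<lambda>z. w z * laplace w z) = (\<Sum>i\<in>UNIV. Sum_any (\<lambda>z. w z * fdiff i (bdiff i w) z))"
    by (simp add: laplace_eq sum_distrib_left Sum_any_sum fsupp_mult1 assms)
  also have "\<dots> = (\<Sum>i\<in>UNIV. - Sum_any (\<lambda>z. (bdiff i w z)\<^sup>2))"
    using Sum_any_bdiff_mult[OF assms] by (simp add: power2_eq_square)
  also have "\<dots> \<le> 0" by (intro sum_nonpos) (simp add: Sum_any_nonneg)
  finally show ?thesis .
qed

text \<open>When the square is expanded, the cross term has the favourable sign by
  \<open>Sum_any_laplace_nonpos\<close>; hence the bound is uniform in \<alpha>.\<close>

lemma Sum_any_hessian_le: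
  fixes w :: "int ^ 'n \<Rightarrow> real"
  assumes "fsupp w" "0 \<le> \<alpha>"
  shows "Sum_any (\<lambda>z. \<Sum>i\<in>UNIV. \<Sum>j\<in>UNIV. (fdiff j (bdiff i w) z)\<^sup>2)
       \<le> Sum_any (\<lambda>z. (\<alpha> * w z - laplace w z)\<^sup>2)"
proof -
  have fs: "fsupp (\<lambda>z. \<alpha>\<^sup>2 * (w z)\<^sup>2)" "fsupp (\<lambda>z. 2 * \<alpha> * (w z * laplace w z))"
     "fsupp (\<lambda>z. (laplace w z)\<^sup>2)"
    using assms(1) by (auto intro!: fsupp_mult2 fsupp_mult1 fsupp_power2 fsupp_laplace)
  have "Sum_any (\<lambda>z. (\<alpha> * w z - laplace w z)\<^sup>2)
     = Sum_any (\<lambda>z. (\<alpha>\<^sup>2 * (w z)\<^sup>2 - 2 * \<alpha> * (w z * laplace w z)) + (laplace w z)\<^sup>2)"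
    by (simp add: power2_eq_square algebra_simps)
  also have "\<dots> = Sum_any (\<lambda>z. \<alpha>\<^sup>2 * (w z)\<^sup>2) - Sum_any (\<lambda>z. 2 * \<alpha> * (w z * laplace w z))
      + Sum_any (\<lambda>z. (laplace w z)\<^sup>2)"
    using fs Sum_any_add[OF fsupp_diff[OF fs(1,2)] fs(3)] Sum_any_diff[OF fs(1,2)] by simp
  also have "Sum_any (\<lambda>z. 2 * \<alpha> * (w z * laplace w z)) \<le> 0"
    using Sum_any_laplace_nonpos[OF assms(1)] assms(2)
    by (simp only: Sum_any_scale) (simp add: mult_nonneg_nonpos)
  moreover have "Sum_any (\<lambda>z. \<alpha>\<^sup>2 * (w z)\<^sup>2) \<ge> 0" by (intro Sum_any_nonneg) simp
  ultimately show ?thesis using Sum_any_hessian[OF assms(1)] by linarith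
qed

subsection \<open>The resolvent of the lattice Laplacian\<close>

text \<open>Jacobi iteration for \<alpha> \<psi> - \<Delta> \<psi> = h: the diagonal of the operator
  is \<alpha> + 2n. Starting from 0 keeps all iterates finitely supported, so the energy identity
  applies to them although their limit may have infinite support.\<close>

fun jacobi :: "real \<Rightarrow> (int ^ 'n \<Rightarrow> real) \<Rightarrow> nat \<Rightarrow> int ^ 'n \<Rightarrow> real" where
  "jacobi \<alpha> h 0 = (\<lambda>_. 0)"
| "jacobi \<alpha> h (Suc k) = (\<lambda>z. (h z + neighbour_sum (jacobi \<alpha> h k) z) / (\<alpha> + 2 * real CARD('n)))"

declare jacobi.simps(2) [simp del]

lemma neighbour_sum_mono: "(\<And>z. u z \<le> v z) \<Longrightarrow> neighbour_sum u z \<le> neighbour_sum v z"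
  unfolding neighbour_sum_def by (intro sum_mono add_mono) auto

lemma neighbour_sum_const: "neighbour_sum (\<lambda>_. c) (z :: int ^ 'n) = 2 * real CARD('n) * c"
  by (simp add: neighbour_sum_def)

lemma neighbour_sum_diff: "neighbour_sum (\<lambda>z. u z - v z) z = neighbour_sum u z - neighbour_sum v z"
  by (simp add: neighbour_sum_def sum_subtractf sum.distrib algebra_simps)

lemma neighbour_sum_scale: "neighbour_sum (\<lambda>z. c * u z) z = c * neighbour_sum u z"
  by (simp add: neighbour_sum_def sum_distrib_left algebra_simps)

lemma Sum_any_neighbour_sum:
  fixes u :: "int ^ 'n \<Rightarrow> real"
  assumes "fsupp u"
  shows "Sum_any (neighbour_sum u) = 2 * real CARD('n) * Sum_any u"
proof -
  have "Sum_any (\<lambda>z. u (z + unit_step i) + u (z - unit_step i)) = 2 * Sum_any u" for i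
    using Sum_any_add[OF fsupp_shift[OF assms] fsupp_shift_minus[OF assms]]
      Sum_any_shift[of u "unit_step i"] Sum_any_shift[of u "- unit_step i"] by simp
  then show ?thesis
    unfolding neighbour_sum_def
    by (subst Sum_any_sum) (auto intro!: fsupp_add fsupp_shift fsupp_shift_minus assms)
qed

text \<open>The iterates increase and stay below 1/\<alpha>, hence converge pointwise. Each
  satisfies the energy bound up to a residual that is as harmless as \<open>h\<close> itself, which
  explains the factor 2; on a finite set the bound passes to the limit.\<close>

lemma resolvent_exists:
  fixes h :: "int ^ 'n \<Rightarrow> real"
  assumes h: "fsupp h" "\<And>z. 0 \<le> h z" "\<And>z. h z \<le> 1" and \<alpha>: "0 < \<alpha>"
  obtains \<psi> where "\<And>z. \<alpha> * \<psi> z - laplace \<psi> z = h z" "\<And>z. 0 \<le> \<psi> z" "\<And>z. \<psi> z \<le> 1 / \<alpha>"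
    "\<And>B. finite B \<Longrightarrow> (\<Sum>z\<in>B. \<Sum>i\<in>UNIV. \<Sum>j\<in>UNIV. (fdiff j (bdiff i \<psi>) z)\<^sup>2) \<le> 2 * Sum_any h"
proof -
  define \<beta> where "\<beta> = \<alpha> + 2 * real CARD('n)"
  have \<beta>: "\<beta> > 0" "2 * real CARD('n) \<le> \<beta>" using \<alpha> by (auto simp: \<beta>_def)
  let ?J = "jacobi \<alpha> h"
  have rec: "?J (Suc k) z = (h z + neighbour_sum (?J k) z) / \<beta>" for k z by (simp add: \<beta>_def jacobi.simps(2))
  have J0: "0 \<le> ?J k z" for k z
  proof (induction k arbitrary: z)
    case (Suc k)
    have "0 \<le> neighbour_sum (?J k) z" unfolding neighbour_sum_def using Suc by (intro sum_nonneg) auto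
    then show ?case unfolding rec using h(2)[of z] \<beta> by simp
  qed simp
  have J1: "?J k z \<le> 1 / \<alpha>" for k z
  proof (induction k arbitrary: z)
    case (Suc k)
    have "neighbour_sum (?J k) z \<le> 2 * real CARD('n) * (1 / \<alpha>)"
      using neighbour_sum_mono[of "?J k" "\<lambda>_. 1/\<alpha>" z] Suc by (simp add: neighbour_sum_const)
    then have "h z + neighbour_sum (?J k) z \<le> \<beta> / \<alpha>"
      using h(3)[of z] \<alpha> by (simp add: \<beta>_def add_divide_distrib)
    then show ?case unfolding rec using \<beta> \<alpha> by (simp add: field_simps)
  qed (use \<alpha> in simp)
  have Jmono: "?J k z \<le> ?J (Suc k) z" for k z
  proof (induction k arbitrary: z)
    case 0 then show ?case using J0[of "Suc 0"] by simp
  next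
    case (Suc k)
    have "neighbour_sum (?J k) z \<le> neighbour_sum (?J (Suc k)) z"
      by (rule neighbour_sum_mono) (rule Suc)
    then show ?case unfolding rec[of "Suc k"] rec[of k] using \<beta> by (simp add: divide_right_mono)
  qed
  have Jf: "fsupp (?J k)" for k
  proof (induction k)
    case (Suc k)
    then show ?case unfolding rec by (intro fsupp_divide fsupp_add h(1) fsupp_neighbour_sum)
  qed simp
  \<comment> \<open>The residual of the k-th iterate: \<open>h\<close> minus the operator applied to
    it. It evolves by neighbour sums divided by \<beta>, so it stays in [0, 1] and its total never
    grows.\<close>
  define g where "g k z = \<beta> * (?J (Suc k) z - ?J k z)" for k z
  have g_Suc: "g (Suc k) z = neighbour_sum (g k) z / \<beta>" for k z
  proof -
    have "\<beta> * ?J (Suc (Suc k)) z - \<beta> * ?J (Suc k) z = neighbour_sum (?J (Suc k)) z - neighbour_sum (?J k) z"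
      unfolding rec[of "Suc k"] rec[of k z] using \<beta> by (simp add: field_simps)
    moreover have "neighbour_sum (g k) z = \<beta> * (neighbour_sum (?J (Suc k)) z - neighbour_sum (?J k) z)"
      unfolding g_def using neighbour_sum_scale neighbour_sum_diff by metis
    ultimately show ?thesis using \<beta> unfolding g_def[of "Suc k"] by (simp add: right_diff_distrib diff_divide_distrib)
  qed
  have g_0: "g 0 z = h z" for z
    unfolding g_def rec[of 0] using \<beta> by (simp add: neighbour_sum_const)
  have g_nonneg: "0 \<le> g k z" for k z using Jmono[of k z] \<beta> by (simp add: g_def)
  have gf: "fsupp (g k)" for k unfolding g_def by (intro fsupp_mult2 fsupp_diff Jf)
  have g_le: "g k z \<le> 1" for k z
  proof (induction k arbitrary: z)
    case 0 then show ?case using h g_0 by simp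
  next
    case (Suc k)
    have "neighbour_sum (g k) z \<le> 2 * real CARD('n) * 1"
      using neighbour_sum_mono[of "g k" "\<lambda>_. 1" z] Suc by (simp add: neighbour_sum_const)
    then show ?case unfolding g_Suc using \<beta> by simp
  qed
  have g_sum: "Sum_any (g k) \<le> Sum_any h" for k
  proof (induction k)
    case 0 then show ?case using g_0 by simp
  next
    case (Suc k)
    have "Sum_any (g (Suc k)) = Sum_any (\<lambda>z. (1 / \<beta>) * neighbour_sum (g k) z)" by (simp add: g_Suc)
    also have "\<dots> = (1 / \<beta>) * (2 * real CARD('n) * Sum_any (g k))"
      by (simp only: Sum_any_scale Sum_any_neighbour_sum[OF gf])
    also have "\<dots> = (2 * real CARD('n) / \<beta>) * Sum_any (g k)" by simp
    also have "\<dots> \<le> 1 * Sum_any (g k)"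
      using \<beta> by (intro mult_right_mono Sum_any_nonneg g_nonneg) auto
    finally show ?case using Suc by simp
  qed
  have residual: "\<alpha> * ?J k z - laplace (?J k) z = h z - g k z" for k z
    unfolding g_def rec using \<beta> by (simp add: laplace_def \<beta>_def field_simps)
  have bound: "(\<Sum>z\<in>B. \<Sum>i\<in>UNIV. \<Sum>j\<in>UNIV. (fdiff j (bdiff i (?J k)) z)\<^sup>2) \<le> 2 * Sum_any h"
    if "finite B" for B k
  proof -
    have "(\<Sum>z\<in>B. \<Sum>i\<in>UNIV. \<Sum>j\<in>UNIV. (fdiff j (bdiff i (?J k)) z)\<^sup>2)
       \<le> Sum_any (\<lambda>z. \<Sum>i\<in>UNIV. \<Sum>j\<in>UNIV. (fdiff j (bdiff i (?J k)) z)\<^sup>2)"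
      using that by (intro sum_le_Sum_any fsupp_sum fsupp_power2 fsupp_fdiff fsupp_bdiff Jf sum_nonneg) auto
    also have "\<dots> \<le> Sum_any (\<lambda>z. (h z - g k z)\<^sup>2)"
      using Sum_any_hessian_le[OF Jf[of k], of \<alpha>] \<alpha> unfolding residual by simp
    also have "\<dots> \<le> Sum_any (\<lambda>z. h z + g k z)"
    proof (rule Sum_any_mono)
      fix z
      \<comment> \<open>Both functions take values in [0, 1], so squaring the difference can only
        decrease it. This turns the energy into a plain sum, that is, a volume.\<close>
      have "(h z - g k z)\<^sup>2 \<le> \<bar>h z - g k z\<bar>"
      proof -
        have "\<bar>h z - g k z\<bar> \<le> 1"
          using h(2,3)[of z] g_le[of k z] g_nonneg[of k z] by (simp add: abs_if)
        then have "\<bar>h z - g k z\<bar> * \<bar>h z - g k z\<bar> \<le> 1 * \<bar>h z - g k z\<bar>" by (intro mult_right_mono) auto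
        then show ?thesis by (simp add: power2_eq_square abs_mult_self_eq)
      qed
      then show "(h z - g k z)\<^sup>2 \<le> h z + g k z" using h(2)[of z] g_nonneg[of k z] by linarith
    qed (rule fsupp_power2[OF fsupp_diff[OF h(1) gf]], rule fsupp_add[OF h(1) gf])
    also have "\<dots> \<le> 2 * Sum_any h" using Sum_any_add[OF h(1) gf[of k]] g_sum[of k] by simp
    finally show ?thesis .
  qed
  define \<psi> where "\<psi> z = lim (\<lambda>k. ?J k z)" for z
  have lim: "(\<lambda>k. ?J k z) \<longlonglongrightarrow> \<psi> z" for z
  proof -
    have "convergent (\<lambda>k. ?J k z)"
    proof (rule Bseq_mono_convergent)
      show "Bseq (\<lambda>k. ?J k z)"
        by (rule BseqI'[of _ "1/\<alpha>"]) (use J0 J1 in simp)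
      show "\<forall>m n. m \<le> n \<longrightarrow> ?J m z \<le> ?J n z"
        using lift_Suc_mono_le[of "\<lambda>k. ?J k z", OF Jmono] by blast
    qed
    then show ?thesis by (simp add: \<psi>_def convergent_LIMSEQ_iff)
  qed
  have lim_n: "(\<lambda>k. neighbour_sum (?J k) z) \<longlonglongrightarrow> neighbour_sum \<psi> z" for z
    unfolding neighbour_sum_def by (intro tendsto_sum tendsto_add lim)
  show ?thesis
  proof
    fix z
    have "(\<lambda>k. ?J (Suc k) z) \<longlonglongrightarrow> (h z + neighbour_sum \<psi> z) / \<beta>"
      unfolding rec using \<beta> by (intro tendsto_intros lim_n) auto
    then have "\<psi> z = (h z + neighbour_sum \<psi> z) / \<beta>"
      using LIMSEQ_unique LIMSEQ_Suc[OF lim] by blast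
    then show "\<alpha> * \<psi> z - laplace \<psi> z = h z" using \<beta> by (simp add: laplace_def \<beta>_def field_simps)
    show "0 \<le> \<psi> z" by (rule LIMSEQ_le_const[OF lim]) (use J0 in auto)
    show "\<psi> z \<le> 1 / \<alpha>" by (rule LIMSEQ_le_const2[OF lim]) (use J1 in auto)
  next
    fix B :: "(int ^ 'n) set" assume "finite B"
    have "(\<lambda>k. \<Sum>z\<in>B. \<Sum>i\<in>UNIV. \<Sum>j\<in>UNIV. (fdiff j (bdiff i (?J k)) z)\<^sup>2)
       \<longlonglongrightarrow> (\<Sum>z\<in>B. \<Sum>i\<in>UNIV. \<Sum>j\<in>UNIV. (fdiff j (bdiff i \<psi>) z)\<^sup>2)"
      unfolding fdiff_def bdiff_def by (intro tendsto_intros lim)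
    then show "(\<Sum>z\<in>B. \<Sum>i\<in>UNIV. \<Sum>j\<in>UNIV. (fdiff j (bdiff i \<psi>) z)\<^sup>2) \<le> 2 * Sum_any h"
      by (rule LIMSEQ_le_const2) (use bound[OF \<open>finite B\<close>] in auto)
  qed
qed

section \<open>Lattice boxes, the l1 distance and bounds along lattice paths\<close>

definition lbox :: "int \<Rightarrow> int ^ 'n \<Rightarrow> (int ^ 'n) set" where
  "lbox r z = {y. \<forall>i. \<bar>y $ i - z $ i\<bar> \<le> r}"

definition dist1 :: "int ^ 'n \<Rightarrow> int ^ 'n \<Rightarrow> real" where
  "dist1 x y = (\<Sum>i\<in>UNIV. \<bar>real_of_int (x $ i - y $ i)\<bar>)"

lemma card_vec_product:
  fixes A :: "'n::finite \<Rightarrow> 'b set"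
  shows "card {z :: 'b ^ 'n. \<forall>i. z $ i \<in> A i} = (\<Prod>i\<in>UNIV. card (A i))"
    and "(\<And>i. finite (A i)) \<Longrightarrow> finite {z :: 'b ^ 'n. \<forall>i. z $ i \<in> A i}"
proof -
  have bij: "bij_betw (\<lambda>z. vec_nth z) {z :: 'b ^ 'n. \<forall>i. z $ i \<in> A i} (PiE UNIV A)"
    by (rule bij_betw_byWitness[where f' = vec_lambda]) (auto simp: PiE_def Pi_def extensional_def)
  show "card {z :: 'b ^ 'n. \<forall>i. z $ i \<in> A i} = (\<Prod>i\<in>UNIV. card (A i))"
    using bij_betw_same_card[OF bij] by (simp add: card_PiE)
  show "(\<And>i. finite (A i)) \<Longrightarrow> finite {z :: 'b ^ 'n. \<forall>i. z $ i \<in> A i}"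
    using bij_betw_finite[OF bij] by (simp add: finite_PiE)
qed

lemma sum_prod_vec:
  fixes f :: "'n::finite \<Rightarrow> 'b \<Rightarrow> real"
  assumes "\<And>i. finite (A i)"
  shows "(\<Sum>z \<in> {z :: 'b ^ 'n. \<forall>i. z $ i \<in> A i}. \<Prod>i\<in>UNIV. f i (z $ i)) = (\<Prod>i\<in>UNIV. \<Sum>t\<in>A i. f i t)"
proof -
  have bij: "bij_betw (\<lambda>z. vec_nth z) {z :: 'b ^ 'n. \<forall>i. z $ i \<in> A i} (PiE UNIV A)"
    by (rule bij_betw_byWitness[where f' = vec_lambda]) (auto simp: PiE_def Pi_def extensional_def)
  have "(\<Prod>i\<in>UNIV. \<Sum>t\<in>A i. f i t) = (\<Sum>g\<in>PiE UNIV A. \<Prod>i\<in>UNIV. f i (g i))"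
    using assms by (intro prod_sum_PiE) auto
  also have "\<dots> = (\<Sum>z \<in> {z :: 'b ^ 'n. \<forall>i. z $ i \<in> A i}. \<Prod>i\<in>UNIV. f i (z $ i))"
    using sum.reindex_bij_betw[OF bij, of "\<lambda>g. \<Prod>i\<in>UNIV. f i (g i)"] by simp
  finally show ?thesis by simp
qed

lemma lbox_eq: "lbox r z = {y. \<forall>i. y $ i \<in> {z $ i - r .. z $ i + r}}"
proof -
  have "\<bar>a - b\<bar> \<le> r \<longleftrightarrow> a \<in> {b - r .. b + r}" for a b :: int by auto
  then show ?thesis by (simp add: lbox_def)
qed

lemma finite_lbox [simp]: "finite (lbox r z)"
  unfolding lbox_eq by (rule card_vec_product(2)) simp

lemma lbox_mono: "r \<le> s \<Longrightarrow> lbox r z \<subseteq> lbox s z"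
  by (auto simp: lbox_def intro: order_trans)

lemma lbox_trans: "y \<in> lbox r z \<Longrightarrow> x \<in> lbox s y \<Longrightarrow> x \<in> lbox (r + s) z"
proof -
  assume a: "y \<in> lbox r z" "x \<in> lbox s y"
  have "\<bar>x $ i - z $ i\<bar> \<le> r + s" for i
    using a[unfolded lbox_def, simplified, THEN spec, of i] by linarith
  then show ?thesis by (simp add: lbox_def)
qed

lemma lbox_unit_step [simp]: "z + unit_step i \<in> lbox 1 z" "z - unit_step i \<in> lbox 1 z"
  by (auto simp: lbox_def)

lemma self_in_lbox [simp]: "0 \<le> r \<Longrightarrow> z \<in> lbox r z"
  by (simp add: lbox_def)

lemma dist1_nonneg: "0 \<le> dist1 x y" by (simp add: dist1_def sum_nonneg)
lemma dist1_commute: "dist1 x y = dist1 y x" by (simp add: dist1_def abs_minus_commute)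
lemma dist1_triangle: "dist1 x z \<le> dist1 x y + dist1 y z"
  unfolding dist1_def sum.distrib[symmetric] by (intro sum_mono) auto
lemma dist1_self [simp]: "dist1 x x = 0" by (simp add: dist1_def)

lemma dist1_lbox: "y \<in> lbox r z \<Longrightarrow> dist1 (z :: int ^ 'n) y \<le> real CARD('n) * real_of_int r"
proof -
  assume y: "y \<in> lbox r z"
  have "dist1 z y \<le> (\<Sum>i\<in>(UNIV :: 'n set). real_of_int r)"
    unfolding dist1_def
  proof (rule sum_mono)
    fix i
    have "\<bar>y $ i - z $ i\<bar> \<le> r" using y by (simp add: lbox_def)
    then show "\<bar>real_of_int (z $ i - y $ i)\<bar> \<le> real_of_int r" by linarith
  qed
  then show ?thesis by simp
qed

lemma lbox_dist1: "dist1 z y \<le> real_of_int r \<Longrightarrow> y \<in> lbox r z"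
proof -
  assume d: "dist1 z y \<le> real_of_int r"
  have "\<bar>y $ i - z $ i\<bar> \<le> r" for i
  proof -
    have "\<bar>real_of_int (z $ i - y $ i)\<bar> \<le> dist1 z y"
      unfolding dist1_def by (rule member_le_sum) auto
    then show ?thesis using d by linarith
  qed
  then show ?thesis by (simp add: lbox_def)
qed

lemma dist1_unit_step [simp]: "dist1 z (z + unit_step i) = 1"
  by (simp add: dist1_def if_distrib[of real_of_int] cong: if_cong)

text \<open>Walk from \<open>x\<close> to \<open>y\<close> by unit steps, each moving one coordinate
  towards its target and shortening the l1 distance by 1. A product of intervals contains the whole
  walk, so differences are needed only inside \<open>Q\<close>.\<close>

lemma lattice_path_bound:
  fixes u :: "int ^ 'n \<Rightarrow> real"
  assumes step: "\<And>x i. x \<in> Q \<Longrightarrow> x + unit_step i \<in> Q \<Longrightarrow> \<bar>u (x + unit_step i) - u x\<bar> \<le> B"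
    and Q: "Q = {x. \<forall>i. l $ i \<le> x $ i \<and> x $ i \<le> h $ i}" and "x \<in> Q" "y \<in> Q"
  shows "\<bar>u x - u y\<bar> \<le> B * dist1 x y"
  using \<open>x \<in> Q\<close>
proof (induction "nat (\<Sum>i\<in>UNIV. \<bar>x $ i - y $ i\<bar>)" arbitrary: x)
  case 0
  then have "(\<Sum>i\<in>UNIV. \<bar>x $ i - y $ i\<bar>) \<le> 0" by simp
  then have "(\<Sum>i\<in>UNIV. \<bar>x $ i - y $ i\<bar>) = 0" by (intro antisym sum_nonneg) auto
  then have "x = y" by (auto simp: sum_nonneg_eq_0_iff vec_eq_iff)
  then show ?case by simp
next
  case (Suc k)
  then have "x \<noteq> y" by auto
  then obtain i where i: "x $ i \<noteq> y $ i" by (auto simp: vec_eq_iff)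
  define x' where "x' = (if x $ i < y $ i then x + unit_step i else x - unit_step i)"
  have split: "(\<Sum>j\<in>UNIV. g j) = g i + (\<Sum>j\<in>UNIV - {i}. g j)" for g :: "'n \<Rightarrow> 'c :: ab_group_add"
    by (simp add: sum.remove)
  have x'j: "x' $ j = x $ j" if "j \<noteq> i" for j using that by (simp add: x'_def)
  have x'i: "\<bar>x' $ i - y $ i\<bar> = \<bar>x $ i - y $ i\<bar> - 1" using i by (auto simp: x'_def)
  have s1: "(\<Sum>j\<in>UNIV. \<bar>x' $ j - y $ j\<bar>) = (\<Sum>j\<in>UNIV. \<bar>x $ j - y $ j\<bar>) - 1"
    unfolding split[of "\<lambda>j. \<bar>x' $ j - y $ j\<bar>"] split[of "\<lambda>j. \<bar>x $ j - y $ j\<bar>"] x'i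
    using x'j by simp
  have s2: "dist1 x' y = dist1 x y - 1"
    using arg_cong[OF s1, of real_of_int] by (simp add: dist1_def)
  have k: "k = nat (\<Sum>j\<in>UNIV. \<bar>x' $ j - y $ j\<bar>)" using Suc.hyps(2) s1 by simp
  have x'Q: "x' \<in> Q"
  proof -
    have "l $ j \<le> x' $ j \<and> x' $ j \<le> h $ j" for j
    proof (cases "j = i")
      case True
      have "l $ i \<le> x $ i \<and> x $ i \<le> h $ i" "l $ i \<le> y $ i \<and> y $ i \<le> h $ i"
        using Suc.prems assms(4) Q by auto
      then show ?thesis using True i by (auto simp: x'_def)
    next
      case False then show ?thesis using Suc.prems Q x'j by auto
    qed
    then show ?thesis using Q by simp
  qed
  have "\<bar>u x - u x'\<bar> \<le> B"
  proof (cases "x $ i < y $ i")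
    case True
    then show ?thesis using step[of x i] Suc.prems x'Q by (simp add: x'_def abs_minus_commute)
  next
    case False
    then show ?thesis using step[of x' i] Suc.prems x'Q by (simp add: x'_def)
  qed
  moreover have "\<bar>u x' - u y\<bar> \<le> B * dist1 x' y" using Suc.hyps(1)[OF k x'Q] .
  ultimately show ?case unfolding s2 by (simp add: algebra_simps)
qed

lemma lattice_path_lbox:
  fixes u :: "int ^ 'n \<Rightarrow> real"
  assumes "\<And>x i. x \<in> lbox r z \<Longrightarrow> \<bar>fdiff i u x\<bar> \<le> B" and "x \<in> lbox r z" "y \<in> lbox r z"
  shows "\<bar>u x - u y\<bar> \<le> B * dist1 x y"
proof (rule lattice_path_bound)
  show "lbox r z = {x. \<forall>i. (\<chi> i. z $ i - r) $ i \<le> x $ i \<and> x $ i \<le> (\<chi> i. z $ i + r) $ i}"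
    by (simp add: lbox_eq)
qed (use assms in \<open>auto simp: fdiff_def\<close>)

subsection \<open>A mean value inequality\<close>

text \<open>A quadratic bump. Squaring the positive part makes it smooth enough at the edge for its
  second differences to be bounded above by a multiple of L^-2.\<close>

definition cutoff :: "real \<Rightarrow> int ^ 'n \<Rightarrow> int ^ 'n \<Rightarrow> real" where
  "cutoff L z0 z = (max 0 (1 - (\<Sum>i\<in>UNIV. (real_of_int (z $ i - z0 $ i))\<^sup>2) / L\<^sup>2))\<^sup>2"

text \<open>Second-order Taylor inequality for the square of the positive part, whose second
  derivative is at most 2.\<close>

lemma max_square_le: "(max 0 a)\<^sup>2 \<le> (max 0 b)\<^sup>2 + 2 * max 0 b * (a - b) + (a - b)\<^sup>2" for a b :: real
proof (cases "0 \<le> b")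
  case True
  then have "(max 0 b)\<^sup>2 + 2 * max 0 b * (a - b) + (a - b)\<^sup>2 = a\<^sup>2"
    by (simp add: power2_eq_square algebra_simps)
  moreover have "(max 0 a)\<^sup>2 \<le> a\<^sup>2" by (simp add: max_def)
  ultimately show ?thesis by simp
next
  case False
  then have "max 0 a \<le> \<bar>a - b\<bar>" by auto
  then have "(max 0 a)\<^sup>2 \<le> \<bar>a - b\<bar>\<^sup>2" by (rule power_mono) simp
  then show ?thesis using False by simp
qed

lemma cutoff_outside:
  assumes "0 < L" "real_of_int \<bar>z $ i - z0 $ i\<bar> \<ge> L"
  shows "cutoff L z0 z = 0"
proof -
  have "L\<^sup>2 \<le> (real_of_int \<bar>z $ i - z0 $ i\<bar>)\<^sup>2" using assms by (intro power_mono) auto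
  also have "\<dots> = (real_of_int (z $ i - z0 $ i))\<^sup>2" by simp
  also have "\<dots> \<le> (\<Sum>i\<in>UNIV. (real_of_int (z $ i - z0 $ i))\<^sup>2)"
    by (rule member_le_sum[of i UNIV "\<lambda>i. (real_of_int (z $ i - z0 $ i))\<^sup>2"]) auto
  finally have "1 \<le> (\<Sum>i\<in>UNIV. (real_of_int (z $ i - z0 $ i))\<^sup>2) / L\<^sup>2" using assms by simp
  then show ?thesis by (simp add: cutoff_def)
qed

text \<open>The inner function is concave, so its two first-order increments add up to something
  negative. What remains are two squared increments, each at most (3L)^2 / L^4; hence 18 = 9 +
  9.\<close>

lemma cutoff_second_difference:
  assumes z: "z \<in> lbox L z0" and L: "1 \<le> L"
  shows "cutoff (real_of_int L) z0 (z + unit_step i) + cutoff (real_of_int L) z0 (z - unit_step i)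
      - 2 * cutoff (real_of_int L) z0 z \<le> 18 / (real_of_int L)\<^sup>2"
proof -
  let ?L = "real_of_int L" let ?t = "real_of_int (z $ i - z0 $ i)"
  define f where "f z = 1 - (\<Sum>i\<in>UNIV. (real_of_int (z $ i - z0 $ i))\<^sup>2) / ?L\<^sup>2" for z
  have split: "(\<Sum>j\<in>UNIV. g j) = g i + (\<Sum>j\<in>UNIV - {i}. g j)" for g :: "'a \<Rightarrow> real"
    by (simp add: sum.remove)
  have fp: "f (z + unit_step i) - f z = - (2 * ?t + 1) / ?L\<^sup>2"
    unfolding f_def split[of "\<lambda>j. (real_of_int ((z + unit_step i) $ j - z0 $ j))\<^sup>2"]
      split[of "\<lambda>j. (real_of_int (z $ j - z0 $ j))\<^sup>2"]
    by (simp add: diff_divide_distrib[symmetric] power2_eq_square algebra_simps)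
  have fm: "f (z - unit_step i) - f z = - (- 2 * ?t + 1) / ?L\<^sup>2"
    unfolding f_def split[of "\<lambda>j. (real_of_int ((z - unit_step i) $ j - z0 $ j))\<^sup>2"]
      split[of "\<lambda>j. (real_of_int (z $ j - z0 $ j))\<^sup>2"]
    by (simp add: diff_divide_distrib[symmetric] power2_eq_square algebra_simps)
  have t: "\<bar>?t\<bar> \<le> ?L" using z unfolding lbox_def by (metis (mono_tags, lifting) mem_Collect_eq of_int_abs of_int_le_iff)
  have sq: "((a * ?t + 1) / ?L\<^sup>2)\<^sup>2 \<le> 9 / ?L\<^sup>2" if "\<bar>a\<bar> = 2" for a
  proof -
    have "\<bar>a * ?t + 1\<bar> \<le> 3 * ?L"
    proof -
      have "\<bar>a * ?t\<bar> \<le> 2 * ?L" using t that by (simp add: abs_mult)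
      then show ?thesis using L by linarith
    qed
    then have "(a * ?t + 1)\<^sup>2 \<le> (3 * ?L)\<^sup>2" by (metis abs_ge_zero power2_abs power_mono)
    then have "((a * ?t + 1) / ?L\<^sup>2)\<^sup>2 \<le> (3 * ?L)\<^sup>2 / (?L\<^sup>2)\<^sup>2" by (simp add: power_divide divide_right_mono)
    also have "\<dots> = 9 / ?L\<^sup>2" using L by (simp add: power2_eq_square)
    finally show ?thesis .
  qed
  have s: "(f (z + unit_step i) - f z)\<^sup>2 \<le> 9 / ?L\<^sup>2" "(f (z - unit_step i) - f z)\<^sup>2 \<le> 9 / ?L\<^sup>2"
    unfolding fp fm using sq[of 2] sq[of "-2"] by (simp_all only: power2_minus minus_divide_left[symmetric])
  have c: "cutoff ?L z0 y = (max 0 (f y))\<^sup>2" for y by (simp add: cutoff_def f_def)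
  have "(f (z + unit_step i) - f z) + (f (z - unit_step i) - f z) \<le> 0"
    unfolding fp fm by (simp add: add_divide_distrib[symmetric])
  then have "2 * max 0 (f z) * ((f (z + unit_step i) - f z) + (f (z - unit_step i) - f z)) \<le> 0"
    by (simp add: mult_nonneg_nonpos)
  then show ?thesis
    unfolding c using s max_square_le[of "f (z + unit_step i)" "f z"] max_square_le[of "f (z - unit_step i)" "f z"]
    by (simp add: algebra_simps)
qed

lemma cutoff_nonneg: "0 \<le> cutoff L z0 z" by (simp add: cutoff_def)

lemma cutoff_inside:
  assumes z: "z \<in> lbox (int m) (z0 :: int ^ 'n)" and "1 \<le> m"
  shows "9/16 \<le> cutoff (real (2 * CARD('n) * m)) z0 z"
proof -
  have n: "1 \<le> real CARD('n)" by (simp add: Suc_leI)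
  have "(\<Sum>i\<in>UNIV. (real_of_int (z $ i - z0 $ i))\<^sup>2) \<le> (\<Sum>i\<in>(UNIV::'n set). (real m)\<^sup>2)"
  proof (rule sum_mono)
    fix i have "\<bar>z $ i - z0 $ i\<bar> \<le> int m" using z by (simp add: lbox_def)
    then have "\<bar>real_of_int (z $ i - z0 $ i)\<bar> \<le> real m" by linarith
    then show "(real_of_int (z $ i - z0 $ i))\<^sup>2 \<le> (real m)\<^sup>2" by (metis abs_ge_zero power2_abs power_mono)
  qed
  also have "\<dots> = real CARD('n) * (real m)\<^sup>2" by simp
  also have "\<dots> \<le> (real CARD('n) * real CARD('n)) * (real m)\<^sup>2" using n by (intro mult_right_mono) auto
  also have "\<dots> = (real (2 * CARD('n) * m))\<^sup>2 / 4" by (simp add: power2_eq_square)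
  finally have "(\<Sum>i\<in>UNIV. (real_of_int (z $ i - z0 $ i))\<^sup>2) / (real (2 * CARD('n) * m))\<^sup>2 \<le> 1/4"
    using assms(2) n by (subst pos_divide_le_eq) auto
  then have "3/4 \<le> max 0 (1 - (\<Sum>i\<in>UNIV. (real_of_int (z $ i - z0 $ i))\<^sup>2) / (real (2 * CARD('n) * m))\<^sup>2)"
    by (simp only: le_max_iff_disj) linarith
  then have "(3/4)\<^sup>2 \<le> cutoff (real (2 * CARD('n) * m)) z0 z"
    unfolding cutoff_def by (rule power_mono) simp
  then show ?thesis by (simp add: power2_eq_square)
qed

lemma Sum_any_laplace_mult:
  assumes "fsupp (\<phi> :: int ^ 'n \<Rightarrow> real)"
  shows "Sum_any (\<lambda>z. \<phi> z * laplace s z) = Sum_any (\<lambda>z. laplace \<phi> z * s z)"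
proof -
  have "Sum_any (\<lambda>z. \<phi> z * laplace s z) = (\<Sum>i\<in>UNIV. Sum_any (\<lambda>z. \<phi> z * fdiff i (bdiff i s) z))"
    by (simp add: laplace_eq sum_distrib_left Sum_any_sum fsupp_mult1 assms)
  also have "\<dots> = (\<Sum>i\<in>UNIV. Sum_any (\<lambda>z. fdiff i (bdiff i \<phi>) z * s z))"
    using Sum_any_bdiff_mult[OF assms] Sum_any_fdiff_mult[OF fsupp_bdiff[OF assms]] by simp
  also have "\<dots> = Sum_any (\<lambda>z. laplace \<phi> z * s z)"
    by (simp add: laplace_eq sum_distrib_right Sum_any_sum fsupp_mult1 assms fsupp_fdiff fsupp_bdiff)
  finally show ?thesis .
qed

text \<open>Since \<alpha> is nonnegative, the Laplacian of u^2 dominates the squared gradient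
  wherever \<open>u\<close> solves the equation. Testing with the cutoff and moving the Laplacian
  onto it leaves only u^2 times a multiple of L^-2.\<close>

lemma caccioppoli:
  fixes u :: "int ^ 'n \<Rightarrow> real"
  assumes m: "1 \<le> m" and \<alpha>: "0 \<le> \<alpha>"
    and eq: "\<And>z. z \<in> lbox (int (2 * CARD('n) * m)) z0 \<Longrightarrow> laplace u z = \<alpha> * u z"
  shows "(\<Sum>z\<in>lbox (int m) z0. \<Sum>i\<in>UNIV. (fdiff i u z)\<^sup>2)
     \<le> 8 / (real m)\<^sup>2 * (\<Sum>z\<in>lbox (int (2 * CARD('n) * m)) z0. (u z)\<^sup>2)"
proof -
  define L where "L = 2 * CARD('n) * m"
  have n: "1 \<le> CARD('n)" by (simp add: Suc_leI)
  have "1 * 1 \<le> CARD('n) * m" using m n by (rule mult_le_mono[rotated])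
  then have L: "1 \<le> L" unfolding L_def by simp
  define \<phi> where "\<phi> = cutoff (real L) z0"
  \<comment> \<open>The cutoff already vanishes on the outermost layer, so its Laplacian, which
    looks one step further, vanishes outside the box.\<close>
  have out: "\<phi> z = 0" if nz: "z \<notin> lbox (int L - 1) z0" for z
  proof -
    obtain i where "\<not> \<bar>z $ i - z0 $ i\<bar> \<le> int L - 1"
      using nz unfolding lbox_def mem_Collect_eq by blast
    then have "real_of_int \<bar>z $ i - z0 $ i\<bar> \<ge> real L" by linarith
    then show ?thesis unfolding \<phi>_def using L by (intro cutoff_outside) auto
  qed
  have sub: "lbox (int L - 1) z0 \<subseteq> lbox (int L) z0" by (rule lbox_mono) simp
  have fs: "fsupp \<phi>" by (rule finite_subset[OF _ finite_lbox[of "int L - 1" z0]]) (use out in auto)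
  have lap: "laplace \<phi> z * (u z)\<^sup>2 \<le> (if z \<in> lbox (int L) z0 then 18 * real CARD('n) / (real L)\<^sup>2 * (u z)\<^sup>2 else 0)" for z
  proof (cases "z \<in> lbox (int L) z0")
    case True
    have "laplace \<phi> z = (\<Sum>i\<in>UNIV. \<phi> (z + unit_step i) + \<phi> (z - unit_step i) - 2 * \<phi> z)"
      by (simp add: laplace_def neighbour_sum_def sum_subtractf)
    also have "\<dots> \<le> (\<Sum>i\<in>(UNIV::'n set). 18 / (real L)\<^sup>2)"
      using cutoff_second_difference[OF True] L unfolding \<phi>_def by (intro sum_mono) auto
    finally have "laplace \<phi> z \<le> 18 * real CARD('n) / (real L)\<^sup>2" by (simp add: mult.commute)
    from mult_right_mono[OF this, of "(u z)\<^sup>2"] show ?thesis using True by simp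
  next
    case False
    have "\<phi> z = 0" using out False sub by auto
    moreover have "\<phi> (z + unit_step i) = 0" for i
    proof (rule out, rule notI)
      assume "z + unit_step i \<in> lbox (int L - 1) z0"
      from lbox_trans[OF this lbox_unit_step(2)[of _ i]] show False using False by simp
    qed
    moreover have "\<phi> (z - unit_step i) = 0" for i
    proof (rule out, rule notI)
      assume "z - unit_step i \<in> lbox (int L - 1) z0"
      from lbox_trans[OF this lbox_unit_step(1)[of _ i]] show False using False by simp
    qed
    ultimately show ?thesis using False by (simp add: laplace_def neighbour_sum_def)
  qed
  have pt: "\<phi> z * (\<Sum>i\<in>UNIV. (fdiff i u z)\<^sup>2) \<le> \<phi> z * laplace (\<lambda>z. (u z)\<^sup>2) z" for z
  proof (cases "z \<in> lbox (int L) z0")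
    case True
    have "laplace (\<lambda>z. (u z)\<^sup>2) z - 2 * u z * laplace u z
       = (\<Sum>i\<in>UNIV. (u (z + unit_step i) - u z)\<^sup>2 + (u (z - unit_step i) - u z)\<^sup>2)"
      unfolding laplace_eq fdiff_def bdiff_def sum_distrib_left sum_subtractf[symmetric]
      by (intro sum.cong refl) (simp add: power2_eq_square algebra_simps)
    moreover have "laplace (\<lambda>z. (u z)\<^sup>2) z = 2 * \<alpha> * (u z)\<^sup>2
       + (\<Sum>i\<in>UNIV. (u (z + unit_step i) - u z)\<^sup>2 + (u (z - unit_step i) - u z)\<^sup>2)"
    proof -
      have "2 * u z * laplace u z = 2 * \<alpha> * (u z)\<^sup>2"
        unfolding eq[folded L_def, OF True] by (simp add: power2_eq_square)
      with calculation show ?thesis by linarith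
    qed
    moreover have "(\<Sum>i\<in>UNIV. (fdiff i u z)\<^sup>2) \<le> (\<Sum>i\<in>UNIV. (u (z + unit_step i) - u z)\<^sup>2 + (u (z - unit_step i) - u z)\<^sup>2)"
      unfolding fdiff_def by (intro sum_mono) simp
    moreover have "0 \<le> 2 * \<alpha> * (u z)\<^sup>2" using \<alpha> by simp
    ultimately have "(\<Sum>i\<in>UNIV. (fdiff i u z)\<^sup>2) \<le> laplace (\<lambda>z. (u z)\<^sup>2) z" by linarith
    then show ?thesis by (intro mult_left_mono) (auto simp: \<phi>_def cutoff_nonneg)
  next
    case False
    then have "\<phi> z = 0" using out sub by auto
    then show ?thesis by simp
  qed
  have f0: "0 \<le> \<phi> z * (\<Sum>i\<in>UNIV. (fdiff i u z)\<^sup>2)" for z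
    by (intro mult_nonneg_nonneg sum_nonneg) (auto simp: \<phi>_def cutoff_nonneg)
  have "9/16 * (\<Sum>z\<in>lbox (int m) z0. \<Sum>i\<in>UNIV. (fdiff i u z)\<^sup>2)
      = (\<Sum>z\<in>lbox (int m) z0. 9/16 * (\<Sum>i\<in>UNIV. (fdiff i u z)\<^sup>2))"
    by (rule sum_distrib_left)
  also have "\<dots> \<le> (\<Sum>z\<in>lbox (int m) z0. \<phi> z * (\<Sum>i\<in>UNIV. (fdiff i u z)\<^sup>2))"
    unfolding \<phi>_def L_def by (intro sum_mono mult_right_mono cutoff_inside sum_nonneg m) auto
  also have "\<dots> \<le> Sum_any (\<lambda>z. \<phi> z * (\<Sum>i\<in>UNIV. (fdiff i u z)\<^sup>2))"
    by (rule sum_le_Sum_any[OF fsupp_mult1[OF fs] f0]) simp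
  also have "\<dots> \<le> Sum_any (\<lambda>z. \<phi> z * laplace (\<lambda>z. (u z)\<^sup>2) z)"
    by (intro Sum_any_mono fsupp_mult1 fs pt)
  also have "\<dots> = Sum_any (\<lambda>z. laplace \<phi> z * (u z)\<^sup>2)" by (rule Sum_any_laplace_mult[OF fs])
  also have "\<dots> \<le> Sum_any (\<lambda>z. if z \<in> lbox (int L) z0 then 18 * real CARD('n) / (real L)\<^sup>2 * (u z)\<^sup>2 else 0)"
    by (intro Sum_any_mono fsupp_mult1 fsupp_laplace fs lap)
       (rule finite_subset[OF _ finite_lbox[of "int L" z0]], auto)
  also have "\<dots> = (\<Sum>z\<in>lbox (int L) z0. 18 * real CARD('n) / (real L)\<^sup>2 * (u z)\<^sup>2)"
    by (rule Sum_any.conditionalize[symmetric]) simp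
  also have "\<dots> = 18 * real CARD('n) / (real L)\<^sup>2 * (\<Sum>z\<in>lbox (int L) z0. (u z)\<^sup>2)"
    by (simp add: sum_distrib_left)
  \<comment> \<open>With L = 2nm the coefficient is (9/2) / (n m^2). The factor n is dropped, and
    division by the lower bound 9/16 of the cutoff on the inner box gives the final 8.\<close>
  also have "18 * real CARD('n) / (real L)\<^sup>2 = (9 / 2) / (real CARD('n) * (real m)\<^sup>2)"
    unfolding L_def using n m by (simp add: power2_eq_square field_simps)
  also have "\<dots> * (\<Sum>z\<in>lbox (int L) z0. (u z)\<^sup>2) \<le> (9/2) / (real m)\<^sup>2 * (\<Sum>z\<in>lbox (int L) z0. (u z)\<^sup>2)"
  proof (intro mult_right_mono divide_left_mono sum_nonneg)
    have "1 * (real m)\<^sup>2 \<le> real CARD('n) * (real m)\<^sup>2" using n by (intro mult_right_mono) auto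
    then show "(real m)\<^sup>2 \<le> real CARD('n) * (real m)\<^sup>2" by simp
  qed (use m in auto)
  finally show ?thesis unfolding L_def by (simp add: field_simps)
qed

section \<open>Interior estimates for iterated differences and a lattice Sobolev inequality\<close>

definition fdiffs :: "'n list \<Rightarrow> (int ^ 'n \<Rightarrow> real) \<Rightarrow> int ^ 'n \<Rightarrow> real" where
  "fdiffs ds u = fold fdiff ds u"

lemma laplace_fdiff: "laplace (fdiff i u) z = laplace u (z + unit_step i) - laplace u z"
  unfolding laplace_def neighbour_sum_def fdiff_def
  by (simp add: sum_subtractf sum.distrib algebra_simps)

text \<open>Differences of a solution solve the same equation, so \<open>caccioppoli\<close> can be
  applied once per difference. Every application gains 8 / m^2 and enlarges the box by the factor
  \<open>N\<close>.\<close>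

lemma caccioppoli_iterated:
  fixes u :: "int ^ 'n \<Rightarrow> real"
  defines "N \<equiv> 2 * CARD('n) + 1"
  assumes m: "1 \<le> m" and \<alpha>: "0 \<le> \<alpha>"
    and eq: "\<And>z. z \<in> lbox (int (N ^ length ds * m)) z0 \<Longrightarrow> laplace u z = \<alpha> * u z"
  shows "(\<Sum>z\<in>lbox (int m) z0. (fdiffs ds u z)\<^sup>2)
     \<le> (8 / (real m)\<^sup>2) ^ length ds * (\<Sum>z\<in>lbox (int (N ^ length ds * m)) z0. (u z)\<^sup>2)"
  using eq
proof (induction ds arbitrary: u)
  case Nil
  then show ?case by (simp add: fdiffs_def)
next
  case (Cons i js)
  define k where "k = N ^ length js * m"
  have N: "1 \<le> N" by (simp add: N_def)
  have k: "1 \<le> k" using N m by (simp add: k_def)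
  have mk: "m \<le> k" using N m by (simp add: k_def)
  have Nk: "N ^ length (i # js) * m = 2 * CARD('n) * k + k" by (simp add: k_def N_def algebra_simps)
  have equ: "laplace u z = \<alpha> * u z" if "z \<in> lbox (int (2 * CARD('n) * k + k)) z0" for z
    using Cons.prems that unfolding Nk by simp
  have eqd: "laplace (fdiff i u) z = \<alpha> * fdiff i u z" if "z \<in> lbox (int k) z0" for z
  proof -
    have "z + unit_step i \<in> lbox (int k + 1) z0" by (rule lbox_trans[OF that lbox_unit_step(1)])
    moreover have "lbox (int k + 1) z0 \<subseteq> lbox (int (2 * CARD('n) * k + k)) z0"
    proof (rule lbox_mono)
      have "1 * 1 \<le> CARD('n) * k" using k by (intro mult_mono) (auto simp: Suc_leI)
      then have "k + 1 \<le> 2 * CARD('n) * k + k" by linarith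
      then show "int k + 1 \<le> int (2 * CARD('n) * k + k)" by linarith
    qed
    moreover have "lbox (int k) z0 \<subseteq> lbox (int (2 * CARD('n) * k + k)) z0" by (rule lbox_mono) simp
    ultimately have "laplace u (z + unit_step i) = \<alpha> * u (z + unit_step i)" "laplace u z = \<alpha> * u z"
      using that equ by blast+
    then show ?thesis by (simp only: laplace_fdiff fdiff_def right_diff_distrib)
  qed
  have "(\<Sum>z\<in>lbox (int k) z0. (fdiff i u z)\<^sup>2) \<le> (\<Sum>z\<in>lbox (int k) z0. \<Sum>i\<in>UNIV. (fdiff i u z)\<^sup>2)"
    by (intro sum_mono member_le_sum) auto
  also have "\<dots> \<le> 8 / (real k)\<^sup>2 * (\<Sum>z\<in>lbox (int (2 * CARD('n) * k)) z0. (u z)\<^sup>2)"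
    by (rule caccioppoli[OF k \<alpha>]) (use equ lbox_mono[of "int (2 * CARD('n) * k)" "int (2 * CARD('n) * k + k)" z0] in auto)
  also have "\<dots> \<le> 8 / (real m)\<^sup>2 * (\<Sum>z\<in>lbox (int (2 * CARD('n) * k + k)) z0. (u z)\<^sup>2)"
    using mk m by (intro mult_mono divide_left_mono power_mono sum_mono2 lbox_mono sum_nonneg) auto
  finally have D: "(\<Sum>z\<in>lbox (int k) z0. (fdiff i u z)\<^sup>2) \<le> 8 / (real m)\<^sup>2 * (\<Sum>z\<in>lbox (int (2 * CARD('n) * k + k)) z0. (u z)\<^sup>2)" .
  have "(\<Sum>z\<in>lbox (int m) z0. (fdiffs (i # js) u z)\<^sup>2) = (\<Sum>z\<in>lbox (int m) z0. (fdiffs js (fdiff i u) z)\<^sup>2)"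
    by (simp add: fdiffs_def)
  also have "\<dots> \<le> (8 / (real m)\<^sup>2) ^ length js * (\<Sum>z\<in>lbox (int k) z0. (fdiff i u z)\<^sup>2)"
    unfolding k_def by (rule Cons.IH) (use eqd k_def in simp)
  also have "\<dots> \<le> (8 / (real m)\<^sup>2) ^ length js * (8 / (real m)\<^sup>2 * (\<Sum>z\<in>lbox (int (2 * CARD('n) * k + k)) z0. (u z)\<^sup>2))"
    by (intro mult_left_mono D) simp
  finally show ?case unfolding Nk by (simp add: mult_ac)
qed

text \<open>Write f(0) as f(t) minus a telescoping sum, apply Cauchy-Schwarz to that sum, and
  average over t < m.\<close>

lemma sobolev_1d:
  fixes f :: "nat \<Rightarrow> real"
  assumes m: "1 \<le> m"
  shows "(f 0)\<^sup>2 \<le> 2 / real m * ((\<Sum>t<m. (f t)\<^sup>2) + (real m)\<^sup>2 * (\<Sum>t<m. (f (Suc t) - f t)\<^sup>2))"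
proof -
  let ?D = "\<Sum>t<m. (f (Suc t) - f t)\<^sup>2"
  have pt: "(f 0)\<^sup>2 \<le> 2 * (f t)\<^sup>2 + 2 * real m * ?D" if "t < m" for t
  proof -
    have "(\<Sum>s<t. f (Suc s) - f s) = f t - f 0" by (rule sum_lessThan_telescope)
    moreover have "(\<Sum>s<t. f (Suc s) - f s)\<^sup>2 \<le> real t * (\<Sum>s<t. (f (Suc s) - f s)\<^sup>2)"
      using sum_squared_le_sum_of_squares[of "\<lambda>s. f (Suc s) - f s" "{..<t}"]
      by (simp add: mult.commute)
    moreover have "real t * (\<Sum>s<t. (f (Suc s) - f s)\<^sup>2) \<le> real m * ?D"
      using that by (intro mult_mono sum_mono2 sum_nonneg) auto
    ultimately have "(f t - f 0)\<^sup>2 \<le> real m * ?D" by simp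
    moreover have "(f 0)\<^sup>2 \<le> 2 * (f t)\<^sup>2 + 2 * (f t - f 0)\<^sup>2"
    proof -
      have "0 \<le> (2 * f t - f 0)\<^sup>2" by simp
      then show ?thesis by (simp add: power2_eq_square algebra_simps)
    qed
    ultimately show ?thesis by linarith
  qed
  have "real m * (f 0)\<^sup>2 = (\<Sum>t<m. (f 0)\<^sup>2)" by simp
  also have "\<dots> \<le> (\<Sum>t<m. 2 * (f t)\<^sup>2 + 2 * real m * ?D)" by (rule sum_mono) (use pt in auto)
  also have "\<dots> = 2 * (\<Sum>t<m. (f t)\<^sup>2) + 2 * (real m)\<^sup>2 * ?D"
    by (simp add: sum.distrib sum_distrib_left[symmetric] power2_eq_square)
  finally show ?thesis using m by (simp add: field_simps)
qed

text \<open>Interpolates between the point \<open>z0\<close> (no free direction) and a half-open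
  cube of side \<open>m\<close> (all directions free), so that a Sobolev inequality can be proved
  one direction at a time.\<close>

definition slab :: "nat \<Rightarrow> int ^ 'n \<Rightarrow> 'n set \<Rightarrow> (int ^ 'n) set" where
  "slab m z0 J = {z. \<forall>i. z $ i \<in> (if i \<in> J then {z0 $ i ..< z0 $ i + int m} else {z0 $ i})}"

lemma slab_insert_sum:
  fixes g :: "int ^ 'n \<Rightarrow> real"
  assumes "i \<notin> J"
  shows "(\<Sum>z\<in>slab m z0 (insert i J). g z) = (\<Sum>z\<in>slab m z0 J. \<Sum>t<m. g (z + of_nat t * unit_step i))"
proof -
  have "(\<Sum>z\<in>slab m z0 J. \<Sum>t<m. g (z + of_nat t * unit_step i))
      = (\<Sum>(z,t)\<in>slab m z0 J \<times> {..<m}. g (z + of_nat t * unit_step i))"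
    by (rule sum.cartesian_product)
  also have "\<dots> = (\<Sum>z\<in>slab m z0 (insert i J). g z)"
  proof (rule sum.reindex_bij_witness[where j = "\<lambda>p. fst p + of_nat (snd p) * unit_step i"
        and i = "\<lambda>y. (\<chi> j. if j = i then z0 $ i else y $ j, nat (y $ i - z0 $ i))"])
    fix p assume p: "p \<in> slab m z0 J \<times> {..<m}"
    have zi: "fst p $ i = z0 $ i"
      using p assms by (auto simp: slab_def dest: spec[of _ i])
    have n: "(fst p + of_nat (snd p) * unit_step i) $ j = (if j = i then z0 $ i + int (snd p) else fst p $ j)" for j
      using zi by (simp add: of_nat_index)
    show "(\<chi> j. if j = i then z0 $ i else (fst p + of_nat (snd p) * unit_step i) $ j,
         nat ((fst p + of_nat (snd p) * unit_step i) $ i - z0 $ i)) = p"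
      unfolding n using zi by (cases p) (auto simp: vec_eq_iff)
    show "fst p + of_nat (snd p) * unit_step i \<in> slab m z0 (insert i J)"
      using p unfolding slab_def mem_Collect_eq n by (auto simp: slab_def split: if_splits)
    show "g (fst p + of_nat (snd p) * unit_step i) = (case p of (z, t) \<Rightarrow> g (z + of_nat t * unit_step i))"
      by (cases p) simp
  next
    fix y assume y: "y \<in> slab m z0 (insert i J)"
    have yi: "z0 $ i \<le> y $ i" "y $ i < z0 $ i + int m"
      using y by (auto simp: slab_def dest: spec[of _ i])
    show "fst (\<chi> j. if j = i then z0 $ i else y $ j, nat (y $ i - z0 $ i))
        + of_nat (snd (\<chi> j. if j = i then z0 $ i else y $ j, nat (y $ i - z0 $ i))) * unit_step i = y"
      using yi by (auto simp: vec_eq_iff of_nat_index simp del: of_nat_nat)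
    show "(\<chi> j. if j = i then z0 $ i else y $ j, nat (y $ i - z0 $ i)) \<in> slab m z0 J \<times> {..<m}"
      using yi y assms unfolding slab_def by (auto split: if_splits)
  qed
  finally show ?thesis by simp
qed

lemma slab_step:
  fixes u :: "int ^ 'n \<Rightarrow> real"
  assumes "i \<notin> J" and m: "1 \<le> m"
  shows "(\<Sum>z\<in>slab m z0 J. (u z)\<^sup>2) \<le> 2 / real m * ((\<Sum>z\<in>slab m z0 (insert i J). (u z)\<^sup>2)
      + (real m)\<^sup>2 * (\<Sum>z\<in>slab m z0 (insert i J). (fdiff i u z)\<^sup>2))"
proof -
  have "(\<Sum>z\<in>slab m z0 J. (u z)\<^sup>2) \<le> (\<Sum>z\<in>slab m z0 J. 2 / real m * ((\<Sum>t<m. (u (z + of_nat t * unit_step i))\<^sup>2)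
      + (real m)\<^sup>2 * (\<Sum>t<m. (fdiff i u (z + of_nat t * unit_step i))\<^sup>2)))"
  proof (rule sum_mono)
    fix z
    show "(u z)\<^sup>2 \<le> 2 / real m * ((\<Sum>t<m. (u (z + of_nat t * unit_step i))\<^sup>2)
      + (real m)\<^sup>2 * (\<Sum>t<m. (fdiff i u (z + of_nat t * unit_step i))\<^sup>2))"
      using sobolev_1d[OF m, of "\<lambda>t. u (z + of_nat t * unit_step i)"]
      by (simp add: fdiff_def algebra_simps)
  qed
  also have "\<dots> = 2 / real m * ((\<Sum>z\<in>slab m z0 (insert i J). (u z)\<^sup>2)
      + (real m)\<^sup>2 * (\<Sum>z\<in>slab m z0 (insert i J). (fdiff i u z)\<^sup>2))"
    unfolding slab_insert_sum[OF assms(1)]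
    by (simp add: sum_distrib_left sum.distrib algebra_simps)
  finally show ?thesis .
qed

text \<open>The directions in \<open>J\<close> are frozen one by one by \<open>slab_step\<close>.
  Each costs one further difference in that direction, so the hypothesis is used for
  \<open>ds\<close> and for \<open>ds @ [i]\<close>; the weights m^2 per difference make both terms
  equal in size, and 2/m times two of them is the factor 4/m.\<close>

lemma sobolev_slab:
  fixes u :: "int ^ 'n \<Rightarrow> real"
  assumes m: "1 \<le> m"
    and Q: "\<And>ds. length ds \<le> CARD('n) \<Longrightarrow> ((real m)\<^sup>2) ^ length ds * (\<Sum>z\<in>slab m z0 UNIV. (fdiffs ds u z)\<^sup>2) \<le> Q"
    and "finite J" "length ds + card J \<le> CARD('n)"
  shows "((real m)\<^sup>2) ^ length ds * (\<Sum>z\<in>slab m z0 (- J). (fdiffs ds u z)\<^sup>2) \<le> (4 / real m) ^ card J * Q"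
  using assms(3,4)
proof (induction J arbitrary: ds)
    case empty
    then show ?case using Q by simp
  next
    case (insert i J)
    have iJ: "insert i (- insert i J) = - J" using insert by auto
    have 1: "((real m)\<^sup>2) ^ length ds * (\<Sum>z\<in>slab m z0 (- J). (fdiffs ds u z)\<^sup>2) \<le> (4 / real m) ^ card J * Q"
      using insert by (intro insert.IH) auto
    have 2: "((real m)\<^sup>2) ^ length (ds @ [i]) * (\<Sum>z\<in>slab m z0 (- J). (fdiffs (ds @ [i]) u z)\<^sup>2) \<le> (4 / real m) ^ card J * Q"
      using insert by (intro insert.IH) auto
    have "((real m)\<^sup>2) ^ length ds * (\<Sum>z\<in>slab m z0 (- insert i J). (fdiffs ds u z)\<^sup>2)
       \<le> ((real m)\<^sup>2) ^ length ds * (2 / real m * ((\<Sum>z\<in>slab m z0 (- J). (fdiffs ds u z)\<^sup>2)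
      + (real m)\<^sup>2 * (\<Sum>z\<in>slab m z0 (- J). (fdiff i (fdiffs ds u) z)\<^sup>2)))"
      using slab_step[where i = i and m = m and J = "- insert i J" and u = "fdiffs ds u", OF _ m] unfolding iJ
      by (intro mult_left_mono) auto
    also have "\<dots> = 2 / real m * (((real m)\<^sup>2) ^ length ds * (\<Sum>z\<in>slab m z0 (- J). (fdiffs ds u z)\<^sup>2)
       + ((real m)\<^sup>2) ^ length (ds @ [i]) * (\<Sum>z\<in>slab m z0 (- J). (fdiffs (ds @ [i]) u z)\<^sup>2))"
      by (simp add: fdiffs_def algebra_simps)
    also have "\<dots> \<le> 2 / real m * ((4 / real m) ^ card J * Q + (4 / real m) ^ card J * Q)"
      using 1 2 by (intro mult_left_mono add_mono) auto
    finally show ?case using insert(1,2) by (simp add: mult_ac)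
qed

lemma sobolev:
  fixes u :: "int ^ 'n \<Rightarrow> real"
  assumes m: "1 \<le> m"
    and Q: "\<And>ds. length ds \<le> CARD('n) \<Longrightarrow> ((real m)\<^sup>2) ^ length ds * (\<Sum>z\<in>slab m z0 UNIV. (fdiffs ds u z)\<^sup>2) \<le> Q"
  shows "(u z0)\<^sup>2 \<le> (4 / real m) ^ CARD('n) * Q"
proof -
  have "slab m z0 {} = {z0}" by (auto simp: slab_def vec_eq_iff)
  then show ?thesis using sobolev_slab[OF assms, of UNIV "[]"] by (simp add: fdiffs_def)
qed

text \<open>Sobolev needs up to n differences with weight m^2 each; the iterated Caccioppoli
  inequality supplies them with 8 / m^2 each, so the powers of m cancel. The constant is 32 = 4 *
  8.\<close>

lemma mean_value:
  fixes u :: "int ^ 'n \<Rightarrow> real"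
  defines "N \<equiv> (2 * CARD('n) + 1) ^ CARD('n)"
  assumes m: "1 \<le> m" and \<alpha>: "0 \<le> \<alpha>"
    and eq: "\<And>z. z \<in> lbox (int (N * m)) z0 \<Longrightarrow> laplace u z = \<alpha> * u z"
  shows "(u z0)\<^sup>2 \<le> (32 / real m) ^ CARD('n) * (\<Sum>z\<in>lbox (int (N * m)) z0. (u z)\<^sup>2)"
proof -
  let ?S = "\<Sum>z\<in>lbox (int (N * m)) z0. (u z)\<^sup>2"
  have S: "0 \<le> ?S" by (simp add: sum_nonneg)
  have "((real m)\<^sup>2) ^ length ds * (\<Sum>z\<in>slab m z0 UNIV. (fdiffs ds u z)\<^sup>2) \<le> 8 ^ CARD('n) * ?S"
    if len: "length ds \<le> CARD('n)" for ds
  proof -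
    let ?k = "(2 * CARD('n) + 1) ^ length ds * m"
    have k: "?k \<le> N * m" unfolding N_def using len by (intro mult_right_mono power_increasing) auto
    then have sub: "lbox (int ?k) z0 \<subseteq> lbox (int (N * m)) z0" by (intro lbox_mono) (simp only: of_nat_le_iff)
    have "slab m z0 UNIV \<subseteq> lbox (int m) z0"
    proof
      fix y assume "y \<in> slab m z0 UNIV"
      then have y: "z0 $ i \<le> y $ i \<and> y $ i < z0 $ i + int m" for i
        by (simp add: slab_def)
      have "\<bar>y $ i - z0 $ i\<bar> \<le> int m" for i using y[of i] by linarith
      then show "y \<in> lbox (int m) z0" by (simp add: lbox_def)
    qed
    then have "(\<Sum>z\<in>slab m z0 UNIV. (fdiffs ds u z)\<^sup>2) \<le> (\<Sum>z\<in>lbox (int m) z0. (fdiffs ds u z)\<^sup>2)"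
      by (intro sum_mono2) auto
    also have "\<dots> \<le> (8 / (real m)\<^sup>2) ^ length ds * (\<Sum>z\<in>lbox (int ?k) z0. (u z)\<^sup>2)"
      by (rule caccioppoli_iterated[OF m \<alpha>]) (use eq sub in auto)
    also have "\<dots> \<le> (8 / (real m)\<^sup>2) ^ length ds * ?S"
      using sub by (intro mult_left_mono sum_mono2) auto
    finally have "((real m)\<^sup>2) ^ length ds * (\<Sum>z\<in>slab m z0 UNIV. (fdiffs ds u z)\<^sup>2)
       \<le> ((real m)\<^sup>2) ^ length ds * ((8 / (real m)\<^sup>2) ^ length ds * ?S)" by (intro mult_left_mono) auto
    also have "\<dots> = 8 ^ length ds * ?S" using m by (simp add: power_divide)
    also have "\<dots> \<le> 8 ^ CARD('n) * ?S" using len S by (intro mult_right_mono power_increasing) auto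
    finally show ?thesis .
  qed
  from sobolev[OF m this] have "(u z0)\<^sup>2 \<le> (4 / real m) ^ CARD('n) * (8 ^ CARD('n) * ?S)" .
  also have "\<dots> = (32 / real m) ^ CARD('n) * ?S" by (simp add: power_divide power_mult_distrib[symmetric])
  finally show ?thesis .
qed

subsection \<open>Dyadic blocks and stopping levels\<close>

text \<open>\<open>div\<close> rounds down also for negative numbers, so these blocks tile the whole
  lattice and are nested in \<open>p\<close>. The neighbourhood \<open>nbh\<close> is defined
  through the block of \<open>z\<close>, which makes it constant on blocks.\<close>

definition blk :: "nat \<Rightarrow> int ^ 'n \<Rightarrow> (int ^ 'n) set" where
  "blk p z = {y. \<forall>i. y $ i div 2 ^ p = z $ i div 2 ^ p}"

definition nbh :: "nat \<Rightarrow> nat \<Rightarrow> int ^ 'n \<Rightarrow> (int ^ 'n) set" where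
  "nbh c p z = {y. \<forall>i. \<bar>y $ i div 2 ^ p - z $ i div 2 ^ p\<bar> \<le> int c}"

lemma le_div_iff_int:
  fixes a t m :: int
  assumes "0 < m"
  shows "a \<le> t div m \<longleftrightarrow> a * m \<le> t"
proof
  assume "a \<le> t div m"
  then have "a * m \<le> (t div m) * m" using assms by (intro mult_right_mono) auto
  also have "\<dots> \<le> t" using assms by (metis add_le_same_cancel1 div_mult_mod_eq le_add_same_cancel1 pos_mod_sign)
  finally show "a * m \<le> t" .
next
  assume "a * m \<le> t"
  then have "(a * m) div m \<le> t div m" using assms by (rule zdiv_mono1)
  then show "a \<le> t div m" using assms by simp
qed

lemma div_between_iff: "(t :: int) div 2 ^ p \<in> {a..<b} \<longleftrightarrow> t \<in> {a * 2 ^ p ..< b * 2 ^ p}"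
  using le_div_iff_int[of "2 ^ p" a t] le_div_iff_int[of "2 ^ p" b t] by auto

lemma abs_div_diff_le:
  fixes a b m :: int
  assumes "0 < m" "\<bar>a - b\<bar> \<le> int c * m"
  shows "\<bar>a div m - b div m\<bar> \<le> int c"
proof -
  have "x div m \<le> y div m + int c" if "x \<le> y + int c * m" for x y
    using zdiv_mono1[OF that assms(1)] assms(1) by simp
  from this[of a b] this[of b a] assms(2) show ?thesis by linarith
qed

lemma nbh_eq: "nbh c p z = {y. \<forall>i. y $ i \<in> {(z $ i div 2 ^ p - int c) * 2 ^ p ..< (z $ i div 2 ^ p + int c + 1) * 2 ^ p}}"
proof -
  have "\<bar>t div 2 ^ p - q\<bar> \<le> int c \<longleftrightarrow> t \<in> {(q - int c) * 2 ^ p ..< (q + int c + 1) * 2 ^ p}" for t q :: int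
    unfolding div_between_iff[symmetric] by auto
  then show ?thesis by (simp add: nbh_def)
qed

lemma blk_eq_nbh: "blk p z = nbh 0 p z" by (simp add: blk_def nbh_def)

lemma finite_nbh [simp]: "finite (nbh c p z)"
  unfolding nbh_eq by (rule card_vec_product(2)) simp

lemma finite_blk [simp]: "finite (blk p z)" by (simp add: blk_eq_nbh)

lemma card_nbh: "card (nbh c p (z :: int ^ 'n)) = (2 * c + 1) ^ CARD('n) * (2 ^ p) ^ CARD('n)"
proof -
  have "card {(q - int c) * 2 ^ p ..< (q + int c + 1) * 2 ^ p} = (2 * c + 1) * 2 ^ p" for q :: int
  proof -
    have "(q + int c + 1) * 2 ^ p - (q - int c) * 2 ^ p = int ((2 * c + 1) * 2 ^ p)" by (simp add: algebra_simps)
    then show ?thesis by (simp only: card_atLeastLessThan_int nat_int)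
  qed
  then show ?thesis unfolding nbh_eq card_vec_product(1) by (simp add: power_mult_distrib[symmetric])
qed

lemma card_blk: "card (blk p (z :: int ^ 'n)) = (2 ^ p) ^ CARD('n)"
  by (simp add: blk_eq_nbh card_nbh)

lemma self_in_blk [simp]: "z \<in> blk p z" by (simp add: blk_def)

lemma blk_cong: "y \<in> blk p z \<Longrightarrow> blk p y = blk p z" by (simp add: blk_def)
lemma nbh_cong: "y \<in> blk p z \<Longrightarrow> nbh c p y = nbh c p z" by (simp add: blk_def nbh_def)

lemma div_level: "p \<le> q \<Longrightarrow> (t :: int) div 2 ^ q = t div 2 ^ p div 2 ^ (q - p)"
  using zdiv_zmult2_eq[of "2 ^ (q - p)" t "2 ^ p"] by (simp add: power_add[symmetric])

lemma blk_mono: "p \<le> q \<Longrightarrow> y \<in> blk p z \<Longrightarrow> y \<in> blk q z"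
  by (simp add: blk_def div_level)

lemma nbh_mono: "p \<le> q \<Longrightarrow> y \<in> nbh c p z \<Longrightarrow> y \<in> nbh c q z"
proof -
  assume pq: "p \<le> q" and y: "y \<in> nbh c p z"
  have "\<bar>y $ i div 2 ^ p div 2 ^ (q - p) - z $ i div 2 ^ p div 2 ^ (q - p)\<bar> \<le> int c" for i
  proof (rule abs_div_diff_le)
    have "\<bar>y $ i div 2 ^ p - z $ i div 2 ^ p\<bar> \<le> int c * 1" using y by (simp add: nbh_def)
    also have "\<dots> \<le> int c * 2 ^ (q - p)" by (rule mult_left_mono) auto
    finally show "\<bar>y $ i div 2 ^ p - z $ i div 2 ^ p\<bar> \<le> int c * 2 ^ (q - p)" .
  qed simp
  then show ?thesis unfolding nbh_def using pq by (simp add: div_level)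
qed

lemma lbox_subset_nbh: "lbox (int c * 2 ^ p) z \<subseteq> nbh c p z"
  unfolding lbox_def nbh_def by (auto intro!: abs_div_diff_le)

text \<open>A decomposition into disjoint dyadic blocks of varying size, encoded by a level function
  that is constant on each block; no family of blocks or choice of centres has to be carried
  along.\<close>

definition block_partition :: "(int ^ 'n \<Rightarrow> nat) \<Rightarrow> (int ^ 'n) set \<Rightarrow> bool" where
  "block_partition l S \<longleftrightarrow> finite S \<and> (\<forall>z\<in>S. blk (l z) z \<subseteq> S \<and> (\<forall>y\<in>blk (l z) z. l y = l z))"

lemma block_partition_Union:
  assumes "block_partition l S"
  shows "S = \<Union> ((\<lambda>z. blk (l z) z) ` S)"
    and "\<And>A B. A \<in> (\<lambda>z. blk (l z) z) ` S \<Longrightarrow> B \<in> (\<lambda>z. blk (l z) z) ` S \<Longrightarrow> A \<noteq> B \<Longrightarrow> A \<inter> B = {}"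
proof -
  have "blk (l z) z \<subseteq> S" if "z \<in> S" for z using assms that unfolding block_partition_def by blast
  then show "S = \<Union> ((\<lambda>z. blk (l z) z) ` S)" using self_in_blk by blast
  fix A B assume "A \<in> (\<lambda>z. blk (l z) z) ` S" "B \<in> (\<lambda>z. blk (l z) z) ` S" "A \<noteq> B"
  then obtain z w where zw: "z \<in> S" "w \<in> S" "A = blk (l z) z" "B = blk (l w) w" by blast
  show "A \<inter> B = {}"
  proof (rule ccontr)
    assume "A \<inter> B \<noteq> {}"
    then obtain y where y: "y \<in> blk (l z) z" "y \<in> blk (l w) w" using zw by auto
    then have "l y = l z" "l y = l w" using assms zw(1,2) unfolding block_partition_def by blast+
    then show False using blk_cong[OF y(1)] blk_cong[OF y(2)] zw \<open>A \<noteq> B\<close> by simp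
  qed
qed

lemma block_partition_sum_le:
  fixes F G :: "int ^ 'n \<Rightarrow> real"
  assumes bp: "block_partition l S"
    and le: "\<And>z. z \<in> S \<Longrightarrow> sum F (blk (l z) z) \<le> sum G (blk (l z) z)"
  shows "sum F S \<le> sum G S"
proof -
  let ?B = "(\<lambda>z. blk (l z) z) ` S"
  have "sum H S = (\<Sum>A\<in>?B. sum H A)" for H :: "int ^ 'n \<Rightarrow> real"
    using sum.Union_disjoint[of ?B H] block_partition_Union[OF bp] by auto
  note eq = this
  show ?thesis unfolding eq by (rule sum_mono) (use le in blast)
qed

text \<open>Enlarging a block by \<open>c\<close> rings multiplies its volume by (2c+1)^n. The
  neighbourhoods may overlap, but disjointness of the blocks themselves sums the volumes.\<close>

lemma block_partition_card_nbh:
  fixes S :: "(int ^ 'n) set"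
  assumes bp: "block_partition l S"
  shows "card (\<Union>z\<in>S. nbh c (l z) z) \<le> (2 * c + 1) ^ CARD('n) * card S"
proof -
  let ?B = "(\<lambda>z. blk (l z) z) ` S"
  have finS: "finite S" using bp by (simp add: block_partition_def)
  \<comment> \<open>One representative point per block, so that each neighbourhood is counted once
    and not once per point of its block.\<close>
  define r where "r A = (SOME z. z \<in> S \<and> blk (l z) z = A)" for A
  have r: "r A \<in> S" "blk (l (r A)) (r A) = A" if "A \<in> ?B" for A
    using someI_ex[of "\<lambda>z. z \<in> S \<and> blk (l z) z = A"] that unfolding r_def by auto
  have "(\<Union>z\<in>S. nbh c (l z) z) \<subseteq> (\<Union>A\<in>?B. nbh c (l (r A)) (r A))"
  proof
    fix y assume "y \<in> (\<Union>z\<in>S. nbh c (l z) z)"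
    then obtain z where z: "z \<in> S" "y \<in> nbh c (l z) z" by auto
    let ?A = "blk (l z) z"
    have A: "?A \<in> ?B" using z by auto
    have "z \<in> blk (l (r ?A)) (r ?A)" using r(2)[OF A] by simp
    then have "l z = l (r ?A)" "nbh c (l (r ?A)) z = nbh c (l (r ?A)) (r ?A)"
      using bp r(1)[OF A] nbh_cong unfolding block_partition_def by blast+
    with z(2) have "y \<in> nbh c (l (r ?A)) (r ?A)" by simp
    with A show "y \<in> (\<Union>A\<in>?B. nbh c (l (r A)) (r A))" by blast
  qed
  then have "card (\<Union>z\<in>S. nbh c (l z) z) \<le> card (\<Union>A\<in>?B. nbh c (l (r A)) (r A))"
    using finS by (intro card_mono) auto
  also have "\<dots> \<le> (\<Sum>A\<in>?B. card (nbh c (l (r A)) (r A)))" using finS by (intro card_UN_le) auto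
  also have "\<dots> = (\<Sum>A\<in>?B. (2 * c + 1) ^ CARD('n) * card A)"
  proof (rule sum.cong[OF refl])
    fix A assume A: "A \<in> ?B"
    show "card (nbh c (l (r A)) (r A)) = (2 * c + 1) ^ CARD('n) * card A"
      using card_blk[of "l (r A)" "r A"] unfolding r(2)[OF A] by (simp add: card_nbh)
  qed
  also have "\<dots> = (2 * c + 1) ^ CARD('n) * (\<Sum>A\<in>?B. card A)" by (simp add: sum_distrib_left)
  also have "(\<Sum>A\<in>?B. card A) = card (\<Union>?B)"
    using block_partition_Union(2)[OF bp] by (intro card_Union_disjoint[symmetric]) (auto simp: pairwise_def disjnt_def)
  also have "\<Union>?B = S" using block_partition_Union(1)[OF bp] by simp
  finally show ?thesis .
qed

text \<open>The stopping rule: scales are searched from the top down. The value is meaningful only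
  if some level up to \<open>p0\<close> has the property.\<close>

definition toplevel :: "nat \<Rightarrow> (nat \<Rightarrow> 'b \<Rightarrow> bool) \<Rightarrow> 'b \<Rightarrow> nat" where
  "toplevel p0 H z = Max {p. p \<le> p0 \<and> H p z}"

lemma toplevel:
  assumes "\<exists>p\<le>p0. H p z"
  shows "toplevel p0 H z \<le> p0" "H (toplevel p0 H z) z"
    and "\<And>q. q \<le> p0 \<Longrightarrow> H q z \<Longrightarrow> q \<le> toplevel p0 H z"
proof -
  have fin: "finite {p. p \<le> p0 \<and> H p z}" by simp
  have "toplevel p0 H z \<in> {p. p \<le> p0 \<and> H p z}"
    unfolding toplevel_def using assms by (intro Max_in fin) auto
  then show "toplevel p0 H z \<le> p0" "H (toplevel p0 H z) z" by auto
  show "q \<le> toplevel p0 H z" if "q \<le> p0" "H q z" for q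
    unfolding toplevel_def using that by (intro Max_ge fin) auto
qed

text \<open>If \<open>y\<close> lies in the top block of \<open>z\<close>, the top level of
  \<open>y\<close> is at least that of \<open>z\<close> by maximality, and its block then contains
  \<open>z\<close>; maximality at \<open>z\<close> gives equality. This replaces a covering
  argument.\<close>

lemma block_partition_toplevel:
  assumes inv: "\<And>p y z. y \<in> blk p z \<Longrightarrow> H p y = H p z"
    and fin: "finite {z. \<exists>p\<le>p0. H p z}"
  shows "block_partition (toplevel p0 H) {z. \<exists>p\<le>p0. H p z}"
  unfolding block_partition_def
proof (intro conjI ballI fin)
  fix z assume "z \<in> {z. \<exists>p\<le>p0. H p z}"
  then have z: "\<exists>p\<le>p0. H p z" by simp
  let ?l = "toplevel p0 H"
  have y: "H (?l z) y" if "y \<in> blk (?l z) z" for y using inv[OF that] toplevel(2)[of p0 H z, OF z] by simp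
  then show "blk (?l z) z \<subseteq> {z. \<exists>p\<le>p0. H p z}" using toplevel(1)[of p0 H z, OF z] by auto
  fix y assume yb: "y \<in> blk (?l z) z"
  then have ey: "\<exists>p\<le>p0. H p y" using y toplevel(1)[of p0 H z, OF z] by auto
  have 1: "?l z \<le> ?l y" using toplevel(3)[of p0 H y, OF ey] toplevel(1)[of p0 H z, OF z] y[OF yb] by blast
  have "H (?l y) z" using toplevel(2)[of p0 H y, OF ey] inv[OF blk_mono[OF 1 yb]] by simp
  then have "?l y \<le> ?l z" using toplevel(3)[of p0 H z, OF z] toplevel(1)[of p0 H y, OF ey] by blast
  with 1 show "?l y = ?l z" by simp
qed

lemma finite_heavy:
  assumes "fsupp a" "\<And>p. 0 \<le> t p"
  shows "finite {z. \<exists>p\<le>p0. t p < sum a (blk p z)}"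
proof (rule finite_subset)
  show "{z. \<exists>p\<le>p0. t p < sum a (blk p z)} \<subseteq> (\<Union>p\<in>{..p0}. \<Union>y\<in>{y. a y \<noteq> 0}. blk p y)"
  proof
    fix z assume "z \<in> {z. \<exists>p\<le>p0. t p < sum a (blk p z)}"
    then obtain p where p: "p \<le> p0" "t p < sum a (blk p z)" by auto
    then have "sum a (blk p z) \<noteq> 0" using assms(2)[of p] by auto
    then obtain y where "y \<in> blk p z" "a y \<noteq> 0" by (rule sum.not_neutral_contains_not_neutral)
    then show "z \<in> (\<Union>p\<in>{..p0}. \<Union>y\<in>{y. a y \<noteq> 0}. blk p y)"
    proof -
      have "z \<in> blk p y" using \<open>y \<in> blk p z\<close> by (simp add: blk_def)
      then show ?thesis using p \<open>a y \<noteq> 0\<close> by blast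
    qed
  qed
qed (use assms in auto)

definition heavy :: "(int ^ 'n \<Rightarrow> real) \<Rightarrow> real \<Rightarrow> nat \<Rightarrow> int ^ 'n \<Rightarrow> bool" where
  "heavy a L p z \<longleftrightarrow> L * (2 ^ p) ^ CARD('n) < sum a (blk p z)"

lemma heavy_cong: "y \<in> blk p z \<Longrightarrow> heavy a L p y = heavy a L p z"
  by (simp add: heavy_def blk_cong)

lemma heavy_partition:
  assumes "fsupp a" "0 \<le> L"
  shows "block_partition (toplevel p0 (heavy a L)) {z. \<exists>p\<le>p0. heavy a L p z}"
  using finite_heavy[OF assms(1), of "\<lambda>p. L * (2 ^ p) ^ CARD('a)"] assms
  by (intro block_partition_toplevel heavy_cong) (auto simp: heavy_def)

text \<open>Weak-type bound for the dyadic maximal function: on each of the disjoint maximal blocks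
  the mass exceeds L times the volume.\<close>

lemma card_heavy_le:
  assumes "fsupp a" "0 \<le> L" "\<And>z. 0 \<le> a z"
  shows "L * card {z. \<exists>p\<le>p0. heavy a L p z} \<le> Sum_any a"
proof -
  let ?S = "{z. \<exists>p\<le>p0. heavy a L p z}"
  have bp: "block_partition (toplevel p0 (heavy a L)) ?S" by (rule heavy_partition[OF assms(1,2)])
  have "L * card ?S = sum (\<lambda>_. L) ?S" by simp
  also have "\<dots> \<le> sum a ?S"
  proof (rule block_partition_sum_le[OF bp])
    fix z assume "z \<in> ?S"
    then have "heavy a L (toplevel p0 (heavy a L) z) z" using toplevel(2)[of p0 "heavy a L" z] by simp
    then show "sum (\<lambda>_. L) (blk (toplevel p0 (heavy a L) z) z) \<le> sum a (blk (toplevel p0 (heavy a L) z) z)"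
      by (simp add: heavy_def card_blk mult.commute)
  qed
  also have "\<dots> \<le> Sum_any a"
    using bp assms by (intro sum_le_Sum_any) (auto simp: block_partition_def)
  finally show ?thesis .
qed

lemma sum_UN_le:
  fixes f :: "'b \<Rightarrow> real"
  assumes "finite I" "\<And>i. i \<in> I \<Longrightarrow> finite (X i)" "\<And>x. 0 \<le> f x"
  shows "sum f (\<Union>i\<in>I. X i) \<le> (\<Sum>i\<in>I. sum f (X i))"
  using assms(1,2)
proof (induction I)
  case (insert i I)
  have "sum f (X i \<union> (\<Union>i\<in>I. X i)) = sum f (X i) + sum f ((\<Union>i\<in>I. X i) - X i)"
    using insert by (subst sum.union_disjoint[symmetric]) (auto simp: Un_Diff_cancel)
  also have "sum f ((\<Union>i\<in>I. X i) - X i) \<le> sum f (\<Union>i\<in>I. X i)"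
    using insert assms(3) by (intro sum_mono2) auto
  finally show ?case using insert by simp
qed simp

text \<open>A maximal inequality for \<open>e\<close> whose exceptional set is measured by
  \<open>a\<close> instead of volume. At and above the stopping level the density of
  \<open>a\<close> is at most 2^n * L, so the mass of the bad blocks is bounded by their volume. One
  factor (2c+1)^n comes from covering neighbourhoods by blocks, the other from enlarging these
  blocks.\<close>

lemma bad_mass:
  fixes a e :: "int ^ 'n \<Rightarrow> real" and c :: nat
  assumes a: "fsupp a" "\<And>z. 0 \<le> a z" and L: "0 < L" and M: "Sum_any a \<le> L * (2 ^ p0) ^ CARD('n)"
    and e: "\<And>z. 0 \<le> e z" "\<And>B. finite B \<Longrightarrow> sum e B \<le> Se" and A: "0 < A"
  defines "\<Omega> \<equiv> {z. \<exists>p\<le>p0. heavy a L p z}" and "lev \<equiv> toplevel p0 (heavy a L)"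
  defines "Bad \<equiv> {z\<in>\<Omega>. \<exists>p\<le>p0. lev z \<le> p \<and> A * (2 ^ p) ^ CARD('n) < sum e (nbh c p z)}"
  shows "sum a Bad \<le> L * 2 ^ CARD('n) * (real (2 * c + 1) ^ CARD('n)) ^ 2 / A * Se"
proof -
  let ?n = "CARD('n)"
  define K where "K = real (2 * c + 1) ^ ?n"
  have K: "0 < K" by (simp add: K_def)
  have fin\<Omega>: "finite \<Omega>" using heavy_partition[OF a(1), of L p0] L by (simp add: \<Omega>_def block_partition_def)
  have lev: "lev z \<le> p0" "heavy a L (lev z) z" "\<And>q. q \<le> p0 \<Longrightarrow> heavy a L q z \<Longrightarrow> q \<le> lev z" if "z \<in> \<Omega>" for z
    using that toplevel[of p0 "heavy a L" z] unfolding lev_def \<Omega>_def by auto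
  \<comment> \<open>The parent of the block is no longer heavy, and its volume is 2^n times larger.
    At the top level the bound on the total mass takes the place of the parent.\<close>
  have above: "sum a (blk p z) \<le> 2 ^ ?n * L * (2 ^ p) ^ ?n" if "z \<in> \<Omega>" "lev z \<le> p" "p \<le> p0" for z p
  proof (cases "p = p0")
    case True
    have "sum a (blk p z) \<le> Sum_any a" using a by (intro sum_le_Sum_any) auto
    also have "\<dots> \<le> 1 * (L * (2 ^ p) ^ ?n)" using M True by simp
    also have "\<dots> \<le> 2 ^ ?n * (L * (2 ^ p) ^ ?n)" using L by (intro mult_right_mono) auto
    finally show ?thesis by (simp add: mult.assoc)
  next
    case False
    then have "\<not> heavy a L (Suc p) z" using lev(3)[OF that(1), of "Suc p"] that by auto
    then have "sum a (blk (Suc p) z) \<le> L * (2 ^ Suc p) ^ ?n" by (simp add: heavy_def)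
    moreover have "sum a (blk p z) \<le> sum a (blk (Suc p) z)"
      using a blk_mono[of p "Suc p"] by (intro sum_mono2) auto
    ultimately show ?thesis by (simp add: power_mult_distrib mult_ac)
  qed
  \<comment> \<open>A block-invariant version of being bad at level \<open>p\<close>. The density
    bound is stored so that it is available on the maximal blocks, and the last conjunct ties the
    block to \<open>\<Omega>\<close>, which keeps its neighbourhood inside the finite set
    \<open>G\<close>.\<close>
  define H where "H p z \<longleftrightarrow> A * (2 ^ p) ^ ?n < sum e (nbh c p z) \<and> sum a (blk p z) \<le> 2 ^ ?n * L * (2 ^ p) ^ ?n
    \<and> (\<exists>w\<in>\<Omega>. w \<in> blk p z)" for p z
  define G where "G = (\<Union>w\<in>\<Omega>. \<Union>p\<in>{..p0}. nbh c p w)"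
  have finG: "finite G" using fin\<Omega> by (simp add: G_def)
  \<comment> \<open>The weak-type bound needs finite support, while only sums of \<open>e\<close>
    over finite sets are controlled.\<close>
  define e' where "e' z = (if z \<in> G then e z else 0)" for z
  have e': "fsupp e'" "0 \<le> e' z" for z
    using e finG by (auto simp: e'_def intro: finite_subset[OF _ finG])
  have Se': "Sum_any e' \<le> Se" using e(2)[OF finG] finG by (simp add: e'_def Sum_any.conditionalize[symmetric])
  have Hinv: "H p y = H p z" if "y \<in> blk p z" for p y z
    unfolding H_def using blk_cong[OF that] nbh_cong[OF that] by simp
  let ?T = "{z. \<exists>p\<le>p0. heavy e' (A / K) p z}"
  have bpT: "block_partition (toplevel p0 (heavy e' (A / K))) ?T" using A K by (intro heavy_partition e') simp
  have sub: "{z. \<exists>p\<le>p0. H p z} \<subseteq> (\<Union>z\<in>?T. nbh c (toplevel p0 (heavy e' (A / K)) z) z)"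
  proof
    fix z assume "z \<in> {z. \<exists>p\<le>p0. H p z}"
    then obtain p w where p: "p \<le> p0" "A * (2 ^ p) ^ ?n < sum e (nbh c p z)" and w: "w \<in> \<Omega>" "w \<in> blk p z"
      by (auto simp: H_def)
    have "nbh c p z \<subseteq> G" using w p nbh_cong[OF w(2)] by (auto simp: G_def)
    then have ee: "sum e (nbh c p z) = sum e' (nbh c p z)" by (intro sum.cong) (auto simp: e'_def)
    \<comment> \<open>The neighbourhood consists of (2c+1)^n translates of the block. By pigeonhole
      one of them carries density above A / K.\<close>
    let ?t = "\<lambda>s. \<chi> i. z $ i + 2 ^ p * s $ i"
    let ?I = "{s :: int ^ 'n. \<forall>i. s $ i \<in> {- int c .. int c}}"
    have cI: "card ?I = (2 * c + 1) ^ ?n" "finite ?I"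
      using card_vec_product(1)[of "\<lambda>_::'n. {- int c .. int c}"] card_vec_product(2)[of "\<lambda>_::'n. {- int c .. int c}"]
      by (auto simp: nat_add_distrib nat_mult_distrib)
    have div: "?t s $ i div 2 ^ p = z $ i div 2 ^ p + s $ i" for s i by simp
    have "nbh c p z \<subseteq> (\<Union>s\<in>?I. blk p (?t s))"
    proof
      fix y assume y: "y \<in> nbh c p z"
      let ?s = "\<chi> i. y $ i div 2 ^ p - z $ i div 2 ^ p"
      have "y \<in> blk p (?t ?s)" unfolding blk_def mem_Collect_eq div by simp
      moreover have "?s $ i \<in> {- int c .. int c}" for i
        using y unfolding nbh_def mem_Collect_eq by (auto dest!: spec[of _ i])
      ultimately show "y \<in> (\<Union>s\<in>?I. blk p (?t s))" by (intro UN_I[of ?s]) simp_all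
    qed
    then have "sum e' (nbh c p z) \<le> sum e' (\<Union>s\<in>?I. blk p (?t s))"
      using e' cI(2) by (intro sum_mono2) auto
    also have "\<dots> \<le> (\<Sum>s\<in>?I. sum e' (blk p (?t s)))"
      using e' cI(2) by (intro sum_UN_le) auto
    finally have big: "A * (2 ^ p) ^ ?n < (\<Sum>s\<in>?I. sum e' (blk p (?t s)))" using p ee by simp
    have "\<exists>s\<in>?I. heavy e' (A / K) p (?t s)"
    proof (rule ccontr)
      assume "\<not> ?thesis"
      then have "(\<Sum>s\<in>?I. sum e' (blk p (?t s))) \<le> (\<Sum>s\<in>?I. A / K * (2 ^ p) ^ ?n)"
        by (intro sum_mono) (auto simp: heavy_def)
      also have "\<dots> = A * (2 ^ p) ^ ?n" using cI(1) K by (simp add: K_def)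
      finally show False using big by simp
    qed
    then obtain s where s: "s \<in> ?I" "heavy e' (A / K) p (?t s)" by auto
    have zt: "z \<in> nbh c p (?t s)" using s(1) unfolding nbh_def mem_Collect_eq div by (simp add: abs_le_iff minus_le_iff)
    have T: "?t s \<in> ?T" using s p by auto
    \<comment> \<open>The heavy translate may lie in a larger heavy block; neighbourhoods grow with
      the level, so \<open>z\<close> is still covered.\<close>
    then have "p \<le> toplevel p0 (heavy e' (A / K)) (?t s)"
      using toplevel(3)[of p0 "heavy e' (A / K)" "?t s"] s p by auto
    from nbh_mono[OF this zt] T show "z \<in> (\<Union>z\<in>?T. nbh c (toplevel p0 (heavy e' (A / K)) z) z)" by blast
  qed
  have finT: "finite ?T" using bpT by (simp add: block_partition_def)
  have finH: "finite {z. \<exists>p\<le>p0. H p z}" by (rule finite_subset[OF sub]) (use finT in auto)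
  have bpH: "block_partition (toplevel p0 H) {z. \<exists>p\<le>p0. H p z}"
    by (rule block_partition_toplevel[OF Hinv finH])
  have "Bad \<subseteq> {z. \<exists>p\<le>p0. H p z}"
  proof
    fix z assume "z \<in> Bad"
    then obtain p where "z \<in> \<Omega>" "p \<le> p0" "lev z \<le> p" "A * (2 ^ p) ^ ?n < sum e (nbh c p z)"
      unfolding Bad_def by blast
    then have "H p z" unfolding H_def using above[of z p] self_in_blk[of z p] by blast
    then show "z \<in> {z. \<exists>p\<le>p0. H p z}" using \<open>p \<le> p0\<close> by blast
  qed
  then have "sum a Bad \<le> sum a {z. \<exists>p\<le>p0. H p z}" using a finH by (intro sum_mono2) auto
  also have "\<dots> \<le> sum (\<lambda>_. 2 ^ ?n * L) {z. \<exists>p\<le>p0. H p z}"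
  proof (rule block_partition_sum_le[OF bpH])
    fix z assume "z \<in> {z. \<exists>p\<le>p0. H p z}"
    then have "H (toplevel p0 H z) z" using toplevel(2)[of p0 H z] by simp
    then show "sum a (blk (toplevel p0 H z) z) \<le> sum (\<lambda>_. 2 ^ ?n * L) (blk (toplevel p0 H z) z)"
      by (simp add: H_def card_blk mult_ac)
  qed
  also have "\<dots> = 2 ^ ?n * L * card {z. \<exists>p\<le>p0. H p z}" by simp
  also have "\<dots> \<le> 2 ^ ?n * L * (K * card ?T)"
  proof (intro mult_left_mono)
    have "card {z. \<exists>p\<le>p0. H p z} \<le> card (\<Union>z\<in>?T. nbh c (toplevel p0 (heavy e' (A / K)) z) z)"
      using sub finT by (intro card_mono) auto
    also have "\<dots> \<le> (2 * c + 1) ^ ?n * card ?T" by (rule block_partition_card_nbh[OF bpT])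
    finally have "real (card {z. \<exists>p\<le>p0. H p z}) \<le> real ((2 * c + 1) ^ ?n * card ?T)" by (rule of_nat_mono)
    then show "real (card {z. \<exists>p\<le>p0. H p z}) \<le> K * card ?T" by (simp add: K_def)
  qed (use L in auto)
  also have "\<dots> \<le> 2 ^ ?n * L * (K * (K / A * Se))"
  proof (intro mult_left_mono)
    have "A / K * card ?T \<le> Sum_any e'" using A K by (intro card_heavy_le e') auto
    then have "A / K * card ?T \<le> Se" using Se' by simp
    then show "real (card ?T) \<le> K / A * Se" using A K by (simp add: field_simps)
  qed (use L K in auto)
  finally show ?thesis by (simp add: K_def power2_eq_square field_simps)
qed

subsection \<open>Box averages\<close>

definition cube :: "nat \<Rightarrow> (int ^ 'n) set" where
  "cube p = {s. \<forall>i. s $ i \<in> {0..<2 ^ p}}"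

text \<open>The average runs over a cube attached to \<open>z\<close>, not over the dyadic block of
  \<open>z\<close>. It is therefore translation invariant and commutes with differences and with the
  Laplacian.\<close>

definition avg :: "nat \<Rightarrow> (int ^ 'n \<Rightarrow> real) \<Rightarrow> int ^ 'n \<Rightarrow> real" where
  "avg p u z = (\<Sum>s\<in>cube p. u (z + s)) / (2 ^ p) ^ CARD('n)"

lemma finite_cube [simp]: "finite (cube p)"
  unfolding cube_def by (rule card_vec_product(2)) simp

lemma card_cube: "card (cube p :: (int ^ 'n) set) = (2 ^ p) ^ CARD('n)"
  unfolding cube_def card_vec_product(1) by (simp add: nat_power_eq)

lemma cube_lbox: "s \<in> cube p \<Longrightarrow> z + s \<in> lbox (2 ^ p) z"
  by (auto simp: cube_def lbox_def abs_le_iff intro: order_trans[of _ 0] less_imp_le)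

lemma avg_fdiff: "avg p (fdiff i u) z = fdiff i (avg p u) z"
  by (simp add: avg_def fdiff_def sum_subtractf diff_divide_distrib add_ac)

lemma avg_bdiff: "avg p (bdiff i u) z = bdiff i (avg p u) z"
  by (simp add: avg_def bdiff_def sum_subtractf diff_divide_distrib algebra_simps)

lemma avg_diff: "avg p (\<lambda>z. u z - v z) z = avg p u z - avg p v z"
  by (simp add: avg_def sum_subtractf diff_divide_distrib)

lemma avg_uminus: "avg p (\<lambda>z. - u z) z = - avg p u z"
  by (simp add: avg_def sum_negf)

lemma avg_scale: "avg p (\<lambda>z. c * u z) z = c * avg p u z"
  by (simp add: avg_def sum_distrib_left)

lemma avg_shift: "avg p (\<lambda>z. u (z + a)) z = avg p u (z + a)"
  by (simp add: avg_def add_ac)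

lemma avg_const: "avg p (\<lambda>_. c) (z :: int ^ 'n) = c"
  by (simp add: avg_def card_cube)

lemma avg_sum: "avg p (\<lambda>z. \<Sum>i\<in>I. u i z) z = (\<Sum>i\<in>I. avg p (u i) z)"
  unfolding avg_def sum_divide_distrib[symmetric] by (subst sum.swap) simp

lemma avg_laplace: "avg p (laplace u) z = laplace (avg p u) z"
proof -
  have "laplace u = (\<lambda>z. \<Sum>i\<in>UNIV. fdiff i (bdiff i u) z)" by (auto simp: laplace_eq)
  then have "avg p (laplace u) z = (\<Sum>i\<in>UNIV. avg p (fdiff i (bdiff i u)) z)" by (simp add: avg_sum)
  also have "avg p (bdiff i u) = bdiff i (avg p u)" for i by (auto simp: avg_bdiff)
  then have "(\<Sum>i\<in>UNIV. avg p (fdiff i (bdiff i u)) z) = laplace (avg p u) z"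
    by (simp add: laplace_eq avg_fdiff)
  finally show ?thesis .
qed

lemma avg_abs_le:
  assumes "\<And>s. s \<in> cube p \<Longrightarrow> \<bar>u (z + s)\<bar> \<le> B"
  shows "\<bar>avg p u (z :: int ^ 'n)\<bar> \<le> B"
proof -
  have "\<bar>\<Sum>s\<in>cube p. u (z + s)\<bar> \<le> (\<Sum>s\<in>(cube p :: (int ^ 'n) set). B)"
    using assms by (intro order_trans[OF sum_abs sum_mono])
  then show ?thesis by (simp add: avg_def card_cube abs_divide divide_le_eq mult.commute)
qed

lemma avg_power2_le:
  assumes "lbox (2 ^ p) z \<subseteq> B" "finite B"
  shows "(avg p u (z :: int ^ 'n))\<^sup>2 \<le> (\<Sum>y\<in>B. (u y)\<^sup>2) / (2 ^ p) ^ CARD('n)"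
proof -
  let ?m = "(2 ^ p) ^ CARD('n) :: real"
  have "(\<Sum>s\<in>cube p. u (z + s))\<^sup>2 \<le> (\<Sum>s\<in>cube p. (u (z + s))\<^sup>2) * ?m"
    using sum_squared_le_sum_of_squares[of "\<lambda>s. u (z + s)" "cube p"] by (simp add: card_cube)
  then have "(avg p u z)\<^sup>2 \<le> (\<Sum>s\<in>cube p. (u (z + s))\<^sup>2) / ?m"
    by (simp add: avg_def power_divide field_simps power2_eq_square[of ?m])
  also have "(\<Sum>s\<in>cube p. (u (z + s))\<^sup>2) = (\<Sum>y\<in>(\<lambda>s. z + s) ` cube p. (u y)\<^sup>2)"
    by (subst sum.reindex) auto
  also have "\<dots> \<le> (\<Sum>y\<in>B. (u y)\<^sup>2)" using assms cube_lbox[of _ p z] by (intro sum_mono2) auto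
  finally show ?thesis by (simp add: divide_right_mono)
qed

lemma avg_le_Sum_any:
  assumes "fsupp u" "\<And>z. 0 \<le> u z"
  shows "avg p u (z :: int ^ 'n) \<le> Sum_any u / (2 ^ p) ^ CARD('n)"
proof -
  have "(\<Sum>s\<in>cube p. u (z + s)) = (\<Sum>y\<in>(\<lambda>s. z + s) ` cube p. u y)"
    by (subst sum.reindex) auto
  also have "\<dots> \<le> Sum_any u" using assms by (intro sum_le_Sum_any) auto
  finally show ?thesis by (simp add: avg_def divide_right_mono)
qed

lemma avg_Suc:
  "avg (Suc p) u (z :: int ^ 'n) = (\<Sum>t\<in>cube 1. avg p u (z + (\<chi> i. 2 ^ p * t $ i))) / 2 ^ CARD('n)"
proof -
  have "(\<Sum>t\<in>cube 1. \<Sum>s\<in>cube p. u (z + (\<chi> i. 2 ^ p * t $ i) + s))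
      = (\<Sum>(t,s)\<in>cube 1 \<times> cube p. u (z + (\<chi> i. 2 ^ p * t $ i) + s))"
    by (rule sum.cartesian_product)
  also have "\<dots> = (\<Sum>s\<in>cube (Suc p). u (z + s))"
  proof (rule sum.reindex_bij_witness[where j = "\<lambda>q. (\<chi> i. 2 ^ p * fst q $ i) + snd q"
        and i = "\<lambda>s. (\<chi> i. s $ i div 2 ^ p, \<chi> i. s $ i mod 2 ^ p)"])
    fix q :: "(int ^ 'n) \<times> (int ^ 'n)" assume "q \<in> cube 1 \<times> cube p"
    then have q: "\<And>i. fst q $ i \<in> {0..<2}" "\<And>i. snd q $ i \<in> {0..<2^p}" by (auto simp: cube_def)
    show "(\<chi> i. ((\<chi> i. 2 ^ p * fst q $ i) + snd q) $ i div 2 ^ p,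
          \<chi> i. ((\<chi> i. 2 ^ p * fst q $ i) + snd q) $ i mod 2 ^ p) = q"
      using q by (cases q) (auto simp: vec_eq_iff)
    show "(\<chi> i. 2 ^ p * fst q $ i) + snd q \<in> cube (Suc p)"
      unfolding cube_def
    proof (intro CollectI allI)
      fix i
      have "fst q $ i = 0 \<or> fst q $ i = 1" using q(1)[of i] by auto
      then show "((\<chi> i. 2 ^ p * fst q $ i) + snd q) $ i \<in> {0..<2 ^ Suc p}" using q(2)[of i] by auto
    qed
    show "u (z + ((\<chi> i. 2 ^ p * fst q $ i) + snd q)) = (case q of (t, s) \<Rightarrow> u (z + (\<chi> i. 2 ^ p * t $ i) + s))"
      by (cases q) (simp add: add_ac)
  next
    fix s :: "int ^ 'n" assume s: "s \<in> cube (Suc p)"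
    show "(\<chi> i. 2 ^ p * fst (\<chi> i. s $ i div 2 ^ p, \<chi> i. s $ i mod 2 ^ p) $ i)
        + snd (\<chi> i. s $ i div 2 ^ p, \<chi> i. s $ i mod 2 ^ p) = s"
      by (simp add: vec_eq_iff)
    have "s $ i div 2 ^ p \<in> {0..<2}" for i
      using s unfolding div_between_iff by (auto simp: cube_def)
    then show "(\<chi> i. s $ i div 2 ^ p, \<chi> i. s $ i mod 2 ^ p) \<in> cube 1 \<times> cube p"
      by (auto simp: cube_def)
  qed
  finally show ?thesis
    by (simp add: avg_def sum_divide_distrib[symmetric] power_mult_distrib)
qed

text \<open>The average at the double scale is the mean of 2^n averages at points at l1 distance at
  most n * 2^p, which a lattice path joins to \<open>z\<close>. Only differences of averages enter,
  not of \<open>u\<close> itself.\<close>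

lemma avg_doubling:
  fixes u :: "int ^ 'n \<Rightarrow> real"
  assumes "\<And>x i. x \<in> lbox (2 ^ p) z \<Longrightarrow> \<bar>avg p (fdiff i u) x\<bar> \<le> B"
  shows "\<bar>avg (Suc p) u z - avg p u z\<bar> \<le> real CARD('n) * 2 ^ p * B"
proof -
  have B: "0 \<le> B" using assms[of z undefined] by simp
  let ?t = "\<lambda>t. z + (\<chi> i. 2 ^ p * t $ i)"
  have d: "\<bar>avg p u (?t t) - avg p u z\<bar> \<le> real CARD('n) * 2 ^ p * B" if t: "t \<in> cube 1" for t
  proof -
    have tl: "?t t \<in> lbox (2 ^ p) z"
    proof -
      have "\<bar>2 ^ p * t $ i\<bar> \<le> 2 ^ p" for i
      proof -
        have "t $ i \<in> {0..<2}" using t by (simp add: cube_def)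
        then have "t $ i = 0 \<or> t $ i = 1" by auto
        then show ?thesis by auto
      qed
      then show ?thesis by (simp add: lbox_def)
    qed
    have "\<bar>avg p u (?t t) - avg p u z\<bar> \<le> B * dist1 (?t t) z"
      by (rule lattice_path_lbox[OF _ tl self_in_lbox]) (use assms in \<open>simp_all add: avg_fdiff[symmetric]\<close>)
    also have "B * dist1 (?t t) z \<le> B * (real CARD('n) * 2 ^ p)"
      using dist1_lbox[OF tl] B by (intro mult_left_mono) (auto simp: dist1_commute)
    finally show ?thesis by (simp add: mult_ac)
  qed
  have "avg (Suc p) u z - avg p u z = (\<Sum>t\<in>cube 1. avg p u (?t t) - avg p u z) / 2 ^ CARD('n)"
    by (simp add: avg_Suc sum_subtractf card_cube diff_divide_distrib)
  also have "\<bar>\<dots>\<bar> = \<bar>\<Sum>t\<in>cube 1. avg p u (?t t) - avg p u z\<bar> / 2 ^ CARD('n)" by simp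
  also have "\<dots> \<le> (\<Sum>t\<in>(cube 1 :: (int ^ 'n) set). real CARD('n) * 2 ^ p * B) / 2 ^ CARD('n)"
    by (intro divide_right_mono order_trans[OF sum_abs sum_mono]) (use d in auto)
  also have "\<dots> = real CARD('n) * 2 ^ p * B" by (simp add: card_cube)
  finally show ?thesis .
qed

text \<open>The supremum need not be attained on the infinite lattice, so the equation is first
  turned into an upper bound for w(z) in terms of the supremum, and the supremum is taken
  afterwards.\<close>

lemma resolvent_max_principle:
  fixes w :: "int ^ 'n \<Rightarrow> real"
  assumes "0 < \<alpha>" "\<And>z. \<alpha> * w z - laplace w z \<le> \<eta>" "\<And>z. w z \<le> B"
  shows "\<alpha> * w z \<le> \<eta>"
proof -
  define M where "M = (SUP z. w z)"
  have bdd: "bdd_above (range w)" using assms(3) by (auto simp: bdd_above_def)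
  have M: "w z \<le> M" for z unfolding M_def by (rule cSUP_upper[OF _ bdd]) simp
  define \<beta> where "\<beta> = \<alpha> + 2 * real CARD('n)"
  have \<beta>: "0 < \<beta>" using assms(1) by (simp add: \<beta>_def add_pos_nonneg)
  have "w z \<le> (2 * real CARD('n) * M + \<eta>) / \<beta>" for z
  proof -
    have "neighbour_sum w z \<le> 2 * real CARD('n) * M"
      using neighbour_sum_mono[of w "\<lambda>_. M" z] M by (simp add: neighbour_sum_const)
    then have "\<beta> * w z \<le> 2 * real CARD('n) * M + \<eta>"
      using assms(2)[of z] by (simp add: laplace_def \<beta>_def algebra_simps)
    then show ?thesis using \<beta> by (simp add: field_simps)
  qed
  then have "M \<le> (2 * real CARD('n) * M + \<eta>) / \<beta>" unfolding M_def by (intro cSUP_least) auto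
  then have "\<beta> * M \<le> 2 * real CARD('n) * M + \<eta>" using \<beta> by (simp add: field_simps)
  then have "\<alpha> * M \<le> \<eta>" by (simp add: \<beta>_def algebra_simps)
  moreover have "\<alpha> * w z \<le> \<alpha> * M" using M assms(1) by simp
  ultimately show ?thesis by linarith
qed

subsection \<open>The resolvent near good stopping points\<close>

lemma mean_value_bound:
  fixes u :: "int ^ 'n \<Rightarrow> real"
  defines "N \<equiv> (2 * CARD('n) + 1) ^ CARD('n)"
  assumes \<alpha>: "0 \<le> \<alpha>"
    and eq: "\<And>z. z \<in> lbox (int N * 2 ^ p) z0 \<Longrightarrow> laplace u z = \<alpha> * u z"
    and S: "(\<Sum>z\<in>lbox (int N * 2 ^ p) z0. (u z)\<^sup>2) \<le> A\<^sup>2 * (2 ^ p) ^ CARD('n)" and A: "0 \<le> A"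
  shows "\<bar>u z0\<bar> \<le> 32 ^ CARD('n) * A"
proof -
  have i: "int (N * 2 ^ p) = int N * 2 ^ p" by simp
  have "(u z0)\<^sup>2 \<le> (32 / real (2 ^ p)) ^ CARD('n) * (\<Sum>z\<in>lbox (int N * 2 ^ p) z0. (u z)\<^sup>2)"
    using mean_value[of "2 ^ p" \<alpha> z0 u, folded N_def, unfolded i] \<alpha> eq by simp
  also have "\<dots> \<le> (32 / real (2 ^ p)) ^ CARD('n) * (A\<^sup>2 * (2 ^ p) ^ CARD('n))"
    by (intro mult_left_mono S) simp
  also have "\<dots> = 32 ^ CARD('n) * A\<^sup>2" by (simp add: power_divide)
  also have "\<dots> \<le> (32 ^ CARD('n) * 32 ^ CARD('n)) * A\<^sup>2" by (intro mult_right_mono) (auto simp: self_le_power)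
  also have "\<dots> = (32 ^ CARD('n) * A)\<^sup>2" by (simp add: power2_eq_square)
  finally have "\<bar>u z0\<bar>\<^sup>2 \<le> (32 ^ CARD('n) * A)\<^sup>2" by simp
  then show ?thesis using A by (intro power2_le_imp_le[of "\<bar>u z0\<bar>"]) auto
qed

text \<open>The radius required by the mean value inequality, with room for starting points in boxes
  of radius 16 and for the few unit shifts of a second difference.\<close>

definition radius :: "'n itself \<Rightarrow> nat" where
  "radius _ = (2 * CARD('n) + 1) ^ CARD('n) + 20"

text \<open>
  The Hessian of \<open>\<psi>\<close> is under control at all scales from \<open>2 ^ l z\<close> to \<open>2 ^ p0\<close> around the points \<open>z\<close> of \<open>\<Gamma>\<close>,
  and \<open>h = 1\<close> near \<open>z\<close>, so that the second differences of \<open>\<psi>\<close> solve a homogeneous equation there.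
\<close>

locale good_points =
  fixes \<psi> h :: "int ^ 'n \<Rightarrow> real" and p0 :: nat and A :: real and \<Gamma> :: "(int ^ 'n) set" and l :: "int ^ 'n \<Rightarrow> nat"
    and k :: nat and n C1 C3 :: real
  assumes A: "1 \<le> A"
    and resolvent: "\<And>z. 1 / 4 ^ p0 * \<psi> z - laplace \<psi> z = h z"
    and \<psi>_bounds: "\<And>z. 0 \<le> \<psi> z" "\<And>z. \<psi> z \<le> 4 ^ p0"
    and h_eq_1: "\<And>z y. z \<in> \<Gamma> \<Longrightarrow> y \<in> lbox (int (radius TYPE('n)) * 2 ^ l z) z \<Longrightarrow> h y = 1"
    and good: "\<And>z p. z \<in> \<Gamma> \<Longrightarrow> l z \<le> p \<Longrightarrow> p \<le> p0 \<Longrightarrow>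
      (\<Sum>y\<in>lbox (int (radius TYPE('n)) * 2 ^ p) z. \<Sum>i\<in>UNIV. \<Sum>j\<in>UNIV. (fdiff j (bdiff i \<psi>) y)\<^sup>2) \<le> A\<^sup>2 * (2 ^ p) ^ CARD('n)"
    and n_def: "n = real CARD('n)" and C1_def: "C1 = 32 ^ CARD('n)" and C3_def: "C3 = n * (C1 + 2) + 2"
    and level: "\<And>z. z \<in> \<Gamma> \<Longrightarrow> l z + k \<le> p0"
    and h_avg: "\<And>z. avg (p0 - k) h z \<le> 1 / 4"
    and k_large: "4 * n * C3 * A \<le> 2 ^ k"
begin

text \<open>The backward difference is chosen so that the forward divergence of \<open>v\<close> is
  exactly \<open>- laplace \<psi>\<close>.\<close>

definition v :: "'n \<Rightarrow> int ^ 'n \<Rightarrow> real" where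
  "v i z = - bdiff i \<psi> z"

lemma n_ge_1: "1 \<le> n" by (simp add: n_def Suc_leI)
lemma C1_ge_1: "1 \<le> C1" by (simp add: C1_def)

lemma hess_component: "(fdiff j (v i) y)\<^sup>2 \<le> (\<Sum>i\<in>UNIV. \<Sum>j\<in>UNIV. (fdiff j (bdiff i \<psi>) y)\<^sup>2)"
proof -
  have "(fdiff j (v i) y)\<^sup>2 = (fdiff j (bdiff i \<psi>) y)\<^sup>2" by (simp add: v_def fdiff_def power2_commute)
  also have "\<dots> \<le> (\<Sum>j\<in>UNIV. (fdiff j (bdiff i \<psi>) y)\<^sup>2)"
    by (rule member_le_sum[of j UNIV "\<lambda>j. (fdiff j (bdiff i \<psi>) y)\<^sup>2"]) auto
  also have "\<dots> \<le> (\<Sum>i\<in>UNIV. \<Sum>j\<in>UNIV. (fdiff j (bdiff i \<psi>) y)\<^sup>2)"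
    by (rule member_le_sum[of i UNIV "\<lambda>i. \<Sum>j\<in>UNIV. (fdiff j (bdiff i \<psi>) y)\<^sup>2"]) (auto intro: sum_nonneg)
  finally show ?thesis .
qed

lemma sum_hess_le:
  assumes "z \<in> \<Gamma>" "l z \<le> p" "p \<le> p0" "B \<subseteq> lbox (int (radius TYPE('n)) * 2 ^ p) z"
  shows "(\<Sum>y\<in>B. (fdiff j (v i) y)\<^sup>2) \<le> A\<^sup>2 * (2 ^ p) ^ CARD('n)"
proof -
  have "(\<Sum>y\<in>B. (fdiff j (v i) y)\<^sup>2) \<le> (\<Sum>y\<in>lbox (int (radius TYPE('n)) * 2 ^ p) z. (fdiff j (v i) y)\<^sup>2)"
    using assms(4) by (intro sum_mono2) auto
  also have "\<dots> \<le> (\<Sum>y\<in>lbox (int (radius TYPE('n)) * 2 ^ p) z. \<Sum>i\<in>UNIV. \<Sum>j\<in>UNIV. (fdiff j (bdiff i \<psi>) y)\<^sup>2)"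
    by (intro sum_mono hess_component)
  also have "\<dots> \<le> A\<^sup>2 * (2 ^ p) ^ CARD('n)" by (rule good[OF assms(1-3)])
  finally show ?thesis .
qed

lemma lbox_scale:
  assumes "y \<in> lbox (a * 2 ^ p) z" "x \<in> lbox (b * 2 ^ p) y" "a + b \<le> c"
  shows "x \<in> lbox (c * 2 ^ p) z"
proof -
  have "x \<in> lbox (a * 2 ^ p + b * 2 ^ p) z" by (rule lbox_trans[OF assms(1,2)])
  moreover have "a * 2 ^ p + b * 2 ^ p \<le> c * 2 ^ p"
    using assms(3) by (simp add: distrib_right[symmetric] mult_right_mono)
  ultimately show ?thesis using lbox_mono by blast
qed

lemma lbox_one: "x \<in> lbox 1 y \<Longrightarrow> x \<in> lbox (1 * 2 ^ p) y"
  using lbox_mono[of 1 "1 * 2 ^ p" y] by auto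

lemma lbox_level: "p \<le> q \<Longrightarrow> 0 \<le> a \<Longrightarrow> x \<in> lbox (a * 2 ^ p) z \<Longrightarrow> x \<in> lbox (a * 2 ^ q) z"
  using lbox_mono[of "a * 2 ^ p" "a * 2 ^ q" z] by (auto simp: mult_left_mono power_increasing)

text \<open>Near \<open>z\<close> the right-hand side \<open>h\<close> is constant, so mixed
  differences of \<psi> solve the homogeneous equation there, and the mean value inequality at the
  stopping scale upgrades the mean square bound to a pointwise one.\<close>

lemma pointwise_bound:
  assumes z: "z \<in> \<Gamma>" and y: "y \<in> lbox (16 * 2 ^ l z) z"
  shows "\<bar>fdiff j (v i) y\<bar> \<le> C1 * A"
  unfolding C1_def
proof (rule mean_value_bound)
  let ?N = "(2 * CARD('n) + 1) ^ CARD('n)"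
  show "0 \<le> (1 / 4 ^ p0 :: real)" by simp
  show "0 \<le> A" using A by simp
  have sub: "x \<in> lbox ((int ?N + 16) * 2 ^ l z) z" if "x \<in> lbox (int ?N * 2 ^ l z) y" for x
    by (rule lbox_scale[OF y that]) simp
  show "(\<Sum>z\<in>lbox (int ?N * 2 ^ l z) y. (fdiff j (v i) z)\<^sup>2) \<le> A\<^sup>2 * (2 ^ l z) ^ CARD('n)"
    by (rule sum_hess_le[OF z]) (use level[OF z] sub lbox_mono[of "(int ?N + 16) * 2 ^ l z" "int (radius TYPE('n)) * 2 ^ l z" z] in \<open>auto simp: radius_def\<close>)
  fix x assume x: "x \<in> lbox (int ?N * 2 ^ l z) y"
  have near: "h w = 1" if w: "w \<in> lbox (2 * 2 ^ l z) x" for w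
    by (rule h_eq_1[OF z lbox_scale[OF sub[OF x] w]]) (simp add: radius_def)
  have step: "w \<in> lbox (a * 2 ^ l z) x \<Longrightarrow> w + unit_step i \<in> lbox ((a + 1) * 2 ^ l z) x"
    "w \<in> lbox (a * 2 ^ l z) x \<Longrightarrow> w - unit_step i \<in> lbox ((a + 1) * 2 ^ l z) x" for a w i
    using lbox_scale[OF _ lbox_one[OF lbox_unit_step(1)], of w a "l z" x "a + 1" i]
      lbox_scale[OF _ lbox_one[OF lbox_unit_step(2)], of w a "l z" x "a + 1" i] by auto
  have x0: "x \<in> lbox (0 * 2 ^ l z) x" by simp
  have x1: "x + unit_step j \<in> lbox (1 * 2 ^ l z) x" "x - unit_step i \<in> lbox (1 * 2 ^ l z) x"
    using step(1)[OF x0, of j] step(2)[OF x0, of i] by auto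
  have x2: "x + unit_step j - unit_step i \<in> lbox (2 * 2 ^ l z) x"
    using step(2)[OF x1(1), of i] by simp
  \<comment> \<open>The mixed difference in directions i and j involves exactly these four points;
    their values of \<open>h\<close> cancel.\<close>
  have h: "h x = 1" "h (x + unit_step j) = 1" "h (x - unit_step i) = 1" "h (x + unit_step j - unit_step i) = 1"
    using near lbox_level[of 0 "l z"] x0 x2 lbox_mono[of "1 * 2 ^ l z" "2 * 2 ^ l z" x] x1 by auto
  have lap: "laplace \<psi> w = 1 / 4 ^ p0 * \<psi> w - h w" for w using resolvent[of w] by simp
  have "laplace (fdiff j (v i)) x = - laplace (\<lambda>w. \<psi> (w + unit_step j) - \<psi> (w + unit_step j - unit_step i) - (\<psi> w - \<psi> (w - unit_step i))) x"
    by (simp add: laplace_def neighbour_sum_def fdiff_def v_def bdiff_def sum_subtractf sum.distrib sum_negf algebra_simps)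
  also have "laplace (\<lambda>w. \<psi> (w + unit_step j) - \<psi> (w + unit_step j - unit_step i) - (\<psi> w - \<psi> (w - unit_step i))) x
     = laplace \<psi> (x + unit_step j) - laplace \<psi> (x + unit_step j - unit_step i) - (laplace \<psi> x - laplace \<psi> (x - unit_step i))"
    by (simp add: laplace_def neighbour_sum_def sum_subtractf sum.distrib algebra_simps)
  also have "- \<dots> = 1 / 4 ^ p0 * fdiff j (v i) x"
    unfolding lap h by (simp add: fdiff_def v_def bdiff_def algebra_simps)
  finally show "laplace (fdiff j (v i)) x = 1 / 4 ^ p0 * fdiff j (v i) x" .
qed

text \<open>Above the stopping scale \<open>h\<close> is no longer known to be constant and no
  pointwise bound is available. Cauchy-Schwarz still bounds averages at that scale.\<close>

lemma avg_bound:
  assumes z: "z \<in> \<Gamma>" and p: "l z \<le> p" "p \<le> p0" and x: "x \<in> lbox (16 * 2 ^ p) z"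
  shows "\<bar>avg p (fdiff j (v i)) x\<bar> \<le> A"
proof -
  have "lbox (2 ^ p) x \<subseteq> lbox (int (radius TYPE('n)) * 2 ^ p) z"
    using lbox_scale[OF x, of _ 1 "int (radius TYPE('n))"] by (auto simp: radius_def)
  then have "(avg p (fdiff j (v i)) x)\<^sup>2 \<le> (\<Sum>y\<in>lbox (int (radius TYPE('n)) * 2 ^ p) z. (fdiff j (v i) y)\<^sup>2) / (2 ^ p) ^ CARD('n)"
    by (rule avg_power2_le) simp
  also have "\<dots> \<le> (A\<^sup>2 * (2 ^ p) ^ CARD('n)) / (2 ^ p) ^ CARD('n)"
    by (intro divide_right_mono sum_hess_le[OF z p]) auto
  finally have "(avg p (fdiff j (v i)) x)\<^sup>2 \<le> A\<^sup>2" by simp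
  then show ?thesis using A by (simp add: power2_le_iff_abs_le)
qed

lemma avg_v_step:
  assumes z: "z \<in> \<Gamma>" and p: "l z \<le> p" "p \<le> p0" and x: "x \<in> lbox (15 * 2 ^ p) z"
  shows "\<bar>avg (Suc p) (v i) x - avg p (v i) x\<bar> \<le> n * 2 ^ p * A"
  unfolding n_def
proof (rule avg_doubling)
  fix y j assume "y \<in> lbox (2 ^ p) x"
  then have "y \<in> lbox (16 * 2 ^ p) z" using lbox_scale[OF x, of y 1 16] by simp
  then show "\<bar>avg p (fdiff j (v i)) y\<bar> \<le> A" by (rule avg_bound[OF z p])
qed

text \<open>At the stopping scale the pointwise bound applies; every doubling adds at most n * A *
  2^q. The geometric sum is dominated by its last term, which the form of the bound absorbs.\<close>

lemma avg_v_pointwise: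
  assumes z: "z \<in> \<Gamma>" and p: "l z \<le> p" "p \<le> p0" and x: "x \<in> lbox (14 * 2 ^ l z) z"
  shows "\<bar>avg p (v i) x - v i x\<bar> \<le> n * (C1 + 1) * A * 2 ^ p"
  using p
proof (induction p rule: dec_induct)
  case base
  have x15: "w \<in> lbox (15 * 2 ^ l z) z" if "w \<in> lbox (2 ^ l z) x" for w
    using lbox_scale[OF x, of w 1 15] that by simp
  have "\<bar>avg (l z) (\<lambda>w. v i w - v i x) x\<bar> \<le> C1 * A * (n * 2 ^ l z)"
  proof (rule avg_abs_le)
    fix s :: "int ^ 'n" assume "s \<in> cube (l z)"
    then have s: "x + s \<in> lbox (2 ^ l z) x" by (rule cube_lbox)
    have "\<bar>v i (x + s) - v i x\<bar> \<le> C1 * A * dist1 (x + s) x"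
    proof (rule lattice_path_lbox[OF _ s])
      fix y j assume "y \<in> lbox (2 ^ l z) x"
      then have "y \<in> lbox (16 * 2 ^ l z) z" using lbox_scale[OF x, of y 1 16] by simp
      then show "\<bar>fdiff j (v i) y\<bar> \<le> C1 * A" by (rule pointwise_bound[OF z])
    qed simp
    also have "\<dots> \<le> C1 * A * (n * 2 ^ l z)"
      using dist1_lbox[OF s] C1_ge_1 A by (intro mult_left_mono) (auto simp: dist1_commute n_def)
    finally show "\<bar>v i (x + s) - v i x\<bar> \<le> C1 * A * (n * 2 ^ l z)" .
  qed
  then have "\<bar>avg (l z) (v i) x - v i x\<bar> \<le> C1 * A * (n * 2 ^ l z)"
    by (simp add: avg_diff avg_const)
  also have "\<dots> \<le> n * (C1 + 1) * A * 2 ^ l z" using A n_ge_1 by (simp add: algebra_simps)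
  finally show ?case .
next
  case (step q)
  have "x \<in> lbox (15 * 2 ^ q) z"
    using lbox_level[OF step(1), of 15 x z] x lbox_mono[of "14 * 2 ^ l z" "15 * 2 ^ l z" z] by auto
  then have "\<bar>avg (Suc q) (v i) x - avg q (v i) x\<bar> \<le> n * 2 ^ q * A" using avg_v_step[OF z, of q x i] step by simp
  moreover have "\<bar>avg q (v i) x - v i x\<bar> \<le> n * (C1 + 1) * A * 2 ^ q" using step by simp
  moreover have "n * 2 ^ q * A \<le> n * (C1 + 1) * A * 2 ^ q"
  proof -
    have "n * A * 2 ^ q * 1 \<le> n * A * 2 ^ q * (C1 + 1)" using C1_ge_1 A n_ge_1 by (intro mult_left_mono) auto
    then show ?thesis by (simp add: mult_ac)
  qed
  ultimately show ?case by (simp add: field_simps)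
qed

text \<open>An interpolation inequality between \<psi> and its second differences. Along a segment
  of length 2^p0 the averaged \<open>v\<close> sums to a difference of averages of \<psi>, at most
  4^p0, while it deviates from its initial value by at most A * 2^p0. Dividing by the length bounds
  that value.\<close>

lemma avg_v_top:
  assumes z: "z \<in> \<Gamma>" and x: "x \<in> lbox (15 * 2 ^ p0) z"
  shows "\<bar>avg p0 (v i) x\<bar> \<le> 2 * A * 2 ^ p0"
proof -
  let ?V = "avg p0 (v i)" let ?X = "?V x" let ?L = "2 ^ p0 :: nat"
  let ?x = "\<lambda>t::nat. x + of_nat t * unit_step i"
  have lz: "l z \<le> p0" using level[OF z] by simp
  have xt: "?x t \<in> lbox (1 * 2 ^ p0) x" if "t \<le> ?L" for t
  proof -
    have "int t \<le> 2 ^ p0" using that by (metis of_nat_le_iff of_nat_numeral of_nat_power)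
    then show ?thesis by (auto simp: lbox_def of_nat_index)
  qed
  have near: "\<bar>?V (?x t) - ?X\<bar> \<le> A * 2 ^ p0" if "t \<le> ?L" for t
  proof -
    have "\<bar>?V (?x t) - ?X\<bar> \<le> A * real t" using that
    proof (induction t)
      case (Suc t)
      have "?x t \<in> lbox (16 * 2 ^ p0) z" using lbox_scale[OF x xt[of t], of 16] Suc by simp
      then have "\<bar>avg p0 (fdiff i (v i)) (?x t)\<bar> \<le> A" by (intro avg_bound[OF z lz]) auto
      then have "\<bar>?V (?x (Suc t)) - ?V (?x t)\<bar> \<le> A" by (simp add: avg_fdiff fdiff_def algebra_simps)
      then show ?case using Suc by (simp add: algebra_simps)
    qed simp
    also have "\<dots> \<le> A * 2 ^ p0" using that A by (intro mult_left_mono) (auto simp flip: of_nat_le_iff)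
    finally show ?thesis .
  qed
  have tele: "(\<Sum>t<?L. ?V (?x (Suc t))) = avg p0 \<psi> x - avg p0 \<psi> (?x ?L)"
  proof -
    have "?V (?x (Suc t)) = avg p0 \<psi> (?x t) - avg p0 \<psi> (?x (Suc t))" for t
    proof -
      have "?V y = - bdiff i (avg p0 \<psi>) y" for y
        unfolding v_def avg_uminus avg_bdiff by simp
      then show ?thesis by (simp add: bdiff_def algebra_simps)
    qed
    then have "(\<Sum>t<?L. ?V (?x (Suc t))) = - (\<Sum>t<?L. avg p0 \<psi> (?x (Suc t)) - avg p0 \<psi> (?x t))"
      by (simp add: sum_negf[symmetric])
    then show ?thesis by (simp only: sum_lessThan_telescope[of "\<lambda>t. avg p0 \<psi> (?x t)" ?L]) simp
  qed
  have psi: "0 \<le> avg p0 \<psi> y" "avg p0 \<psi> y \<le> 4 ^ p0" for y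
  proof -
    show "0 \<le> avg p0 \<psi> y" unfolding avg_def by (intro divide_nonneg_nonneg sum_nonneg \<psi>_bounds) auto
    have "\<bar>avg p0 \<psi> y\<bar> \<le> 4 ^ p0" by (rule avg_abs_le) (use \<psi>_bounds in simp)
    then show "avg p0 \<psi> y \<le> 4 ^ p0" by simp
  qed
  have "real ?L * ?X = (\<Sum>t<?L. ?V (?x (Suc t))) - (\<Sum>t<?L. ?V (?x (Suc t)) - ?X)"
    by (simp add: sum_subtractf)
  moreover have "\<bar>\<Sum>t<?L. ?V (?x (Suc t))\<bar> \<le> 4 ^ p0" unfolding tele using psi[of x] psi[of "?x ?L"] by linarith
  moreover have "\<bar>\<Sum>t<?L. ?V (?x (Suc t)) - ?X\<bar> \<le> (\<Sum>t<?L. A * 2 ^ p0)"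
    by (intro order_trans[OF sum_abs sum_mono] near) auto
  ultimately have "\<bar>real ?L * ?X\<bar> \<le> 4 ^ p0 + (\<Sum>t<?L. A * 2 ^ p0)" by linarith
  also have "\<dots> = 2 ^ p0 * (2 ^ p0 * (1 + A))"
    by (simp add: algebra_simps flip: power_mult_distrib)
  finally have "2 ^ p0 * \<bar>?X\<bar> \<le> 2 ^ p0 * (2 ^ p0 * (1 + A))" by (simp add: abs_mult)
  then have "\<bar>?X\<bar> \<le> 2 ^ p0 * (1 + A)" by simp
  also have "\<dots> \<le> 2 * A * 2 ^ p0" using A by (simp add: algebra_simps)
  finally show ?thesis .
qed

text \<open>Descend from the top scale: the increments n * A * 2^q sum to n * A * (2^p0 - 2^p), the
  form that the induction preserves.\<close>

lemma avg_v_all: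
  assumes z: "z \<in> \<Gamma>" and p: "l z \<le> p" "p \<le> p0" and x: "x \<in> lbox (15 * 2 ^ p) z"
  shows "\<bar>avg p (v i) x\<bar> \<le> (n + 2) * A * 2 ^ p0"
proof -
  have "\<bar>avg p (v i) x - avg p0 (v i) x\<bar> \<le> n * A * (2 ^ p0 - 2 ^ p)"
    using p(2,1) x
  proof (induction p rule: inc_induct)
    case base then show ?case by simp
  next
    case (step q)
    have "x \<in> lbox (15 * 2 ^ Suc q) z" using lbox_level[of q "Suc q" 15 x z] step by simp
    then have "\<bar>avg (Suc q) (v i) x - avg p0 (v i) x\<bar> \<le> n * A * (2 ^ p0 - 2 ^ Suc q)" using step by simp
    moreover have "\<bar>avg (Suc q) (v i) x - avg q (v i) x\<bar> \<le> n * 2 ^ q * A"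
      using avg_v_step[OF z, of q x i] step by simp
    ultimately show ?case by (simp add: algebra_simps)
  qed
  also have "\<dots> \<le> n * A * 2 ^ p0" using A n_ge_1 by (intro mult_left_mono) auto
  finally have "\<bar>avg p (v i) x - avg p0 (v i) x\<bar> \<le> n * A * 2 ^ p0" .
  moreover have "\<bar>avg p0 (v i) x\<bar> \<le> 2 * A * 2 ^ p0"
    by (rule avg_v_top[OF z lbox_level[OF p(2) _ x]]) simp
  ultimately show ?thesis by (simp add: algebra_simps)
qed

lemma v_bound:
  assumes z: "z \<in> \<Gamma>" and x: "x \<in> lbox (14 * 2 ^ l z) z"
  shows "\<bar>v i x\<bar> \<le> C3 * A * 2 ^ p0"
proof -
  have lz: "l z \<le> p0" using level[OF z] by simp
  have "x \<in> lbox (15 * 2 ^ p0) z"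
    using lbox_level[OF lz, of 15 x z] x lbox_mono[of "14 * 2 ^ l z" "15 * 2 ^ l z" z] by auto
  then have "\<bar>avg p0 (v i) x\<bar> \<le> 2 * A * 2 ^ p0" by (rule avg_v_top[OF z])
  moreover have "\<bar>avg p0 (v i) x - v i x\<bar> \<le> n * (C1 + 1) * A * 2 ^ p0" by (rule avg_v_pointwise[OF z lz _ x]) simp
  moreover have "n * (C1 + 1) * A * 2 ^ p0 + 2 * A * 2 ^ p0 \<le> C3 * A * 2 ^ p0"
    unfolding C3_def using A n_ge_1 by (simp add: algebra_simps)
  ultimately show ?thesis by linarith
qed

lemma C3_ge: "n + 2 \<le> C3" "1 \<le> C3"
proof -
  have "n * 1 \<le> n * (C1 + 2)" using C1_ge_1 n_ge_1 by (intro mult_left_mono) auto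
  then show "n + 2 \<le> C3" "1 \<le> C3" unfolding C3_def using n_ge_1 by linarith+
qed

lemma fdiff_psi: "fdiff i \<psi> x = - v i (x + unit_step i)"
  by (simp add: fdiff_def v_def bdiff_def)

text \<open>Three regimes of the distance d. Up to the stopping scale of \<open>z\<close>, a path
  inside the region of pointwise bounds; up to 2^p0, comparison of both values with averages at a
  scale comparable to d; beyond, the sup bound of order 2^p0. The ordering of the levels makes the
  averages around both points available in the middle regime.\<close>

lemma v_lipschitz_ordered:
  assumes z: "z \<in> \<Gamma>" "z' \<in> \<Gamma>" and le: "l z' \<le> l z" and x: "x \<in> lbox 4 z" and y: "y \<in> lbox 4 z'"
  shows "\<bar>v i x - v i y\<bar> \<le> (4 * n * (C1 + 1) + 1 + 2 * C3) * A * dist1 x y"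
proof -
  let ?d = "dist1 x y"
  have lz: "l z \<le> p0" "l z' \<le> p0" using level z by fastforce+
  have four: "w \<in> lbox 4 u \<Longrightarrow> w \<in> lbox (4 * 2 ^ q) u" for w u :: "int ^ 'n" and q
    using lbox_level[of 0 q 4 w u] by simp
  have x14: "x \<in> lbox (14 * 2 ^ l z) z" and y14: "y \<in> lbox (14 * 2 ^ l z') z'"
    using lbox_mono[of "4 * 2 ^ l z" "14 * 2 ^ l z" z] four[OF x, of "l z"]
      lbox_mono[of "4 * 2 ^ l z'" "14 * 2 ^ l z'" z'] four[OF y, of "l z'"] by auto
  have pos: "0 \<le> n * (C1 + 1)" "0 \<le> C3" "0 \<le> ?d" "0 \<le> A" "0 \<le> C1"
    using C1_ge_1 C3_ge A n_ge_1 by (auto simp: dist1_nonneg)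
  consider "?d \<le> 2 ^ l z" | "2 ^ l z < ?d" "?d \<le> 2 ^ p0" | "2 ^ p0 < ?d" by linarith
  then show ?thesis
  proof cases
    case 1
    have yx: "y \<in> lbox (1 * 2 ^ l z) x" using lbox_dist1[of x y "2 ^ l z"] 1 by simp
    have "\<bar>v i x - v i y\<bar> \<le> C1 * A * ?d"
    proof (rule lattice_path_lbox[where r = "2 ^ l z" and z = x])
      fix w j assume "w \<in> lbox (2 ^ l z) x"
      then have "w \<in> lbox (16 * 2 ^ l z) z" using lbox_scale[OF four[OF x, of "l z"], of w 1 16] by simp
      then show "\<bar>fdiff j (v i) w\<bar> \<le> C1 * A" by (rule pointwise_bound[OF z(1)])
    qed (use yx in auto)
    also have "\<dots> \<le> (4 * n * (C1 + 1) + 1 + 2 * C3) * A * ?d"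
    proof (intro mult_right_mono pos)
      have "1 * C1 \<le> n * (C1 + 1)" using n_ge_1 C1_ge_1 by (intro mult_mono) auto
      then show "C1 \<le> 4 * n * (C1 + 1) + 1 + 2 * C3" using pos by linarith
    qed
    finally show ?thesis .
  next
    case 2
    \<comment> \<open>The least dyadic scale covering the distance: minimality gives 2^p at most 2d,
      so errors proportional to 2^p are errors proportional to d.\<close>
    define p where "p = (LEAST p. ?d \<le> 2 ^ p)"
    have p: "?d \<le> 2 ^ p" "p \<le> p0" unfolding p_def using 2(2) by (rule LeastI, rule Least_le)
    have lp: "l z < p"
    proof (rule ccontr)
      assume "\<not> ?thesis"
      then have "(2::real) ^ p \<le> 2 ^ l z" by (intro power_increasing) auto
      then show False using p(1) 2(1) by linarith
    qed
    have half: "2 ^ p \<le> 2 * ?d"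
    proof -
      have "\<not> ?d \<le> 2 ^ (p - 1)" using not_less_Least[of "p - 1" "\<lambda>p. ?d \<le> 2 ^ p"] lp unfolding p_def[symmetric] by auto
      then show ?thesis using lp by (cases p) auto
    qed
    have a: "\<bar>avg p (v i) x - v i x\<bar> \<le> n * (C1 + 1) * A * 2 ^ p"
      using lp p by (intro avg_v_pointwise[OF z(1) _ _ x14]) auto
    have b: "\<bar>avg p (v i) y - v i y\<bar> \<le> n * (C1 + 1) * A * 2 ^ p"
      using lp p le by (intro avg_v_pointwise[OF z(2) _ _ y14]) auto
    have yx: "y \<in> lbox (1 * 2 ^ p) x" using lbox_dist1[of x y "2 ^ p"] p by simp
    have c: "\<bar>avg p (v i) x - avg p (v i) y\<bar> \<le> A * ?d"
    proof (rule lattice_path_lbox[where r = "2 ^ p" and z = x])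
      fix w j assume "w \<in> lbox (2 ^ p) x"
      then have "w \<in> lbox (16 * 2 ^ p) z" using lbox_scale[OF four[OF x, of p], of w 1 16] by simp
      then have "\<bar>avg p (fdiff j (v i)) w\<bar> \<le> A" using lp p by (intro avg_bound[OF z(1)]) auto
      then show "\<bar>fdiff j (avg p (v i)) w\<bar> \<le> A" by (simp add: avg_fdiff)
    qed (use yx in auto)
    have "n * (C1 + 1) * A * 2 ^ p \<le> n * (C1 + 1) * A * (2 * ?d)"
      by (intro mult_left_mono half mult_nonneg_nonneg pos)
    then have "\<bar>v i x - v i y\<bar> \<le> 4 * (n * (C1 + 1) * A * ?d) + A * ?d" using a b c by linarith
    also have "\<dots> = (4 * n * (C1 + 1) + 1) * (A * ?d)" by (simp add: algebra_simps)
    also have "\<dots> \<le> (4 * n * (C1 + 1) + 1 + 2 * C3) * (A * ?d)" using pos by (intro mult_right_mono) auto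
    finally show ?thesis by (simp add: mult.assoc)
  next
    case 3
    have "\<bar>v i x - v i y\<bar> \<le> 2 * (C3 * A * 2 ^ p0)"
      using v_bound[OF z(1) x14, of i] v_bound[OF z(2) y14, of i] by linarith
    also have "\<dots> \<le> 2 * (C3 * A * ?d)" using 3 pos by (intro mult_left_mono) auto
    also have "\<dots> = (2 * C3) * (A * ?d)" by simp
    also have "\<dots> \<le> (4 * n * (C1 + 1) + 1 + 2 * C3) * (A * ?d)" using pos by (intro mult_right_mono) auto
    finally show ?thesis by (simp add: mult.assoc)
  qed
qed

lemma v_lipschitz:
  assumes z: "z \<in> \<Gamma>" "z' \<in> \<Gamma>" and x: "x \<in> lbox 4 z" and y: "y \<in> lbox 4 z'"
  shows "\<bar>v i x - v i y\<bar> \<le> (4 * n * (C1 + 1) + 1 + 2 * C3) * A * dist1 x y"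
proof (cases "l z' \<le> l z")
  case True
  then show ?thesis using v_lipschitz_ordered[OF z] x y by blast
next
  case False
  then show ?thesis using v_lipschitz_ordered[OF z(2,1) _ y x, of i] by (simp add: abs_minus_commute dist1_commute)
qed

lemma avg_psi_step:
  assumes z: "z \<in> \<Gamma>" and p: "l z \<le> p" "p \<le> p0" and x: "x \<in> lbox (5 * 2 ^ p) z"
  shows "\<bar>avg (Suc p) \<psi> x - avg p \<psi> x\<bar> \<le> n * 2 ^ p * (C3 * A * 2 ^ p0)"
  unfolding n_def
proof (rule avg_doubling)
  fix y j assume "y \<in> lbox (2 ^ p) x"
  then have "y \<in> lbox (6 * 2 ^ p) z" using lbox_scale[OF x, of y 1 6] by simp
  then have "y + unit_step j \<in> lbox (15 * 2 ^ p) z"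
    using lbox_scale[OF _ lbox_one[OF lbox_unit_step(1)], of y 6 p z 15 j] by simp
  then have "\<bar>avg p (v j) (y + unit_step j)\<bar> \<le> (n + 2) * A * 2 ^ p0" by (rule avg_v_all[OF z p])
  also have "\<dots> \<le> C3 * A * 2 ^ p0" using C3_ge A by (intro mult_right_mono) auto
  finally have "\<bar>avg p (v j) (y + unit_step j)\<bar> \<le> C3 * A * 2 ^ p0" .
  then show "\<bar>avg p (fdiff j \<psi>) y\<bar> \<le> C3 * A * 2 ^ p0"
  proof -
    have "fdiff j \<psi> = (\<lambda>x. - v j (x + unit_step j))" by (auto simp: fdiff_psi)
    with \<open>\<bar>avg p (v j) (y + unit_step j)\<bar> \<le> C3 * A * 2 ^ p0\<close> show ?thesis
      by (simp add: avg_uminus avg_shift)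
  qed
qed

text \<open>The telescoping argument for \<open>v\<close>, one order lower: the gradient bound C3 *
  A * 2^p0 replaces the Hessian bound.\<close>

lemma avg_psi_pointwise:
  assumes z: "z \<in> \<Gamma>" and p: "l z \<le> p" "p \<le> p0" and x: "x \<in> lbox (5 * 2 ^ l z) z"
  shows "\<bar>avg p \<psi> x - \<psi> x\<bar> \<le> n * (C3 * A * 2 ^ p0) * 2 ^ p"
  using p
proof (induction p rule: dec_induct)
  case base
  have "\<bar>avg (l z) (\<lambda>w. \<psi> w - \<psi> x) x\<bar> \<le> C3 * A * 2 ^ p0 * (n * 2 ^ l z)"
  proof (rule avg_abs_le)
    fix s :: "int ^ 'n" assume "s \<in> cube (l z)"
    then have s: "x + s \<in> lbox (2 ^ l z) x" by (rule cube_lbox)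
    have "\<bar>\<psi> (x + s) - \<psi> x\<bar> \<le> C3 * A * 2 ^ p0 * dist1 (x + s) x"
    proof (rule lattice_path_lbox[OF _ s])
      fix y j assume "y \<in> lbox (2 ^ l z) x"
      then have "y \<in> lbox (6 * 2 ^ l z) z" using lbox_scale[OF x, of y 1 6] by simp
      then have "y + unit_step j \<in> lbox (14 * 2 ^ l z) z"
        using lbox_scale[OF _ lbox_one[OF lbox_unit_step(1)], of y 6 "l z" z 14 j] by simp
      then show "\<bar>fdiff j \<psi> y\<bar> \<le> C3 * A * 2 ^ p0" unfolding fdiff_psi using v_bound[OF z] by simp
    qed simp
    also have "\<dots> \<le> C3 * A * 2 ^ p0 * (n * 2 ^ l z)"
      using dist1_lbox[OF s] C3_ge A by (intro mult_left_mono) (auto simp: dist1_commute n_def)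
    finally show "\<bar>\<psi> (x + s) - \<psi> x\<bar> \<le> C3 * A * 2 ^ p0 * (n * 2 ^ l z)" .
  qed
  then show ?case by (simp add: avg_diff avg_const mult_ac)
next
  case (step q)
  have "x \<in> lbox (5 * 2 ^ q) z" using lbox_level[OF step(1), of 5 x z] x by simp
  then have "\<bar>avg (Suc q) \<psi> x - avg q \<psi> x\<bar> \<le> n * 2 ^ q * (C3 * A * 2 ^ p0)" using avg_psi_step[OF z, of q x] step by simp
  moreover have "\<bar>avg q \<psi> x - \<psi> x\<bar> \<le> n * (C3 * A * 2 ^ p0) * 2 ^ q" using step by simp
  ultimately show ?case by (simp add: algebra_simps)
qed

text \<open>The average of \<psi> at scale 2^(p0 - k) solves the resolvent equation with right-hand
  side at most 1/4, so the maximum principle bounds \<alpha> times it by 1/4. Returning from the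
  average to \<psi> costs n * C3 * A / 2^k, at most another 1/4 by the choice of
  \<open>k\<close>.\<close>

lemma psi_small:
  assumes z: "z \<in> \<Gamma>" and x: "x \<in> lbox 4 z"
  shows "1 / 4 ^ p0 * \<psi> x \<le> 1 / 2"
proof -
  let ?p = "p0 - k" let ?w = "avg ?p \<psi>"
  have p: "l z \<le> ?p" "?p \<le> p0" "k \<le> p0" using level[OF z] by auto
  have "1 / 4 ^ p0 * ?w x \<le> 1 / 4"
  proof (rule resolvent_max_principle)
    fix y
    have "(\<lambda>z. 1 / 4 ^ p0 * \<psi> z - laplace \<psi> z) = h" using resolvent by auto
    then have "avg ?p (\<lambda>z. 1 / 4 ^ p0 * \<psi> z - laplace \<psi> z) y = avg ?p h y" by simp
    then have "1 / 4 ^ p0 * ?w y - laplace ?w y = avg ?p h y"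
      unfolding avg_diff avg_scale avg_laplace .
    then show "1 / 4 ^ p0 * ?w y - laplace ?w y \<le> 1 / 4" using h_avg[of y] by linarith
    have "\<bar>?w y\<bar> \<le> 4 ^ p0" by (rule avg_abs_le) (use \<psi>_bounds in simp)
    then show "?w y \<le> 4 ^ p0" by simp
  qed simp
  moreover have "1 / 4 ^ p0 * \<bar>?w x - \<psi> x\<bar> \<le> 1 / 4"
  proof -
    have "x \<in> lbox (5 * 2 ^ l z) z"
      using lbox_level[of 0 "l z" 5 x z] lbox_mono[of 4 5 z] x by auto
    then have "1 / 4 ^ p0 * \<bar>?w x - \<psi> x\<bar> \<le> 1 / 4 ^ p0 * (n * (C3 * A * 2 ^ p0) * 2 ^ ?p)"
      by (intro mult_left_mono avg_psi_pointwise[OF z p(1,2)]) auto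
    also have "1 / 4 ^ p0 * (n * (C3 * A * 2 ^ p0) * 2 ^ ?p) = n * C3 * A / 2 ^ k"
    proof -
      have "(2 :: real) ^ ?p = 2 ^ p0 / 2 ^ k" using p(3) by (simp add: power_diff)
      moreover
      have "(4 :: real) ^ p0 = 2 ^ p0 * 2 ^ p0" by (simp flip: power_mult_distrib)
      ultimately show ?thesis by (simp add: field_simps)
    qed
    also have "\<dots> \<le> 1 / 4"
      using k_large by (simp add: field_simps)
    finally show ?thesis .
  qed
  moreover have "1 / 4 ^ p0 * \<psi> x \<le> 1 / 4 ^ p0 * ?w x + 1 / 4 ^ p0 * \<bar>?w x - \<psi> x\<bar>"
    unfolding distrib_left[symmetric] by (intro mult_left_mono) auto
  ultimately show ?thesis by linarith
qed

lemma divergence: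
  assumes z: "z \<in> \<Gamma>" and x: "x \<in> lbox 4 z"
  shows "1 / 2 \<le> (\<Sum>i\<in>UNIV. fdiff i (v i) x)"
proof -
  have "x \<in> lbox (int (radius TYPE('n)) * 2 ^ l z) z"
    using lbox_level[of 0 "l z" "int (radius TYPE('n))" x z] lbox_mono[of 4 "int (radius TYPE('n))" z] x
    by (auto simp: radius_def)
  then have "h x = 1" by (rule h_eq_1[OF z])
  then have "laplace \<psi> x \<le> - 1 / 2" using psi_small[OF assms] resolvent[of x] by linarith
  moreover have "(\<Sum>i\<in>UNIV. fdiff i (v i) x) = - laplace \<psi> x"
    by (simp add: laplace_eq v_def fdiff_def sum_negf[symmetric])
  ultimately show ?thesis by simp
qed

end

subsection \<open>Lipschitz extension\<close>

text \<open>The infimal convolution of McShane. It is stated for an abstract pseudometric because it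
  serves both the l1 distance on the lattice and the Euclidean distance in the chain rule.\<close>

lemma mcshane_extension:
  fixes f :: "'b \<Rightarrow> real" and d :: "'b \<Rightarrow> 'b \<Rightarrow> real"
  assumes d: "\<And>x y. 0 \<le> d x y" "\<And>x. d x x = 0" "\<And>x y. d x y = d y x" "\<And>x y z. d x z \<le> d x y + d y z"
    and L: "0 \<le> L" and f: "\<And>x y. x \<in> S \<Longrightarrow> y \<in> S \<Longrightarrow> \<bar>f x - f y\<bar> \<le> L * d x y"
  obtains g where "\<And>x. x \<in> S \<Longrightarrow> g x = f x" "\<And>x y. \<bar>g x - g y\<bar> \<le> L * d x y"
proof (cases "S = {}")
  case True
  then show thesis using that[of "\<lambda>_. 0"] d L by simp
next
  case False
  then obtain s where s: "s \<in> S" by auto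
  define g where "g x = (INF y\<in>S. f y + L * d x y)" for x
  have bdd: "bdd_below ((\<lambda>y. f y + L * d x y) ` S)" for x
  proof (rule bdd_belowI2)
    fix y assume y: "y \<in> S"
    have "d y s \<le> d x y + d x s" using d(4)[of y s x] d(3)[of y x] by simp
    then have "L * d y s \<le> L * d x y + L * d x s" using L by (metis distrib_left mult_left_mono)
    then show "f s - L * d x s \<le> f y + L * d x y" using f[OF s y] d(3)[of s y] by (simp add: abs_le_iff)
  qed
  have low: "g x \<le> f y + L * d x y" if "y \<in> S" for x y
    unfolding g_def by (rule cINF_lower[OF bdd that])
  have "g x = f x" if "x \<in> S" for x
  proof (rule antisym)
    show "g x \<le> f x" using low[OF that, of x] d(2) by simp
    show "f x \<le> g x" unfolding g_def
    proof (rule cINF_greatest[OF False])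
      fix y assume "y \<in> S"
      then show "f x \<le> f y + L * d x y" using f[OF that, of y] by (simp add: abs_le_iff)
    qed
  qed
  moreover have le: "g x - g y \<le> L * d x y" for x y
  proof -
    have "g x - L * d x y \<le> g y" unfolding g_def[of y]
    proof (rule cINF_greatest[OF False])
      fix w assume w: "w \<in> S"
      have "L * d x w \<le> L * d x y + L * d y w" using d(4)[of x w y] L by (metis distrib_left mult_left_mono)
      then show "g x - L * d x y \<le> f w + L * d y w" using low[OF w, of x] by linarith
    qed
    then show ?thesis by linarith
  qed
  then have "\<bar>g x - g y\<bar> \<le> L * d x y" for x y using le[of x y] le[of y x] d(3)[of x y] by (simp add: abs_le_iff)
  ultimately show thesis using that by blast
qed

lemma clip_lipschitz: "\<bar>max (- t) (min t g) - max (- t') (min t' g')\<bar> \<le> B"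
  if "\<bar>t - t'\<bar> \<le> B" "\<bar>g - g'\<bar> \<le> B" for t t' g g' B :: real
  using that by linarith

text \<open>The McShane extension is neither bounded nor finitely supported. Clipping it between
  \<open>- t\<close> and \<open>t\<close>, with a tent \<open>t\<close> of slope \<open>L\<close>,
  repairs both without increasing the Lipschitz constant.\<close>

lemma lattice_extension:
  fixes f :: "int ^ 'n \<Rightarrow> real"
  assumes S: "finite S" and L: "0 < L" and f: "\<And>x y. x \<in> S \<Longrightarrow> y \<in> S \<Longrightarrow> \<bar>f x - f y\<bar> \<le> L * dist1 x y"
    and B: "0 \<le> B" "\<And>x. x \<in> S \<Longrightarrow> \<bar>f x\<bar> \<le> B"
  obtains g where "\<And>x. x \<in> S \<Longrightarrow> g x = f x" "\<And>x y. \<bar>g x - g y\<bar> \<le> L * dist1 x y" "\<And>x. \<bar>g x\<bar> \<le> B" "fsupp g"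
proof -
  obtain g0 where g0: "\<And>x. x \<in> S \<Longrightarrow> g0 x = f x" "\<And>x y. \<bar>g0 x - g0 y\<bar> \<le> L * dist1 x y"
    using mcshane_extension[of dist1 L S f, OF dist1_nonneg dist1_self dist1_commute dist1_triangle _ f] L by auto
  define R where "R = (\<Sum>x\<in>S. dist1 x 0)"
  have R: "dist1 x 0 \<le> R" if "x \<in> S" for x
    unfolding R_def by (rule member_le_sum[OF that]) (auto simp: S dist1_nonneg)
  \<comment> \<open>The tent equals \<open>B\<close> on the ball of radius \<open>R\<close>
    containing \<open>S\<close>, so clipping does not change the values there, and it vanishes from
    radius R + B / L on.\<close>
  define t where "t x = min B (max 0 (B + L * R - L * dist1 x 0))" for x :: "int ^ 'n"
  have t0: "0 \<le> t x" "t x \<le> B" for x using B by (auto simp: t_def)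
  have tS: "t x = B" if "x \<in> S" for x
  proof -
    have "L * dist1 x 0 \<le> L * R" using R[OF that] L by simp
    then show ?thesis using B by (simp add: t_def)
  qed
  have t_lip: "\<bar>t x - t y\<bar> \<le> L * dist1 x y" for x y
  proof -
    have "\<bar>dist1 x 0 - dist1 y 0\<bar> \<le> dist1 x y"
      using dist1_triangle[of x 0 y] dist1_triangle[of y 0 x] dist1_commute[of x y] by linarith
    then have "\<bar>L * dist1 x 0 - L * dist1 y 0\<bar> \<le> L * dist1 x y"
      using L by (simp flip: right_diff_distrib add: abs_mult)
    then show ?thesis unfolding t_def by linarith
  qed
  define g where "g x = max (- t x) (min (t x) (g0 x))" for x
  show thesis
  proof
    show "g x = f x" if "x \<in> S" for x
      using g0(1)[OF that] B(2)[OF that] tS[OF that] by (simp add: g_def)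
    show "\<bar>g x - g y\<bar> \<le> L * dist1 x y" for x y
      unfolding g_def by (rule clip_lipschitz[OF t_lip g0(2)])
    show "\<bar>g x\<bar> \<le> B" for x using t0[of x] unfolding g_def by linarith
    show "fsupp g"
    proof (rule finite_subset)
      show "{x. g x \<noteq> 0} \<subseteq> lbox \<lceil>R + B / L\<rceil> 0"
      proof
        fix x assume "x \<in> {x. g x \<noteq> 0}"
        then have "t x \<noteq> 0" by (auto simp: g_def)
        then have "L * dist1 x 0 < B + L * R" using B by (auto simp: t_def max_def min_def split: if_splits)
        then have "dist1 x 0 \<le> R + B / L" using L by (simp add: field_simps)
        then have "dist1 0 x \<le> real_of_int \<lceil>R + B / L\<rceil>" by (simp add: dist1_commute) linarith
        then show "x \<in> lbox \<lceil>R + B / L\<rceil> 0" by (rule lbox_dist1)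
      qed
    qed simp
  qed
qed

subsection \<open>The lattice vector field\<close>

text \<open>The order of the quantifiers matters: \<open>C\<close> is fixed before \<open>A\<close>,
  so that C / A^2 can later be made small against 1 / (C * A). Only \<kappa> depends on
  \<open>A\<close>; it says that the mean density at the top scale is far below the threshold
  \<open>L\<close>.\<close>

lemma lattice_field_exists:
  obtains C :: real where "1 \<le> C"
    "\<And>A. 1 \<le> A \<Longrightarrow> \<exists>\<kappa>>0. \<forall>(a :: int ^ 'n \<Rightarrow> real) L p0.
      fsupp a \<longrightarrow> (\<forall>z. 0 \<le> a z) \<longrightarrow> 0 < L \<longrightarrow> Sum_any a \<le> \<kappa> * L * (2 ^ p0) ^ CARD('n) \<longrightarrow>
      (\<exists>\<Gamma> v. finite \<Gamma> \<and> sum a ({z. \<exists>p\<le>p0. heavy a L p z} - \<Gamma>) \<le> C / A\<^sup>2 * Sum_any a \<and>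
        (\<forall>i. fsupp (v i)) \<and> (\<forall>i j z. \<bar>fdiff j (v i) z\<bar> \<le> C * A) \<and> (\<forall>i z. \<bar>v i z\<bar> \<le> C * A * 2 ^ p0) \<and>
        (\<forall>z\<in>\<Gamma>. \<forall>y\<in>lbox 2 z. 1 / 2 \<le> (\<Sum>i\<in>UNIV. fdiff i (v i) y)))"
proof -
  define n where "n = real CARD('n)"
  define C1 where "C1 = (32 :: real) ^ CARD('n)"
  define C3 where "C3 = n * (C1 + 2) + 2"
  define C0 where "C0 = 4 * n * (C1 + 1) + 1 + 2 * C3"
  define c where "c = radius TYPE('n)"
  define K where "K = real (2 * c + 1) ^ CARD('n)"
  \<comment> \<open>\<open>C0\<close> is the Lipschitz constant of \<open>v\<close> divided by
    \<open>A\<close>. In the second term, the energy bound contributes 2, \<open>bad_mass\<close>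
    contributes 2^n * K^2, and the volume of the support of \<open>h\<close> contributes one more
    \<open>K\<close>.\<close>
  define C where "C = C0 + 2 * 2 ^ CARD('n) * K ^ 3"
  have n: "1 \<le> n" by (simp add: n_def Suc_leI)
  have C1: "1 \<le> C1" by (simp add: C1_def)
  have C3: "2 \<le> C3" unfolding C3_def using n C1 by simp
  have C0: "C3 \<le> C0" "1 \<le> C0" unfolding C0_def using n C1 C3 by (simp_all add: add_nonneg_nonneg)
  have K: "1 \<le> K" by (simp add: K_def)
  have C: "C0 \<le> C" "2 * 2 ^ CARD('n) * K ^ 3 \<le> C" "1 \<le> C" using C0 K by (simp_all add: C_def add_increasing2)
  show thesis
  proof
    show "1 \<le> C" by fact
    fix A :: real assume A: "1 \<le> A"
    obtain k where k: "4 * n * C3 * A \<le> 2 ^ k"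
      using real_arch_pow[of 2 "4 * n * C3 * A"] by (auto intro: less_imp_le)
    \<comment> \<open>Chosen so that the mean of \<open>h\<close> at scale 2^(p0 - k) is at most K *
      \<kappa> * 2^(kn) = 1/4. The same smallness keeps all stopping levels below p0 - k.\<close>
    define \<kappa> where "\<kappa> = 1 / (4 * K * (2 ^ k) ^ CARD('n))"
    have "(1 :: real) * 1 \<le> K * (2 ^ k) ^ CARD('n)" using K by (intro mult_mono) auto
    then have \<kappa>: "0 < \<kappa>" "\<kappa> \<le> 1" using K by (simp_all add: \<kappa>_def mult.assoc)
    show "\<exists>\<kappa>>0. \<forall>(a :: int ^ 'n \<Rightarrow> real) L p0.
      fsupp a \<longrightarrow> (\<forall>z. 0 \<le> a z) \<longrightarrow> 0 < L \<longrightarrow> Sum_any a \<le> \<kappa> * L * (2 ^ p0) ^ CARD('n) \<longrightarrow>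
      (\<exists>\<Gamma> v. finite \<Gamma> \<and> sum a ({z. \<exists>p\<le>p0. heavy a L p z} - \<Gamma>) \<le> C / A\<^sup>2 * Sum_any a \<and>
        (\<forall>i. fsupp (v i)) \<and> (\<forall>i j z. \<bar>fdiff j (v i) z\<bar> \<le> C * A) \<and> (\<forall>i z. \<bar>v i z\<bar> \<le> C * A * 2 ^ p0) \<and>
        (\<forall>z\<in>\<Gamma>. \<forall>y\<in>lbox 2 z. 1 / 2 \<le> (\<Sum>i\<in>UNIV. fdiff i (v i) y)))"
    proof (intro exI[of _ \<kappa>] conjI allI impI \<kappa>(1))
      fix a :: "int ^ 'n \<Rightarrow> real" and L :: real and p0 :: nat
      assume a: "fsupp a" "\<forall>z. 0 \<le> a z" and L: "0 < L" and M: "Sum_any a \<le> \<kappa> * L * (2 ^ p0) ^ CARD('n)"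
      define \<Omega> where "\<Omega> = {z. \<exists>p\<le>p0. heavy a L p z}"
      define lev where "lev = toplevel p0 (heavy a L)"
      define \<Omega>' where "\<Omega>' = (\<Union>z\<in>\<Omega>. nbh c (lev z) z)"
      define h where "h z = (if z \<in> \<Omega>' then 1 else 0 :: real)" for z
      have bp: "block_partition lev \<Omega>"
        unfolding lev_def \<Omega>_def using a L by (intro heavy_partition) auto
      then have "finite \<Omega>" unfolding block_partition_def by blast
      then have fin: "finite \<Omega>" "finite \<Omega>'" by (simp_all add: \<Omega>'_def)
      have card\<Omega>: "L * card \<Omega> \<le> Sum_any a" unfolding \<Omega>_def using a L by (intro card_heavy_le) auto
      have card\<Omega>': "real (card \<Omega>') \<le> K * card \<Omega>"
        using of_nat_mono[OF block_partition_card_nbh[OF bp, of c], where 'a = real] by (simp add: K_def \<Omega>'_def)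
      have Sh: "Sum_any h = card \<Omega>'"
        using Sum_any.conditionalize[OF fin(2), of "\<lambda>_. 1 :: real"] by (simp add: h_def[abs_def])
      have hf: "fsupp h" by (rule finite_subset[OF _ fin(2)]) (auto simp: h_def)
      have Sh_le: "Sum_any h \<le> K * (Sum_any a / L)"
      proof -
        have "real (card \<Omega>) \<le> Sum_any a / L" using card\<Omega> L by (simp add: field_simps)
        then have "K * real (card \<Omega>) \<le> K * (Sum_any a / L)" using K by (intro mult_left_mono) auto
        then show ?thesis using card\<Omega>' Sh by linarith
      qed
      have h01: "0 \<le> h z" "h z \<le> 1" for z by (auto simp: h_def)
      \<comment> \<open>With \<alpha> = 4^-p0 the screening length is the top scale 2^p0.\<close>
      obtain \<psi> where \<psi>: "\<And>z. 1 / 4 ^ p0 * \<psi> z - laplace \<psi> z = h z" "\<And>z. 0 \<le> \<psi> z" "\<And>z. \<psi> z \<le> 1 / (1 / 4 ^ p0)"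
        "\<And>B. finite B \<Longrightarrow> (\<Sum>z\<in>B. \<Sum>i\<in>UNIV. \<Sum>j\<in>UNIV. (fdiff j (bdiff i \<psi>) z)\<^sup>2) \<le> 2 * Sum_any h"
        using resolvent_exists[OF hf h01, of "1 / 4 ^ p0"] by auto
      define e where "e z = (\<Sum>i\<in>UNIV. \<Sum>j\<in>UNIV. (fdiff j (bdiff i \<psi>) z)\<^sup>2)" for z
      define Bad where "Bad = {z\<in>\<Omega>. \<exists>p\<le>p0. lev z \<le> p \<and> A\<^sup>2 * (2 ^ p) ^ CARD('n) < sum e (nbh c p z)}"
      have M': "Sum_any a \<le> L * (2 ^ p0) ^ CARD('n)"
      proof -
        have "\<kappa> * (L * (2 ^ p0) ^ CARD('n)) \<le> 1 * (L * (2 ^ p0) ^ CARD('n))" using \<kappa> L by (intro mult_right_mono) auto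
        then show ?thesis using M by (simp add: mult.assoc)
      qed
      have "sum a Bad \<le> L * 2 ^ CARD('n) * (real (2 * c + 1) ^ CARD('n)) ^ 2 / A\<^sup>2 * (2 * Sum_any h)"
        unfolding Bad_def lev_def \<Omega>_def
        by (rule bad_mass) (use a L M' A \<psi>(4) in \<open>auto simp: e_def intro!: sum_nonneg\<close>)
      also have "\<dots> \<le> L * 2 ^ CARD('n) * (real (2 * c + 1) ^ CARD('n)) ^ 2 / A\<^sup>2 * (2 * (K * (Sum_any a / L)))"
        using Sh_le L by (intro mult_left_mono) auto
      also have "\<dots> = (2 * 2 ^ CARD('n) * K ^ 3) / A\<^sup>2 * Sum_any a"
        unfolding K_def[symmetric] using L by (simp add: power2_eq_square power3_eq_cube)
      also have "\<dots> \<le> C / A\<^sup>2 * Sum_any a"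
        using C a by (intro mult_right_mono divide_right_mono Sum_any_nonneg) auto
      finally have Bad: "sum a Bad \<le> C / A\<^sup>2 * Sum_any a" .
      define \<Gamma> where "\<Gamma> = \<Omega> - Bad"
      \<comment> \<open>A heavy block of level \<open>lev z\<close> has mass above L * 2^(n * lev
        z), while the total mass is at most \<kappa> * L * 2^(n * p0); comparing the two forces the
        gap \<open>k\<close>.\<close>
      have level: "lev z + k < p0" if "z \<in> \<Omega>" for z
      proof -
        have "heavy a L (lev z) z" using that toplevel(2)[of p0 "heavy a L" z] by (simp add: \<Omega>_def lev_def)
        then have "L * (2 ^ lev z) ^ CARD('n) < sum a (blk (lev z) z)" by (simp add: heavy_def)
        also have "\<dots> \<le> Sum_any a" using a by (intro sum_le_Sum_any) auto
        also have "\<dots> \<le> L * (\<kappa> * (2 ^ p0) ^ CARD('n))" using M by (simp add: mult_ac)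
        finally have "(2 ^ lev z) ^ CARD('n) < \<kappa> * (2 ^ p0) ^ CARD('n)" using L by simp
        then have "(2 ^ lev z) ^ CARD('n) * (4 * K * (2 ^ k) ^ CARD('n)) < (2 ^ p0) ^ CARD('n)"
          using K by (simp add: \<kappa>_def pos_less_divide_eq)
        moreover have "(2 ^ lev z) ^ CARD('n) * (1 * (2 ^ k) ^ CARD('n)) \<le> (2 ^ lev z) ^ CARD('n) * (4 * K * (2 ^ k) ^ CARD('n))"
          using K by (intro mult_left_mono mult_right_mono) auto
        ultimately have "(2 ^ lev z) ^ CARD('n) * (1 * (2 ^ k) ^ CARD('n)) < (2 ^ p0 :: real) ^ CARD('n)"
          by (rule le_less_trans[rotated])
        then have "((2 :: real) ^ (lev z + k)) ^ CARD('n) < (2 ^ p0) ^ CARD('n)"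
          by (simp add: power_add power_mult_distrib)
        then have "(2 :: real) ^ (lev z + k) < 2 ^ p0" by (rule power_less_imp_less_base) simp
        then show ?thesis by simp
      qed
      have h_avg: "avg (p0 - k) h z \<le> 1 / 4" for z
      proof (cases "\<Omega> = {}")
        case True
        then have "h = (\<lambda>_. 0)" by (auto simp: h_def \<Omega>'_def)
        then show ?thesis by (simp add: avg_const)
      next
        case False
        then have kp: "k \<le> p0" using level by fastforce
        have "avg (p0 - k) h z \<le> Sum_any h / (2 ^ (p0 - k)) ^ CARD('n)" by (rule avg_le_Sum_any[OF hf h01(1)])
        also have "\<dots> \<le> K * (\<kappa> * (2 ^ p0) ^ CARD('n)) / (2 ^ (p0 - k)) ^ CARD('n)"
        proof (rule divide_right_mono)
          have "Sum_any a / L \<le> \<kappa> * (2 ^ p0) ^ CARD('n)" using M L by (simp add: field_simps)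
          then have "K * (Sum_any a / L) \<le> K * (\<kappa> * (2 ^ p0) ^ CARD('n))" using K by (intro mult_left_mono) auto
          then show "Sum_any h \<le> K * (\<kappa> * (2 ^ p0) ^ CARD('n))" using Sh_le by linarith
        qed simp
        also have "\<dots> = 1 / 4"
          using K kp by (simp add: \<kappa>_def power_diff power_divide)
        finally show ?thesis .
      qed
      interpret good_points \<psi> h p0 A \<Gamma> lev k n C1 C3
      proof
        fix z y assume z: "z \<in> \<Gamma>" and "y \<in> lbox (int (radius TYPE('n)) * 2 ^ lev z) z"
        then have "y \<in> nbh c (lev z) z" using lbox_subset_nbh by (auto simp: c_def)
        then show "h y = 1" using z by (auto simp: h_def \<Omega>'_def \<Gamma>_def)
      next
        fix z p assume z: "z \<in> \<Gamma>" and p: "lev z \<le> p" "p \<le> p0"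
        have "sum e (lbox (int c * 2 ^ p) z) \<le> sum e (nbh c p z)"
          by (intro sum_mono2 lbox_subset_nbh) (auto simp: e_def intro!: sum_nonneg)
        also have "\<dots> \<le> A\<^sup>2 * (2 ^ p) ^ CARD('n)" using z p by (auto simp: \<Gamma>_def Bad_def not_less)
        finally show "(\<Sum>y\<in>lbox (int (radius TYPE('n)) * 2 ^ p) z. \<Sum>i\<in>UNIV. \<Sum>j\<in>UNIV. (fdiff j (bdiff i \<psi>) y)\<^sup>2)
          \<le> A\<^sup>2 * (2 ^ p) ^ CARD('n)" by (simp add: e_def c_def)
      next
        fix z assume "z \<in> \<Gamma>"
        then show "lev z + k \<le> p0" using level[of z] by (simp add: \<Gamma>_def)
      qed (use A \<psi> h_avg k in \<open>auto simp: n_def C1_def C3_def\<close>)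
      \<comment> \<open>Radius 4 leaves room for the unit shifts: the divergence at a point within 2
        of \<open>z\<close> also uses the neighbours of that point, and there the extension must
        agree with \<open>v\<close>.\<close>
      define S where "S = (\<Union>z\<in>\<Gamma>. lbox 4 z)"
      have finS: "finite S" using fin by (simp add: S_def \<Gamma>_def)
      have "\<exists>g. (\<forall>x\<in>S. g x = v i x) \<and> (\<forall>x y. \<bar>g x - g y\<bar> \<le> (C0 * A) * dist1 x y) \<and> (\<forall>x. \<bar>g x\<bar> \<le> C3 * A * 2 ^ p0) \<and> fsupp g" for i
      proof (rule lattice_extension[OF finS, of "C0 * A" "v i" "C3 * A * 2 ^ p0"])
        fix x y assume "x \<in> S" "y \<in> S"
        then show "\<bar>v i x - v i y\<bar> \<le> C0 * A * dist1 x y" using v_lipschitz by (auto simp: S_def C0_def)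
      next
        fix x assume "x \<in> S"
        then obtain z where z: "z \<in> \<Gamma>" "x \<in> lbox 4 z" by (auto simp: S_def)
        have "x \<in> lbox (14 * 2 ^ lev z) z"
          using lbox_level[of 0 "lev z" 14 x z] z lbox_mono[of 4 14 z] by auto
        then show "\<bar>v i x\<bar> \<le> C3 * A * 2 ^ p0" by (rule v_bound[OF z(1)])
      qed (use C0 C3 A in auto)
      then obtain w where w: "\<And>i x. x \<in> S \<Longrightarrow> w i x = v i x" "\<And>i x y. \<bar>w i x - w i y\<bar> \<le> (C0 * A) * dist1 x y"
        "\<And>i x. \<bar>w i x\<bar> \<le> C3 * A * 2 ^ p0" "\<And>i. fsupp (w i)" by metis
      show "\<exists>\<Gamma> v. finite \<Gamma> \<and> sum a ({z. \<exists>p\<le>p0. heavy a L p z} - \<Gamma>) \<le> C / A\<^sup>2 * Sum_any a \<and>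
        (\<forall>i. fsupp (v i)) \<and> (\<forall>i j z. \<bar>fdiff j (v i) z\<bar> \<le> C * A) \<and> (\<forall>i z. \<bar>v i z\<bar> \<le> C * A * 2 ^ p0) \<and>
        (\<forall>z\<in>\<Gamma>. \<forall>y\<in>lbox 2 z. 1 / 2 \<le> (\<Sum>i\<in>UNIV. fdiff i (v i) y))"
      proof (intro exI[of _ \<Gamma>] exI[of _ w] conjI allI ballI)
        show "finite \<Gamma>" using fin by (simp add: \<Gamma>_def)
        have "{z. \<exists>p\<le>p0. heavy a L p z} - \<Gamma> = Bad" unfolding \<Gamma>_def \<Omega>_def[symmetric] by (auto simp: Bad_def)
        then show "sum a ({z. \<exists>p\<le>p0. heavy a L p z} - \<Gamma>) \<le> C / A\<^sup>2 * Sum_any a" using Bad by simp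
        show "fsupp (w i)" for i by fact
        show "\<bar>fdiff j (w i) z\<bar> \<le> C * A" for i j z
        proof -
          have "\<bar>fdiff j (w i) z\<bar> \<le> C0 * A"
            using w(2)[of i "z + unit_step j" z] by (simp add: fdiff_def dist1_commute[of _ z])
          also have "\<dots> \<le> C * A" using C A by (intro mult_right_mono) auto
          finally show ?thesis .
        qed
        show "\<bar>w i z\<bar> \<le> C * A * 2 ^ p0" for i z
        proof -
          have "C3 * A * 2 ^ p0 \<le> C * A * 2 ^ p0" using C C0 A by (intro mult_right_mono) auto
          then show ?thesis using w(3)[of i z] by linarith
        qed
        fix z y assume z: "z \<in> \<Gamma>" and y: "y \<in> lbox 2 z"
        have y4: "y \<in> lbox 4 z" "y + unit_step i \<in> lbox 4 z" for i
          using lbox_mono[of 2 4 z] lbox_mono[of 3 4 z] y lbox_trans[OF y lbox_unit_step(1), of i] by auto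
        then have "y \<in> S" "y + unit_step i \<in> S" for i using z unfolding S_def by blast+
        then have "fdiff i (w i) y = fdiff i (v i) y" for i
          using w(1)[of y i] w(1)[of "y + unit_step i" i] by (simp add: fdiff_def)
        then show "1 / 2 \<le> (\<Sum>i\<in>UNIV. fdiff i (w i) y)" using divergence[OF z y4(1)] by simp
      qed
    qed
  qed
qed

subsection \<open>B-splines\<close>

definition ppow :: "nat \<Rightarrow> real \<Rightarrow> real" where
  "ppow m s = (max 0 s) ^ m"

lemma DERIV_ppow: "(ppow (Suc (Suc m)) has_real_derivative (real m + 2) * ppow (Suc m) s) (at s)"
proof -
  consider "0 < s" | "s < 0" | "s = 0" by linarith
  then show ?thesis
  proof cases
    case 1
    have "((\<lambda>s. s ^ Suc (Suc m)) has_real_derivative (real m + 2) * s ^ Suc m) (at s)"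
      using DERIV_pow[of "Suc (Suc m)" s] by (simp add: add.commute)
    then have "((\<lambda>s. s ^ Suc (Suc m)) has_real_derivative (real m + 2) * ppow (Suc m) s) (at s)"
      using 1 by (simp add: ppow_def)
    then show ?thesis
      by (rule has_field_derivative_transform_within_open[of _ _ _ "{0<..}"]) (use 1 in \<open>auto simp: ppow_def\<close>)
  next
    case 2
    have "((\<lambda>s. 0) has_real_derivative (real m + 2) * ppow (Suc m) s) (at s)"
      using 2 by (simp add: ppow_def)
    then show ?thesis
      by (rule has_field_derivative_transform_within_open[of _ _ _ "{..<0}"]) (use 2 in \<open>auto simp: ppow_def\<close>)
  next
    case 3
    have lim: "((\<lambda>h. \<bar>h :: real\<bar> ^ Suc m) \<longlongrightarrow> 0) (at 0)"
      by (intro tendsto_eq_intros) auto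
    have "((\<lambda>h. (ppow (Suc (Suc m)) (0 + h) - ppow (Suc (Suc m)) 0) / h) \<longlongrightarrow> 0) (at 0)"
    proof (rule Lim_null_comparison[OF _ lim])
      show "\<forall>\<^sub>F h in at 0. norm ((ppow (Suc (Suc m)) (0 + h) - ppow (Suc (Suc m)) 0) / h) \<le> \<bar>h\<bar> ^ Suc m"
      proof (intro always_eventually allI)
        fix h :: real
        have "max 0 h ^ Suc (Suc m) \<le> \<bar>h\<bar> ^ Suc (Suc m)" by (intro power_mono) auto
        then show "norm ((ppow (Suc (Suc m)) (0 + h) - ppow (Suc (Suc m)) 0) / h) \<le> \<bar>h\<bar> ^ Suc m"
          by (cases "h = 0") (auto simp: ppow_def abs_mult field_simps)
      qed
    qed
    then show ?thesis using 3 by (simp add: DERIV_def ppow_def)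
  qed
qed

text \<open>A monotone transition from 0 to 1, written through truncated powers. It is the sum of
  the integer translates of a B-spline to one side, so \<open>bspl d\<close>, its unit difference,
  is the uniform B-spline of degree d + 1. The right end of the support is kept at 1 for all d,
  which makes derivatives come out as forward differences.\<close>

definition ramp :: "nat \<Rightarrow> real \<Rightarrow> real" where
  "ramp d s = (if d = 0 then ppow 1 s - ppow 1 (s - 1)
    else if d = 1 then (ppow 2 (s + 1) - 2 * ppow 2 s + ppow 2 (s - 1)) / 2
    else (ppow 3 (s + 2) - 3 * ppow 3 (s + 1) + 3 * ppow 3 s - ppow 3 (s - 1)) / 6)"

definition bspl :: "nat \<Rightarrow> real \<Rightarrow> real" where
  "bspl d s = ramp d (s + 1) - ramp d s"

lemma DERIV_ppow_shift:
  "((\<lambda>s. ppow 2 (s + c)) has_real_derivative 2 * ppow 1 (s + c)) (at s)"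
  "((\<lambda>s. ppow 3 (s + c)) has_real_derivative 3 * ppow 2 (s + c)) (at s)"
  using DERIV_ppow[of 0 "s + c"] DERIV_ppow[of 1 "s + c"]
  by (simp_all only: DERIV_shift numeral_eq_Suc One_nat_def) (simp_all add: numeral_eq_Suc)

lemma DERIV_ramp:
  assumes "d < 2"
  shows "(ramp (Suc d) has_real_derivative bspl d s) (at s)"
proof -
  consider "d = 0" | "d = 1" using assms by linarith
  then show ?thesis
  proof cases
    case 1
    have f: "ramp (Suc d) = (\<lambda>s. (ppow 2 (s + 1) - 2 * ppow 2 (s + 0) + ppow 2 (s + - 1)) / 2)"
      using 1 by (auto simp: ramp_def)
    have g: "bspl d s = (2 * ppow 1 (s + 1) - 2 * (2 * ppow 1 (s + 0)) + 2 * ppow 1 (s + - 1)) / 2"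
      using 1 by (simp add: bspl_def ramp_def)
    show ?thesis unfolding f g
      by (intro DERIV_cdivide DERIV_add DERIV_diff DERIV_cmult DERIV_ppow_shift)
  next
    case 2
    have f: "ramp (Suc d) = (\<lambda>s. (ppow 3 (s + 2) - 3 * ppow 3 (s + 1) + 3 * ppow 3 (s + 0) - ppow 3 (s + - 1)) / 6)"
      using 2 by (auto simp: ramp_def)
    have r: "ramp 1 s = (ppow 2 (s + 1) - 2 * ppow 2 s + ppow 2 (s - 1)) / 2" for s by (simp add: ramp_def)
    have e: "ppow 2 (s + 1 + 1) = ppow 2 (s + 2)" "ppow 2 (s + 1 - 1) = ppow 2 s"
      "ppow 2 (s + 0) = ppow 2 s" "ppow 2 (s + - 1) = ppow 2 (s - 1)" by (simp_all add: add.assoc)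
    have g: "bspl d s = (3 * ppow 2 (s + 2) - 3 * (3 * ppow 2 (s + 1)) + 3 * (3 * ppow 2 (s + 0)) - 3 * ppow 2 (s + - 1)) / 6"
      unfolding 2 bspl_def r e by (simp add: field_simps)
    show ?thesis unfolding f g
      by (intro DERIV_cdivide DERIV_add DERIV_diff DERIV_cmult DERIV_ppow_shift)
  qed
qed

text \<open>Induction on the degree: monotonicity of one ramp says that its unit difference is
  nonnegative, and that difference is the derivative of the next ramp.\<close>

lemma ramp_mono: "d \<le> 2 \<Longrightarrow> s \<le> t \<Longrightarrow> ramp d s \<le> ramp d t"
proof (induction d arbitrary: s t)
  case 0
  then show ?case by (simp add: ramp_def ppow_def)
next
  case (Suc d)
  have "0 \<le> bspl d x" for x unfolding bspl_def using Suc.IH[of x "x + 1"] Suc.prems by simp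
  then show ?case using Suc.prems DERIV_ramp[of d] by (intro DERIV_nonneg_imp_nondecreasing[OF Suc.prems(2)]) auto
qed

lemma ramp_0: "s \<le> - 2 \<Longrightarrow> ramp d s = 0" "d \<le> 1 \<Longrightarrow> s \<le> - 1 \<Longrightarrow> ramp d s = 0"
  by (simp_all add: ramp_def ppow_def)

lemma ramp_1: "1 \<le> s \<Longrightarrow> ramp d s = 1"
  by (simp add: ramp_def ppow_def power2_eq_square power3_eq_cube algebra_simps)

lemma bspl_nonneg: "d \<le> 2 \<Longrightarrow> 0 \<le> bspl d s"
  using ramp_mono[of d s "s + 1"] by (simp add: bspl_def)

lemma bspl_le_1: "d \<le> 2 \<Longrightarrow> bspl d s \<le> 1"
proof -
  assume d: "d \<le> 2"
  have "ramp d (s + 1) \<le> ramp d (max 1 (s + 1))" by (rule ramp_mono[OF d]) simp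
  moreover have "ramp d (max 1 (s + 1)) = 1" by (rule ramp_1) simp
  moreover have "ramp d (min (- 2) s) \<le> ramp d s" by (rule ramp_mono[OF d]) simp
  moreover have "ramp d (min (- 2) s) = 0" by (rule ramp_0) simp
  ultimately show ?thesis unfolding bspl_def by linarith
qed

lemma bspl_eq_0: "1 \<le> s \<Longrightarrow> bspl d s = 0" "s \<le> - 3 \<Longrightarrow> bspl d s = 0" "d \<le> 1 \<Longrightarrow> s \<le> - 2 \<Longrightarrow> bspl d s = 0"
  by (simp_all add: bspl_def ramp_0 ramp_1)

lemma DERIV_bspl:
  assumes "d < 2"
  shows "(bspl (Suc d) has_real_derivative bspl d (s + 1) - bspl d s) (at s)"
  unfolding bspl_def[of "Suc d", abs_def]
  by (intro DERIV_diff DERIV_ramp assms) (use DERIV_ramp[OF assms, of "s + 1"] in \<open>simp add: DERIV_shift\<close>)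

lemma bspl_lipschitz: "d \<le> 2 \<Longrightarrow> \<bar>bspl d s - bspl d t\<bar> \<le> 2 * \<bar>s - t\<bar>"
proof (cases d)
  case 0
  have "\<bar>ramp 0 s - ramp 0 t\<bar> \<le> \<bar>s - t\<bar>" for s t by (simp add: ramp_def ppow_def)
  from this[of s t] this[of "s + 1" "t + 1"]
  have ab: "\<bar>ramp 0 s - ramp 0 t\<bar> \<le> \<bar>s - t\<bar>" "\<bar>ramp 0 (s + 1) - ramp 0 (t + 1)\<bar> \<le> \<bar>s - t\<bar>" by simp_all
  have "\<bar>(a - b) - (c - e)\<bar> \<le> \<bar>a - c\<bar> + \<bar>b - e\<bar>" for a b c e :: real by linarith
  from this[of "ramp 0 (s + 1)" "ramp 0 s" "ramp 0 (t + 1)" "ramp 0 t"]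
  have "\<bar>bspl d s - bspl d t\<bar> \<le> \<bar>ramp 0 (s + 1) - ramp 0 (t + 1)\<bar> + \<bar>ramp 0 s - ramp 0 t\<bar>"
    by (simp add: bspl_def 0)
  also have "\<dots> \<le> \<bar>s - t\<bar> + \<bar>s - t\<bar>" by (rule add_mono[OF ab(2,1)])
  finally show ?thesis by simp
next
  case (Suc e)
  assume "d \<le> 2"
  then have e: "e < 2" "e \<le> 2" using Suc by auto
  have "norm (bspl d s - bspl d t) \<le> 2 * norm (s - t)"
  proof (rule field_differentiable_bound[of UNIV])
    show "(bspl d has_real_derivative bspl e (z + 1) - bspl e z) (at z within UNIV)" for z
      unfolding Suc using DERIV_bspl[OF e(1)] by simp
    show "norm (bspl e (z + 1) - bspl e z) \<le> 2" for z
      using bspl_nonneg[OF e(2), of z] bspl_nonneg[OF e(2), of "z + 1"] bspl_le_1[OF e(2), of z] bspl_le_1[OF e(2), of "z + 1"]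
      by simp
  qed auto
  then show ?thesis by simp
qed

text \<open>Partition of unity by telescoping of ramps. The supports have length at most 4, so four
  consecutive translates suffice at every point.\<close>

lemma bspl_sum: "(\<Sum>k\<in>{\<lfloor>s\<rfloor>..\<lfloor>s\<rfloor> + 3}. bspl d (s - real_of_int k)) = 1"
proof -
  have set: "{\<lfloor>s\<rfloor>..\<lfloor>s\<rfloor> + 3} = {\<lfloor>s\<rfloor>, \<lfloor>s\<rfloor> + 1, \<lfloor>s\<rfloor> + 2, \<lfloor>s\<rfloor> + 3}" by auto
  have "(\<Sum>k\<in>{\<lfloor>s\<rfloor>..\<lfloor>s\<rfloor> + 3}. bspl d (s - real_of_int k)) = ramp d (s - \<lfloor>s\<rfloor> + 1) - ramp d (s - \<lfloor>s\<rfloor> - 3)"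
    unfolding set by (simp add: bspl_def algebra_simps)
  also have "ramp d (s - \<lfloor>s\<rfloor> + 1) = 1" by (rule ramp_1) simp
  also have "ramp d (s - \<lfloor>s\<rfloor> - 3) = 0" by (rule ramp_0) linarith
  finally show ?thesis by simp
qed

subsection \<open>Tensor spline interpolation of lattice functions\<close>

definition weight :: "real \<Rightarrow> ('n \<Rightarrow> nat) \<Rightarrow> real ^ 'n \<Rightarrow> int ^ 'n \<Rightarrow> real" where
  "weight \<delta> D x z = (\<Prod>k\<in>UNIV. bspl (D k) (x $ k / \<delta> - real_of_int (z $ k)))"

text \<open>The degree is allowed to vary with the coordinate, since a partial derivative lowers it
  in its own direction only.\<close>

definition spl :: "real \<Rightarrow> ('n \<Rightarrow> nat) \<Rightarrow> (int ^ 'n \<Rightarrow> real) \<Rightarrow> real ^ 'n \<Rightarrow> real" where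
  "spl \<delta> D u x = Sum_any (\<lambda>z. u z * weight \<delta> D x z)"

definition cell_of :: "real \<Rightarrow> real ^ 'n \<Rightarrow> int ^ 'n" where
  "cell_of \<delta> x = (\<chi> k. \<lfloor>x $ k / \<delta>\<rfloor>)"

definition window :: "real \<Rightarrow> real ^ 'n \<Rightarrow> (int ^ 'n) set" where
  "window \<delta> x = {z. \<forall>k. z $ k \<in> {\<lfloor>x $ k / \<delta>\<rfloor>..\<lfloor>x $ k / \<delta>\<rfloor> + 3}}"

lemma finite_window [simp]: "finite (window \<delta> x)"
  unfolding window_def by (rule card_vec_product(2)) simp

context
  fixes D :: "'n::finite \<Rightarrow> nat"
  assumes D: "\<And>k. D k \<le> 2"
begin

lemma weight_nonneg: "0 \<le> weight \<delta> D x z"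
  unfolding weight_def by (intro prod_nonneg ballI bspl_nonneg D)

lemma weight_eq_0: "z \<notin> window \<delta> x \<Longrightarrow> weight \<delta> D x z = 0"
proof -
  assume "z \<notin> window \<delta> x"
  then obtain k where k: "z $ k \<notin> {\<lfloor>x $ k / \<delta>\<rfloor>..\<lfloor>x $ k / \<delta>\<rfloor> + 3}" by (auto simp: window_def)
  then consider "z $ k < \<lfloor>x $ k / \<delta>\<rfloor>" | "\<lfloor>x $ k / \<delta>\<rfloor> + 3 < z $ k" by fastforce
  then have "1 \<le> x $ k / \<delta> - real_of_int (z $ k) \<or> x $ k / \<delta> - real_of_int (z $ k) \<le> - 3"
    by cases linarith+
  then have "bspl (D k) (x $ k / \<delta> - real_of_int (z $ k)) = 0" using bspl_eq_0(1,2) by blast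
  then show ?thesis unfolding weight_def by (intro prod_zero) auto
qed

lemma weight_sum: "(\<Sum>z\<in>window \<delta> x. weight \<delta> D x z) = 1"
  unfolding window_def weight_def
  by (subst sum_prod_vec[of _ "\<lambda>k t. bspl (D k) (x $ k / \<delta> - real_of_int t)"]) (simp_all add: bspl_sum)

lemma spl_window: "spl \<delta> D u x = (\<Sum>z\<in>window \<delta> x. u z * weight \<delta> D x z)"
  unfolding spl_def by (rule Sum_any.expand_superset) (use weight_eq_0 in auto)

lemma spl_approx:
  assumes "\<And>z. z \<in> window \<delta> x \<Longrightarrow> \<bar>u z - c\<bar> \<le> B"
  shows "\<bar>spl \<delta> D u x - c\<bar> \<le> B"
proof -
  have "spl \<delta> D u x - c = (\<Sum>z\<in>window \<delta> x. (u z - c) * weight \<delta> D x z)"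
    unfolding spl_window left_diff_distrib sum_subtractf sum_distrib_left[symmetric] weight_sum by simp
  also have "\<bar>\<dots>\<bar> \<le> (\<Sum>z\<in>window \<delta> x. B * weight \<delta> D x z)"
    by (intro order_trans[OF sum_abs sum_mono]) (use assms weight_nonneg in \<open>auto simp: abs_mult intro!: mult_right_mono\<close>)
  also have "\<dots> = B" unfolding sum_distrib_left[symmetric] weight_sum by simp
  finally show ?thesis .
qed

lemma spl_bound:
  assumes "\<And>z. \<bar>u z\<bar> \<le> B"
  shows "\<bar>spl \<delta> D u x\<bar> \<le> B"
  using spl_approx[of \<delta> x u 0 B] assms by simp

lemma spl_lipschitz:
  assumes u: "fsupp u" and \<delta>: "0 < \<delta>"
  shows "\<exists>L. L-lipschitz_on UNIV (spl \<delta> D u)"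
proof -
  define S where "S = {z. u z \<noteq> 0}"
  define L where "L = (\<Sum>z\<in>S. \<bar>u z\<bar> * (2 * real CARD('n) / \<delta>))"
  have S: "finite S" using u by (simp add: S_def)
  have "dist (spl \<delta> D u x) (spl \<delta> D u y) \<le> L * dist x y" for x y
  proof -
    have w: "\<bar>weight \<delta> D x z - weight \<delta> D y z\<bar> \<le> 2 * real CARD('n) / \<delta> * dist x y" for z
    proof -
      have "norm (weight \<delta> D x z - weight \<delta> D y z) \<le>
        (\<Sum>k\<in>UNIV. norm (bspl (D k) (x $ k / \<delta> - real_of_int (z $ k)) - bspl (D k) (y $ k / \<delta> - real_of_int (z $ k))))"
        unfolding weight_def by (rule norm_prod_diff) (use bspl_nonneg[OF D] bspl_le_1[OF D] in auto)
      also have "\<dots> \<le> (\<Sum>k\<in>(UNIV :: 'n set). 2 / \<delta> * dist x y)"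
      proof (rule sum_mono)
        fix k
        have "norm (bspl (D k) (x $ k / \<delta> - real_of_int (z $ k)) - bspl (D k) (y $ k / \<delta> - real_of_int (z $ k)))
          \<le> 2 * \<bar>x $ k / \<delta> - y $ k / \<delta>\<bar>"
          using bspl_lipschitz[OF D[of k], of "x $ k / \<delta> - real_of_int (z $ k)" "y $ k / \<delta> - real_of_int (z $ k)"] by simp
        also have "\<dots> = 2 / \<delta> * \<bar>(x - y) $ k\<bar>" using \<delta> by (simp flip: diff_divide_distrib)
        also have "\<dots> \<le> 2 / \<delta> * dist x y"
          using component_le_norm_cart[of "x - y" k] \<delta> by (intro mult_left_mono) (auto simp: dist_norm)
        finally show "norm (bspl (D k) (x $ k / \<delta> - real_of_int (z $ k)) - bspl (D k) (y $ k / \<delta> - real_of_int (z $ k)))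
          \<le> 2 / \<delta> * dist x y" .
      qed
      finally show ?thesis by (simp add: mult_ac)
    qed
    have "spl \<delta> D u x = (\<Sum>z\<in>S. u z * weight \<delta> D x z)" for x
      unfolding spl_def by (rule Sum_any.expand_superset[OF S]) (auto simp: S_def)
    then have "\<bar>spl \<delta> D u x - spl \<delta> D u y\<bar> = \<bar>\<Sum>z\<in>S. u z * (weight \<delta> D x z - weight \<delta> D y z)\<bar>"
      by (simp add: sum_subtractf right_diff_distrib)
    also have "\<dots> \<le> (\<Sum>z\<in>S. \<bar>u z\<bar> * (2 * real CARD('n) / \<delta> * dist x y))"
      by (intro order_trans[OF sum_abs sum_mono]) (simp only: abs_mult mult_left_mono[OF w] abs_ge_zero)
    also have "\<dots> = L * dist x y" by (simp add: L_def sum_distrib_right mult.assoc)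
    finally show ?thesis by (simp add: dist_real_def)
  qed
  moreover have "0 \<le> L" unfolding L_def using \<delta> by (intro sum_nonneg) auto
  ultimately show ?thesis by (intro exI[of _ L] lipschitz_onI) auto
qed

text \<open>The derivative of a B-spline is a difference of two translates one degree lower.
  Shifting the summation index moves this difference onto the coefficients, so the formula is exact
  and lattice bounds carry over without loss.\<close>

lemma spl_partial:
  fixes u :: "int ^ 'n \<Rightarrow> real"
  assumes u: "fsupp u" and \<delta>: "0 < \<delta>" and j: "D j = Suc d"
  shows "((\<lambda>s. spl \<delta> D u (x + s *\<^sub>R axis j 1)) has_real_derivative 1 / \<delta> * spl \<delta> (D(j := d)) (fdiff j u) x) (at 0)"
proof -
  have d: "d < 2" using D[of j] j by simp
  define S where "S = {z. u z \<noteq> 0}"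
  define r where "r z = (\<Prod>k\<in>UNIV - {j}. bspl (D k) (x $ k / \<delta> - real_of_int (z $ k)))" for z :: "int ^ 'n"
  let ?t = "\<lambda>z. x $ j / \<delta> - real_of_int (z $ j)"
  have S: "finite S" using u by (simp add: S_def)
  have w: "weight \<delta> D (x + s *\<^sub>R axis j 1) z = bspl (Suc d) (s / \<delta> + ?t z) * r z" for s z
    unfolding weight_def r_def prod.remove[OF finite UNIV_I[of j]] j
    by (auto simp: axis_def add_divide_distrib algebra_simps intro!: arg_cong2[where f = "(*)"] prod.cong)
  have w': "weight \<delta> (D(j := d)) x z = bspl d (?t z) * r z" for z
    unfolding weight_def r_def prod.remove[OF finite UNIV_I[of j]] by simp
  have r_step: "r (z - unit_step j) = r z" "r (z + unit_step j) = r z" for z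
    unfolding r_def by (auto intro!: prod.cong)
  have sp: "spl \<delta> D u y = (\<Sum>z\<in>S. u z * weight \<delta> D y z)" for y
    unfolding spl_def by (rule Sum_any.expand_superset[OF S]) (auto simp: S_def)
  have "((\<lambda>s. bspl (Suc d) (s / \<delta> + ?t z)) has_real_derivative (bspl d (?t z + 1) - bspl d (?t z)) * (1 / \<delta>)) (at 0)" for z
  proof (rule DERIV_chain2[of "bspl (Suc d)"])
    show "(bspl (Suc d) has_real_derivative bspl d (?t z + 1) - bspl d (?t z)) (at (0 / \<delta> + ?t z))"
      using DERIV_bspl[OF d, of "?t z"] by simp
    show "((\<lambda>s. s / \<delta> + ?t z) has_real_derivative 1 / \<delta>) (at 0)"
      using \<delta> by (auto intro!: derivative_eq_intros)
  qed
  then have "((\<lambda>s. spl \<delta> D u (x + s *\<^sub>R axis j 1)) has_real_derivative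
      (\<Sum>z\<in>S. u z * ((bspl d (?t z + 1) - bspl d (?t z)) * (1 / \<delta>) * r z))) (at 0)"
    unfolding sp w by (intro DERIV_sum DERIV_cmult DERIV_cmult_right)
  also have "(\<Sum>z\<in>S. u z * ((bspl d (?t z + 1) - bspl d (?t z)) * (1 / \<delta>) * r z))
      = Sum_any (\<lambda>z. u z * ((bspl d (?t z + 1) - bspl d (?t z)) * (1 / \<delta>) * r z))"
    by (rule Sum_any.expand_superset[OF S, symmetric]) (auto simp: S_def)
  also have "\<dots> = 1 / \<delta> * Sum_any (\<lambda>z. u z * weight \<delta> (D(j := d)) x (z - unit_step j) - u z * weight \<delta> (D(j := d)) x z)"
    unfolding Sum_any_scale[symmetric] w' r_step by (simp add: algebra_simps)
  also have "Sum_any (\<lambda>z. u z * weight \<delta> (D(j := d)) x (z - unit_step j) - u z * weight \<delta> (D(j := d)) x z)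
     = Sum_any (\<lambda>z. u z * weight \<delta> (D(j := d)) x (z - unit_step j)) - Sum_any (\<lambda>z. u z * weight \<delta> (D(j := d)) x z)"
    by (intro Sum_any_diff fsupp_mult1 u)
  also have "Sum_any (\<lambda>z. u z * weight \<delta> (D(j := d)) x (z - unit_step j))
     = Sum_any (\<lambda>z. u (z + unit_step j) * weight \<delta> (D(j := d)) x z)"
    using Sum_any_shift[of "\<lambda>z. u z * weight \<delta> (D(j := d)) x (z - unit_step j)" "unit_step j"] by simp
  also have "\<dots> - Sum_any (\<lambda>z. u z * weight \<delta> (D(j := d)) x z) = spl \<delta> (D(j := d)) (fdiff j u) x"
    unfolding spl_def fdiff_def left_diff_distrib
    by (intro Sum_any_diff[symmetric] fsupp_mult1 u fsupp_shift)
  finally show ?thesis .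
qed

end

text \<open>For these lower degrees only the first three of the four window points per direction
  count, and they lie in the box of radius 2. A convex combination inherits the lower bound.\<close>

lemma spl_lower_bound:
  assumes D: "\<And>k. D k \<le> 1" and u: "\<And>z. z \<in> lbox 2 (cell_of \<delta> x) \<Longrightarrow> c \<le> u z"
  shows "c \<le> spl \<delta> D u x"
proof -
  have D2: "D k \<le> 2" for k using D[of k] by simp
  have "c = (\<Sum>z\<in>window \<delta> x. c * weight \<delta> D x z)"
    unfolding sum_distrib_left[symmetric] weight_sum[OF D2] by simp
  also have "\<dots> \<le> (\<Sum>z\<in>window \<delta> x. u z * weight \<delta> D x z)"
  proof (rule sum_mono)
    fix z assume z: "z \<in> window \<delta> x"
    show "c * weight \<delta> D x z \<le> u z * weight \<delta> D x z"
    proof (cases "z \<in> lbox 2 (cell_of \<delta> x)")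
      case True
      then show ?thesis using u weight_nonneg[OF D2] by (intro mult_right_mono) auto
    next
      case False
      then obtain k where "\<not> \<bar>z $ k - \<lfloor>x $ k / \<delta>\<rfloor>\<bar> \<le> 2" by (auto simp: lbox_def cell_of_def)
      moreover have "z $ k \<in> {\<lfloor>x $ k / \<delta>\<rfloor>..\<lfloor>x $ k / \<delta>\<rfloor> + 3}" using z by (simp add: window_def)
      ultimately have "\<lfloor>x $ k / \<delta>\<rfloor> + 3 \<le> z $ k" by auto
      \<comment> \<open>The fourth point is at offset 3 from the floor, beyond the shorter support
        [-2, 1].\<close>
      then have "x $ k / \<delta> - real_of_int (z $ k) \<le> - 2" by linarith
      then have "bspl (D k) (x $ k / \<delta> - real_of_int (z $ k)) = 0" using bspl_eq_0(3)[OF D] by blast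
      then have "weight \<delta> D x z = 0" unfolding weight_def by (intro prod_zero) auto
      then show ?thesis by simp
    qed
  qed
  also have "\<dots> = spl \<delta> D u x" by (rule spl_window[OF D2, symmetric])
  finally show ?thesis .
qed

subsection \<open>Functions with Lipschitz partial derivatives\<close>

text \<open>The gradient is carried along as data and only one-dimensional derivatives along the
  axes are required: everything below moves along coordinate segments, and this is what splines
  provide directly.\<close>

definition c11 :: "(real ^ 'n \<Rightarrow> real) \<Rightarrow> ('n \<Rightarrow> real ^ 'n \<Rightarrow> real) \<Rightarrow> bool" where
  "c11 u u' \<longleftrightarrow> (\<forall>j x. ((\<lambda>s. u (x + s *\<^sub>R axis j 1)) has_real_derivative u' j x) (at 0)) \<and>
     (\<forall>j. \<exists>L. L-lipschitz_on UNIV (u' j)) \<and> (\<forall>j. \<exists>B. \<forall>x. \<bar>u' j x\<bar> \<le> B)"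

text \<open>Change the coordinates of \<open>y\<close> into those of \<open>x\<close> one at a time;
  the intermediate points stay in a product of convex sets, and the mean value theorem applies to
  each change. With \<open>c = 0\<close> this is a Lipschitz bound, with \<open>c\<close> a frozen
  gradient it is a first-order Taylor estimate.\<close>

lemma coordinate_mvt:
  fixes u :: "real ^ 'n \<Rightarrow> real"
  assumes u: "\<And>j x. ((\<lambda>s. u (x + s *\<^sub>R axis j 1)) has_real_derivative u' j x) (at 0)"
    and Q: "Q = {w. \<forall>i. w $ i \<in> I i}" "\<And>i. convex (I i)"
    and B: "\<And>w j. w \<in> Q \<Longrightarrow> \<bar>u' j w - c j\<bar> \<le> B" and xy: "x \<in> Q" "y \<in> Q"
  shows "\<bar>u x - u y - (\<Sum>j\<in>UNIV. c j * (x $ j - y $ j))\<bar> \<le> B * (\<Sum>j\<in>UNIV. \<bar>x $ j - y $ j\<bar>)"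
proof -
  define m where "m F = (\<chi> i. if i \<in> F then x $ i else y $ i)" for F :: "'n set"
  have "\<bar>u (m F) - u y - (\<Sum>j\<in>F. c j * (x $ j - y $ j))\<bar> \<le> B * (\<Sum>j\<in>F. \<bar>x $ j - y $ j\<bar>)" if "finite F" for F
    using that
  proof (induction F)
    case empty
    have "m {} = y" by (simp add: m_def vec_eq_iff)
    then show ?case by simp
  next
    case (insert j F)
    let ?h = "\<lambda>s. u (m F + s *\<^sub>R axis j 1) - c j * s"
    let ?T = "closed_segment 0 (x $ j - y $ j)"
    have mF: "m (insert j F) = m F + (x $ j - y $ j) *\<^sub>R axis j 1"
      using insert by (auto simp: m_def vec_eq_iff axis_def)
    have "norm (?h (x $ j - y $ j) - ?h 0) \<le> B * norm (x $ j - y $ j - 0)"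
    proof (rule field_differentiable_bound[of ?T])
      fix s assume s: "s \<in> ?T"
      have "((\<lambda>t. u (m F + s *\<^sub>R axis j 1 + (t - s) *\<^sub>R axis j 1)) has_real_derivative u' j (m F + s *\<^sub>R axis j 1) * 1) (at s)"
        by (rule DERIV_chain2[where g = "\<lambda>t. t - s"]) (use u in \<open>auto intro!: derivative_eq_intros\<close>)
      moreover have "m F + s *\<^sub>R axis j 1 + (t - s) *\<^sub>R axis j 1 = m F + t *\<^sub>R axis j 1" for t
        by (simp add: scaleR_left_diff_distrib)
      ultimately have "((\<lambda>t. u (m F + t *\<^sub>R axis j 1)) has_real_derivative u' j (m F + s *\<^sub>R axis j 1)) (at s)"
        by simp
      from DERIV_diff[OF this DERIV_cmult_Id[of "c j"]]
      show "(?h has_real_derivative u' j (m F + s *\<^sub>R axis j 1) - c j) (at s within ?T)"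
        by (auto intro: has_field_derivative_at_within)
      have "m F + s *\<^sub>R axis j 1 \<in> Q"
        unfolding Q mem_Collect_eq
      proof
        fix i
        show "(m F + s *\<^sub>R axis j 1) $ i \<in> I i"
        proof (cases "i = j")
          case True
          have "y $ j + s \<in> closed_segment (y $ j) (x $ j)"
            using s by (auto simp: closed_segment_eq_real_ivl split: if_splits)
          moreover have "closed_segment (y $ j) (x $ j) \<subseteq> I j"
            using xy Q by (intro closed_segment_subset) auto
          ultimately show ?thesis using True insert(2) by (auto simp: m_def axis_def)
        next
          case False
          then show ?thesis using xy Q(1) by (simp add: m_def axis_def)
        qed
      qed
      then show "norm (u' j (m F + s *\<^sub>R axis j 1) - c j) \<le> B" using B by simp
    qed auto
    then have "\<bar>u (m (insert j F)) - u (m F) - c j * (x $ j - y $ j)\<bar> \<le> B * \<bar>x $ j - y $ j\<bar>"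
      unfolding mF by simp
    moreover have "(\<Sum>j\<in>insert j F. c j * (x $ j - y $ j)) = c j * (x $ j - y $ j) + (\<Sum>j\<in>F. c j * (x $ j - y $ j))"
      "B * (\<Sum>j\<in>insert j F. \<bar>x $ j - y $ j\<bar>) = B * \<bar>x $ j - y $ j\<bar> + B * (\<Sum>j\<in>F. \<bar>x $ j - y $ j\<bar>)"
      using insert by (simp_all add: distrib_left)
    ultimately show ?case using insert.IH by linarith
  qed
  from this[of UNIV] show ?thesis by (simp add: m_def vec_nth_inverse)
qed

lemma l1_le_dist: "(\<Sum>j\<in>UNIV. \<bar>x $ j - y $ j\<bar>) \<le> real CARD('n) * dist x (y :: real ^ 'n)"
proof -
  have "(\<Sum>j\<in>UNIV. \<bar>x $ j - y $ j\<bar>) \<le> (\<Sum>j\<in>(UNIV :: 'n set). dist x y)"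
    using component_le_norm_cart[of "x - y"] by (intro sum_mono) (simp add: dist_norm)
  then show ?thesis by simp
qed

lemma partials_bounded_lipschitz:
  fixes u :: "real ^ 'n \<Rightarrow> real"
  assumes u: "\<And>j x. ((\<lambda>s. u (x + s *\<^sub>R axis j 1)) has_real_derivative u' j x) (at 0)"
    and B: "\<And>j x. \<bar>u' j x\<bar> \<le> B"
  shows "(real CARD('n) * B)-lipschitz_on UNIV u"
proof (rule lipschitz_onI)
  fix x y :: "real ^ 'n"
  have B0: "0 \<le> B" using B[of undefined undefined] by simp
  have "\<bar>u x - u y - (\<Sum>j\<in>UNIV. 0 * (x $ j - y $ j))\<bar> \<le> B * (\<Sum>j\<in>UNIV. \<bar>x $ j - y $ j\<bar>)"
    by (rule coordinate_mvt[OF u, of UNIV "\<lambda>_. UNIV"]) (use B in auto)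
  also have "\<dots> \<le> B * (real CARD('n) * dist x y)" by (intro mult_left_mono l1_le_dist B0)
  finally show "dist (u x) (u y) \<le> real CARD('n) * B * dist x y" by (simp add: dist_real_def mult_ac)
  show "0 \<le> real CARD('n) * B" using B0 by simp
qed

text \<open>The prefactor \<delta> cancels the 1 / \<delta> of differentiation, so derivatives keep
  the lattice bound whatever the mesh. After one differentiation the spline is at least piecewise
  linear in each direction, hence Lipschitz.\<close>

lemma c11_spl:
  fixes u :: "int ^ 'n \<Rightarrow> real"
  assumes u: "fsupp u" and \<delta>: "0 < \<delta>" and D: "\<And>k. D k \<in> {1, 2}" and B: "\<And>j z. \<bar>fdiff j u z\<bar> \<le> B"
  shows "c11 (\<lambda>x. \<delta> * spl \<delta> D u x) (\<lambda>j. spl \<delta> (D(j := D j - 1)) (fdiff j u))"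
    and "\<bar>spl \<delta> (D(j := D j - 1)) (fdiff j u) x\<bar> \<le> B"
proof -
  have D2: "D k \<le> 2" "(D(j := D j - 1)) k \<le> 2" "D j = Suc (D j - 1)" for j k
    using D[of k] D[of j] by auto
  show bound: "\<bar>spl \<delta> (D(j := D j - 1)) (fdiff j u) x\<bar> \<le> B" for j x
    by (rule spl_bound[OF D2(2) B])
  show "c11 (\<lambda>x. \<delta> * spl \<delta> D u x) (\<lambda>j. spl \<delta> (D(j := D j - 1)) (fdiff j u))"
    unfolding c11_def
  proof (intro conjI allI)
    fix j x
    show "((\<lambda>s. \<delta> * spl \<delta> D u (x + s *\<^sub>R axis j 1)) has_real_derivative spl \<delta> (D(j := D j - 1)) (fdiff j u) x) (at 0)"
      using DERIV_cmult[OF spl_partial[where x = x, OF D2(1) u \<delta> D2(3)], of \<delta>] \<delta> by simp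
    show "\<exists>L. L-lipschitz_on UNIV (spl \<delta> (D(j := D j - 1)) (fdiff j u))"
      by (rule spl_lipschitz[OF D2(2) fsupp_fdiff[OF u] \<delta>])
    show "\<exists>B. \<forall>x. \<bar>spl \<delta> (D(j := D j - 1)) (fdiff j u) x\<bar> \<le> B" using bound by blast
  qed
qed

subsection \<open>Vector fields adapted to a singular measure\<close>

definition grid_cell :: "real \<Rightarrow> int ^ 'n \<Rightarrow> (real ^ 'n) set" where
  "grid_cell \<delta> z = {x. cell_of \<delta> x = z}"

lemma grid_cell_eq:
  assumes "0 < \<delta>"
  shows "grid_cell \<delta> z = {x. \<forall>k. x $ k \<in> {\<delta> * real_of_int (z $ k)..<\<delta> * (real_of_int (z $ k) + 1)}}"
proof -
  have "\<lfloor>t / \<delta>\<rfloor> = q \<longleftrightarrow> t \<in> {\<delta> * real_of_int q..<\<delta> * (real_of_int q + 1)}" for t q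
    using assms by (simp add: floor_eq_iff field_simps)
  then show ?thesis by (simp add: grid_cell_def cell_of_def vec_eq_iff)
qed

lemma borel_grid_cell [measurable]:
  assumes "0 < \<delta>"
  shows "grid_cell \<delta> z \<in> sets borel"
proof -
  have "grid_cell \<delta> z = (\<Inter>k. {x. \<delta> * real_of_int (z $ k) \<le> x $ k} \<inter> {x. x $ k < \<delta> * (real_of_int (z $ k) + 1)})"
    unfolding grid_cell_eq[OF assms] by auto
  moreover have "closed {x :: real ^ 'a. \<delta> * real_of_int (z $ k) \<le> x $ k}" for k
    by (intro closed_Collect_le continuous_intros)
  moreover have "open {x :: real ^ 'a. x $ k < \<delta> * (real_of_int (z $ k) + 1)}" for k
    by (intro open_Collect_less continuous_intros)
  ultimately show ?thesis by (auto intro!: sets.finite_INT sets.Int borel_closed borel_open)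
qed

lemma grid_cell_dist:
  assumes "0 < \<delta>" "x \<in> grid_cell \<delta> z" "y \<in> grid_cell \<delta> z"
  shows "dist x (y :: real ^ 'n) \<le> real CARD('n) * \<delta>"
proof -
  have "\<bar>(x - y) $ i\<bar> \<le> \<delta>" for i
  proof -
    have "x $ i \<in> {\<delta> * real_of_int (z $ i)..<\<delta> * (real_of_int (z $ i) + 1)}"
      "y $ i \<in> {\<delta> * real_of_int (z $ i)..<\<delta> * (real_of_int (z $ i) + 1)}"
      using assms by (simp_all add: grid_cell_eq)
    then show ?thesis by (auto simp: abs_le_iff algebra_simps)
  qed
  then have "norm (x - y) \<le> (\<Sum>i\<in>(UNIV :: 'n set). \<delta>)" by (intro order_trans[OF norm_le_l1_cart sum_mono])
  then show ?thesis by (simp add: dist_norm)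
qed

lemma finite_cells_of_bounded:
  assumes "0 < \<delta>" "bounded P"
  shows "finite (cell_of \<delta> ` P)"
proof -
  obtain B where B: "\<And>x. x \<in> P \<Longrightarrow> norm x \<le> B" using assms(2) by (auto simp: bounded_iff)
  have "cell_of \<delta> ` P \<subseteq> {z. \<forall>k. z $ k \<in> {\<lfloor>- B / \<delta>\<rfloor>..\<lfloor>B / \<delta>\<rfloor>}}"
  proof clarify
    fix x k assume "x \<in> P"
    then have "\<bar>x $ k\<bar> \<le> B" using B component_le_norm_cart[of x k] by (meson order_trans)
    then have "- B \<le> x $ k" "x $ k \<le> B" by linarith+
    then have "- B / \<delta> \<le> x $ k / \<delta>" "x $ k / \<delta> \<le> B / \<delta>"
      using assms(1) by (metis divide_right_mono less_imp_le)+
    then show "cell_of \<delta> x $ k \<in> {\<lfloor>- B / \<delta>\<rfloor>..\<lfloor>B / \<delta>\<rfloor>}" by (auto simp: cell_of_def intro!: floor_mono)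
  qed
  then show ?thesis by (rule finite_subset) (rule card_vec_product(2), simp)
qed

lemma volume_of_cells:
  fixes U :: "(real ^ 'n) set"
  assumes \<delta>: "0 < \<delta>" and S: "finite S" "\<And>z. z \<in> S \<Longrightarrow> grid_cell \<delta> z \<subseteq> U" and U: "U \<in> sets borel" "emeasure lborel U \<le> ennreal e" "0 \<le> e"
  shows "real (card S) * \<delta> ^ CARD('n) \<le> e"
proof -
  define b where "b z = box (\<chi> k. \<delta> * real_of_int (z $ k)) (\<chi> k. \<delta> * (real_of_int (z $ k) + 1))" for z :: "int ^ 'n"
  have b_cell: "b z \<subseteq> grid_cell \<delta> z" for z
    unfolding b_def grid_cell_eq[OF \<delta>] by (auto simp: mem_box_cart less_imp_le)
  have "measure lborel (b z) = \<delta> ^ CARD('n)" for z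
  proof -
    let ?l = "\<chi> k. \<delta> * real_of_int (z $ k)" and ?u = "\<chi> k. \<delta> * (real_of_int (z $ k) + 1)"
    have "cbox ?l ?u \<noteq> {}" using \<delta> by (simp add: interval_ne_empty_cart)
    then have "measure lborel (cbox ?l ?u) = (\<Prod>k\<in>UNIV. ?u $ k - ?l $ k)" by (rule content_cbox_cart)
    then show ?thesis
      unfolding b_def measure_def emeasure_lborel_box_eq emeasure_lborel_cbox_eq by (simp add: algebra_simps)
  qed
  then have vol: "emeasure lborel (b z) = ennreal (\<delta> ^ CARD('n))" for z
    unfolding b_def by (metis emeasure_eq_ennreal_measure emeasure_lborel_box_finite less_irrefl infinity_ennreal_def)
  have disj: "disjoint_family_on b S"
    unfolding disjoint_family_on_def
  proof (intro ballI impI)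
    fix y z :: "int ^ 'n" assume "y \<noteq> z"
    then have "grid_cell \<delta> y \<inter> grid_cell \<delta> z = {}" by (auto simp: grid_cell_def)
    then show "b y \<inter> b z = {}" using b_cell[of y] b_cell[of z] by blast
  qed
  have "ennreal (real (card S) * \<delta> ^ CARD('n)) = (\<Sum>z\<in>S. emeasure lborel (b z))"
    using \<delta> by (simp add: vol ennreal_mult ennreal_of_nat_eq_real_of_nat)
  also have "\<dots> = emeasure lborel (\<Union>z\<in>S. b z)"
  proof (rule sum_emeasure[OF _ disj S(1)])
    show "b ` S \<subseteq> sets lborel" by (auto simp: b_def)
  qed
  also have "\<dots> \<le> emeasure lborel U" using S b_cell U by (intro emeasure_mono) fastforce+
  also have "\<dots> \<le> ennreal e" by fact
  finally show ?thesis using U by (simp add: ennreal_le_iff)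
qed

lemma blk_0: "blk 0 z = {z}" by (auto simp: blk_def vec_eq_iff)

text \<open>The last inequality is tuned to its use: the divergence is at least 1/2 on
  \<open>G\<close> and at least -nC elsewhere, so its integral is at least \<mu>(UNIV)/2 - (nC +
  1/2) \<mu>(-G), hence at least a quarter of the mass. \<open>C\<close> does not depend on
  \<open>r\<close>.\<close>

lemma singular_field_exists:
  obtains C :: real where "0 \<le> C"
    "\<And>(\<mu> :: (real ^ 'n) measure) P r. finite_measure \<mu> \<Longrightarrow> sets \<mu> = sets borel \<Longrightarrow> P \<in> sets borel \<Longrightarrow> bounded P \<Longrightarrow>
      emeasure lborel P = 0 \<Longrightarrow> measure \<mu> (- P) = 0 \<Longrightarrow> 0 < r \<Longrightarrow>
      \<exists>W W' G. (\<forall>i. c11 (W i) (W' i)) \<and> (\<forall>i j x. \<bar>W' i j x\<bar> \<le> C) \<and> (\<forall>i x. \<bar>W i x\<bar> \<le> C * r) \<and>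
        G \<in> sets borel \<and> (\<forall>x\<in>G. 1 / 2 \<le> (\<Sum>i\<in>UNIV. W' i i x)) \<and>
        (real CARD('n) * C + 1 / 2) * measure \<mu> (- G) \<le> 1 / 4 * measure \<mu> UNIV"
proof -
  obtain C0 where C0: "1 \<le> C0" and lattice: "\<And>A. 1 \<le> A \<Longrightarrow> \<exists>\<kappa>>0. \<forall>(a :: int ^ 'n \<Rightarrow> real) L p0.
      fsupp a \<longrightarrow> (\<forall>z. 0 \<le> a z) \<longrightarrow> 0 < L \<longrightarrow> Sum_any a \<le> \<kappa> * L * (2 ^ p0) ^ CARD('n) \<longrightarrow>
      (\<exists>\<Gamma> v. finite \<Gamma> \<and> sum a ({z. \<exists>p\<le>p0. heavy a L p z} - \<Gamma>) \<le> C0 / A\<^sup>2 * Sum_any a \<and>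
        (\<forall>i. fsupp (v i)) \<and> (\<forall>i j z. \<bar>fdiff j (v i) z\<bar> \<le> C0 * A) \<and> (\<forall>i z. \<bar>v i z\<bar> \<le> C0 * A * 2 ^ p0) \<and>
        (\<forall>z\<in>\<Gamma>. \<forall>y\<in>lbox 2 z. 1 / 2 \<le> (\<Sum>i\<in>UNIV. fdiff i (v i) y)))"
    by (rule lattice_field_exists) blast
  define n where "n = real CARD('n)"
  have n: "1 \<le> n" by (simp add: n_def Suc_leI)
  \<comment> \<open>The lost fraction \<eta> is C0 / A^2 and the derivative bound is C0 * A, so the
    loss in the divergence is at most 4 * n * C0^2 / A, which this choice makes equal to
    1/4.\<close>
  define A where "A = 16 * n * C0\<^sup>2"
  have C02: "1 \<le> C0\<^sup>2" using C0 by simp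
  have "1 * 1 \<le> n * C0\<^sup>2" using n C02 by (intro mult_mono) auto
  then have A: "1 \<le> A" by (simp add: A_def)
  define C where "C = C0 * A"
  have C: "0 \<le> C" using C0 A by (simp add: C_def)
  define \<eta> where "\<eta> = C0 / A\<^sup>2"
  have \<eta>: "0 < \<eta>" using C0 A by (simp add: \<eta>_def)
  have const: "(n * C + 1 / 2) * (2 * \<eta>) \<le> 1 / 4"
  proof -
    have "1 * 1 \<le> n * C0" using n C0 by (intro mult_mono) auto
    then have "1 * 1 \<le> (n * C0) * A" using A by (intro mult_mono) auto
    moreover have "n * C = n * C0 * A" by (simp add: C_def)
    ultimately have "n * C + 1 / 2 \<le> 2 * (n * C0 * A)" by linarith
    then have "(n * C + 1 / 2) * (2 * \<eta>) \<le> 2 * (n * C0 * A) * (2 * \<eta>)" using \<eta> by (intro mult_right_mono) auto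
    also have "\<dots> = 4 * n * C0\<^sup>2 / A" using A by (simp add: \<eta>_def power2_eq_square field_simps)
    also have "\<dots> = 1 / 4" using C0 n by (simp add: A_def)
    finally show ?thesis .
  qed
  obtain \<kappa> where \<kappa>: "0 < \<kappa>" and field: "\<And>(a :: int ^ 'n \<Rightarrow> real) L p0.
      fsupp a \<Longrightarrow> (\<forall>z. 0 \<le> a z) \<Longrightarrow> 0 < L \<Longrightarrow> Sum_any a \<le> \<kappa> * L * (2 ^ p0) ^ CARD('n) \<Longrightarrow>
      (\<exists>\<Gamma> v. finite \<Gamma> \<and> sum a ({z. \<exists>p\<le>p0. heavy a L p z} - \<Gamma>) \<le> C0 / A\<^sup>2 * Sum_any a \<and>
        (\<forall>i. fsupp (v i)) \<and> (\<forall>i j z. \<bar>fdiff j (v i) z\<bar> \<le> C0 * A) \<and> (\<forall>i z. \<bar>v i z\<bar> \<le> C0 * A * 2 ^ p0) \<and>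
        (\<forall>z\<in>\<Gamma>. \<forall>y\<in>lbox 2 z. 1 / 2 \<le> (\<Sum>i\<in>UNIV. fdiff i (v i) y)))"
    using lattice[OF A] by blast
  show thesis
  proof (rule that[OF C])
    fix \<mu> :: "(real ^ 'n) measure" and P :: "(real ^ 'n) set" and r :: real
    assume "finite_measure \<mu>" and sets: "sets \<mu> = sets borel" and P: "P \<in> sets borel" "bounded P" "emeasure lborel P = 0"
      and \<mu>P: "measure \<mu> (- P) = 0" and r: "0 < r"
    interpret finite_measure \<mu> by fact
    note [measurable_cong] = sets
    have space: "space \<mu> = UNIV" using sets_eq_imp_space_eq[OF sets] by simp
    define M where "M = measure \<mu> UNIV"
    show "\<exists>W W' G. (\<forall>i. c11 (W i) (W' i)) \<and> (\<forall>i j x. \<bar>W' i j x\<bar> \<le> C) \<and> (\<forall>i x. \<bar>W i x\<bar> \<le> C * r) \<and>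
        G \<in> sets borel \<and> (\<forall>x\<in>G. 1 / 2 \<le> (\<Sum>i\<in>UNIV. W' i i x)) \<and>
        (real CARD('n) * C + 1 / 2) * measure \<mu> (- G) \<le> 1 / 4 * measure \<mu> UNIV"
    proof (cases "M = 0")
      case True
      have "c11 (\<lambda>_ :: real ^ 'n. 0) (\<lambda>_ _. 0)"
        unfolding c11_def by (auto intro!: exI[of _ 0] lipschitz_onI)
      then show ?thesis using True C r
        by (intro exI[of _ "\<lambda>_ _. 0"] exI[of _ "\<lambda>_ _ _. 0"] exI[of _ "{}"]) (auto simp: M_def)
    next
      case False
      then have M: "0 < M" by (simp add: M_def measure_nonneg less_le)
      obtain k0 where k0: "(1 / 2 :: real) ^ k0 < r" using real_arch_pow_inv[OF r, of "1 / 2"] by auto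
      \<comment> \<open>The density threshold in Euclidean units. It makes \<kappa> * \<Lambda>
        times the volume of a cube of side 2^-k0 equal to the total mass, which is exactly what the
        lattice lemma asks for.\<close>
      define \<Lambda> where "\<Lambda> = M / (\<kappa> * ((1 / 2) ^ k0) ^ CARD('n))"
      have \<Lambda>: "0 < \<Lambda>" using M \<kappa> by (simp add: \<Lambda>_def)
      \<comment> \<open>Here singularity enters: \<open>P\<close> is null and has neighbourhoods of
        arbitrarily small volume. Cells inside \<open>U\<close> with density at most \<Lambda> then
        carry mass at most \<Lambda> * e = \<eta> * M / 2.\<close>
      define e where "e = \<eta> * M / (2 * \<Lambda>)"
      have e: "0 < e" using \<eta> M \<Lambda> by (simp add: e_def)
      obtain U where U: "open U" "P \<subseteq> U" "emeasure lborel (U - P) < e"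
        using outer_regular_lborel[OF P(1) e] by blast
      have Ub: "U \<in> sets borel" using U by simp
      have U_vol: "emeasure lborel U \<le> ennreal e"
      proof -
        have "emeasure lborel U = emeasure lborel ((U - P) \<union> P)" using U(2) by (simp add: Un_absorb2)
        also have "\<dots> \<le> emeasure lborel (U - P) + emeasure lborel P"
          using P Ub by (intro emeasure_subadditive) auto
        finally show ?thesis using U(3) P(3) by (simp add: order_trans less_imp_le)
      qed
      \<comment> \<open>Points at a definite distance from the complement of \<open>U\<close>; for a
        fine mesh their whole cells lie in \<open>U\<close>. They exhaust \<open>U\<close>, so some
        \<open>F m\<close> carries almost all the mass.\<close>
      define F where "F m = {x. \<forall>y\<in>- U. 1 / real (Suc m) \<le> dist x y}" for m
      have F_borel: "F m \<in> sets \<mu>" for m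
      proof -
        have "F m = (\<Inter>y\<in>- U. {x. 1 / real (Suc m) \<le> dist x y})" by (auto simp: F_def)
        then have "closed (F m)" by (auto intro!: closed_INT closed_Collect_le continuous_intros)
        then show ?thesis by (simp add: sets)
      qed
      have "incseq F"
      proof (rule incseq_SucI)
        show "F m \<le> F (Suc m)" for m unfolding F_def
          using frac_le[of 1 1 "real (Suc m)" "real (Suc (Suc m))"] by (force intro: order_trans)
      qed
      moreover have UF: "(\<Union>m. F m) = U"
      proof (intro equalityI subsetI)
        fix x assume "x \<in> (\<Union>m. F m)"
        then show "x \<in> U" by (force simp: F_def)
      next
        fix x assume "x \<in> U"
        then obtain d where d: "0 < d" "ball x d \<subseteq> U" using U(1) by (meson openE)
        obtain m where "1 / real (Suc m) < d" using d(1) by (metis inverse_eq_divide reals_Archimedean)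
        moreover have "d \<le> dist x y" if "y \<in> - U" for y using d(2) that by (force simp: not_less[symmetric])
        ultimately show "x \<in> (\<Union>m. F m)" unfolding F_def by (auto intro!: exI[of _ m] intro: less_imp_le order_trans[of _ d])
      qed
      ultimately have "(\<lambda>m. measure \<mu> (F m)) \<longlonglongrightarrow> measure \<mu> U"
        using finite_Lim_measure_incseq[of F] F_borel by auto
      moreover have "measure \<mu> U = M"
      proof -
        have "measure \<mu> UNIV \<le> measure \<mu> U + measure \<mu> (- P)"
          using U(2) Ub P by (intro order_trans[OF finite_measure_mono measure_Un_le]) (auto simp: sets)
        moreover have "measure \<mu> U \<le> measure \<mu> UNIV" using Ub by (intro finite_measure_mono) (auto simp: sets)
        ultimately show ?thesis using \<mu>P by (simp add: M_def)
      qed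
      ultimately have "\<forall>\<^sub>F m in sequentially. M - \<eta> * M / 2 < measure \<mu> (F m)"
        using \<eta> M by (intro order_tendstoD(1)) auto
      then obtain m where m: "M - \<eta> * M / 2 < measure \<mu> (F m)" by (auto simp: eventually_sequentially)
      have \<mu>F: "measure \<mu> (- F m) \<le> \<eta> * M / 2"
        using m finite_measure_compl[OF F_borel[of m]] by (simp add: space M_def Compl_eq_Diff_UNIV)
      \<comment> \<open>\<open>k1\<close> has two roles: it refines the mesh until cells meeting
        \<open>F m\<close> stay in \<open>U\<close>, and it is the number of dyadic levels between
        the mesh 2^-(k0 + k1) and the macroscopic scale 2^-k0, which lies below
        \<open>r\<close>.\<close>
      obtain k1 where k1: "(1 / 2 :: real) ^ k1 < 1 / (n * real (Suc m))"
        using real_arch_pow_inv[of "1 / (n * real (Suc m))" "1 / 2"] n by auto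
      define K where "K = k0 + k1"
      define \<delta> where "\<delta> = (1 / 2 :: real) ^ K"
      have \<delta>: "0 < \<delta>" by (simp add: \<delta>_def)
      have cell_U: "grid_cell \<delta> (cell_of \<delta> x) \<subseteq> U" if "x \<in> F m" for x
      proof
        fix y assume "y \<in> grid_cell \<delta> (cell_of \<delta> x)"
        then have "dist x y \<le> n * \<delta>" using grid_cell_dist[OF \<delta>, of x "cell_of \<delta> x" y] by (simp add: n_def grid_cell_def)
        also have "n * \<delta> \<le> n * (1 / 2) ^ k1"
          unfolding \<delta>_def K_def power_add using n by (intro mult_left_mono mult_left_le_one_le) (auto simp: power_le_one)
        also have "\<dots> < n * (1 / (n * real (Suc m)))" using k1 n by (intro mult_strict_left_mono) auto
        also have "\<dots> = 1 / real (Suc m)" using n by simp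
        finally show "y \<in> U" using that by (force simp: F_def)
      qed
      define a where "a z = measure \<mu> (grid_cell \<delta> z)" for z
      define L where "L = \<Lambda> * \<delta> ^ CARD('n)"
      define Z where "Z = cell_of \<delta> ` P"
      have Z: "finite Z" unfolding Z_def by (rule finite_cells_of_bounded[OF \<delta> P(2)])
      have cell_sets [simp]: "grid_cell \<delta> z \<in> sets \<mu>" for z using borel_grid_cell[OF \<delta>] by (simp add: sets)
      have aZ: "a z = 0" if "z \<notin> Z" for z
      proof -
        have "grid_cell \<delta> z \<subseteq> - P" using that by (auto simp: Z_def grid_cell_def)
        then have "a z \<le> measure \<mu> (- P)" unfolding a_def using P by (intro finite_measure_mono) (auto simp: sets)
        then show ?thesis using \<mu>P by (simp add: a_def antisym)
      qed
      have disj: "disjoint_family_on (grid_cell \<delta>) S" for S :: "(int ^ 'n) set"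
        by (auto simp: disjoint_family_on_def grid_cell_def)
      have sum_a: "sum a S = measure \<mu> (\<Union>z\<in>S. grid_cell \<delta> z)" if "finite S" for S
        unfolding a_def using that disj by (intro finite_measure_finite_Union[symmetric]) auto
      have fa: "fsupp a" by (rule finite_subset[OF _ Z]) (use aZ in auto)
      have Sa: "Sum_any a \<le> M"
      proof -
        have "Sum_any a = sum a Z" by (rule Sum_any.expand_superset[OF Z]) (use aZ in auto)
        also have "\<dots> \<le> M" unfolding sum_a[OF Z] M_def by (intro finite_measure_mono) (auto simp: sets)
        finally show ?thesis .
      qed
      have L: "0 < L" using \<Lambda> \<delta> by (simp add: L_def)
      have "Sum_any a \<le> \<kappa> * L * (2 ^ k1) ^ CARD('n)"
      proof -
        have "\<delta> * 2 ^ k1 = (1 / 2) ^ k0" by (simp add: \<delta>_def K_def power_add power_one_over)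
        then have "\<kappa> * L * (2 ^ k1) ^ CARD('n) = \<kappa> * \<Lambda> * ((1 / 2) ^ k0) ^ CARD('n)"
          by (simp add: L_def power_mult_distrib[symmetric] mult.assoc)
        also have "\<dots> = M" using \<kappa> by (simp add: \<Lambda>_def)
        finally show ?thesis using Sa by simp
      qed
      moreover have a0: "\<forall>z. 0 \<le> a z" by (simp add: a_def measure_nonneg)
      ultimately obtain \<Gamma> v where \<Gamma>: "finite \<Gamma>"
        "sum a ({z. \<exists>p\<le>k1. heavy a L p z} - \<Gamma>) \<le> \<eta> * Sum_any a"
        and v: "\<And>i. fsupp (v i)" "\<And>i j z. \<bar>fdiff j (v i) z\<bar> \<le> C" "\<And>i z. \<bar>v i z\<bar> \<le> C * 2 ^ k1"
        and div: "\<And>z y. z \<in> \<Gamma> \<Longrightarrow> y \<in> lbox 2 z \<Longrightarrow> 1 / 2 \<le> (\<Sum>i\<in>UNIV. fdiff i (v i) y)"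
        using field[OF fa a0 L, of k1] unfolding \<eta>_def C_def by blast
      define G where "G = (\<Union>z\<in>\<Gamma>. grid_cell \<delta> z)"
      \<comment> \<open>One degree more in direction i for the i-th component: after differentiation
        in its own direction every component has the same degrees, so the divergence is the spline
        of the lattice divergence.\<close>
      define D where "D i = (\<lambda>k::'n. if k = i then 2 else 1 :: nat)" for i
      define W where "W i x = \<delta> * spl \<delta> (D i) (v i) x" for i x
      define W' where "W' i j = spl \<delta> ((D i)(j := D i j - 1)) (fdiff j (v i))" for i j
      have D12: "D i k \<in> {1, 2}" "D i k \<le> 2" for i k by (auto simp: D_def)
      have \<mu>G: "measure \<mu> (- G) \<le> 2 * \<eta> * M"
      proof -
        let ?H = "{z. \<exists>p\<le>k1. heavy a L p z}"
        define Zl where "Zl = Z - ?H"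
        have "- G \<subseteq> - P \<union> (\<Union>z\<in>Z - \<Gamma>. grid_cell \<delta> z)" by (auto simp: G_def Z_def grid_cell_def)
        then have "measure \<mu> (- G) \<le> measure \<mu> (- P \<union> (\<Union>z\<in>Z - \<Gamma>. grid_cell \<delta> z))"
          using P Z by (intro finite_measure_mono) (auto simp: sets intro!: sets.finite_UN borel_grid_cell \<delta>)
        also have "\<dots> \<le> measure \<mu> (- P) + measure \<mu> (\<Union>z\<in>Z - \<Gamma>. grid_cell \<delta> z)"
          using P Z by (intro measure_Un_le) (auto simp: sets intro!: sets.finite_UN borel_grid_cell \<delta>)
        also have "\<dots> = sum a (Z - \<Gamma>)" using \<mu>P sum_a[of "Z - \<Gamma>"] Z by simp
        also have "\<dots> \<le> sum a ((?H - \<Gamma>) \<union> Zl)"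
        proof (rule sum_mono2)
          have "?H = {z. \<exists>p\<le>k1. L * (2 ^ p) ^ CARD('n) < sum a (blk p z)}" by (simp add: heavy_def)
          then have "finite ?H" using finite_heavy[OF fa, of "\<lambda>p. L * (2 ^ p) ^ CARD('n)" k1] L by simp
          then show "finite ((?H - \<Gamma>) \<union> Zl)" using Z by (simp add: Zl_def)
        qed (auto simp: Zl_def a_def measure_nonneg)
        also have "\<dots> \<le> sum a (?H - \<Gamma>) + sum a Zl"
        proof -
          have "?H = {z. \<exists>p\<le>k1. L * (2 ^ p) ^ CARD('n) < sum a (blk p z)}" by (simp add: heavy_def)
          then have "finite ?H" using finite_heavy[OF fa, of "\<lambda>p. L * (2 ^ p) ^ CARD('n)" k1] L by simp
          then show ?thesis using Z by (subst sum.union_disjoint) (auto simp: Zl_def)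
        qed
        also have "sum a (?H - \<Gamma>) + sum a Zl \<le> \<eta> * M + \<eta> * M"
        proof (rule add_mono)
          have "\<eta> * Sum_any a \<le> \<eta> * M" using Sa \<eta> by simp
          then show "sum a (?H - \<Gamma>) \<le> \<eta> * M" using \<Gamma>(2) by linarith
          \<comment> \<open>Cells that are not heavy: those inside \<open>U\<close> have little mass
            since their density and total volume are bounded, and the others contain no point of
            \<open>F m\<close>.\<close>
          define Z1 where "Z1 = {z\<in>Zl. grid_cell \<delta> z \<subseteq> U}"
          define Z2 where "Z2 = Zl - Z1"
          have fin: "finite Z1" "finite Z2" "Zl = Z1 \<union> Z2" "Z1 \<inter> Z2 = {}" using Z by (auto simp: Z1_def Z2_def Zl_def)
          have "sum a Z1 \<le> (\<Sum>z\<in>Z1. L)"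
          proof (rule sum_mono)
            fix z assume "z \<in> Z1"
            then have "\<not> heavy a L 0 z" by (auto simp: Z1_def Zl_def)
            then show "a z \<le> L" by (simp add: heavy_def blk_0)
          qed
          also have "\<dots> = \<Lambda> * (real (card Z1) * \<delta> ^ CARD('n))" by (simp add: L_def)
          also have "\<dots> \<le> \<Lambda> * e"
            using \<Lambda> e by (intro mult_left_mono volume_of_cells[OF \<delta> fin(1) _ Ub U_vol]) (auto simp: Z1_def)
          also have "\<dots> = \<eta> * M / 2" using \<Lambda> by (simp add: e_def)
          finally have 1: "sum a Z1 \<le> \<eta> * M / 2" .
          have "sum a Z2 = measure \<mu> (\<Union>z\<in>Z2. grid_cell \<delta> z)" by (rule sum_a[OF fin(2)])
          also have "\<dots> \<le> measure \<mu> (- F m)"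
          proof (rule finite_measure_mono)
            show "(\<Union>z\<in>Z2. grid_cell \<delta> z) \<subseteq> - F m"
              using cell_U by (auto simp: Z1_def Z2_def grid_cell_def)
            show "- F m \<in> sets \<mu>" using F_borel[of m] by (simp add: sets)
          qed
          finally have 2: "sum a Z2 \<le> \<eta> * M / 2" using \<mu>F by linarith
          show "sum a Zl \<le> \<eta> * M" using 1 2 fin by (simp add: sum.union_disjoint)
        qed
        finally show ?thesis by (simp add: mult_ac)
      qed
      show ?thesis
      proof (intro exI[of _ W] exI[of _ W'] exI[of _ G] conjI allI ballI)
        show "c11 (W i) (W' i)" for i
          using c11_spl(1)[where D = "D i", OF v(1) \<delta> D12(1) v(2)] by (simp add: W_def[abs_def] W'_def[abs_def])
        show "\<bar>W' i j x\<bar> \<le> C" for i j x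
          unfolding W'_def by (rule c11_spl(2)[OF v(1) \<delta> D12(1) v(2)])
        show "\<bar>W i x\<bar> \<le> C * r" for i x
        proof -
          have "\<bar>W i x\<bar> = \<delta> * \<bar>spl \<delta> (D i) (v i) x\<bar>" using \<delta> by (simp add: W_def abs_mult)
          also have "\<dots> \<le> \<delta> * (C * 2 ^ k1)" using \<delta> by (intro mult_left_mono spl_bound D12 v(3)) auto
          also have "\<dots> = C * (1 / 2) ^ k0" by (simp add: \<delta>_def K_def power_add power_one_over)
          also have "\<dots> \<le> C * r" using k0 C by (intro mult_left_mono) auto
          finally show ?thesis .
        qed
        show "G \<in> sets borel" unfolding G_def using \<Gamma>(1) by (intro sets.finite_UN borel_grid_cell \<delta>)
        have "(n * C + 1 / 2) * measure \<mu> (- G) \<le> (n * C + 1 / 2) * (2 * \<eta> * M)"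
          using \<mu>G n C by (intro mult_left_mono) auto
        also have "\<dots> = (n * C + 1 / 2) * (2 * \<eta>) * M" by simp
        also have "\<dots> \<le> 1 / 4 * M" using const M by (intro mult_right_mono) auto
        finally show "(real CARD('n) * C + 1 / 2) * measure \<mu> (- G) \<le> 1 / 4 * measure \<mu> UNIV"
          by (simp add: n_def M_def)
        fix x assume "x \<in> G"
        then obtain z where z: "z \<in> \<Gamma>" "cell_of \<delta> x = z" by (auto simp: G_def grid_cell_def)
        have D1: "(D i)(i := D i i - 1) = (\<lambda>_. 1)" for i by (auto simp: D_def)
        have "1 / 2 \<le> spl \<delta> (\<lambda>_. 1) (\<lambda>y. \<Sum>i\<in>UNIV. fdiff i (v i) y) x"
          by (rule spl_lower_bound) (use div z in auto)
        also have "\<dots> = (\<Sum>i\<in>UNIV. W' i i x)"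
          unfolding W'_def D1 by (subst (1 2) spl_window) (auto simp: sum_distrib_right intro: sum.swap)
        finally show "1 / 2 \<le> (\<Sum>i\<in>UNIV. W' i i x)" .
      qed
    qed
  qed
qed

subsection \<open>Lipschitz constants\<close>

lemma Lip_lipschitz:
  assumes "lipschitz f"
  shows "(Lip f)-lipschitz_on UNIV f"
proof -
  let ?S = "{L. L-lipschitz_on UNIV f}"
  have ne: "?S \<noteq> {}" using assms by (auto simp: lipschitz_def)
  show ?thesis
  proof (rule lipschitz_onI)
    show "0 \<le> Lip f" unfolding Lip_def
      by (rule cInf_greatest[OF ne]) (auto simp: lipschitz_on_def)
    fix x y
    show "dist (f x) (f y) \<le> Lip f * dist x y"
    proof (cases "x = y")
      case False
      have "dist (f x) (f y) / dist x y \<le> Lip f" unfolding Lip_def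
      proof (rule cInf_greatest[OF ne])
        fix L assume "L \<in> ?S"
        then show "dist (f x) (f y) / dist x y \<le> L"
          using False by (simp add: lipschitz_on_def pos_divide_le_eq)
      qed
      then show ?thesis using False by (simp add: pos_divide_le_eq)
    qed simp
  qed
qed

lemma Lip_le:
  assumes "L-lipschitz_on UNIV f"
  shows "Lip f \<le> L"
  unfolding Lip_def using assms
  by (intro cInf_lower) (auto intro!: bdd_belowI[of _ 0] simp: lipschitz_on_def)

lemma Lip_nonneg: "lipschitz f \<Longrightarrow> 0 \<le> Lip f"
  using Lip_lipschitz by (auto simp: lipschitz_on_def)

lemma Lip_bound: "lipschitz f \<Longrightarrow> \<bar>f x - f y\<bar> \<le> Lip f * dist x y"
  using Lip_lipschitz[of f] by (auto simp: lipschitz_on_def dist_real_def)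

lemma lipschitzI:
  assumes "\<And>x y. \<bar>f x - f y\<bar> \<le> L * dist x y" "0 \<le> L"
  shows "lipschitz f" "Lip f \<le> L"
  using assms Lip_le[of L f] by (auto simp: lipschitz_def lipschitz_on_def dist_real_def)

lemma lipschitz_const [simp]: "lipschitz (\<lambda>_. c)"
  by (rule lipschitzI(1)[of _ 0]) auto

lemma lipschitz_lin: "lipschitz f \<Longrightarrow> lipschitz g \<Longrightarrow> lipschitz (\<lambda>x. a * f x + b * g x)"
proof -
  assume f: "lipschitz f" and g: "lipschitz g"
  have "\<bar>(a * f x + b * g x) - (a * f y + b * g y)\<bar> \<le> (\<bar>a\<bar> * Lip f + \<bar>b\<bar> * Lip g) * dist x y" for x y
  proof -
    have "(a * f x + b * g x) - (a * f y + b * g y) = a * (f x - f y) + b * (g x - g y)" by (simp add: algebra_simps)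
    also have "\<bar>\<dots>\<bar> \<le> \<bar>a\<bar> * \<bar>f x - f y\<bar> + \<bar>b\<bar> * \<bar>g x - g y\<bar>" by (metis abs_mult abs_triangle_ineq)
    also have "\<dots> \<le> \<bar>a\<bar> * (Lip f * dist x y) + \<bar>b\<bar> * (Lip g * dist x y)"
      by (intro add_mono mult_left_mono Lip_bound f g) auto
    finally show ?thesis by (simp add: algebra_simps)
  qed
  moreover have "0 \<le> \<bar>a\<bar> * Lip f + \<bar>b\<bar> * Lip g" by (simp add: Lip_nonneg f g)
  ultimately show ?thesis by (rule lipschitzI(1))
qed

lemma lipschitz_continuous: "lipschitz f \<Longrightarrow> continuous_on UNIV f"
  using lipschitz_on_continuous_on by (auto simp: lipschitz_def)

section \<open>Bounded Lipschitz functions, bounded Borel functions and finite Borel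
  measures\<close>

definition blip :: "('a::metric_space \<Rightarrow> real) \<Rightarrow> bool" where
  "blip f \<longleftrightarrow> bounded (range f) \<and> lipschitz f"

definition bborel :: "('a::metric_space \<Rightarrow> real) \<Rightarrow> bool" where
  "bborel g \<longleftrightarrow> g \<in> borel_measurable borel \<and> (\<exists>B. \<forall>x. \<bar>g x\<bar> \<le> B)"

lemma blip_bborel: "blip f \<Longrightarrow> bborel f"
  unfolding blip_def bborel_def
  by (auto intro!: borel_measurable_continuous_onI lipschitz_continuous simp: bounded_iff)

lemma blip_mult:
  assumes "blip f" "blip g"
  shows "blip (\<lambda>x. f x * g x)"
proof -
  obtain A where A: "\<And>x. \<bar>f x\<bar> \<le> A" using assms(1) by (auto simp: blip_def bounded_iff)
  obtain B where B: "\<And>x. \<bar>g x\<bar> \<le> B" using assms(2) by (auto simp: blip_def bounded_iff)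
  have AB: "0 \<le> A" "0 \<le> B" using A[of undefined] B[of undefined] by linarith+
  have L: "lipschitz f" "lipschitz g" using assms by (auto simp: blip_def)
  have "\<bar>f x * g x - f y * g y\<bar> \<le> (A * Lip g + B * Lip f) * dist x y" for x y
  proof -
    have "f x * g x - f y * g y = f x * (g x - g y) + g y * (f x - f y)" by (simp add: algebra_simps)
    also have "\<bar>\<dots>\<bar> \<le> \<bar>f x\<bar> * \<bar>g x - g y\<bar> + \<bar>g y\<bar> * \<bar>f x - f y\<bar>" by (metis abs_mult abs_triangle_ineq)
    also have "\<dots> \<le> A * (Lip g * dist x y) + B * (Lip f * dist x y)"
      by (intro add_mono mult_mono A B Lip_bound L AB) auto
    finally show ?thesis by (simp add: algebra_simps)
  qed
  then have "lipschitz (\<lambda>x. f x * g x)" by (rule lipschitzI(1)) (simp add: Lip_nonneg AB L)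
  moreover have "\<bar>f x * g x\<bar> \<le> A * B" for x unfolding abs_mult using A B AB by (intro mult_mono) auto
  then have "bounded (range (\<lambda>x. f x * g x))" by (auto simp: bounded_iff)
  ultimately show ?thesis by (simp add: blip_def)
qed

lemma bborel_lin: "bborel f \<Longrightarrow> bborel g \<Longrightarrow> bborel (\<lambda>x. a * f x + b * g x)"
  unfolding bborel_def
proof (elim conjE exE, intro conjI)
  fix A B assume "\<forall>x. \<bar>f x\<bar> \<le> A" "\<forall>x. \<bar>g x\<bar> \<le> B"
  then have "\<bar>a * f x + b * g x\<bar> \<le> \<bar>a\<bar> * A + \<bar>b\<bar> * B" for x
    by (intro order_trans[OF abs_triangle_ineq] add_mono) (auto simp: abs_mult intro!: mult_left_mono)
  then show "\<exists>B. \<forall>x. \<bar>a * f x + b * g x\<bar> \<le> B" by blast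
qed auto

lemma blip_lin: "blip f \<Longrightarrow> blip g \<Longrightarrow> blip (\<lambda>x. a * f x + b * g x)"
proof -
  assume f: "blip f" and g: "blip g"
  have "bborel (\<lambda>x. a * f x + b * g x)" by (intro bborel_lin blip_bborel f g)
  then have "bounded (range (\<lambda>x. a * f x + b * g x))" by (auto simp: bborel_def bounded_iff)
  then show ?thesis using f g by (simp add: blip_def lipschitz_lin)
qed

lemma bborel_mult: "bborel f \<Longrightarrow> bborel g \<Longrightarrow> bborel (\<lambda>x. f x * g x)"
  unfolding bborel_def
proof (elim conjE exE, intro conjI)
  fix A B assume A: "\<forall>x. \<bar>f x\<bar> \<le> A" and B: "\<forall>x. \<bar>g x\<bar> \<le> B"
  have "0 \<le> A" using A[THEN spec, of undefined] by linarith
  then have "\<bar>f x * g x\<bar> \<le> A * B" for x unfolding abs_mult using A B by (intro mult_mono) auto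
  then show "\<exists>B. \<forall>x. \<bar>f x * g x\<bar> \<le> B" by blast
qed auto

lemma bborel_indicator [simp]: "A \<in> sets borel \<Longrightarrow> bborel (indicator A)"
  unfolding bborel_def by (auto intro!: exI[of _ 1] simp: indicator_def)

lemma bborel_const [simp]: "bborel (\<lambda>_. c)" unfolding bborel_def by auto

lemma bborel_add: "bborel f \<Longrightarrow> bborel g \<Longrightarrow> bborel (\<lambda>x. f x + g x)"
  using bborel_lin[of f g 1 1] by simp
lemma bborel_diff: "bborel f \<Longrightarrow> bborel g \<Longrightarrow> bborel (\<lambda>x. f x - g x)"
  using bborel_lin[of f g 1 "-1"] by simp
lemma bborel_scale: "bborel f \<Longrightarrow> bborel (\<lambda>x. a * f x)"
  using bborel_lin[of f f a 0] by simp
lemma bborel_abs: "bborel f \<Longrightarrow> bborel (\<lambda>x. \<bar>f x\<bar>)"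
  unfolding bborel_def by auto

lemma bborel_sum: "(\<And>i. i \<in> I \<Longrightarrow> bborel (f i)) \<Longrightarrow> bborel (\<lambda>x. \<Sum>i\<in>I. f i x)"
  by (induction I rule: infinite_finite_induct) (auto intro: bborel_add)

definition borel_finite :: "'a::metric_space measure \<Rightarrow> bool" where
  "borel_finite \<nu> \<longleftrightarrow> sets \<nu> = sets borel \<and> finite_measure \<nu>"

lemma bborel_integrable: "borel_finite \<nu> \<Longrightarrow> bborel g \<Longrightarrow> integrable \<nu> g"
proof -
  assume "borel_finite \<nu>" "bborel g"
  then interpret finite_measure \<nu> by (simp add: borel_finite_def)
  obtain B where B: "\<And>x. \<bar>g x\<bar> \<le> B" using \<open>bborel g\<close> by (auto simp: bborel_def)
  have "g \<in> borel_measurable \<nu>"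
    using \<open>borel_finite \<nu>\<close> \<open>bborel g\<close> by (simp add: borel_finite_def bborel_def cong: measurable_cong_sets)
  then show ?thesis by (rule integrable_const_bound[rotated, where B = B]) (use B in auto)
qed

lemma space_borel_finite: "borel_finite \<nu> \<Longrightarrow> space \<nu> = UNIV"
  using sets_eq_imp_space_eq[of \<nu> borel] by (simp add: borel_finite_def)

lemma integral_indicator_borel: "borel_finite \<nu> \<Longrightarrow> (\<integral>x. indicator A x \<partial>\<nu>) = measure \<nu> A"
  by (simp add: space_borel_finite)

section \<open>Approximation by simple functions and by bounded Lipschitz functions\<close>

lemma floor_simple_approx:
  fixes g :: "'a::metric_space \<Rightarrow> real"
  assumes g: "bborel g" and \<epsilon>: "0 < \<epsilon>"
  obtains N :: int where
    "\<And>x. \<bar>g x - (\<Sum>k\<in>{- N..N}. (\<epsilon> * real_of_int k) * indicator {x. \<lfloor>g x / \<epsilon>\<rfloor> = k} x)\<bar> \<le> \<epsilon>"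
    "\<And>k. {x. \<lfloor>g x / \<epsilon>\<rfloor> = k} \<in> sets borel"
proof -
  obtain B where B: "\<And>x. \<bar>g x\<bar> \<le> B" using g by (auto simp: bborel_def)
  define N where "N = \<lceil>B / \<epsilon>\<rceil> + 1"
  have g_meas [measurable]: "g \<in> borel_measurable borel" using g by (simp add: bborel_def)
  show thesis
  proof
    fix k have "{x \<in> space borel. \<lfloor>g x / \<epsilon>\<rfloor> = k} \<in> sets borel" by measurable
    then show "{x. \<lfloor>g x / \<epsilon>\<rfloor> = k} \<in> sets borel" by simp
  next
    fix x
    have "- B \<le> g x" "g x \<le> B" using B[of x] by linarith+
    then have "- B / \<epsilon> \<le> g x / \<epsilon>" "g x / \<epsilon> \<le> B / \<epsilon>"
      using \<epsilon> by (metis divide_right_mono less_imp_le)+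
    then have "- (B / \<epsilon>) \<le> g x / \<epsilon>" "g x / \<epsilon> \<le> B / \<epsilon>" by simp_all
    then have kN: "\<lfloor>g x / \<epsilon>\<rfloor> \<in> {- N..N}" unfolding N_def by (simp add: le_floor_iff floor_le_iff) linarith
    have "(\<Sum>k\<in>{- N..N}. (\<epsilon> * real_of_int k) * indicator {x. \<lfloor>g x / \<epsilon>\<rfloor> = k} x)
        = (\<Sum>k\<in>{- N..N}. if k = \<lfloor>g x / \<epsilon>\<rfloor> then \<epsilon> * real_of_int k else 0)"
      by (intro sum.cong) (auto simp: indicator_def)
    also have "\<dots> = \<epsilon> * real_of_int \<lfloor>g x / \<epsilon>\<rfloor>" using kN by (simp add: sum.delta)
    moreover have "\<bar>g x - \<epsilon> * real_of_int \<lfloor>g x / \<epsilon>\<rfloor>\<bar> \<le> \<epsilon>"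
    proof -
      have "\<bar>g x / \<epsilon> - real_of_int \<lfloor>g x / \<epsilon>\<rfloor>\<bar> \<le> 1" by linarith
      then have "\<epsilon> * \<bar>g x / \<epsilon> - real_of_int \<lfloor>g x / \<epsilon>\<rfloor>\<bar> \<le> \<epsilon> * 1" using \<epsilon> by (intro mult_left_mono) auto
      moreover have "\<epsilon> * \<bar>g x / \<epsilon> - real_of_int \<lfloor>g x / \<epsilon>\<rfloor>\<bar> = \<bar>\<epsilon> * (g x / \<epsilon> - real_of_int \<lfloor>g x / \<epsilon>\<rfloor>)\<bar>"
        using \<epsilon> by (simp only: abs_mult abs_of_pos)
      moreover have "\<epsilon> * (g x / \<epsilon> - real_of_int \<lfloor>g x / \<epsilon>\<rfloor>) = g x - \<epsilon> * real_of_int \<lfloor>g x / \<epsilon>\<rfloor>"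
        using \<epsilon> by (simp add: right_diff_distrib)
      ultimately show ?thesis by simp
    qed
    ultimately show "\<bar>g x - (\<Sum>k\<in>{- N..N}. (\<epsilon> * real_of_int k) * indicator {x. \<lfloor>g x / \<epsilon>\<rfloor> = k} x)\<bar> \<le> \<epsilon>" by simp
  qed
qed

text \<open>The whole space is treated separately because \<open>infdist\<close> to the empty set is
  0 by convention.\<close>

definition cutoff_open :: "'a::metric_space set \<Rightarrow> nat \<Rightarrow> 'a \<Rightarrow> real" where
  "cutoff_open U j x = (if U = UNIV then 1 else min 1 (real j * infdist x (- U)))"

lemma cutoff_open:
  assumes "open U"
  shows "blip (cutoff_open U j)" "0 \<le> cutoff_open U j x" "cutoff_open U j x \<le> 1"
    "x \<notin> U \<Longrightarrow> cutoff_open U j x = 0" "(\<lambda>j. cutoff_open U j x) \<longlonglongrightarrow> indicator U x"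
proof -
  show b: "0 \<le> cutoff_open U j x" "cutoff_open U j x \<le> 1" for j x
    by (auto simp: cutoff_open_def infdist_nonneg)
  show z: "x \<notin> U \<Longrightarrow> cutoff_open U j x = 0" for x j by (auto simp: cutoff_open_def)
  have "\<bar>cutoff_open U j x - cutoff_open U j y\<bar> \<le> real j * dist x y" for x y
  proof (cases "U = UNIV")
    case False
    have "\<bar>real j * infdist x (- U) - real j * infdist y (- U)\<bar> \<le> real j * dist x y"
      by (simp flip: right_diff_distrib add: abs_mult infdist_triangle_abs mult_left_mono)
    then show ?thesis using False unfolding cutoff_open_def by (auto simp: min_def)
  qed (simp add: cutoff_open_def)
  then have "lipschitz (cutoff_open U j)" by (rule lipschitzI(1)) simp
  moreover have "bounded (range (cutoff_open U j))" using b by (auto simp: bounded_iff intro!: exI[of _ 1])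
  ultimately show "blip (cutoff_open U j)" by (simp add: blip_def)
  show "(\<lambda>j. cutoff_open U j x) \<longlonglongrightarrow> indicator U x"
  proof (cases "x \<in> U")
    case True
    have "\<forall>\<^sub>F j in sequentially. cutoff_open U j x = 1"
    proof (cases "U = UNIV")
      case False
      have "closed (- U)" "- U \<noteq> {}" using assms False by auto
      then have "0 < infdist x (- U)" using True
        by (metis Compl_iff in_closed_iff_infdist_zero infdist_nonneg less_eq_real_def)
      then obtain j0 :: nat where j0: "1 < real j0 * infdist x (- U)" by (metis ex_less_of_nat_mult)
      show ?thesis
      proof (rule eventually_sequentiallyI[of j0])
        fix j assume "j0 \<le> j"
        then have "real j0 * infdist x (- U) \<le> real j * infdist x (- U)" by (intro mult_right_mono) (auto simp: infdist_nonneg)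
        then show "cutoff_open U j x = 1" using j0 False by (simp add: cutoff_open_def)
      qed
    qed (simp add: cutoff_open_def)
    then show ?thesis using True by (simp add: tendsto_eventually)
  next
    case False then show ?thesis by (simp add: z)
  qed
qed

text \<open>Outer regularity, available on Polish spaces, replaces the Borel set by an open one; the
  cutoffs of an open set converge to its indicator by dominated convergence.\<close>

lemma blip_dense_indicator:
  fixes A :: "'a::polish_space set"
  assumes \<nu>: "borel_finite \<nu>" and A: "A \<in> sets borel" and \<epsilon>: "0 < \<epsilon>"
  shows "\<exists>f. blip f \<and> (\<integral>x. \<bar>indicator A x - f x\<bar> \<partial>\<nu>) < \<epsilon>"
proof -
  interpret finite_measure \<nu> using \<nu> by (simp add: borel_finite_def)
  have s: "sets \<nu> = sets borel" using \<nu> by (simp add: borel_finite_def)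
  have "emeasure \<nu> A = (INF U\<in>{U. A \<subseteq> U \<and> open U}. emeasure \<nu> U)"
    by (rule outer_regular[OF s _ A]) (simp add: emeasure_eq_measure)
  moreover have "emeasure \<nu> A < emeasure \<nu> A + ennreal (\<epsilon> / 2)"
    using \<epsilon> emeasure_finite[of A] by (simp add: ennreal_add_left_cancel_less less_top)
  ultimately obtain U where U: "A \<subseteq> U" "open U" "emeasure \<nu> U < emeasure \<nu> A + ennreal (\<epsilon> / 2)"
    by (metis (no_types, lifting) INF_less_iff mem_Collect_eq)
  have UB: "U \<in> sets borel" using U by simp
  have "measure \<nu> U - measure \<nu> A < \<epsilon> / 2"
  proof -
    have "ennreal (measure \<nu> U) < ennreal (measure \<nu> A + \<epsilon> / 2)"
      using U(3) \<epsilon> by (simp add: emeasure_eq_measure ennreal_plus)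
    then show ?thesis by (simp add: ennreal_less_iff)
  qed
  then have UA: "(\<integral>x. \<bar>indicator A x - indicator U x :: real\<bar> \<partial>\<nu>) < \<epsilon> / 2"
  proof -
    have "\<bar>indicator A x - indicator U x :: real\<bar> = indicator (U - A) x" for x using U(1) by (auto simp: indicator_def)
    moreover have "measure \<nu> (U - A) = measure \<nu> U - measure \<nu> A" using U(1) UB A by (intro finite_measure_Diff) (auto simp: s)
    ultimately show ?thesis using \<open>measure \<nu> U - measure \<nu> A < \<epsilon> / 2\<close> \<nu> by (simp add: space_borel_finite)
  qed
  note bb = bborel_indicator[OF UB] bborel_indicator[OF A] blip_bborel[OF cutoff_open(1)[OF U(2)]]
  have int: "integrable \<nu> (\<lambda>x. \<bar>indicator U x - cutoff_open U j x\<bar>)" for j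
    by (intro bborel_integrable[OF \<nu>] bborel_abs bborel_diff bb)
  have "(\<lambda>j. \<integral>x. \<bar>indicator U x - cutoff_open U j x\<bar> \<partial>\<nu>) \<longlonglongrightarrow> (\<integral>x. 0 \<partial>\<nu>)"
  proof (rule integral_dominated_convergence[where w = "\<lambda>_. 1"])
    show "AE x in \<nu>. (\<lambda>j. \<bar>indicator U x - cutoff_open U j x\<bar>) \<longlonglongrightarrow> 0"
    proof (intro AE_I2)
      fix x
      have "(\<lambda>j. \<bar>indicator U x - cutoff_open U j x\<bar>) \<longlonglongrightarrow> \<bar>indicator U x - indicator U x\<bar>"
        by (intro tendsto_intros cutoff_open U)
      then show "(\<lambda>j. \<bar>indicator U x - cutoff_open U j x\<bar>) \<longlonglongrightarrow> 0" by simp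
    qed
    show "AE x in \<nu>. norm \<bar>indicator U x - cutoff_open U j x\<bar> \<le> 1" for j
    proof (intro AE_I2)
      fix x
      show "norm \<bar>indicator U x - cutoff_open U j x\<bar> \<le> 1"
        using cutoff_open(2,3)[OF U(2), of j x] by (cases "x \<in> U") auto
    qed
  qed (use int in auto)
  then have "\<forall>\<^sub>F j in sequentially. (\<integral>x. \<bar>indicator U x - cutoff_open U j x\<bar> \<partial>\<nu>) < \<epsilon> / 2"
    using \<epsilon> by (intro order_tendstoD(2)) auto
  then obtain j where j: "(\<integral>x. \<bar>indicator U x - cutoff_open U j x\<bar> \<partial>\<nu>) < \<epsilon> / 2"
    by (auto simp: eventually_sequentially)
  have intA: "integrable \<nu> (\<lambda>x. \<bar>indicator A x - indicator U x :: real\<bar>)"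
    "integrable \<nu> (\<lambda>x. \<bar>indicator A x - cutoff_open U j x\<bar>)"
    by (intro bborel_integrable[OF \<nu>] bborel_abs bborel_diff bb)+
  have "(\<integral>x. \<bar>indicator A x - cutoff_open U j x\<bar> \<partial>\<nu>)
     \<le> (\<integral>x. \<bar>indicator A x - indicator U x :: real\<bar> + \<bar>indicator U x - cutoff_open U j x\<bar> \<partial>\<nu>)"
    by (intro integral_mono intA Bochner_Integration.integrable_add int) auto
  also have "\<dots> < \<epsilon>" using UA j by (subst Bochner_Integration.integral_add[OF intA(1) int]) linarith
  finally show ?thesis using cutoff_open(1)[OF U(2)] by blast
qed

lemma blip_dense:
  fixes g :: "'a::polish_space \<Rightarrow> real"
  assumes \<nu>: "borel_finite \<nu>" and g: "bborel g" and \<epsilon>: "0 < \<epsilon>"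
  shows "\<exists>f. blip f \<and> (\<integral>x. \<bar>g x - f x\<bar> \<partial>\<nu>) < \<epsilon>"
proof -
  interpret finite_measure \<nu> using \<nu> by (simp add: borel_finite_def)
  define V where "V = measure \<nu> UNIV + 1"
  have V: "1 \<le> V" by (simp add: V_def measure_nonneg)
  define \<delta> where "\<delta> = \<epsilon> / (2 * V)"
  have \<delta>: "0 < \<delta>" using \<epsilon> V by (simp add: \<delta>_def)
  obtain N :: int where N: "\<And>x. \<bar>g x - (\<Sum>k\<in>{- N..N}. (\<delta> * real_of_int k) * indicator {x. \<lfloor>g x / \<delta>\<rfloor> = k} x)\<bar> \<le> \<delta>"
    "\<And>k. {x. \<lfloor>g x / \<delta>\<rfloor> = k} \<in> sets borel"
    using floor_simple_approx[OF g \<delta>] by blast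
  let ?A = "\<lambda>k. {x. \<lfloor>g x / \<delta>\<rfloor> = k}"
  define K where "K = (\<Sum>k\<in>{- N..N}. \<bar>\<delta> * real_of_int k\<bar>) + 1"
  have K: "1 \<le> K" by (simp add: K_def sum_nonneg)
  have "\<exists>f. blip f \<and> (\<integral>x. \<bar>indicator (?A k) x - f x\<bar> \<partial>\<nu>) < \<epsilon> / (4 * K)" for k
    by (rule blip_dense_indicator[OF \<nu> N(2)]) (use \<epsilon> K in simp)
  then obtain F where F: "\<And>k. blip (F k)" "\<And>k. (\<integral>x. \<bar>indicator (?A k) x - F k x\<bar> \<partial>\<nu>) < \<epsilon> / (4 * K)" by metis
  define s where "s x = (\<Sum>k\<in>{- N..N}. (\<delta> * real_of_int k) * indicator (?A k) x)" for x
  define f where "f x = (\<Sum>k\<in>{- N..N}. (\<delta> * real_of_int k) * F k x)" for x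
  have "blip (\<lambda>x. \<Sum>k\<in>I. (\<delta> * real_of_int k) * F k x)" if "finite I" for I
    using that
  proof (induction I)
    case empty then show ?case by (simp add: blip_def)
  next
    case (insert i I)
    then show ?case using blip_lin[OF F(1)[of i] insert.IH, of "\<delta> * real_of_int i" 1] by simp
  qed
  then have f: "blip f" by (simp add: f_def[abs_def])
  have s: "bborel s" unfolding s_def[abs_def] by (intro bborel_sum bborel_scale bborel_indicator N)
  have int: "bborel p \<Longrightarrow> bborel q \<Longrightarrow> integrable \<nu> (\<lambda>x. \<bar>p x - q x\<bar>)" for p q
    by (intro bborel_integrable[OF \<nu>] bborel_abs bborel_diff)
  have "(\<integral>x. \<bar>g x - s x\<bar> \<partial>\<nu>) \<le> (\<integral>x. \<delta> \<partial>\<nu>)"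
    by (intro integral_mono int g s) (use N(1) in \<open>auto simp: s_def\<close>)
  also have "\<dots> \<le> \<delta> * V" using \<delta> space_borel_finite[OF \<nu>] by (simp add: V_def)
  also have "\<dots> = \<epsilon> / 2" using V by (simp add: \<delta>_def)
  finally have 1: "(\<integral>x. \<bar>g x - s x\<bar> \<partial>\<nu>) \<le> \<epsilon> / 2" .
  have i2: "integrable \<nu> (\<lambda>x. \<bar>indicator (?A k) x - F k x\<bar>)" for k by (intro int bborel_indicator N blip_bborel F)
  have "(\<integral>x. \<bar>s x - f x\<bar> \<partial>\<nu>) \<le> (\<integral>x. (\<Sum>k\<in>{- N..N}. \<bar>\<delta> * real_of_int k\<bar> * \<bar>indicator (?A k) x - F k x\<bar>) \<partial>\<nu>)"
  proof (rule integral_mono[OF int[OF s blip_bborel[OF f]]])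
    show "integrable \<nu> (\<lambda>x. \<Sum>k\<in>{- N..N}. \<bar>\<delta> * real_of_int k\<bar> * \<bar>indicator (?A k) x - F k x\<bar>)"
      by (intro Bochner_Integration.integrable_sum integrable_mult_right i2)
    fix x
    have "s x - f x = (\<Sum>k\<in>{- N..N}. (\<delta> * real_of_int k) * (indicator (?A k) x - F k x))"
      by (simp add: s_def f_def sum_subtractf right_diff_distrib)
    then show "\<bar>s x - f x\<bar> \<le> (\<Sum>k\<in>{- N..N}. \<bar>\<delta> * real_of_int k\<bar> * \<bar>indicator (?A k) x - F k x\<bar>)"
      by (simp only: abs_mult[symmetric] sum_abs)
  qed
  also have "\<dots> = (\<Sum>k\<in>{- N..N}. \<bar>\<delta> * real_of_int k\<bar> * (\<integral>x. \<bar>indicator (?A k) x - F k x\<bar> \<partial>\<nu>))"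
  proof -
    have i3: "integrable \<nu> (\<lambda>x. \<bar>\<delta> * real_of_int k\<bar> * \<bar>indicator (?A k) x - F k x\<bar>)" for k
      by (intro integrable_mult_right i2)
    show ?thesis by (simp only: Bochner_Integration.integral_sum[OF i3] integral_mult_right_zero)
  qed
  also have "\<dots> \<le> (\<Sum>k\<in>{- N..N}. \<bar>\<delta> * real_of_int k\<bar> * (\<epsilon> / (4 * K)))"
    by (rule sum_mono, rule mult_left_mono, rule less_imp_le, rule F, simp)
  also have "\<dots> = (K - 1) * (\<epsilon> / (4 * K))"
  proof -
    have "(\<Sum>k\<in>{- N..N}. \<bar>\<delta> * real_of_int k\<bar>) = K - 1" by (simp add: K_def)
    then show ?thesis by (simp only: sum_distrib_right[symmetric])
  qed
  also have "\<dots> \<le> K * (\<epsilon> / (4 * K))" using \<epsilon> K by (intro mult_right_mono) auto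
  also have "\<dots> = \<epsilon> / 4" using K by simp
  finally have 2: "(\<integral>x. \<bar>s x - f x\<bar> \<partial>\<nu>) \<le> \<epsilon> / 4" .
  have "(\<integral>x. \<bar>g x - f x\<bar> \<partial>\<nu>) \<le> (\<integral>x. \<bar>g x - s x\<bar> + \<bar>s x - f x\<bar> \<partial>\<nu>)"
    by (intro integral_mono int g blip_bborel f Bochner_Integration.integrable_add s) auto
  also have "\<dots> = (\<integral>x. \<bar>g x - s x\<bar> \<partial>\<nu>) + (\<integral>x. \<bar>s x - f x\<bar> \<partial>\<nu>)"
    by (intro Bochner_Integration.integral_add int g s blip_bborel f)
  also have "\<dots> < \<epsilon>" using 1 2 \<epsilon> by simp
  finally show ?thesis using f by blast
qed

subsection \<open>Extension of functionals to bounded Borel functions\<close>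

text \<open>The choice depends on \<open>g\<close> and \<open>\<nu>\<close> only, not on the
  functional. The same approximants therefore serve all tuples of slots at once, and linear
  relations between slots survive the limit.\<close>

definition approx :: "'a::metric_space measure \<Rightarrow> ('a \<Rightarrow> real) \<Rightarrow> nat \<Rightarrow> 'a \<Rightarrow> real" where
  "approx \<nu> g j = (SOME f. blip f \<and> (\<integral>x. \<bar>g x - f x\<bar> \<partial>\<nu>) < 1 / real (Suc j))"

lemma approx:
  fixes g :: "'a::polish_space \<Rightarrow> real"
  assumes "borel_finite \<nu>" "bborel g"
  shows "blip (approx \<nu> g j)" "(\<integral>x. \<bar>g x - approx \<nu> g j x\<bar> \<partial>\<nu>) < 1 / real (Suc j)"
proof -
  have "\<exists>f. blip f \<and> (\<integral>x. \<bar>g x - f x\<bar> \<partial>\<nu>) < 1 / real (Suc j)"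
    by (rule blip_dense[OF assms]) simp
  from someI_ex[OF this] show "blip (approx \<nu> g j)" "(\<integral>x. \<bar>g x - approx \<nu> g j x\<bar> \<partial>\<nu>) < 1 / real (Suc j)"
    by (auto simp: approx_def)
qed

definition ext :: "'a::metric_space measure \<Rightarrow> (('a \<Rightarrow> real) \<Rightarrow> real) \<Rightarrow> ('a \<Rightarrow> real) \<Rightarrow> real" where
  "ext \<nu> F g = lim (\<lambda>j. F (approx \<nu> g j))"

locale l1_functional =
  fixes F :: "('a::polish_space \<Rightarrow> real) \<Rightarrow> real" and \<nu> :: "'a measure" and C :: real
  assumes \<nu>: "borel_finite \<nu>" and C: "0 \<le> C"
    and lin: "\<And>f g a b. blip f \<Longrightarrow> blip g \<Longrightarrow> F (\<lambda>x. a * f x + b * g x) = a * F f + b * F g"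
    and bound: "\<And>f. blip f \<Longrightarrow> \<bar>F f\<bar> \<le> C * (\<integral>x. \<bar>f x\<bar> \<partial>\<nu>)"
begin

lemma int_abs_diff: "bborel p \<Longrightarrow> bborel q \<Longrightarrow> integrable \<nu> (\<lambda>x. \<bar>p x - q x\<bar>)"
  by (intro bborel_integrable[OF \<nu>] bborel_abs bborel_diff)

lemma F_diff: "blip f \<Longrightarrow> blip g \<Longrightarrow> \<bar>F f - F g\<bar> \<le> C * (\<integral>x. \<bar>f x - g x\<bar> \<partial>\<nu>)"
  using lin[of f g 1 "-1"] bound[of "\<lambda>x. 1 * f x + -1 * g x"] blip_lin[of f g 1 "-1"] by simp

lemma triangle:
  assumes "bborel f" "bborel g" "bborel h"
  shows "(\<integral>x. \<bar>f x - h x\<bar> \<partial>\<nu>) \<le> (\<integral>x. \<bar>f x - g x\<bar> \<partial>\<nu>) + (\<integral>x. \<bar>g x - h x\<bar> \<partial>\<nu>)"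
proof -
  have "(\<integral>x. \<bar>f x - h x\<bar> \<partial>\<nu>) \<le> (\<integral>x. \<bar>f x - g x\<bar> + \<bar>g x - h x\<bar> \<partial>\<nu>)"
    by (intro integral_mono int_abs_diff assms Bochner_Integration.integrable_add) auto
  also have "\<dots> = (\<integral>x. \<bar>f x - g x\<bar> \<partial>\<nu>) + (\<integral>x. \<bar>g x - h x\<bar> \<partial>\<nu>)"
    by (intro Bochner_Integration.integral_add int_abs_diff assms)
  finally show ?thesis .
qed

lemma ext_lim:
  assumes g: "bborel g"
  shows "(\<lambda>j. F (approx \<nu> g j)) \<longlonglongrightarrow> ext \<nu> F g"
proof -
  let ?f = "approx \<nu> g"
  note a = approx[OF \<nu> g]
  have d: "\<bar>F (?f i) - F (?f j)\<bar> \<le> C * (1 / real (Suc i) + 1 / real (Suc j))" for i j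
  proof -
    have "\<bar>F (?f i) - F (?f j)\<bar> \<le> C * (\<integral>x. \<bar>?f i x - ?f j x\<bar> \<partial>\<nu>)" by (rule F_diff[OF a(1) a(1)])
    also have "\<dots> \<le> C * ((\<integral>x. \<bar>?f i x - g x\<bar> \<partial>\<nu>) + (\<integral>x. \<bar>g x - ?f j x\<bar> \<partial>\<nu>))"
      by (intro mult_left_mono triangle blip_bborel a g C)
    also have "\<dots> \<le> C * (1 / real (Suc i) + 1 / real (Suc j))"
      using a(2)[of i] a(2)[of j] by (intro mult_left_mono add_mono C) (auto simp: abs_minus_commute)
    finally show ?thesis .
  qed
  have "Cauchy (\<lambda>j. F (?f j))"
    unfolding Cauchy_def
  proof (intro allI impI)
    fix e :: real assume e: "0 < e"
    obtain M where M: "2 * C / e < real M" using reals_Archimedean2 by blast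
    show "\<exists>M. \<forall>m\<ge>M. \<forall>n\<ge>M. dist (F (?f m)) (F (?f n)) < e"
    proof (intro exI[of _ M] allI impI)
      fix m n assume mn: "M \<le> m" "M \<le> n"
      have "dist (F (?f m)) (F (?f n)) \<le> C * (1 / real (Suc m) + 1 / real (Suc n))"
        using d by (simp add: dist_real_def)
      also have "\<dots> \<le> C * (1 / real (Suc M) + 1 / real (Suc M))"
        using mn by (intro mult_left_mono add_mono divide_left_mono C) auto
      also have "\<dots> = 2 * C / real (Suc M)" by simp
      also have "\<dots> < e"
      proof -
        have "2 * C / e < real (Suc M)" using M by simp
        then show ?thesis using e by (simp add: field_simps)
      qed
      finally show "dist (F (?f m)) (F (?f n)) < e" .
    qed
  qed
  then show ?thesis unfolding ext_def by (simp add: Cauchy_convergent_iff convergent_LIMSEQ_iff)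
qed

lemma ext_diff:
  assumes f: "blip f" and g: "bborel g"
  shows "\<bar>F f - ext \<nu> F g\<bar> \<le> C * (\<integral>x. \<bar>f x - g x\<bar> \<partial>\<nu>)"
proof -
  note a = approx[OF \<nu> g]
  have "(\<lambda>j. \<bar>F f - F (approx \<nu> g j)\<bar>) \<longlonglongrightarrow> \<bar>F f - ext \<nu> F g\<bar>" by (intro tendsto_intros ext_lim g)
  moreover have "(\<lambda>j. C * ((\<integral>x. \<bar>f x - g x\<bar> \<partial>\<nu>) + 1 / real (Suc j))) \<longlonglongrightarrow> C * ((\<integral>x. \<bar>f x - g x\<bar> \<partial>\<nu>) + 0)"
    by (intro tendsto_intros LIMSEQ_Suc lim_1_over_n)
  moreover have "\<bar>F f - F (approx \<nu> g j)\<bar> \<le> C * ((\<integral>x. \<bar>f x - g x\<bar> \<partial>\<nu>) + 1 / real (Suc j))" for j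
  proof -
    have "\<bar>F f - F (approx \<nu> g j)\<bar> \<le> C * (\<integral>x. \<bar>f x - approx \<nu> g j x\<bar> \<partial>\<nu>)" by (rule F_diff[OF f a(1)])
    also have "\<dots> \<le> C * ((\<integral>x. \<bar>f x - g x\<bar> \<partial>\<nu>) + 1 / real (Suc j))"
      using triangle[OF blip_bborel[OF f] g blip_bborel[OF a(1)[of j]]] a(2)[of j] by (intro mult_left_mono C) linarith
    finally show ?thesis .
  qed
  ultimately show ?thesis by (intro LIMSEQ_le[of _ _ "\<lambda>j. C * ((\<integral>x. \<bar>f x - g x\<bar> \<partial>\<nu>) + 1 / real (Suc j))"]) auto
qed

text \<open>To identify a value of the extension, any approximants will do; this frees later proofs
  from the chosen sequence.\<close>

lemma ext_eqI:
  assumes "bborel g" "\<And>\<epsilon>. 0 < \<epsilon> \<Longrightarrow> \<exists>f. blip f \<and> (\<integral>x. \<bar>f x - g x\<bar> \<partial>\<nu>) \<le> \<epsilon> \<and> \<bar>F f - E\<bar> \<le> K * \<epsilon>" and K: "0 \<le> K"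
  shows "ext \<nu> F g = E"
proof -
  have "\<bar>ext \<nu> F g - E\<bar> \<le> 0 + e" if e: "0 < e" for e
  proof -
    define \<epsilon> where "\<epsilon> = e / (C + K + 1)"
    have \<epsilon>: "0 < \<epsilon>" "(C + K) * \<epsilon> \<le> e" using e C K by (simp_all add: \<epsilon>_def field_simps)
    obtain f where f: "blip f" "(\<integral>x. \<bar>f x - g x\<bar> \<partial>\<nu>) \<le> \<epsilon>" "\<bar>F f - E\<bar> \<le> K * \<epsilon>" using assms(2)[OF \<epsilon>(1)] by blast
    have "\<bar>F f - ext \<nu> F g\<bar> \<le> C * \<epsilon>"
      using ext_diff[OF f(1) assms(1)] mult_left_mono[OF f(2) C] by linarith
    then show ?thesis using f(3) \<epsilon>(2) by (simp add: distrib_right)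
  qed
  then have "\<bar>ext \<nu> F g - E\<bar> \<le> 0" by (rule field_le_epsilon)
  then show ?thesis by simp
qed

lemma ext_bound:
  assumes g: "bborel g"
  shows "\<bar>ext \<nu> F g\<bar> \<le> C * (\<integral>x. \<bar>g x\<bar> \<partial>\<nu>)"
proof -
  have z: "bborel (\<lambda>_. 0 :: real)" by simp
  note a = approx[OF \<nu> g]
  have "(\<lambda>j. \<bar>F (approx \<nu> g j)\<bar>) \<longlonglongrightarrow> \<bar>ext \<nu> F g\<bar>" by (intro tendsto_intros ext_lim g)
  moreover have "(\<lambda>j. C * ((\<integral>x. \<bar>g x\<bar> \<partial>\<nu>) + 1 / real (Suc j))) \<longlonglongrightarrow> C * ((\<integral>x. \<bar>g x\<bar> \<partial>\<nu>) + 0)"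
    by (intro tendsto_intros LIMSEQ_Suc lim_1_over_n)
  moreover have "\<bar>F (approx \<nu> g j)\<bar> \<le> C * ((\<integral>x. \<bar>g x\<bar> \<partial>\<nu>) + 1 / real (Suc j))" for j
  proof -
    have "(\<integral>x. \<bar>approx \<nu> g j x\<bar> \<partial>\<nu>) \<le> (\<integral>x. \<bar>g x\<bar> \<partial>\<nu>) + 1 / real (Suc j)"
      using triangle[OF blip_bborel[OF a(1)[of j]] g z] a(2)[of j] by (simp add: abs_minus_commute)
    then have "C * (\<integral>x. \<bar>approx \<nu> g j x\<bar> \<partial>\<nu>) \<le> C * ((\<integral>x. \<bar>g x\<bar> \<partial>\<nu>) + 1 / real (Suc j))" by (intro mult_left_mono C)
    then show ?thesis using bound[OF a(1)[of j]] by linarith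
  qed
  ultimately show ?thesis by (intro LIMSEQ_le[of _ _ "\<lambda>j. C * ((\<integral>x. \<bar>g x\<bar> \<partial>\<nu>) + 1 / real (Suc j))"]) auto
qed

lemma ext_lin:
  assumes g: "bborel g" and h: "bborel h"
  shows "ext \<nu> F (\<lambda>x. a * g x + b * h x) = a * ext \<nu> F g + b * ext \<nu> F h"
proof (rule ext_eqI)
  show "bborel (\<lambda>x. a * g x + b * h x)" by (rule bborel_lin[OF g h])
  show "0 \<le> C" by (rule C)
  fix \<epsilon> :: real assume \<epsilon>: "0 < \<epsilon>"
  define d where "d = \<epsilon> / (\<bar>a\<bar> + \<bar>b\<bar> + 1)"
  have d0: "0 < d" using \<epsilon> by (simp add: d_def add_nonneg_pos)
  have "(\<bar>a\<bar> + \<bar>b\<bar> + 1) * d = \<epsilon>" by (simp add: d_def add_nonneg_pos less_imp_neq[symmetric])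
  then have d: "0 < d" "\<bar>a\<bar> * d + \<bar>b\<bar> * d \<le> \<epsilon>" using d0 by (simp_all add: distrib_right)
  obtain p where p: "blip p" "(\<integral>x. \<bar>g x - p x\<bar> \<partial>\<nu>) < d" using blip_dense[OF \<nu> g d(1)] by blast
  obtain q where q: "blip q" "(\<integral>x. \<bar>h x - q x\<bar> \<partial>\<nu>) < d" using blip_dense[OF \<nu> h d(1)] by blast
  note pb = blip_bborel[OF p(1)] and qb = blip_bborel[OF q(1)]
  have pq: "(\<integral>x. \<bar>p x - g x\<bar> \<partial>\<nu>) \<le> d" "(\<integral>x. \<bar>q x - h x\<bar> \<partial>\<nu>) \<le> d" using p q by (simp_all add: abs_minus_commute)
  show "\<exists>f. blip f \<and> (\<integral>x. \<bar>f x - (a * g x + b * h x)\<bar> \<partial>\<nu>) \<le> \<epsilon> \<and> \<bar>F f - (a * ext \<nu> F g + b * ext \<nu> F h)\<bar> \<le> C * \<epsilon>"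
  proof (intro exI[of _ "\<lambda>x. a * p x + b * q x"] conjI)
    show "blip (\<lambda>x. a * p x + b * q x)" by (rule blip_lin[OF p(1) q(1)])
    have "(\<integral>x. \<bar>a * p x + b * q x - (a * g x + b * h x)\<bar> \<partial>\<nu>) \<le> (\<integral>x. \<bar>a\<bar> * \<bar>p x - g x\<bar> + \<bar>b\<bar> * \<bar>q x - h x\<bar> \<partial>\<nu>)"
    proof (intro integral_mono int_abs_diff bborel_lin pb qb g h Bochner_Integration.integrable_add integrable_mult_right)
      fix x
      have "a * p x + b * q x - (a * g x + b * h x) = a * (p x - g x) + b * (q x - h x)" by (simp add: algebra_simps)
      then show "\<bar>a * p x + b * q x - (a * g x + b * h x)\<bar> \<le> \<bar>a\<bar> * \<bar>p x - g x\<bar> + \<bar>b\<bar> * \<bar>q x - h x\<bar>"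
        by (metis abs_mult abs_triangle_ineq)
    qed
    also have "\<dots> = \<bar>a\<bar> * (\<integral>x. \<bar>p x - g x\<bar> \<partial>\<nu>) + \<bar>b\<bar> * (\<integral>x. \<bar>q x - h x\<bar> \<partial>\<nu>)"
      by (subst Bochner_Integration.integral_add) (auto intro!: int_abs_diff integrable_mult_right pb qb g h)
    also have "\<dots> \<le> \<bar>a\<bar> * d + \<bar>b\<bar> * d" using pq by (intro add_mono mult_left_mono) auto
    finally show "(\<integral>x. \<bar>a * p x + b * q x - (a * g x + b * h x)\<bar> \<partial>\<nu>) \<le> \<epsilon>" using d(2) by linarith
    have 1: "\<bar>F p - ext \<nu> F g\<bar> \<le> C * d" "\<bar>F q - ext \<nu> F h\<bar> \<le> C * d"
      using ext_diff[OF p(1) g] ext_diff[OF q(1) h] mult_left_mono[OF pq(1) C] mult_left_mono[OF pq(2) C] by linarith+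
    have "F (\<lambda>x. a * p x + b * q x) - (a * ext \<nu> F g + b * ext \<nu> F h) = a * (F p - ext \<nu> F g) + b * (F q - ext \<nu> F h)"
      unfolding lin[OF p(1) q(1)] by (simp add: algebra_simps)
    also have "\<bar>\<dots>\<bar> \<le> \<bar>a\<bar> * \<bar>F p - ext \<nu> F g\<bar> + \<bar>b\<bar> * \<bar>F q - ext \<nu> F h\<bar>" by (metis abs_mult abs_triangle_ineq)
    also have "\<dots> \<le> \<bar>a\<bar> * (C * d) + \<bar>b\<bar> * (C * d)" using 1 by (intro add_mono mult_left_mono) auto
    also have "\<dots> = C * (\<bar>a\<bar> * d + \<bar>b\<bar> * d)" by (simp add: algebra_simps)
    also have "\<dots> \<le> C * \<epsilon>" using d(2) C by (intro mult_left_mono)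
    finally show "\<bar>F (\<lambda>x. a * p x + b * q x) - (a * ext \<nu> F g + b * ext \<nu> F h)\<bar> \<le> C * \<epsilon>" .
  qed
qed

lemma ext_blip: "blip f \<Longrightarrow> ext \<nu> F f = F f"
  using ext_diff[of f f] blip_bborel[of f] by simp

end

subsection \<open>Bounded functionals on bounded Borel functions\<close>

text \<open>In other words, integration against a density bounded by \<open>C\<close> with respect
  to \<open>\<nu>\<close>. The functional itself is kept, and its sign is handled through values on
  indicators.\<close>

locale borel_functional =
  fixes F :: "('a::metric_space \<Rightarrow> real) \<Rightarrow> real" and \<nu> :: "'a measure" and C :: real
  assumes \<nu>: "borel_finite \<nu>" and C: "0 \<le> C"
    and lin: "\<And>f g a b. bborel f \<Longrightarrow> bborel g \<Longrightarrow> F (\<lambda>x. a * f x + b * g x) = a * F f + b * F g"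
    and bound: "\<And>f. bborel f \<Longrightarrow> \<bar>F f\<bar> \<le> C * (\<integral>x. \<bar>f x\<bar> \<partial>\<nu>)"
begin

sublocale finite_measure \<nu> using \<nu> by (simp add: borel_finite_def)

lemma sets_\<nu>: "sets \<nu> = sets borel" using \<nu> by (simp add: borel_finite_def)

lemma F_add: "bborel f \<Longrightarrow> bborel g \<Longrightarrow> F (\<lambda>x. f x + g x) = F f + F g" using lin[of f g 1 1] by simp
lemma F_diff: "bborel f \<Longrightarrow> bborel g \<Longrightarrow> F (\<lambda>x. f x - g x) = F f - F g" using lin[of f g 1 "-1"] by simp
lemma F_scale: "bborel f \<Longrightarrow> F (\<lambda>x. a * f x) = a * F f" using lin[of f f a 0] by simp
lemma F_0 [simp]: "F (\<lambda>_. 0) = 0" using F_scale[of "\<lambda>_. 0" 0] by simp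

lemma F_sum: "(\<And>i. i \<in> I \<Longrightarrow> bborel (g i)) \<Longrightarrow> F (\<lambda>x. \<Sum>i\<in>I. g i x) = (\<Sum>i\<in>I. F (g i))"
proof (induction I rule: infinite_finite_induct)
  case (insert i I)
  then show ?case using F_add[of "g i" "\<lambda>x. \<Sum>i\<in>I. g i x"] bborel_sum[of I g] by simp
qed auto

lemma F_empty [simp]: "F (indicator {}) = 0"
proof -
  have "(indicator {} :: 'a \<Rightarrow> real) = (\<lambda>_. 0)" by auto
  then show ?thesis by simp
qed

lemma F_simple:
  assumes "\<And>k. A k \<in> sets borel"
  shows "F (\<lambda>x. \<Sum>k\<in>I. c k * indicator (A k) x) = (\<Sum>k\<in>I. c k * F (indicator (A k)))"
proof -
  have "F (\<lambda>x. \<Sum>k\<in>I. c k * indicator (A k) x) = (\<Sum>k\<in>I. F (\<lambda>x. c k * indicator (A k) x))"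
    by (rule F_sum) (intro bborel_scale bborel_indicator assms)
  also have "\<dots> = (\<Sum>k\<in>I. c k * F (indicator (A k)))"
    by (intro sum.cong refl F_scale bborel_indicator assms)
  finally show ?thesis .
qed

lemma F_indicator_bound: "B \<in> sets borel \<Longrightarrow> \<bar>F (indicator B)\<bar> \<le> C * measure \<nu> B"
  using bound[of "indicator B"] by (simp add: space_borel_finite[OF \<nu>])

text \<open>Round \<open>g\<close> down to multiples of \<epsilon>. Level sets of positive value lie
  in \<open>P\<close>, where indicators have nonnegative value, the level 0 contributes nothing, and
  the rounding error is controlled by the L^1 bound.\<close>

lemma F_nonneg:
  assumes pos: "\<And>B. B \<in> sets borel \<Longrightarrow> B \<subseteq> P \<Longrightarrow> 0 \<le> F (indicator B)"
    and g: "bborel g" "\<And>x. 0 \<le> g x" "\<And>x. x \<notin> P \<Longrightarrow> g x = 0"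
  shows "0 \<le> F g"
proof -
  have "0 \<le> F g + e" if e: "0 < e" for e
  proof -
    define \<epsilon> where "\<epsilon> = e / (C * measure \<nu> UNIV + 1)"
    have CV: "0 \<le> C * measure \<nu> UNIV" using C by (simp add: measure_nonneg)
    have \<epsilon>: "0 < \<epsilon>" using e CV by (simp add: \<epsilon>_def add_nonneg_pos)
    have "(C * measure \<nu> UNIV + 1) * \<epsilon> = e" using CV by (simp add: \<epsilon>_def add_nonneg_pos less_imp_neq[symmetric])
    then have Ce: "C * measure \<nu> UNIV * \<epsilon> \<le> e" using \<epsilon> by (simp add: distrib_right)
    let ?A = "\<lambda>k. {x. \<lfloor>g x / \<epsilon>\<rfloor> = k}"
    obtain N :: int where N: "\<And>x. \<bar>g x - (\<Sum>k\<in>{- N..N}. (\<epsilon> * real_of_int k) * indicator (?A k) x)\<bar> \<le> \<epsilon>"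
      "\<And>k. ?A k \<in> sets borel"
      using floor_simple_approx[OF g(1) \<epsilon>] by blast
    define s where "s x = (\<Sum>k\<in>{- N..N}. (\<epsilon> * real_of_int k) * indicator (?A k) x)" for x
    have s: "bborel s" unfolding s_def[abs_def] by (intro bborel_sum bborel_scale bborel_indicator N)
    have "F s = (\<Sum>k\<in>{- N..N}. (\<epsilon> * real_of_int k) * F (indicator (?A k)))"
      unfolding s_def[abs_def] by (rule F_simple[OF N(2)])
    also have "\<dots> \<ge> 0"
    proof (rule sum_nonneg)
      fix k assume "k \<in> {- N..N}"
      consider "k < 0" | "k = 0" | "0 < k" by linarith
      then show "0 \<le> \<epsilon> * real_of_int k * F (indicator (?A k))"
      proof cases
        case 1
        have "?A k = {}"
        proof -
          have "0 \<le> \<lfloor>g x / \<epsilon>\<rfloor>" for x using g(2)[of x] \<epsilon> by simp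
          then show ?thesis using 1 by (metis (mono_tags, lifting) Collect_empty_eq linorder_not_le)
        qed
        then show ?thesis by (simp only: F_empty mult_zero_right order_refl)
      next
        case 3
        have "?A k \<subseteq> P" using 3 g(3) by force
        then have "0 \<le> F (indicator (?A k))" by (intro pos N)
        then show ?thesis using 3 \<epsilon> by simp
      qed simp
    qed
    finally have "0 \<le> F s" .
    moreover have "\<bar>F g - F s\<bar> \<le> e"
    proof -
      have "\<bar>F g - F s\<bar> \<le> C * (\<integral>x. \<bar>g x - s x\<bar> \<partial>\<nu>)"
        using bound[OF bborel_diff[OF g(1) s]] F_diff[OF g(1) s] by simp
      also have "\<dots> \<le> C * (\<integral>x. \<epsilon> \<partial>\<nu>)"
        by (intro mult_left_mono C integral_mono bborel_integrable[OF \<nu>] bborel_abs bborel_diff g s)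
           (use N(1) in \<open>auto simp: s_def\<close>)
      also have "\<dots> \<le> e" using Ce space_borel_finite[OF \<nu>] by (simp add: mult_ac)
      finally show ?thesis .
    qed
    ultimately show ?thesis by linarith
  qed
  then show ?thesis by (metis add.commute field_le_epsilon)
qed

lemma F_indicator_sums:
  assumes A: "range A \<subseteq> sets borel" "disjoint_family A"
  shows "(\<lambda>i. F (indicator (A i))) sums F (indicator (\<Union>i. A i))"
proof -
  have Ai: "A i \<in> sets borel" for i using A by auto
  have U: "(\<Union>i. A i) \<in> sets borel" using Ai by auto
  have m: "(\<lambda>i. measure \<nu> (A i)) sums measure \<nu> (\<Union>i. A i)"
    by (rule finite_measure_UNION) (use A in \<open>auto simp: sets_\<nu>\<close>)
  have sum_ind: "(\<Sum>i<n. indicator (A i) x :: real) = indicator (\<Union>i<n. A i) x" for n x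
    by (rule indicator_UN_disjoint[symmetric]) (use A in \<open>auto simp: disjoint_family_on_def\<close>)
  have est: "\<bar>F (indicator (\<Union>i. A i)) - (\<Sum>i<n. F (indicator (A i)))\<bar> \<le> C * (measure \<nu> (\<Union>i. A i) - (\<Sum>i<n. measure \<nu> (A i)))" for n
  proof -
    let ?Un = "\<Union>i<n. A i"
    have Un: "?Un \<in> sets borel" using Ai by auto
    have "(\<Sum>i<n. F (indicator (A i))) = F (\<lambda>x. \<Sum>i<n. indicator (A i) x)"
      by (rule F_sum[symmetric]) (use Ai in auto)
    also have "\<dots> = F (indicator ?Un)" by (simp add: sum_ind)
    finally have "F (indicator (\<Union>i. A i)) - (\<Sum>i<n. F (indicator (A i))) = F (\<lambda>x. indicator (\<Union>i. A i) x - indicator ?Un x)"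
      using F_diff[of "indicator (\<Union>i. A i)" "indicator ?Un"] U Un by simp
    also have "(\<lambda>x. indicator (\<Union>i. A i) x - indicator ?Un x :: real) = indicator ((\<Union>i. A i) - ?Un)"
      by (auto simp: indicator_def fun_eq_iff)
    also have "\<bar>F \<dots>\<bar> \<le> C * measure \<nu> ((\<Union>i. A i) - ?Un)" using U Un by (intro F_indicator_bound) auto
    also have "measure \<nu> ((\<Union>i. A i) - ?Un) = measure \<nu> (\<Union>i. A i) - measure \<nu> ?Un"
      using U Un by (intro finite_measure_Diff) (auto simp: sets_\<nu>)
    also have "measure \<nu> ?Un = (\<Sum>i<n. measure \<nu> (A i))"
      using Ai A by (intro finite_measure_finite_Union) (auto simp: sets_\<nu> disjoint_family_on_def)
    finally show ?thesis .
  qed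
  have "(\<lambda>n. C * (measure \<nu> (\<Union>i. A i) - (\<Sum>i<n. measure \<nu> (A i)))) \<longlonglongrightarrow> C * (measure \<nu> (\<Union>i. A i) - measure \<nu> (\<Union>i. A i))"
    using m unfolding sums_def by (intro tendsto_intros)
  then have lim: "(\<lambda>n. C * (measure \<nu> (\<Union>i. A i) - (\<Sum>i<n. measure \<nu> (A i)))) \<longlonglongrightarrow> 0"
    by (simp only: diff_self mult_zero_right)
  have "(\<lambda>n. F (indicator (\<Union>i. A i)) - (\<Sum>i<n. F (indicator (A i)))) \<longlonglongrightarrow> 0"
    by (rule Lim_null_comparison[OF always_eventually lim]) (simp only: real_norm_def est simp_thms)
  from tendsto_diff[OF tendsto_const[of "F (indicator (\<Union>i. A i))"] this]
  show ?thesis unfolding sums_def by simp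
qed

lemma positive_part_measure:
  assumes P: "P \<in> sets borel" and pos: "\<And>B. B \<in> sets borel \<Longrightarrow> B \<subseteq> P \<Longrightarrow> 0 \<le> F (indicator B)"
  obtains \<mu> where "borel_finite \<mu>" "\<And>B. B \<in> sets borel \<Longrightarrow> measure \<mu> B = F (indicator (B \<inter> P))"
    "\<And>B. B \<in> sets borel \<Longrightarrow> emeasure \<mu> B = ennreal (F (indicator (B \<inter> P)))"
proof -
  define \<mu> where "\<mu> = measure_of UNIV (sets borel) (\<lambda>B. ennreal (F (indicator (B \<inter> P))))"
  have s: "sets \<mu> = sets borel" unfolding \<mu>_def by (simp add: sets.sigma_sets_eq[of borel, simplified])
  have e: "emeasure \<mu> B = ennreal (F (indicator (B \<inter> P)))" if "B \<in> sets borel" for B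
  proof (rule emeasure_measure_of[OF \<mu>_def])
    show "positive (sets \<mu>) (\<lambda>B. ennreal (F (indicator (B \<inter> P))))"
      by (simp add: positive_def)
    show "countably_additive (sets \<mu>) (\<lambda>B. ennreal (F (indicator (B \<inter> P))))"
      unfolding countably_additive_def
    proof (intro allI impI)
      fix A :: "nat \<Rightarrow> 'a set" assume A: "range A \<subseteq> sets \<mu>" "disjoint_family A"
      have Ai: "A i \<in> sets borel" for i using A(1) by (auto simp: s)
      have "(\<lambda>i. F (indicator (A i \<inter> P))) sums F (indicator (\<Union>i. A i \<inter> P))"
        by (rule F_indicator_sums) (use A Ai P in \<open>auto simp: disjoint_family_on_def\<close>)
      then have "(\<lambda>i. ennreal (F (indicator (A i \<inter> P)))) sums ennreal (F (indicator (\<Union>i. A i \<inter> P)))"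
        using Ai P by (subst sums_ennreal) (auto intro!: pos)
      moreover have "(\<Union>i. A i \<inter> P) = (\<Union>i. A i) \<inter> P" by auto
      ultimately show "suminf (\<lambda>i. ennreal (F (indicator (A i \<inter> P)))) = ennreal (F (indicator ((\<Union>i. A i) \<inter> P)))"
        by (simp only: sums_iff)
    qed
  qed (use that s in auto)
  have sp: "space \<mu> = UNIV" by (simp add: \<mu>_def)
  have "finite_measure \<mu>" by (rule finite_measureI) (simp add: sp e)
  then have "borel_finite \<mu>" by (simp add: borel_finite_def s)
  moreover have "measure \<mu> B = F (indicator (B \<inter> P))" if "B \<in> sets borel" for B
    using e[OF that] that P pos[of "B \<inter> P"] by (simp add: measure_def)
  ultimately show thesis using that e by blast
qed

text \<open>\<open>F\<close> is signed, but adding \<open>C\<close> times \<open>\<nu>\<close> makes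
  it a measure. The Hahn decomposition of that measure against \<open>C\<close> times
  \<open>\<nu>\<close> separates the signs of \<open>F\<close>.\<close>

lemma hahn:
  obtains Y where "Y \<in> sets borel" "\<And>B. B \<in> sets borel \<Longrightarrow> B \<subseteq> Y \<Longrightarrow> 0 \<le> F (indicator B)"
    "\<And>B. B \<in> sets borel \<Longrightarrow> B \<inter> Y = {} \<Longrightarrow> F (indicator B) \<le> 0"
proof -
  define G where "G g = F g + C * (\<integral>x. g x \<partial>\<nu>)" for g
  interpret G: borel_functional G \<nu> "2 * C"
  proof
    fix f g :: "'a \<Rightarrow> real" and a b assume fg: "bborel f" "bborel g"
    have "(\<integral>x. a * f x + b * g x \<partial>\<nu>) = a * (\<integral>x. f x \<partial>\<nu>) + b * (\<integral>x. g x \<partial>\<nu>)"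
      using bborel_integrable[OF \<nu>] fg by simp
    then show "G (\<lambda>x. a * f x + b * g x) = a * G f + b * G g" by (simp add: G_def lin fg algebra_simps)
  next
    fix f :: "'a \<Rightarrow> real" assume f: "bborel f"
    have "\<bar>C * (\<integral>x. f x \<partial>\<nu>)\<bar> \<le> C * (\<integral>x. \<bar>f x\<bar> \<partial>\<nu>)"
      using C by (simp add: abs_mult mult_left_mono integral_abs_bound)
    then show "\<bar>G f\<bar> \<le> 2 * C * (\<integral>x. \<bar>f x\<bar> \<partial>\<nu>)" unfolding G_def using bound[OF f] by linarith
  qed (use C \<nu> in auto)
  have G_ind: "G (indicator B) = F (indicator B) + C * measure \<nu> B" if "B \<in> sets borel" for B
    by (simp add: G_def space_borel_finite[OF \<nu>])
  have Gp: "0 \<le> G (indicator B)" if "B \<in> sets borel" for B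
    using F_indicator_bound[OF that] G_ind[OF that] by linarith
  obtain \<rho> where \<rho>: "borel_finite \<rho>" "\<And>B. B \<in> sets borel \<Longrightarrow> emeasure \<rho> B = ennreal (G (indicator (B \<inter> UNIV)))"
    by (rule G.positive_part_measure[of UNIV]) (use Gp in auto)
  let ?N = "scale_measure (ennreal C) \<nu>"
  have N: "emeasure ?N B = ennreal (C * measure \<nu> B)" for B
    using C by (simp add: emeasure_eq_measure ennreal_mult)
  have "finite_measure ?N" by (rule finite_measureI) (simp only: N, simp)
  then obtain Y where Y: "Y \<in> sets \<rho>" "\<And>X. X \<in> sets \<rho> \<Longrightarrow> X \<subseteq> Y \<Longrightarrow> ?N X \<le> \<rho> X"
    "\<And>X. X \<in> sets \<rho> \<Longrightarrow> X \<inter> Y = {} \<Longrightarrow> \<rho> X \<le> ?N X"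
    using finite_unsigned_Hahn_decomposition[of \<rho> ?N] \<rho>(1) by (auto simp: borel_finite_def sets_\<nu>)
  have s\<rho>: "sets \<rho> = sets borel" using \<rho> by (simp add: borel_finite_def)
  show thesis
  proof
    show "Y \<in> sets borel" using Y s\<rho> by simp
    fix B :: "'a set" assume B: "B \<in> sets borel"
    note Gp = Gp[OF B]
    { assume "B \<subseteq> Y"
      then have "ennreal (C * measure \<nu> B) \<le> ennreal (G (indicator B))"
        using Y(2)[of B] B \<rho>(2)[OF B] unfolding N s\<rho> by simp
      then show "0 \<le> F (indicator B)" using Gp G_ind[OF B] by (simp add: ennreal_le_iff) }
    { assume "B \<inter> Y = {}"
      then have "ennreal (G (indicator B)) \<le> ennreal (C * measure \<nu> B)"
        using Y(3)[of B] B \<rho>(2)[OF B] unfolding N s\<rho> by simp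
      then show "F (indicator B) \<le> 0" using C G_ind[OF B] by (simp add: ennreal_le_iff measure_nonneg) }
  qed
qed

text \<open>Localisation: an estimate on each piece of a countable partition, with the same
  constant, gives the global estimate; the tail is removed by dominated convergence. With K = 0 it
  is a vanishing criterion.\<close>

lemma partition_bound:
  fixes A :: "nat \<Rightarrow> 'a set"
  assumes A: "range A \<subseteq> sets borel" "disjoint_family A" "(\<Union>i. A i) = UNIV" and g: "bborel g"
    and le: "\<And>i. \<bar>F (\<lambda>x. g x * indicator (A i) x)\<bar> \<le> K * (\<integral>x. \<bar>g x\<bar> * indicator (A i) x \<partial>\<nu>)" and K: "0 \<le> K"
  shows "\<bar>F g\<bar> \<le> K * (\<integral>x. \<bar>g x\<bar> \<partial>\<nu>)"
proof -
  have Ai: "A i \<in> sets borel" for i using A by auto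
  have gi: "bborel (\<lambda>x. g x * indicator (A i) x)" "bborel (\<lambda>x. \<bar>g x\<bar> * indicator (A i) x)" for i
    by (intro bborel_mult g bborel_indicator Ai bborel_abs)+
  let ?U = "\<lambda>n. \<Union>i<n. A i"
  have sum_ind: "(\<Sum>i<n. indicator (A i) x :: real) = indicator (?U n) x" for n x
    by (rule indicator_UN_disjoint[symmetric]) (use A in \<open>auto simp: disjoint_family_on_def\<close>)
  have UB: "?U n \<in> sets borel" for n using Ai by auto
  have gU: "bborel (\<lambda>x. g x * indicator (?U n) x)" "bborel (\<lambda>x. \<bar>g x\<bar> * indicator (?U n) x)" for n
    by (intro bborel_mult g bborel_indicator UB bborel_abs)+
  have part: "\<bar>F (\<lambda>x. g x * indicator (?U n) x)\<bar> \<le> K * (\<integral>x. \<bar>g x\<bar> \<partial>\<nu>)" for n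
  proof -
    have "F (\<lambda>x. g x * indicator (?U n) x) = (\<Sum>i<n. F (\<lambda>x. g x * indicator (A i) x))"
      unfolding sum_ind[symmetric] sum_distrib_left by (rule F_sum) (rule gi)
    also have "\<bar>\<dots>\<bar> \<le> (\<Sum>i<n. K * (\<integral>x. \<bar>g x\<bar> * indicator (A i) x \<partial>\<nu>))"
      by (intro order_trans[OF sum_abs sum_mono] le)
    also have "\<dots> = K * (\<integral>x. (\<Sum>i<n. \<bar>g x\<bar> * indicator (A i) x) \<partial>\<nu>)"
      by (subst Bochner_Integration.integral_sum) (auto intro!: bborel_integrable[OF \<nu>] gi simp: sum_distrib_left)
    also have "\<dots> \<le> K * (\<integral>x. \<bar>g x\<bar> \<partial>\<nu>)"
      unfolding sum_distrib_left[symmetric] sum_ind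
      by (intro mult_left_mono K integral_mono bborel_integrable[OF \<nu>] gU bborel_abs g) (auto simp: indicator_def)
    finally show ?thesis .
  qed
  have "(\<lambda>n. \<integral>x. \<bar>g x - g x * indicator (?U n) x\<bar> \<partial>\<nu>) \<longlonglongrightarrow> (\<integral>x. 0 \<partial>\<nu>)"
  proof (rule integral_dominated_convergence[where w = "\<lambda>x. \<bar>g x\<bar>"])
    show "AE x in \<nu>. (\<lambda>n. \<bar>g x - g x * indicator (?U n) x\<bar>) \<longlonglongrightarrow> 0"
    proof (intro AE_I2)
      fix x
      obtain i where i: "x \<in> A i" using A(3) by blast
      have "\<forall>\<^sub>F n in sequentially. \<bar>g x - g x * indicator (?U n) x\<bar> = 0"
        by (rule eventually_sequentiallyI[of "Suc i"]) (use i in \<open>auto simp: indicator_def\<close>)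
      then show "(\<lambda>n. \<bar>g x - g x * indicator (?U n) x\<bar>) \<longlonglongrightarrow> 0" by (rule tendsto_eventually)
    qed
    show "AE x in \<nu>. norm \<bar>g x - g x * indicator (?U n) x\<bar> \<le> \<bar>g x\<bar>" for n
      by (intro AE_I2) (auto simp: indicator_def)
    show "(\<lambda>x. 0 :: real) \<in> borel_measurable \<nu>" "integrable \<nu> (\<lambda>x. \<bar>g x\<bar>)"
      by (auto intro!: bborel_integrable[OF \<nu>] bborel_abs g)
    show "(\<lambda>x. \<bar>g x - g x * indicator (?U n) x\<bar>) \<in> borel_measurable \<nu>" for n
      by (intro borel_measurable_integrable bborel_integrable[OF \<nu>] bborel_abs bborel_diff g gU)
  qed
  then have "(\<lambda>n. C * (\<integral>x. \<bar>g x - g x * indicator (?U n) x\<bar> \<partial>\<nu>)) \<longlonglongrightarrow> C * 0" by (intro tendsto_intros) simp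
  then have "(\<lambda>n. C * (\<integral>x. \<bar>g x - g x * indicator (?U n) x\<bar> \<partial>\<nu>)) \<longlonglongrightarrow> 0" by simp
  then have "(\<lambda>n. F g - F (\<lambda>x. g x * indicator (?U n) x)) \<longlonglongrightarrow> 0"
    by (rule Lim_null_comparison[OF always_eventually, rotated])
       (use bound[OF bborel_diff[OF g gU(1)]] F_diff[OF g gU(1)] in auto)
  from tendsto_diff[OF tendsto_const[of "F g"] this]
  have "(\<lambda>n. F (\<lambda>x. g x * indicator (?U n) x)) \<longlonglongrightarrow> F g" by simp
  then have "(\<lambda>n. \<bar>F (\<lambda>x. g x * indicator (?U n) x)\<bar>) \<longlonglongrightarrow> \<bar>F g\<bar>" by (intro tendsto_intros)
  then show ?thesis by (rule LIMSEQ_le_const2) (use part in auto)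
qed

text \<open>The measure \<kappa> may be unrelated to the measure \<nu> that controls
  \<open>F\<close>. Simple functions transfer the bound from indicators, for nonnegative functions
  and either sign \<open>s\<close> first; positive and negative parts give the rest.\<close>

lemma F_le_integral:
  assumes \<kappa>: "borel_finite \<kappa>" and le: "\<And>B. B \<in> sets borel \<Longrightarrow> \<bar>F (indicator B)\<bar> \<le> K * measure \<kappa> B"
    and K: "0 \<le> K" and g: "bborel g"
  shows "\<bar>F g\<bar> \<le> K * (\<integral>x. \<bar>g x\<bar> \<partial>\<kappa>)"
proof -
  have gen: "s * F f \<le> K * (\<integral>x. f x \<partial>\<kappa>)" if s: "s \<in> {- 1, 1}" and f: "bborel f" "\<And>x. 0 \<le> f x" for s f
  proof -
    have sk: "sets \<kappa> = sets borel" "space \<kappa> = UNIV" using \<kappa> space_borel_finite by (auto simp: borel_finite_def)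
    interpret \<kappa>: finite_measure \<kappa> using \<kappa> by (simp add: borel_finite_def)
    have "0 \<le> K * (\<integral>x. f x \<partial>\<kappa>) - s * F f + e" if e: "0 < e" for e
    proof -
      define V where "V = K * measure \<kappa> UNIV + C * measure \<nu> UNIV + 1"
      have V: "1 \<le> V" using K C by (simp add: V_def measure_nonneg)
      define \<epsilon> where "\<epsilon> = e / V"
      have \<epsilon>: "0 < \<epsilon>" "V * \<epsilon> = e" using e V by (simp_all add: \<epsilon>_def)
      let ?A = "\<lambda>k. {x. \<lfloor>f x / \<epsilon>\<rfloor> = k}"
      obtain N :: int where N: "\<And>x. \<bar>f x - (\<Sum>k\<in>{- N..N}. (\<epsilon> * real_of_int k) * indicator (?A k) x)\<bar> \<le> \<epsilon>"
        "\<And>k. ?A k \<in> sets borel"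
        using floor_simple_approx[OF f(1) \<epsilon>(1)] by blast
      define q where "q x = (\<Sum>k\<in>{- N..N}. (\<epsilon> * real_of_int k) * indicator (?A k) x)" for x
      have q: "bborel q" unfolding q_def[abs_def] by (intro bborel_sum bborel_scale bborel_indicator N)
      have Fq: "F q = (\<Sum>k\<in>{- N..N}. (\<epsilon> * real_of_int k) * F (indicator (?A k)))"
        unfolding q_def[abs_def] by (rule F_simple[OF N(2)])
      have Iq: "(\<integral>x. q x \<partial>\<kappa>) = (\<Sum>k\<in>{- N..N}. (\<epsilon> * real_of_int k) * measure \<kappa> (?A k))"
      proof -
        have "integrable \<kappa> (\<lambda>x. (\<epsilon> * real_of_int k) * indicator (?A k) x)" for k
          by (intro bborel_integrable[OF \<kappa>] bborel_scale bborel_indicator N)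
        then show ?thesis unfolding q_def
          by (subst Bochner_Integration.integral_sum) (simp_all only: integral_mult_right_zero, simp add: sk)
      qed
      have "s * F q \<le> K * (\<integral>x. q x \<partial>\<kappa>)"
        unfolding Fq Iq sum_distrib_left
      proof (rule sum_mono)
        fix k assume "k \<in> {- N..N}"
        show "s * (\<epsilon> * real_of_int k * F (indicator (?A k))) \<le> K * (\<epsilon> * real_of_int k * measure \<kappa> (?A k))"
        proof (cases "0 \<le> k")
          case True
          have "s * F (indicator (?A k)) \<le> K * measure \<kappa> (?A k)"
            using le[OF N(2)[of k]] s by (auto simp: abs_le_iff)
          then have "(\<epsilon> * real_of_int k) * (s * F (indicator (?A k))) \<le> (\<epsilon> * real_of_int k) * (K * measure \<kappa> (?A k))"
            using True \<epsilon> by (intro mult_left_mono) auto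
          then show ?thesis by (simp only: mult_ac)
        next
          case False
          have "0 \<le> \<lfloor>f x / \<epsilon>\<rfloor>" for x using f(2)[of x] \<epsilon> by simp
          then have "?A k = {}" using False by (metis (mono_tags, lifting) Collect_empty_eq)
          then show ?thesis by (simp only: F_empty measure_empty mult_zero_right order_refl)
        qed
      qed
      moreover have "\<bar>s * F f - s * F q\<bar> \<le> C * measure \<nu> UNIV * \<epsilon>"
      proof -
        have "\<bar>s * F f - s * F q\<bar> = \<bar>F f - F q\<bar>" using s by auto
        also have "\<dots> \<le> C * (\<integral>x. \<bar>f x - q x\<bar> \<partial>\<nu>)"
          using bound[OF bborel_diff[OF f(1) q]] F_diff[OF f(1) q] by simp
        also have "\<dots> \<le> C * (\<integral>x. \<epsilon> \<partial>\<nu>)"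
          by (intro mult_left_mono C integral_mono bborel_integrable[OF \<nu>] bborel_abs bborel_diff f q)
             (use N(1) in \<open>auto simp: q_def\<close>)
        also have "\<dots> = C * measure \<nu> UNIV * \<epsilon>" using space_borel_finite[OF \<nu>] by (simp add: mult_ac)
        finally show ?thesis .
      qed
      moreover have "K * (\<integral>x. q x \<partial>\<kappa>) \<le> K * (\<integral>x. f x \<partial>\<kappa>) + K * measure \<kappa> UNIV * \<epsilon>"
      proof -
        have "(\<integral>x. q x \<partial>\<kappa>) \<le> (\<integral>x. f x + \<epsilon> \<partial>\<kappa>)"
        proof (intro integral_mono bborel_integrable[OF \<kappa>] q bborel_add f bborel_const)
          fix x show "q x \<le> f x + \<epsilon>" using N(1)[of x] by (simp add: q_def abs_le_iff)
        qed
        also have "\<dots> = (\<integral>x. f x \<partial>\<kappa>) + measure \<kappa> UNIV * \<epsilon>"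
          using bborel_integrable[OF \<kappa> f(1)] by (simp add: sk)
        finally show ?thesis using K by (simp add: mult_left_mono distrib_left[symmetric] mult.assoc)
      qed
      moreover have "C * measure \<nu> UNIV * \<epsilon> + K * measure \<kappa> UNIV * \<epsilon> \<le> e"
        using \<epsilon> by (simp add: V_def distrib_right)
      ultimately show ?thesis by linarith
    qed
    from this field_le_epsilon[of 0 "K * (\<integral>x. f x \<partial>\<kappa>) - s * F f"]
    have "0 \<le> K * (\<integral>x. f x \<partial>\<kappa>) - s * F f" by blast
    then show ?thesis by linarith
  qed
  have gp: "bborel (\<lambda>x. max 0 (g x))" "bborel (\<lambda>x. max 0 (- g x))"
  proof -
    have "(\<lambda>x. max 0 (g x)) = (\<lambda>x. 1/2 * g x + 1/2 * \<bar>g x\<bar>)" "(\<lambda>x. max 0 (- g x)) = (\<lambda>x. - 1/2 * g x + 1/2 * \<bar>g x\<bar>)" by auto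
    then show "bborel (\<lambda>x. max 0 (g x))" "bborel (\<lambda>x. max 0 (- g x))" by (simp_all only: bborel_lin g bborel_abs)
  qed
  have "F g = F (\<lambda>x. max 0 (g x) - max 0 (- g x))" by (rule arg_cong[where f = F]) auto
  then have 1: "F g = F (\<lambda>x. max 0 (g x)) - F (\<lambda>x. max 0 (- g x))" by (simp only: F_diff[OF gp])
  have "(\<integral>x. \<bar>g x\<bar> \<partial>\<kappa>) = (\<integral>x. max 0 (g x) + max 0 (- g x) \<partial>\<kappa>)"
    by (rule Bochner_Integration.integral_cong) auto
  then have 2: "(\<integral>x. \<bar>g x\<bar> \<partial>\<kappa>) = (\<integral>x. max 0 (g x) \<partial>\<kappa>) + (\<integral>x. max 0 (- g x) \<partial>\<kappa>)"
    by (simp only: Bochner_Integration.integral_add[OF bborel_integrable[OF \<kappa> gp(1)] bborel_integrable[OF \<kappa> gp(2)]])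
  have part: "\<bar>F f\<bar> \<le> K * (\<integral>x. f x \<partial>\<kappa>)" if "bborel f" "\<And>x. 0 \<le> f x" for f
  proof -
    have "1 * F f \<le> K * (\<integral>x. f x \<partial>\<kappa>)" "- 1 * F f \<le> K * (\<integral>x. f x \<partial>\<kappa>)"
      by (rule gen[OF _ that], simp)+
    then show ?thesis by linarith
  qed
  have "\<bar>F (\<lambda>x. max 0 (g x))\<bar> \<le> K * (\<integral>x. max 0 (g x) \<partial>\<kappa>)"
    "\<bar>F (\<lambda>x. max 0 (- g x))\<bar> \<le> K * (\<integral>x. max 0 (- g x) \<partial>\<kappa>)"
    by (rule part[OF gp(1)], simp, rule part[OF gp(2)], simp)
  then show ?thesis unfolding 1 2 distrib_left by linarith
qed

end

lemma (in l1_functional) borel_functional_ext: "borel_functional (ext \<nu> F) \<nu> C"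
  by standard (use \<nu> C ext_lin ext_bound in auto)

lemma (in borel_functional) countable_partition_bound:
  fixes h :: "'a \<Rightarrow> 'b::countable"
  assumes h: "\<And>c. {x. h x = c} \<in> sets borel" and g: "bborel g" and K: "0 \<le> K"
    and le: "\<And>c. \<bar>F (\<lambda>x. g x * indicator {x. h x = c} x)\<bar> \<le> K * (\<integral>x. \<bar>g x\<bar> * indicator {x. h x = c} x \<partial>\<nu>)"
  shows "\<bar>F g\<bar> \<le> K * (\<integral>x. \<bar>g x\<bar> \<partial>\<nu>)"
proof (rule partition_bound[where A = "\<lambda>i. {x. to_nat (h x) = i}"])
  have eq: "{x. to_nat (h x) = i} = (if i \<in> range (to_nat :: 'b \<Rightarrow> nat) then {x. h x = from_nat i} else {})" for i
    by auto
  show "range (\<lambda>i. {x. to_nat (h x) = i}) \<subseteq> sets borel" unfolding eq using h by auto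
  show "disjoint_family (\<lambda>i. {x. to_nat (h x) = i})" by (auto simp: disjoint_family_on_def)
  show "(\<Union>i. {x. to_nat (h x) = i}) = UNIV" by auto
  show "\<bar>F (\<lambda>x. g x * indicator {x. to_nat (h x) = i} x)\<bar> \<le> K * (\<integral>x. \<bar>g x\<bar> * indicator {x. to_nat (h x) = i} x \<partial>\<nu>)" for i
  proof (cases "i \<in> range (to_nat :: 'b \<Rightarrow> nat)")
    case True then show ?thesis using le[of "from_nat i"] unfolding eq by simp
  next
    case False then show ?thesis unfolding eq by simp
  qed
qed (rule g, rule K)

subsection \<open>Currents acting on bounded Borel functions\<close>

definition slots :: "nat \<Rightarrow> ('a::metric_space \<Rightarrow> real) list \<Rightarrow> bool" where
  "slots k \<pi> \<longleftrightarrow> length \<pi> = k \<and> (\<forall>p\<in>set \<pi>. lipschitz p)"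

lemma metric_forms_iff: "(f, \<pi>) \<in> metric_forms k \<longleftrightarrow> blip f \<and> slots k \<pi>"
  by (auto simp: metric_forms_def blip_def slots_def)

lemma slots_upd: "slots k \<pi> \<Longrightarrow> lipschitz p \<Longrightarrow> slots k (\<pi>[m := p])"
  using set_update_subset_insert[of \<pi> m p] by (auto simp: slots_def)

lemma slots_nth: "slots k \<pi> \<Longrightarrow> m < k \<Longrightarrow> lipschitz (\<pi> ! m)"
  by (auto simp: slots_def)

definition lip_prod :: "('a::metric_space \<Rightarrow> real) list \<Rightarrow> real" where
  "lip_prod \<pi> = (\<Prod>m<length \<pi>. Lip (\<pi> ! m))"

lemma lip_prod_nonneg: "slots k \<pi> \<Longrightarrow> 0 \<le> lip_prod \<pi>"
  unfolding lip_prod_def by (intro prod_nonneg Lip_nonneg) (auto simp: slots_def)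

lemma lip_prod_upd:
  assumes "slots k \<pi>" "m < k"
  shows "lip_prod (\<pi>[m := p]) = Lip p * (\<Prod>i\<in>{..<k} - {m}. Lip (\<pi> ! i))"
proof -
  have "lip_prod (\<pi>[m := p]) = Lip (\<pi>[m := p] ! m) * (\<Prod>i\<in>{..<k} - {m}. Lip (\<pi>[m := p] ! i))"
    unfolding lip_prod_def using assms by (subst prod.remove[of _ m]) (auto simp: slots_def)
  also have "(\<Prod>i\<in>{..<k} - {m}. Lip (\<pi>[m := p] ! i)) = (\<Prod>i\<in>{..<k} - {m}. Lip (\<pi> ! i))"
    by (rule prod.cong) (use assms in \<open>auto simp: slots_def\<close>)
  finally show ?thesis using assms by (simp add: slots_def)
qed

lemma lip_prod_le:
  assumes "slots k \<pi>" "\<And>m. m < k \<Longrightarrow> Lip (\<pi> ! m) \<le> M"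
  shows "lip_prod \<pi> \<le> M ^ k"
proof -
  have "lip_prod \<pi> \<le> (\<Prod>m<length \<pi>. M)" unfolding lip_prod_def
    by (rule prod_mono) (use assms in \<open>auto simp: slots_def intro!: Lip_nonneg\<close>)
  then show ?thesis using assms(1) by (simp add: slots_def)
qed

text \<open>Any admissible measure is allowed for \<open>\<nu>\<close>, not only the minimal one, so
  that the locale can be instantiated with several measures. The extension \<open>E\<close> is built
  from \<open>\<nu>\<close>.\<close>

locale current =
  fixes k :: nat and T :: "'a::polish_space metric_functional" and \<nu> :: "'a measure"
  assumes multilinear: "multilinear_forms k T" and continuous: "continuous_forms k T"
    and local: "local_forms k T" and mass: "mass_bound k T \<nu>"
begin

lemma \<nu>: "borel_finite \<nu>" using mass by (simp add: mass_bound_def borel_finite_def)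

definition E :: "('a \<Rightarrow> real) \<Rightarrow> ('a \<Rightarrow> real) list \<Rightarrow> real" where
  "E g \<pi> = ext \<nu> (\<lambda>f. T f \<pi>) g"

lemma l1: "slots k \<pi> \<Longrightarrow> l1_functional (\<lambda>f. T f \<pi>) \<nu> (lip_prod \<pi>)"
proof
  assume \<pi>: "slots k \<pi>"
  show "borel_finite \<nu>" by (rule \<nu>)
  show "0 \<le> lip_prod \<pi>" by (rule lip_prod_nonneg[OF \<pi>])
  show "T (\<lambda>x. a * f x + b * g x) \<pi> = a * T f \<pi> + b * T g \<pi>" if "blip f" "blip g" for f g a b
    using multilinear that \<pi> unfolding multilinear_forms_def metric_forms_iff by blast
  show "\<bar>T f \<pi>\<bar> \<le> lip_prod \<pi> * (\<integral>x. \<bar>f x\<bar> \<partial>\<nu>)" if "blip f" for f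
  proof -
    have "(f, \<pi>) \<in> metric_forms k" using that \<pi> by (simp add: metric_forms_iff)
    then have "\<bar>T f \<pi>\<bar> \<le> (\<Prod>m<k. Lip (\<pi> ! m)) * (\<integral>x. \<bar>f x\<bar> \<partial>\<nu>)"
      using mass unfolding mass_bound_def by blast
    then show ?thesis using \<pi> by (simp add: lip_prod_def slots_def)
  qed
qed

lemma E_functional: "slots k \<pi> \<Longrightarrow> borel_functional (\<lambda>g. E g \<pi>) \<nu> (lip_prod \<pi>)"
  unfolding E_def by (rule l1_functional.borel_functional_ext[OF l1])

lemma E_blip: "slots k \<pi> \<Longrightarrow> blip f \<Longrightarrow> E f \<pi> = T f \<pi>"
  unfolding E_def by (rule l1_functional.ext_blip[OF l1])

lemma E_bound: "slots k \<pi> \<Longrightarrow> bborel g \<Longrightarrow> \<bar>E g \<pi>\<bar> \<le> lip_prod \<pi> * (\<integral>x. \<bar>g x\<bar> \<partial>\<nu>)"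
  by (rule borel_functional.bound[OF E_functional])

lemma E_slot_lin:
  assumes \<pi>: "slots k \<pi>" and m: "m < k" and g: "bborel g" and p: "lipschitz p" "lipschitz q"
  shows "E g (\<pi>[m := \<lambda>x. a * p x + b * q x]) = a * E g (\<pi>[m := p]) + b * E g (\<pi>[m := q])"
proof (rule LIMSEQ_unique)
  let ?f = "approx \<nu> g"
  have s: "slots k (\<pi>[m := \<lambda>x. a * p x + b * q x])" "slots k (\<pi>[m := p])" "slots k (\<pi>[m := q])"
    by (intro slots_upd \<pi> lipschitz_lin p)+
  note lim = l1_functional.ext_lim[OF l1 g, folded E_def]
  show "(\<lambda>j. T (?f j) (\<pi>[m := \<lambda>x. a * p x + b * q x])) \<longlonglongrightarrow> E g (\<pi>[m := \<lambda>x. a * p x + b * q x])" by (rule lim[OF s(1)])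
  have "T (?f j) (\<pi>[m := \<lambda>x. a * p x + b * q x]) = a * T (?f j) (\<pi>[m := p]) + b * T (?f j) (\<pi>[m := q])" for j
    using multilinear m p \<pi> approx(1)[OF \<nu> g] unfolding multilinear_forms_def metric_forms_iff by blast
  then show "(\<lambda>j. T (?f j) (\<pi>[m := \<lambda>x. a * p x + b * q x])) \<longlonglongrightarrow> a * E g (\<pi>[m := p]) + b * E g (\<pi>[m := q])"
    by (simp only:) (intro tendsto_intros lim s)
qed

lemma E_slot_const:
  assumes \<pi>: "slots k \<pi>" and m: "m < k" and g: "bborel g"
  shows "E g (\<pi>[m := \<lambda>_. c]) = 0"
proof -
  have "Lip (\<lambda>_ :: 'a. c) = 0" using lipschitzI[of "\<lambda>_ :: 'a. c" 0] Lip_nonneg[of "\<lambda>_ :: 'a. c"] by simp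
  then show ?thesis using E_bound[OF slots_upd[OF \<pi>] g, of "\<lambda>_. c" m] lip_prod_upd[OF \<pi> m] by simp
qed

lemma E_slot_sum:
  assumes \<pi>: "slots k \<pi>" and m: "m < k" and g: "bborel g" and p: "\<And>j. lipschitz (p j)" and J: "finite J"
  shows "lipschitz (\<lambda>x. \<Sum>j\<in>J. c j * p j x) \<and> E g (\<pi>[m := \<lambda>x. \<Sum>j\<in>J. c j * p j x]) = (\<Sum>j\<in>J. c j * E g (\<pi>[m := p j]))"
  using J
proof (induction J)
  case empty
  then show ?case using E_slot_const[OF \<pi> m g] by simp
next
  case (insert j J)
  have "(\<lambda>x. \<Sum>j\<in>insert j J. c j * p j x) = (\<lambda>x. c j * p j x + 1 * (\<Sum>j\<in>J. c j * p j x))"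
    using insert by simp
  then show ?case
    using insert E_slot_lin[OF \<pi> m g p[of j], of "\<lambda>x. \<Sum>j\<in>J. c j * p j x" "c j" 1]
      lipschitz_lin[OF p[of j], of "\<lambda>x. \<Sum>j\<in>J. c j * p j x" "c j" 1] by simp
qed

text \<open>A three-epsilon argument: the error of replacing the Borel function \<open>g\<close> by
  a Lipschitz \<open>f\<close> is at most M^k times their L^1 distance, uniformly along the
  sequence, and for \<open>f\<close> the continuity axiom applies.\<close>

lemma E_continuous:
  assumes \<pi>: "slots k \<pi>" "\<And>i. slots k (\<pi>s i)" and g: "bborel g"
    and lim: "\<And>m x. m < k \<Longrightarrow> (\<lambda>i. (\<pi>s i ! m) x) \<longlonglongrightarrow> (\<pi> ! m) x"
    and M: "\<And>m i. m < k \<Longrightarrow> Lip (\<pi>s i ! m) \<le> M" "\<And>m. m < k \<Longrightarrow> Lip (\<pi> ! m) \<le> M" "0 \<le> M"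
  shows "(\<lambda>i. E g (\<pi>s i)) \<longlonglongrightarrow> E g \<pi>"
proof (rule LIMSEQ_I)
  fix e :: real assume e: "0 < e"
  define \<epsilon> where "\<epsilon> = e / (3 * (M ^ k + 1))"
  have Mk: "0 \<le> M ^ k" using M by simp
  have \<epsilon>: "0 < \<epsilon>" using e Mk by (simp add: \<epsilon>_def add_nonneg_pos)
  have "e / (3 * y) * y = e / 3" if "0 < y" for y :: real using that by simp
  from this[of "M ^ k + 1"] have "\<epsilon> * (M ^ k + 1) = e / 3" using Mk unfolding \<epsilon>_def by linarith
  then have \<epsilon>M: "M ^ k * \<epsilon> < e / 3" using \<epsilon> by (simp add: algebra_simps)
  obtain f where f: "blip f" "(\<integral>x. \<bar>g x - f x\<bar> \<partial>\<nu>) < \<epsilon>" using blip_dense[OF \<nu> g \<epsilon>] by blast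
  have f': "(\<integral>x. \<bar>f x - g x\<bar> \<partial>\<nu>) \<le> \<epsilon>" using f by (simp add: abs_minus_commute)
  have close: "\<bar>T f \<rho> - E g \<rho>\<bar> < e / 3" if \<rho>: "slots k \<rho>" "\<And>m. m < k \<Longrightarrow> Lip (\<rho> ! m) \<le> M" for \<rho>
  proof -
    have "\<bar>T f \<rho> - E g \<rho>\<bar> \<le> lip_prod \<rho> * (\<integral>x. \<bar>f x - g x\<bar> \<partial>\<nu>)"
      unfolding E_def by (rule l1_functional.ext_diff[OF l1[OF \<rho>(1)] f(1) g])
    also have "\<dots> \<le> M ^ k * \<epsilon>"
      by (rule mult_mono[OF lip_prod_le[OF \<rho>] f' Mk]) (auto intro: Bochner_Integration.integral_nonneg)
    finally show ?thesis using \<epsilon>M by simp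
  qed
  have "(\<lambda>i. T f (\<pi>s i)) \<longlonglongrightarrow> T f \<pi>"
  proof -
    have "\<forall>m<k. (\<forall>x. (\<lambda>i. (\<pi>s i ! m) x) \<longlonglongrightarrow> (\<pi> ! m) x) \<and> bdd_above (range (\<lambda>i. Lip (\<pi>s i ! m)))"
      using lim M(1) by (intro allI impI conjI bdd_aboveI2) blast+
    then show ?thesis
      using continuous \<pi> f(1) unfolding continuous_forms_def metric_forms_iff by blast
  qed
  then obtain n where n: "\<And>i. n \<le> i \<Longrightarrow> \<bar>T f (\<pi>s i) - T f \<pi>\<bar> < e / 3"
    using LIMSEQ_D[of "\<lambda>i. T f (\<pi>s i)" "T f \<pi>" "e / 3"] e by auto
  show "\<exists>n. \<forall>i\<ge>n. norm (E g (\<pi>s i) - E g \<pi>) < e"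
  proof (intro exI[of _ n] allI impI)
    fix i assume "n \<le> i"
    then show "norm (E g (\<pi>s i) - E g \<pi>) < e"
      using close[OF \<pi>(2)[of i] M(1)] close[OF \<pi>(1) M(2)] n[of i] unfolding real_norm_def by linarith
  qed
qed

text \<open>Lipschitz approximants of \<open>g\<close> multiplied by cutoffs of \<open>U\<close>
  still converge to \<open>g\<close>, since \<open>g\<close> vanishes off \<open>U\<close>, and on
  them the locality axiom gives 0.\<close>

lemma E_local_open:
  assumes \<pi>: "slots k \<pi>" and m: "m < k" and g: "bborel g" and U: "open U" "\<And>x. g x \<noteq> 0 \<Longrightarrow> x \<in> U"
    and c: "\<And>x. x \<in> U \<Longrightarrow> (\<pi> ! m) x = c"
  shows "E g \<pi> = 0"
  unfolding E_def
proof (rule l1_functional.ext_eqI[OF l1[OF \<pi>] g _ order_refl])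
  fix \<epsilon> :: real assume \<epsilon>: "0 < \<epsilon>"
  obtain f where f: "blip f" "(\<integral>x. \<bar>g x - f x\<bar> \<partial>\<nu>) < \<epsilon> / 2" using blip_dense[OF \<nu> g, of "\<epsilon> / 2"] \<epsilon> by auto
  let ?\<chi> = "cutoff_open U"
  note \<chi> = cutoff_open[OF U(1)]
  have i1: "integrable \<nu> (\<lambda>x. \<bar>g x\<bar>)" by (intro bborel_integrable[OF \<nu>] bborel_abs g)
  have i2: "integrable \<nu> (\<lambda>x. \<bar>g x - f x\<bar>)" by (intro bborel_integrable[OF \<nu>] bborel_abs bborel_diff g blip_bborel f)
  have b3: "bborel (\<lambda>x. \<bar>g x\<bar> * (1 - ?\<chi> j x))" for j
    by (intro bborel_mult bborel_abs g bborel_diff bborel_const blip_bborel \<chi>)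
  have "(\<lambda>j. \<integral>x. \<bar>g x\<bar> * (1 - ?\<chi> j x) \<partial>\<nu>) \<longlonglongrightarrow> (\<integral>x. 0 \<partial>\<nu>)"
  proof (rule integral_dominated_convergence[OF _ _ i1])
    show "AE x in \<nu>. (\<lambda>j. \<bar>g x\<bar> * (1 - ?\<chi> j x)) \<longlonglongrightarrow> 0"
    proof (intro AE_I2)
      fix x
      have "(\<lambda>j. \<bar>g x\<bar> * (1 - ?\<chi> j x)) \<longlonglongrightarrow> \<bar>g x\<bar> * (1 - indicator U x)" by (intro tendsto_intros \<chi>)
      moreover have "\<bar>g x\<bar> * (1 - indicator U x) = 0" using U(2)[of x] by (auto simp: indicator_def)
      ultimately show "(\<lambda>j. \<bar>g x\<bar> * (1 - ?\<chi> j x)) \<longlonglongrightarrow> 0" by simp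
    qed
    show "AE x in \<nu>. norm (\<bar>g x\<bar> * (1 - ?\<chi> j x)) \<le> \<bar>g x\<bar>" for j
      using \<chi>(2,3)[of j] by (intro AE_I2) (simp add: abs_mult mult_left_le)
    show "(\<lambda>x. \<bar>g x\<bar> * (1 - ?\<chi> j x)) \<in> borel_measurable \<nu>" for j
      by (intro borel_measurable_integrable bborel_integrable[OF \<nu>] b3)
  qed simp
  then have "(\<lambda>j. \<integral>x. \<bar>g x\<bar> * (1 - ?\<chi> j x) \<partial>\<nu>) \<longlonglongrightarrow> 0" by simp
  from LIMSEQ_D[OF this, of "\<epsilon> / 2"] \<epsilon> obtain j where j: "\<bar>\<integral>x. \<bar>g x\<bar> * (1 - ?\<chi> j x) \<partial>\<nu>\<bar> < \<epsilon> / 2" by auto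
  have fb: "blip (\<lambda>x. f x * ?\<chi> j x)" by (intro blip_mult f \<chi>)
  show "\<exists>f. blip f \<and> (\<integral>x. \<bar>f x - g x\<bar> \<partial>\<nu>) \<le> \<epsilon> \<and> \<bar>T f \<pi> - 0\<bar> \<le> 0 * \<epsilon>"
  proof (intro exI[of _ "\<lambda>x. f x * ?\<chi> j x"] conjI fb)
    have "(\<integral>x. \<bar>f x * ?\<chi> j x - g x\<bar> \<partial>\<nu>) \<le> (\<integral>x. \<bar>g x - f x\<bar> + \<bar>g x\<bar> * (1 - ?\<chi> j x) \<partial>\<nu>)"
    proof (rule integral_mono)
      show "integrable \<nu> (\<lambda>x. \<bar>f x * ?\<chi> j x - g x\<bar>)"
        by (intro bborel_integrable[OF \<nu>] bborel_abs bborel_diff g blip_bborel fb)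
      show "integrable \<nu> (\<lambda>x. \<bar>g x - f x\<bar> + \<bar>g x\<bar> * (1 - ?\<chi> j x))"
        by (intro Bochner_Integration.integrable_add i2 bborel_integrable[OF \<nu>] b3)
      fix x
      have "f x * ?\<chi> j x - g x = (f x - g x) * ?\<chi> j x + g x * (?\<chi> j x - 1)" by (simp add: algebra_simps)
      also have "\<bar>\<dots>\<bar> \<le> \<bar>f x - g x\<bar> * \<bar>?\<chi> j x\<bar> + \<bar>g x\<bar> * \<bar>?\<chi> j x - 1\<bar>" by (metis abs_mult abs_triangle_ineq)
      also have "\<dots> \<le> \<bar>g x - f x\<bar> + \<bar>g x\<bar> * (1 - ?\<chi> j x)"
        using \<chi>(2,3)[of j x] by (intro add_mono) (auto simp: mult_left_le abs_minus_commute)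
      finally show "\<bar>f x * ?\<chi> j x - g x\<bar> \<le> \<bar>g x - f x\<bar> + \<bar>g x\<bar> * (1 - ?\<chi> j x)" .
    qed
    also have "\<dots> = (\<integral>x. \<bar>g x - f x\<bar> \<partial>\<nu>) + (\<integral>x. \<bar>g x\<bar> * (1 - ?\<chi> j x) \<partial>\<nu>)"
      by (intro Bochner_Integration.integral_add i2 bborel_integrable[OF \<nu>] b3)
    also have "\<dots> \<le> \<epsilon>" using j f(2) by linarith
    finally show "(\<integral>x. \<bar>f x * ?\<chi> j x - g x\<bar> \<partial>\<nu>) \<le> \<epsilon>" .
    have "T (\<lambda>x. f x * ?\<chi> j x) \<pi> = 0"
    proof -
      have "{x. f x * ?\<chi> j x \<noteq> 0} \<subseteq> U" using \<chi>(4) by force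
      moreover have "(\<pi> ! m) constant_on U" using c by (auto simp: constant_on_def)
      ultimately show ?thesis
        using local m U(1) \<pi> fb unfolding local_forms_def metric_forms_iff by blast
    qed
    then show "\<bar>T (\<lambda>x. f x * ?\<chi> j x) \<pi> - 0\<bar> \<le> 0 * \<epsilon>" by simp
  qed
qed

text \<open>Locality without a neighbourhood: constancy on the set where \<open>g\<close> is nonzero
  suffices. This makes it possible to cut \<open>g\<close> by arbitrary Borel sets and to argue
  piece by piece.\<close>

lemma E_local:
  assumes \<pi>: "slots k \<pi>" and m: "m < k" and g: "bborel g" and c: "\<And>x. g x \<noteq> 0 \<Longrightarrow> (\<pi> ! m) x = c"
  shows "E g \<pi> = 0"
proof (rule LIMSEQ_unique)
  let ?p = "\<pi> ! m"
  let ?e = "\<lambda>i. 1 / real (Suc i)"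
  \<comment> \<open>soft thresholding makes the slot constant on a neighbourhood of the support\<close>
  define q where "q i x = ?p x - max (- ?e i) (min (?e i) (?p x - c))" for i x
  have p: "lipschitz ?p" by (rule slots_nth[OF \<pi> m])
  have q: "lipschitz (q i) \<and> Lip (q i) \<le> Lip ?p" for i
  proof -
    have "\<bar>q i x - q i y\<bar> \<le> Lip ?p * dist x y" for x y
    proof -
      have "\<bar>q i x - q i y\<bar> \<le> \<bar>?p x - ?p y\<bar>" unfolding q_def by (auto simp: max_def min_def)
      then show ?thesis using Lip_bound[OF p, of x y] by linarith
    qed
    then show ?thesis using lipschitzI[of "q i" "Lip ?p"] Lip_nonneg[OF p] by blast
  qed
  define \<pi>s where "\<pi>s i = \<pi>[m := q i]" for i
  have s: "slots k (\<pi>s i)" for i unfolding \<pi>s_def using q by (intro slots_upd \<pi>) auto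
  have nth: "\<pi>s i ! l = (if l = m then q i else \<pi> ! l)" if "l < k" for i l
    using that \<pi> m by (auto simp: \<pi>s_def slots_def)
  define M where "M = Max ((\<lambda>l. Lip (\<pi> ! l)) ` {..<k})"
  have M: "Lip (\<pi> ! l) \<le> M" if "l < k" for l unfolding M_def using that by (intro Max_ge) auto
  have M0: "0 \<le> M" using M[OF m] Lip_nonneg[OF p] by linarith
  show "(\<lambda>i. E g (\<pi>s i)) \<longlonglongrightarrow> E g \<pi>"
  proof (rule E_continuous[OF \<pi> s g _ _ M M0])
    show "Lip (\<pi>s i ! l) \<le> M" if "l < k" for l i using M[OF that] M[OF m] q[of i] by (auto simp: nth[OF that])
    show "(\<lambda>i. (\<pi>s i ! l) x) \<longlonglongrightarrow> (\<pi> ! l) x" if "l < k" for l x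
    proof (cases "l = m")
      case True
      have "(\<lambda>i. q i x) \<longlonglongrightarrow> ?p x"
      proof (rule LIM_zero_cancel, rule Lim_null_comparison)
        show "\<forall>\<^sub>F i in sequentially. norm (q i x - ?p x) \<le> ?e i"
          by (intro always_eventually allI) (auto simp: q_def max_def min_def)
        show "?e \<longlonglongrightarrow> 0" by (intro LIMSEQ_Suc lim_1_over_n)
      qed
      then show ?thesis using that True by (simp add: nth)
    qed (use that in \<open>simp add: nth\<close>)
  qed
  have "E g (\<pi>s i) = 0" for i
  proof (rule E_local_open[OF s m g])
    have "continuous_on UNIV (\<lambda>x. \<bar>?p x - c\<bar>)" by (intro continuous_intros lipschitz_continuous p)
    then show "open {x. \<bar>?p x - c\<bar> < ?e i}" by (rule open_Collect_less[OF _ continuous_on_const])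
    show "x \<in> {x. \<bar>?p x - c\<bar> < ?e i}" if "g x \<noteq> 0" for x using c[OF that] by simp
    show "(\<pi>s i ! m) x = c" if "x \<in> {x. \<bar>?p x - c\<bar> < ?e i}" for x
      using that by (auto simp: nth[OF m] q_def max_def min_def abs_less_iff)
  qed
  then show "(\<lambda>i. E g (\<pi>s i)) \<longlonglongrightarrow> 0" by simp
qed

lemma E_slot_cong:
  assumes \<pi>: "slots k \<pi>" and m: "m < k" and g: "bborel g" and p: "lipschitz p" "lipschitz q"
    and eq: "\<And>x. g x \<noteq> 0 \<Longrightarrow> p x = q x"
  shows "E g (\<pi>[m := p]) = E g (\<pi>[m := q])"
proof -
  have "E g (\<pi>[m := \<lambda>x. 1 * p x + - 1 * q x]) = 0"
    by (rule E_local[OF slots_upd[OF \<pi> lipschitz_lin[OF p]] m g, where c = 0]) (use \<pi> m eq in \<open>auto simp: slots_def\<close>)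
  then show ?thesis using E_slot_lin[OF \<pi> m g p, of 1 "- 1"] by simp
qed

text \<open>Alternation is not an axiom; it follows from locality and continuity. The two equal
  entries are separated by a small zigzag, the domain is cut along the level intervals of
  \<open>u\<close>, and on every piece one of the two new entries is constant. Letting the height of
  the zigzag tend to 0 restores the original tuple.\<close>

lemma E_alternating:
  assumes \<pi>: "slots k \<pi>" and ij: "i < k" "j < k" "i \<noteq> j" and u: "\<pi> ! i = u" "\<pi> ! j = u" and g: "bborel g"
  shows "E g \<pi> = 0"
proof (rule LIMSEQ_unique)
  let ?e = "\<lambda>n. 1 / real (Suc n)"
  \<comment> \<open>a zigzag of small height and slope 1: on each monotone piece one of u - z(u) and u + z(u) is constant\<close>
  define z where "z n t = infdist t (range (\<lambda>l::int. 2 * ?e n * l))" for n t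
  have z_even: "z n t = t - ?e n * l" if l: "even l" "?e n * l \<le> t" "t \<le> ?e n * (l + 1)" for n t and l :: int
  proof (rule antisym)
    obtain a where a: "l = 2 * a" using l(1) by blast
    have "z n t \<le> dist t (2 * ?e n * a)" unfolding z_def by (rule infdist_le) auto
    then show "z n t \<le> t - ?e n * l" using l by (simp add: a dist_real_def)
    show "t - ?e n * l \<le> z n t" unfolding z_def infdist_def
    proof (simp only: image_is_empty UNIV_not_empty if_False, rule cINF_greatest, simp)
      fix y assume "y \<in> range (\<lambda>l::int. 2 * ?e n * l)"
      then obtain b :: int where b: "y = ?e n * (2 * b)" by auto
      consider "2 * b \<le> l" | "l + 2 \<le> 2 * b" using a by fastforce
      then show "t - ?e n * l \<le> dist t y"
      proof cases
        case 1
        then have "?e n * real_of_int (2 * b) \<le> ?e n * l" by (intro mult_left_mono) auto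
        then show ?thesis unfolding b by (simp add: dist_real_def)
      next
        case 2
        then have "?e n * real_of_int (l + 2) \<le> ?e n * real_of_int (2 * b)" by (intro mult_left_mono of_int_le_iff[THEN iffD2]) auto
        then have "?e n * l + 2 * ?e n \<le> ?e n * (2 * b)" by (simp add: distrib_left)
        moreover have "t \<le> ?e n * l + ?e n" using l(3) by (simp add: distrib_left)
        ultimately show ?thesis unfolding b dist_real_def using l(2) by linarith
      qed
    qed
  qed
  have z_odd: "z n t = ?e n * (l + 1) - t" if l: "odd l" "?e n * l \<le> t" "t \<le> ?e n * (l + 1)" for n t and l :: int
  proof (rule antisym)
    obtain a where a: "l = 2 * a + 1" using l(1) by (rule oddE)
    have "z n t \<le> dist t (2 * ?e n * (a + 1))" unfolding z_def by (rule infdist_le) (auto intro!: image_eqI[of _ _ "a + 1"])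
    moreover have "2 * ?e n * (a + 1) = ?e n * (l + 1)" by (simp add: a)
    ultimately have "z n t \<le> \<bar>t - ?e n * (l + 1)\<bar>" by (simp only: dist_real_def)
    then show "z n t \<le> ?e n * (l + 1) - t" using l(3) by linarith
    show "?e n * (l + 1) - t \<le> z n t" unfolding z_def infdist_def
    proof (simp only: image_is_empty UNIV_not_empty if_False, rule cINF_greatest, simp)
      fix y assume "y \<in> range (\<lambda>l::int. 2 * ?e n * l)"
      then obtain b :: int where b: "y = ?e n * (2 * b)" by auto
      consider "2 * b \<le> l - 1" | "l + 1 \<le> 2 * b" using a by fastforce
      then show "?e n * (l + 1) - t \<le> dist t y"
      proof cases
        case 1
        then have "?e n * real_of_int (2 * b) \<le> ?e n * real_of_int (l - 1)" by (intro mult_left_mono of_int_le_iff[THEN iffD2]) auto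
        then have "?e n * (2 * b) \<le> ?e n * l - ?e n" by (simp add: right_diff_distrib)
        moreover have "?e n * (l + 1) = ?e n * l + ?e n" by (simp add: distrib_left)
        ultimately show ?thesis unfolding b dist_real_def using l(2) by linarith
      next
        case 2
        then have "?e n * real_of_int (l + 1) \<le> ?e n * real_of_int (2 * b)" by (intro mult_left_mono of_int_le_iff[THEN iffD2]) auto
        then show ?thesis unfolding b dist_real_def using l(2) by simp
      qed
    qed
  qed
  have z0: "0 \<le> z n t" for n t by (simp add: z_def infdist_nonneg)
  have pos: "0 < ?e n" for n by simp
  have piece: "?e n * \<lfloor>t / ?e n\<rfloor> \<le> t" "t \<le> ?e n * real_of_int (\<lfloor>t / ?e n\<rfloor> + 1)" for n t
  proof -
    have "real_of_int \<lfloor>t / ?e n\<rfloor> \<le> t / ?e n" "t / ?e n \<le> real_of_int (\<lfloor>t / ?e n\<rfloor> + 1)" by linarith+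
    then show "?e n * \<lfloor>t / ?e n\<rfloor> \<le> t" "t \<le> ?e n * real_of_int (\<lfloor>t / ?e n\<rfloor> + 1)"
      using pos[of n] by (simp_all only: pos_le_divide_eq pos_divide_le_eq mult.commute)
  qed
  have z_le: "z n t \<le> ?e n" for n t
  proof -
    have "?e n * real_of_int (\<lfloor>t / ?e n\<rfloor> + 1) = ?e n * \<lfloor>t / ?e n\<rfloor> + ?e n" by (simp only: of_int_add of_int_1 distrib_left mult_1_right)
    then show ?thesis
      using z_even[OF _ piece(1) piece(2), of t n] z_odd[OF _ piece(1) piece(2), of t n] piece[where n = n and t = t] by linarith
  qed
  have z_lip: "\<bar>z n s - z n t\<bar> \<le> \<bar>s - t\<bar>" for n s t
    using infdist_triangle_abs[of s _ t] by (simp add: z_def dist_real_def)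
  have lu: "lipschitz u" using slots_nth[OF \<pi> ij(1)] u by simp
  have lw: "lipschitz (\<lambda>x. u x + s * z n (u x)) \<and> Lip (\<lambda>x. u x + s * z n (u x)) \<le> 2 * Lip u" if s: "s \<in> {1, - 1}" for s n
  proof -
    have "\<bar>(u x + s * z n (u x)) - (u y + s * z n (u y))\<bar> \<le> (2 * Lip u) * dist x y" for x y
    proof -
      have "\<bar>(u x + s * z n (u x)) - (u y + s * z n (u y))\<bar> \<le> \<bar>u x - u y\<bar> + \<bar>z n (u x) - z n (u y)\<bar>" using s by auto
      then show ?thesis using z_lip[where n = n and s = "u x" and t = "u y"] Lip_bound[OF lu, of x y] by simp
    qed
    then show ?thesis using lipschitzI[of "\<lambda>x. u x + s * z n (u x)" "2 * Lip u"] Lip_nonneg[OF lu] by simp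
  qed
  define \<pi>s where "\<pi>s n = \<pi>[i := \<lambda>x. u x + - 1 * z n (u x), j := \<lambda>x. u x + 1 * z n (u x)]" for n
  have s: "slots k (\<pi>s n)" for n unfolding \<pi>s_def by (intro slots_upd \<pi> lw[THEN conjunct1]) simp_all
  have nth: "\<pi>s n ! l = (if l = j then (\<lambda>x. u x + 1 * z n (u x)) else if l = i then (\<lambda>x. u x + - 1 * z n (u x)) else \<pi> ! l)" if "l < k" for n l
    using that \<pi> ij by (auto simp: \<pi>s_def slots_def)
  \<comment> \<open>The factor 2 accounts for the zigzag, which has slope 1 and can double the
    Lipschitz constant of \<open>u\<close>.\<close>
  define M where "M = 2 * Max ((\<lambda>l. Lip (\<pi> ! l)) ` {..<k})"
  have M1: "2 * Lip (\<pi> ! l) \<le> M" if "l < k" for l unfolding M_def using that by (intro mult_left_mono Max_ge) auto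
  have M: "Lip (\<pi> ! l) \<le> M" if "l < k" for l using M1[OF that] Lip_nonneg[OF slots_nth[OF \<pi> that]] by linarith
  have M0: "0 \<le> M" using M[OF ij(1)] Lip_nonneg[OF slots_nth[OF \<pi> ij(1)]] by linarith
  have lim: "(\<lambda>n. u x + s * z n (u x)) \<longlonglongrightarrow> u x" if s: "s \<in> {1, - 1}" for s x
  proof (rule LIM_zero_cancel, rule Lim_null_comparison)
    show "\<forall>\<^sub>F n in sequentially. norm (u x + s * z n (u x) - u x) \<le> ?e n"
      using s z0 z_le by (intro always_eventually allI) auto
    show "?e \<longlonglongrightarrow> 0" by (intro LIMSEQ_Suc lim_1_over_n)
  qed
  show "(\<lambda>n. E g (\<pi>s n)) \<longlonglongrightarrow> E g \<pi>"
  proof (rule E_continuous[OF \<pi> s g _ _ M M0])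
    show "Lip (\<pi>s n ! l) \<le> M" if "l < k" for l n
      using M[OF that] M1[OF ij(1)] lw[of 1 n] lw[of "- 1" n] unfolding nth[OF that] u by auto
    show "(\<lambda>n. (\<pi>s n ! l) x) \<longlonglongrightarrow> (\<pi> ! l) x" if "l < k" for l x
      using lim[of 1 x] lim[of "- 1" x] u nth[OF that] by (cases "l = j"; cases "l = i") simp_all
  qed
  have "E g (\<pi>s n) = 0" for n
  proof -
    interpret F: borel_functional "\<lambda>g. E g (\<pi>s n)" \<nu> "lip_prod (\<pi>s n)" by (rule E_functional[OF s])
    have um [measurable]: "u \<in> borel_measurable borel"
      by (intro borel_measurable_continuous_onI lipschitz_continuous lu)
    have "\<bar>E g (\<pi>s n)\<bar> \<le> 0 * (\<integral>x. \<bar>g x\<bar> \<partial>\<nu>)"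
    proof (rule F.countable_partition_bound[where h = "\<lambda>x. \<lfloor>u x / ?e n\<rfloor>"])
      fix l
      have "{x \<in> space borel. \<lfloor>u x / ?e n\<rfloor> = l} \<in> sets borel" by measurable
      then show B: "{x. \<lfloor>u x / ?e n\<rfloor> = l} \<in> sets borel" by simp
      have gB: "bborel (\<lambda>x. g x * indicator {x. \<lfloor>u x / ?e n\<rfloor> = l} x)" by (intro bborel_mult g bborel_indicator B)
      have sup: "\<lfloor>u x / ?e n\<rfloor> = l" if "g x * indicator {x. \<lfloor>u x / ?e n\<rfloor> = l} x \<noteq> 0" for x
        using that by (auto simp: indicator_def split: if_splits)
      have "E (\<lambda>x. g x * indicator {x. \<lfloor>u x / ?e n\<rfloor> = l} x) (\<pi>s n) = 0"
      proof (cases "even l")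
        case True
        show ?thesis
        proof (rule E_local[OF s ij(1) gB])
          fix x assume "g x * indicator {x. \<lfloor>u x / ?e n\<rfloor> = l} x \<noteq> 0"
          then have "z n (u x) = u x - ?e n * l" using sup[of x] piece[where n = n and t = "u x"] by (intro z_even True) auto
          then show "(\<pi>s n ! i) x = ?e n * l" using ij by (simp add: nth)
        qed
      next
        case False
        show ?thesis
        proof (rule E_local[OF s ij(2) gB])
          fix x assume "g x * indicator {x. \<lfloor>u x / ?e n\<rfloor> = l} x \<noteq> 0"
          then have "z n (u x) = ?e n * (l + 1) - u x" using sup[of x] piece[where n = n and t = "u x"] by (intro z_odd False) auto
          then show "(\<pi>s n ! j) x = ?e n * (l + 1)" using ij by (simp add: nth)
        qed
      qed
      then show "\<bar>E (\<lambda>x. g x * indicator {x. \<lfloor>u x / ?e n\<rfloor> = l} x) (\<pi>s n)\<bar> \<le> 0 * (\<integral>x. \<bar>g x\<bar> * indicator {x. \<lfloor>u x / ?e n\<rfloor> = l} x \<partial>\<nu>)"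
        by simp
    qed (use g in auto)
    then show ?thesis by simp
  qed
  then show "(\<lambda>n. E g (\<pi>s n)) \<longlonglongrightarrow> 0" by simp
qed

end

subsection \<open>Top-dimensional currents vanish on Lebesgue null sets\<close>

lemma lipschitz_coord [simp]: "lipschitz (\<lambda>x :: real ^ 'n. x $ j)" and Lip_coord: "Lip (\<lambda>x :: real ^ 'n. x $ j) \<le> 1"
proof -
  have "\<bar>x $ j - y $ j\<bar> \<le> 1 * dist x y" for x y :: "real ^ 'n"
    using component_le_norm_cart[of "x - y" j] by (simp add: dist_norm)
  from lipschitzI[OF this] show "lipschitz (\<lambda>x :: real ^ 'n. x $ j)" "Lip (\<lambda>x :: real ^ 'n. x $ j) \<le> 1" by simp_all
qed

lemma c11_bborel: "c11 u u' \<Longrightarrow> bborel (u' j)"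
proof -
  assume "c11 u u'"
  then have "lipschitz (u' j)" "\<exists>B. \<forall>x. \<bar>u' j x\<bar> \<le> B" by (auto simp: c11_def lipschitz_def)
  then show ?thesis unfolding bborel_def by (auto intro!: borel_measurable_continuous_onI lipschitz_continuous)
qed

lemma c11_lipschitz:
  fixes u :: "real ^ 'n \<Rightarrow> real"
  assumes "c11 u u'" "\<And>j x. \<bar>u' j x\<bar> \<le> B"
  shows "lipschitz u" "Lip u \<le> real CARD('n) * B"
proof -
  have "(real CARD('n) * B)-lipschitz_on UNIV u"
    by (rule partials_bounded_lipschitz) (use assms in \<open>auto simp: c11_def\<close>)
  then show "lipschitz u" "Lip u \<le> real CARD('n) * B" by (auto simp: lipschitz_def intro: Lip_le)
qed

locale euclidean_current = current k T \<nu> for k :: nat and T :: "(real ^ 'n) metric_functional" and \<nu>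
begin

text \<open>On a cell of side \<delta>, \<open>u\<close> differs from an affine function by a
  function with Lipschitz constant of order \<delta>. Locality restricts the comparison to the cell,
  linearity treats the affine part, and the errors add up to a multiple of \<delta> by
  \<open>countable_partition_bound\<close>.\<close>

lemma chain_rule:
  assumes \<pi>: "slots k \<pi>" and m: "m < k" and g: "bborel g" and u: "c11 u u'"
  shows "E g (\<pi>[m := u]) = (\<Sum>j\<in>UNIV. E (\<lambda>x. g x * u' j x) (\<pi>[m := \<lambda>x. x $ j]))"
proof -
  obtain B where B: "\<And>j x. \<bar>u' j x\<bar> \<le> B j" using u unfolding c11_def by metis
  have "\<exists>L. \<forall>j x y. \<bar>u' j x - u' j y\<bar> \<le> L * dist x y \<and> 0 \<le> L"
  proof -
    have lu: "lipschitz (u' j)" for j using u by (auto simp: c11_def lipschitz_def)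
    define L where "L = Max (range (\<lambda>j. Lip (u' j)))"
    have L: "Lip (u' j) \<le> L" for j unfolding L_def by (intro Max_ge) auto
    have "0 \<le> L" using L[of undefined] Lip_nonneg[OF lu[of undefined]] by linarith
    moreover have "\<bar>u' j x - u' j y\<bar> \<le> L * dist x y" for j x y
      using Lip_bound[OF lu, of j x y] mult_right_mono[OF L zero_le_dist, of j x y] by linarith
    ultimately show ?thesis by blast
  qed
  then obtain L where L: "\<And>j x y. \<bar>u' j x - u' j y\<bar> \<le> L * dist x y" "0 \<le> L" by blast
  have B': "\<bar>u' j x\<bar> \<le> Max (range B)" for j x
    by (rule order_trans[OF B Max_ge]) auto
  have lu: "lipschitz u" by (rule c11_lipschitz(1)[OF u B'])
  have ub: "bborel (u' j)" for j by (rule c11_bborel[OF u])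
  let ?x = "\<lambda>j x. x $ j :: real"
  have s: "slots k (\<pi>[m := u])" "slots k (\<pi>[m := ?x j])" for j by (intro slots_upd \<pi> lu lipschitz_coord)+
  define Q where "Q = (\<Prod>i\<in>{..<k} - {m}. Lip (\<pi> ! i))"
  have Q0: "0 \<le> Q" unfolding Q_def by (intro prod_nonneg Lip_nonneg slots_nth[OF \<pi>]) auto
  \<comment> \<open>The defect between the two sides, as a functional of \<open>g\<close>, so that
    it can be estimated cell by cell.\<close>
  define D where "D g = E g (\<pi>[m := u]) - (\<Sum>j\<in>UNIV. E (\<lambda>x. g x * u' j x) (\<pi>[m := ?x j]))" for g
  define C where "C = lip_prod (\<pi>[m := u]) + (\<Sum>j\<in>UNIV. lip_prod (\<pi>[m := ?x j]) * B j)"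
  interpret D: borel_functional D \<nu> C
  proof
    show "borel_finite \<nu>" by (rule \<nu>)
    have B0: "0 \<le> B j" for j using B[of j undefined] by simp
    show "0 \<le> C" unfolding C_def by (intro add_nonneg_nonneg sum_nonneg mult_nonneg_nonneg lip_prod_nonneg[OF s(1)] lip_prod_nonneg[OF s(2)] B0)
    fix f h :: "real ^ 'n \<Rightarrow> real" and a b assume f: "bborel f" and h: "bborel h"
    have "E (\<lambda>x. (a * f x + b * h x) * u' j x) (\<pi>[m := ?x j]) = a * E (\<lambda>x. f x * u' j x) (\<pi>[m := ?x j]) + b * E (\<lambda>x. h x * u' j x) (\<pi>[m := ?x j])" for j
      using borel_functional.lin[OF E_functional[OF s(2)[of j]] bborel_mult[OF f ub[of j]] bborel_mult[OF h ub[of j]], of a b] by (simp add: algebra_simps)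
    then show "D (\<lambda>x. a * f x + b * h x) = a * D f + b * D h"
      unfolding D_def borel_functional.lin[OF E_functional[OF s(1)] f h] by (simp add: sum.distrib sum_distrib_left algebra_simps)
  next
    fix f :: "real ^ 'n \<Rightarrow> real" assume f: "bborel f"
    have "\<bar>E (\<lambda>x. f x * u' j x) (\<pi>[m := ?x j])\<bar> \<le> lip_prod (\<pi>[m := ?x j]) * B j * (\<integral>x. \<bar>f x\<bar> \<partial>\<nu>)" for j
    proof -
      have "\<bar>E (\<lambda>x. f x * u' j x) (\<pi>[m := ?x j])\<bar> \<le> lip_prod (\<pi>[m := ?x j]) * (\<integral>x. \<bar>f x * u' j x\<bar> \<partial>\<nu>)"
        by (intro E_bound s bborel_mult f ub)
      also have "(\<integral>x. \<bar>f x * u' j x\<bar> \<partial>\<nu>) \<le> (\<integral>x. B j * \<bar>f x\<bar> \<partial>\<nu>)"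
        by (intro integral_mono bborel_integrable[OF \<nu>] bborel_abs bborel_scale bborel_mult f ub)
           (use B mult_right_mono[OF B abs_ge_zero] in \<open>auto simp: abs_mult mult.commute\<close>)
      then have "lip_prod (\<pi>[m := ?x j]) * (\<integral>x. \<bar>f x * u' j x\<bar> \<partial>\<nu>) \<le> lip_prod (\<pi>[m := ?x j]) * (B j * (\<integral>x. \<bar>f x\<bar> \<partial>\<nu>))"
        by (intro mult_left_mono lip_prod_nonneg[OF s(2)]) simp
      finally show ?thesis by (simp only: mult.assoc)
    qed
    then have "(\<Sum>j\<in>UNIV. \<bar>E (\<lambda>x. f x * u' j x) (\<pi>[m := ?x j])\<bar>) \<le> (\<Sum>j\<in>UNIV. lip_prod (\<pi>[m := ?x j]) * B j) * (\<integral>x. \<bar>f x\<bar> \<partial>\<nu>)"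
      by (simp add: sum_distrib_right sum_mono)
    moreover have "\<bar>\<Sum>j\<in>UNIV. E (\<lambda>x. f x * u' j x) (\<pi>[m := ?x j])\<bar> \<le> (\<Sum>j\<in>UNIV. \<bar>E (\<lambda>x. f x * u' j x) (\<pi>[m := ?x j])\<bar>)"
      by (rule sum_abs)
    ultimately show "\<bar>D f\<bar> \<le> C * (\<integral>x. \<bar>f x\<bar> \<partial>\<nu>)"
      using E_bound[OF s(1) f] unfolding D_def C_def distrib_right by linarith
  qed
  define n where "n = real CARD('n)"
  have n0: "0 \<le> n" by (simp add: n_def)
  have small: "\<bar>D g\<bar> \<le> (\<delta> * (2 * n * n * L * Q)) * (\<integral>x. \<bar>g x\<bar> \<partial>\<nu>)" if \<delta>: "0 < \<delta>" for \<delta>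
  proof (rule D.countable_partition_bound[where h = "cell_of \<delta>"])
    show "0 \<le> \<delta> * (2 * n * n * L * Q)" using \<delta> L Q0 n0 by simp
    fix c
    let ?A = "{x. cell_of \<delta> x = c}" and ?gA = "\<lambda>x. g x * indicator {x. cell_of \<delta> x = c} x"
    show A: "?A \<in> sets borel" using borel_grid_cell[OF \<delta>, of c] by (simp add: grid_cell_def)
    have gA: "bborel ?gA" by (intro bborel_mult g bborel_indicator A)
    have gA': "\<bar>?gA x\<bar> = \<bar>g x\<bar> * indicator ?A x" for x by (simp add: indicator_def)
    show "\<bar>D ?gA\<bar> \<le> (\<delta> * (2 * n * n * L * Q)) * (\<integral>x. \<bar>g x\<bar> * indicator ?A x \<partial>\<nu>)"
    proof (cases "?A = {}")
      case False
      then obtain y where y: "y \<in> grid_cell \<delta> c" by (auto simp: grid_cell_def)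
      define a where "a j = u' j y" for j
      define \<eta> where "\<eta> = L * (n * \<delta>)"
      have \<eta>0: "0 \<le> \<eta>" using L n0 \<delta> by (simp add: \<eta>_def)
      have osc: "\<bar>u' j w - a j\<bar> \<le> \<eta>" if "w \<in> grid_cell \<delta> c" for w j
        using L(1)[of j w y] mult_left_mono[OF grid_cell_dist[OF \<delta> that y] L(2)] unfolding a_def \<eta>_def n_def by linarith
      define l where "l x = (\<Sum>j\<in>UNIV. a j * ?x j x)" for x
      have ll: "lipschitz l" and El: "E ?gA (\<pi>[m := l]) = (\<Sum>j\<in>UNIV. a j * E ?gA (\<pi>[m := ?x j]))"
        using E_slot_sum[OF \<pi> m gA lipschitz_coord finite_class.finite_UNIV, of a id] unfolding l_def[abs_def] by simp_all
      have "\<bar>(u x - l x) - (u w - l w)\<bar> \<le> (\<eta> * n) * dist x w" if "x \<in> grid_cell \<delta> c" "w \<in> grid_cell \<delta> c" for x w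
      proof -
        have "\<bar>u x - u w - (\<Sum>j\<in>UNIV. a j * (x $ j - w $ j))\<bar> \<le> \<eta> * (\<Sum>j\<in>UNIV. \<bar>x $ j - w $ j\<bar>)"
        proof (rule coordinate_mvt)
          show "((\<lambda>s. u (x + s *\<^sub>R axis j 1)) has_real_derivative u' j x) (at 0)" for j x using u by (simp add: c11_def)
          show "grid_cell \<delta> c = {w. \<forall>i. w $ i \<in> {\<delta> * real_of_int (c $ i)..<\<delta> * (real_of_int (c $ i) + 1)}}"
            by (rule grid_cell_eq[OF \<delta>])
        qed (use osc that in auto)
        also have "\<dots> \<le> \<eta> * (n * dist x w)" unfolding n_def by (intro mult_left_mono l1_le_dist \<eta>0)
        finally show ?thesis by (simp add: l_def right_diff_distrib sum_subtractf algebra_simps)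
      qed
      \<comment> \<open>The slot must be defined on the whole space: \<open>u - l\<close> has a
        small Lipschitz constant on the cell only, and is replaced by an extension that keeps this
        constant.\<close>
      then obtain v where v: "\<And>x. x \<in> grid_cell \<delta> c \<Longrightarrow> v x = u x - l x" "\<And>x w. \<bar>v x - v w\<bar> \<le> (\<eta> * n) * dist x w"
        using mcshane_extension[of dist "\<eta> * n" "grid_cell \<delta> c" "\<lambda>x. u x - l x"] \<eta>0 n0
        by (metis dist_commute dist_self dist_triangle mult_nonneg_nonneg zero_le_dist)
      have lv: "lipschitz v" "Lip v \<le> \<eta> * n" using lipschitzI[OF v(2)] \<eta>0 n0 by simp_all
      let ?I = "\<integral>x. \<bar>g x\<bar> * indicator ?A x \<partial>\<nu>"
      have I0: "0 \<le> ?I" by (rule Bochner_Integration.integral_nonneg) simp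
      have "E ?gA (\<pi>[m := v]) = E ?gA (\<pi>[m := \<lambda>x. 1 * u x + - 1 * l x])"
        by (rule E_slot_cong[OF \<pi> m gA lv(1) lipschitz_lin[OF lu ll]])
           (use v(1) in \<open>auto simp: grid_cell_def indicator_def split: if_splits\<close>)
      also have "\<dots> = E ?gA (\<pi>[m := u]) - E ?gA (\<pi>[m := l])" using E_slot_lin[OF \<pi> m gA lu ll, of 1 "- 1"] by simp
      finally have v_eq: "E ?gA (\<pi>[m := u]) - E ?gA (\<pi>[m := l]) = E ?gA (\<pi>[m := v])" ..
      have "\<bar>E ?gA (\<pi>[m := v])\<bar> \<le> lip_prod (\<pi>[m := v]) * ?I"
        using E_bound[OF slots_upd[OF \<pi> lv(1)] gA] unfolding gA' .
      also have "\<dots> \<le> (\<eta> * n * Q) * ?I"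
        unfolding lip_prod_upd[OF \<pi> m] Q_def[symmetric] by (intro mult_right_mono lv Q0 I0)
      finally have 1: "\<bar>E ?gA (\<pi>[m := v])\<bar> \<le> (\<eta> * n * Q) * ?I" .
      have b2: "bborel (\<lambda>x. ?gA x * (u' j x - a j))" for j by (intro bborel_mult[OF gA] bborel_diff ub bborel_const)
      have diff: "E (\<lambda>x. ?gA x * u' j x) (\<pi>[m := ?x j]) - a j * E ?gA (\<pi>[m := ?x j]) = E (\<lambda>x. ?gA x * (u' j x - a j)) (\<pi>[m := ?x j])" for j
        using borel_functional.lin[OF E_functional[OF s(2)[of j]] bborel_mult[OF gA ub[of j]] gA, of 1 "- a j"] by (simp add: algebra_simps)
      have 2: "\<bar>E (\<lambda>x. ?gA x * (u' j x - a j)) (\<pi>[m := ?x j])\<bar> \<le> (\<eta> * Q) * ?I" for j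
      proof -
        have "\<bar>E (\<lambda>x. ?gA x * (u' j x - a j)) (\<pi>[m := ?x j])\<bar> \<le> lip_prod (\<pi>[m := ?x j]) * (\<integral>x. \<bar>?gA x * (u' j x - a j)\<bar> \<partial>\<nu>)"
          by (rule E_bound[OF s(2) b2])
        also have "\<dots> \<le> (1 * Q) * (\<eta> * ?I)"
        proof (rule mult_mono)
          show "lip_prod (\<pi>[m := ?x j]) \<le> 1 * Q" unfolding lip_prod_upd[OF \<pi> m] Q_def[symmetric]
            by (intro mult_right_mono Lip_coord Q0)
          have "(\<integral>x. \<bar>?gA x * (u' j x - a j)\<bar> \<partial>\<nu>) \<le> (\<integral>x. \<eta> * (\<bar>g x\<bar> * indicator ?A x) \<partial>\<nu>)"
          proof (rule integral_mono)
            show "integrable \<nu> (\<lambda>x. \<bar>?gA x * (u' j x - a j)\<bar>)" by (intro bborel_integrable[OF \<nu>] bborel_abs b2)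
            show "integrable \<nu> (\<lambda>x. \<eta> * (\<bar>g x\<bar> * indicator ?A x))"
              by (intro bborel_integrable[OF \<nu>] bborel_scale bborel_mult bborel_abs g bborel_indicator A)
            show "\<bar>?gA x * (u' j x - a j)\<bar> \<le> \<eta> * (\<bar>g x\<bar> * indicator ?A x)" for x
              using mult_left_mono[OF osc[of x j] abs_ge_zero[of "g x"]] by (simp add: indicator_def abs_mult grid_cell_def mult.commute)
          qed
          then show "(\<integral>x. \<bar>?gA x * (u' j x - a j)\<bar> \<partial>\<nu>) \<le> \<eta> * ?I" by simp
          show "0 \<le> (\<integral>x. \<bar>?gA x * (u' j x - a j)\<bar> \<partial>\<nu>)" by (rule Bochner_Integration.integral_nonneg) simp
        qed (use Q0 in simp)
        finally show ?thesis by (simp only: mult_ac mult_1_left)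
      qed
      have "D ?gA = E ?gA (\<pi>[m := v]) - (\<Sum>j\<in>UNIV. E (\<lambda>x. ?gA x * (u' j x - a j)) (\<pi>[m := ?x j]))"
        unfolding D_def diff[symmetric] sum_subtractf El[symmetric] v_eq[symmetric] by simp
      moreover have "\<bar>\<Sum>j\<in>UNIV. E (\<lambda>x. ?gA x * (u' j x - a j)) (\<pi>[m := ?x j])\<bar> \<le> (\<Sum>j\<in>(UNIV :: 'n set). (\<eta> * Q) * ?I)"
        by (rule order_trans[OF sum_abs sum_mono[OF 2]])
      moreover have "(\<Sum>j\<in>(UNIV :: 'n set). (\<eta> * Q) * ?I) = (\<eta> * n * Q) * ?I" by (simp add: n_def)
      moreover have "(\<eta> * n * Q) * ?I + (\<eta> * n * Q) * ?I = (\<delta> * (2 * n * n * L * Q)) * ?I" by (simp add: \<eta>_def algebra_simps)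
      ultimately show ?thesis using 1 by linarith
    qed simp
  qed (rule g)
  have "(\<lambda>i. (1 / real (Suc i) * (2 * n * n * L * Q)) * (\<integral>x. \<bar>g x\<bar> \<partial>\<nu>)) \<longlonglongrightarrow> (0 * (2 * n * n * L * Q)) * (\<integral>x. \<bar>g x\<bar> \<partial>\<nu>)"
    by (intro tendsto_intros LIMSEQ_Suc lim_1_over_n)
  then have "\<bar>D g\<bar> \<le> (0 * (2 * n * n * L * Q)) * (\<integral>x. \<bar>g x\<bar> \<partial>\<nu>)"
    by (rule LIMSEQ_le_const) (intro exI[of _ 0] allI impI small, simp)
  then show ?thesis by (simp add: D_def)
qed


text \<open>Restricting the functional to \<open>N\<close> gives one that vanishes on all
  indicators; \<open>F_le_integral\<close> with K = 0 makes it vanish on every bounded Borel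
  function.\<close>

lemma E_indicator_zero:
  assumes \<pi>: "slots k \<pi>" and N: "N \<in> sets borel" and z: "\<And>B. B \<in> sets borel \<Longrightarrow> B \<subseteq> N \<Longrightarrow> E (indicator B) \<pi> = 0"
    and g: "bborel g" "\<And>x. x \<notin> N \<Longrightarrow> g x = 0"
  shows "E g \<pi> = 0"
proof -
  interpret F: borel_functional "\<lambda>g. E g \<pi>" \<nu> "lip_prod \<pi>" by (rule E_functional[OF \<pi>])
  have gN: "bborel (\<lambda>x. f x * indicator N x)" if "bborel f" for f by (intro bborel_mult that bborel_indicator N)
  interpret G: borel_functional "\<lambda>g. E (\<lambda>x. g x * indicator N x) \<pi>" \<nu> "lip_prod \<pi>"
  proof
    show "borel_finite \<nu>" "0 \<le> lip_prod \<pi>" by (rule F.\<nu>, rule F.C)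
    fix f h :: "real ^ 'n \<Rightarrow> real" and a b assume f: "bborel f" and h: "bborel h"
    show "E (\<lambda>x. (a * f x + b * h x) * indicator N x) \<pi> = a * E (\<lambda>x. f x * indicator N x) \<pi> + b * E (\<lambda>x. h x * indicator N x) \<pi>"
      using F.lin[OF gN[OF f] gN[OF h], of a b] by (simp add: algebra_simps)
  next
    fix f :: "real ^ 'n \<Rightarrow> real" assume f: "bborel f"
    have "\<bar>E (\<lambda>x. f x * indicator N x) \<pi>\<bar> \<le> lip_prod \<pi> * (\<integral>x. \<bar>f x * indicator N x\<bar> \<partial>\<nu>)" by (rule F.bound[OF gN[OF f]])
    also have "\<dots> \<le> lip_prod \<pi> * (\<integral>x. \<bar>f x\<bar> \<partial>\<nu>)"
      by (intro mult_left_mono F.C integral_mono bborel_integrable[OF F.\<nu>] bborel_abs gN f) (simp add: indicator_def)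
    finally show "\<bar>E (\<lambda>x. f x * indicator N x) \<pi>\<bar> \<le> lip_prod \<pi> * (\<integral>x. \<bar>f x\<bar> \<partial>\<nu>)" .
  qed
  have "\<bar>E (\<lambda>x. g x * indicator N x) \<pi>\<bar> \<le> 0 * (\<integral>x. \<bar>g x\<bar> \<partial>\<nu>)"
  proof (rule G.F_le_integral[OF F.\<nu> _ order_refl g(1)])
    fix B :: "(real ^ 'n) set" assume B: "B \<in> sets borel"
    have "(\<lambda>x. indicator B x * indicator N x :: real) = indicator (B \<inter> N)" by (auto simp: indicator_def)
    then show "\<bar>E (\<lambda>x. indicator B x * indicator N x) \<pi>\<bar> \<le> 0 * measure \<nu> B" using z[of "B \<inter> N"] B N by simp
  qed
  moreover have "(\<lambda>x. g x * indicator N x) = g" using g(2) by (auto simp: indicator_def fun_eq_iff)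
  ultimately show ?thesis by simp
qed

definition coords :: "(nat \<Rightarrow> 'n) \<Rightarrow> (real ^ 'n \<Rightarrow> real) list" where
  "coords I = map (\<lambda>m x. x $ I m) [0..<k]"

lemma coords: "slots k (coords I)" "m < k \<Longrightarrow> coords I ! m = (\<lambda>x. x $ I m)"
  by (auto simp: coords_def slots_def)

text \<open>Positivity turns the current on \<open>P\<close> into a measure, to which the fields
  with bounded derivatives and vanishing supremum apply. The sign \<open>s\<close> covers both
  halves of a Hahn decomposition.\<close>

lemma positive_singular_zero:
  assumes kn: "k = CARD('n)" and I: "bij_betw I {..<k} UNIV" and s: "s \<in> {1, - 1}"
    and P: "P \<in> sets borel" "bounded P" "emeasure lborel P = 0"
    and pos: "\<And>B. B \<in> sets borel \<Longrightarrow> B \<subseteq> P \<Longrightarrow> 0 \<le> s * E (indicator B) (coords I)"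
  shows "E (indicator P) (coords I) = 0"
proof -
  let ?\<pi> = "coords I"
  note \<pi> = coords(1)[of I]
  interpret F: borel_functional "\<lambda>g. s * E g ?\<pi>" \<nu> "lip_prod ?\<pi>"
  proof -
    interpret F0: borel_functional "\<lambda>g. E g ?\<pi>" \<nu> "lip_prod ?\<pi>" by (rule E_functional[OF \<pi>])
    show "borel_functional (\<lambda>g. s * E g ?\<pi>) \<nu> (lip_prod ?\<pi>)"
    proof
      show "s * E (\<lambda>x. a * f x + b * g x) ?\<pi> = a * (s * E f ?\<pi>) + b * (s * E g ?\<pi>)" if "bborel f" "bborel g" for f g a b
        using F0.lin[OF that, of a b] by (simp add: algebra_simps)
      show "\<bar>s * E f ?\<pi>\<bar> \<le> lip_prod ?\<pi> * (\<integral>x. \<bar>f x\<bar> \<partial>\<nu>)" if "bborel f" for f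
        using F0.bound[OF that] s by (auto simp: abs_mult)
    qed (rule F0.\<nu>, rule F0.C)
  qed
  let ?F = "\<lambda>g. s * E g ?\<pi>"
  obtain \<mu> where \<mu>: "borel_finite \<mu>" "\<And>B. B \<in> sets borel \<Longrightarrow> measure \<mu> B = ?F (indicator (B \<inter> P))"
    using F.positive_part_measure[OF P(1) pos] by metis
  have \<mu>': "finite_measure \<mu>" "sets \<mu> = sets borel" using \<mu>(1) by (auto simp: borel_finite_def)
  have \<mu>P: "measure \<mu> (- P) = 0" using \<mu>(2)[of "- P"] P(1) F.F_empty by (simp add: Compl_disjoint2 del: mult_eq_0_iff)
  have \<mu>U: "measure \<mu> UNIV = ?F (indicator P)" using \<mu>(2)[of UNIV] by simp
  obtain C :: real where C: "0 \<le> C"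
    and field: "\<And>r. 0 < r \<Longrightarrow> \<exists>W W' G. (\<forall>i :: 'n. c11 (W i) (W' i)) \<and> (\<forall>i j x. \<bar>W' i j x\<bar> \<le> C) \<and> (\<forall>i x. \<bar>W i x\<bar> \<le> C * r) \<and>
        G \<in> sets borel \<and> (\<forall>x\<in>G. 1 / 2 \<le> (\<Sum>i\<in>UNIV. W' i i x)) \<and>
        (real CARD('n) * C + 1 / 2) * measure \<mu> (- G) \<le> 1 / 4 * measure \<mu> UNIV"
  proof -
    show thesis
    proof (rule singular_field_exists[where 'n = 'n])
      fix C :: real assume C: "0 \<le> C" and field: "\<And>(\<mu> :: (real ^ 'n) measure) P r. finite_measure \<mu> \<Longrightarrow> sets \<mu> = sets borel \<Longrightarrow> P \<in> sets borel \<Longrightarrow> bounded P \<Longrightarrow>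
        emeasure lborel P = 0 \<Longrightarrow> measure \<mu> (- P) = 0 \<Longrightarrow> 0 < r \<Longrightarrow>
        \<exists>W W' G. (\<forall>i. c11 (W i) (W' i)) \<and> (\<forall>i j x. \<bar>W' i j x\<bar> \<le> C) \<and> (\<forall>i x. \<bar>W i x\<bar> \<le> C * r) \<and>
          G \<in> sets borel \<and> (\<forall>x\<in>G. 1 / 2 \<le> (\<Sum>i\<in>UNIV. W' i i x)) \<and>
          (real CARD('n) * C + 1 / 2) * measure \<mu> (- G) \<le> 1 / 4 * measure \<mu> UNIV"
      show thesis by (rule that[OF C]) (rule field[OF \<mu>' P \<mu>P])
    qed
  qed
  define R where "R r W W' G \<longleftrightarrow> (\<forall>i :: 'n. c11 (W i) (W' i)) \<and> (\<forall>i j x. \<bar>W' i j x\<bar> \<le> C) \<and> (\<forall>i x. \<bar>W i x\<bar> \<le> C * (1 / real (Suc r))) \<and>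
        G \<in> sets borel \<and> (\<forall>x\<in>G. 1 / 2 \<le> (\<Sum>i\<in>UNIV. W' i i x)) \<and>
        (real CARD('n) * C + 1 / 2) * measure \<mu> (- G) \<le> 1 / 4 * measure \<mu> UNIV" for r :: nat and W W' G
  have "\<exists>W W' G. R r W W' G" for r unfolding R_def by (rule field) simp
  then obtain W W' G where R: "\<And>r. R r (W r) (W' r) (G r)" by metis
  have W: "c11 (W r i) (W' r i)" "\<bar>W' r i j x\<bar> \<le> C" "\<bar>W r i x\<bar> \<le> C * (1 / real (Suc r))" for r i j x
    using R[of r] unfolding R_def by blast+
  have G: "G r \<in> sets borel" "x \<in> G r \<Longrightarrow> 1 / 2 \<le> (\<Sum>i\<in>UNIV. W' r i i x)"
    "(real CARD('n) * C + 1 / 2) * measure \<mu> (- G r) \<le> 1 / 4 * measure \<mu> UNIV" for r x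
    using R[of r] unfolding R_def by blast+
  let ?x = "\<lambda>j x. x $ j :: real"
  let ?\<chi> = "indicator P :: _ \<Rightarrow> real"
  have bP: "bborel ?\<chi>" using P by simp
  have bW: "bborel (W' r i j)" for r i j by (rule c11_bborel[OF W(1)])
  have lW: "lipschitz (W r i)" "Lip (W r i) \<le> real CARD('n) * C" for r i
    using c11_lipschitz[OF W(1) W(2)] by auto
  \<comment> \<open>Off-diagonal terms of the chain rule vanish: the coordinate x_j with j different
    from I m already occupies another slot. The diagonal term restores the original tuple, and
    summation over \<open>m\<close> produces the divergence.\<close>
  have trace: "(\<Sum>m<k. E ?\<chi> (?\<pi>[m := W r (I m)])) = E (\<lambda>x. ?\<chi> x * (\<Sum>i\<in>UNIV. W' r i i x)) ?\<pi>" for r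
  proof -
    have "E ?\<chi> (?\<pi>[m := W r (I m)]) = E (\<lambda>x. ?\<chi> x * W' r (I m) (I m) x) ?\<pi>" if m: "m < k" for m
    proof -
      have "E (\<lambda>x. ?\<chi> x * W' r (I m) j x) (?\<pi>[m := ?x j]) = 0" if j: "j \<noteq> I m" for j
      proof -
        obtain l where l: "l < k" "I l = j" using I by (metis UNIV_I bij_betw_iff_bijections lessThan_iff)
        have lm: "m \<noteq> l" using l j by auto
        show ?thesis
          by (rule E_alternating[OF slots_upd[OF \<pi> lipschitz_coord] m l(1) lm, where u = "?x j"])
             (use lm l j m coords(2)[of l I] coords(1)[of I] in \<open>auto simp: slots_def intro!: bborel_mult bP bW\<close>)
      qed
      then have "(\<Sum>j\<in>UNIV - {I m}. E (\<lambda>x. ?\<chi> x * W' r (I m) j x) (?\<pi>[m := ?x j])) = 0" by (intro sum.neutral) auto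
      moreover have "?\<pi>[m := ?x (I m)] = ?\<pi>" using coords(2)[OF m, of I] by (metis list_update_id)
      ultimately show ?thesis
        unfolding chain_rule[OF \<pi> m bP W(1)] by (subst sum.remove[of _ "I m"]) auto
    qed
    then have "(\<Sum>m<k. E ?\<chi> (?\<pi>[m := W r (I m)])) = (\<Sum>m<k. E (\<lambda>x. ?\<chi> x * W' r (I m) (I m) x) ?\<pi>)" by simp
    also have "\<dots> = (\<Sum>i\<in>UNIV. E (\<lambda>x. ?\<chi> x * W' r i i x) ?\<pi>)"
      by (rule sum.reindex_bij_betw[OF I])
    also have "\<dots> = E (\<lambda>x. \<Sum>i\<in>UNIV. ?\<chi> x * W' r i i x) ?\<pi>"
      by (rule borel_functional.F_sum[OF E_functional[OF \<pi>], symmetric]) (intro bborel_mult bP bW)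
    finally show ?thesis by (simp add: sum_distrib_left)
  qed
  \<comment> \<open>Positivity allows comparison of the divergence with the step function that is
    1/2 on \<open>G r\<close> and -nC on the rest of \<open>P\<close>.\<close>
  have lower: "1 / 4 * ?F ?\<chi> \<le> (\<Sum>m<k. s * E ?\<chi> (?\<pi>[m := W r (I m)]))" for r
  proof -
    let ?n = "real CARD('n)"
    let ?d = "\<lambda>x. \<Sum>i\<in>UNIV. W' r i i x"
    let ?PG = "indicator (G r \<inter> P) :: _ \<Rightarrow> real" and ?PC = "indicator (- G r \<inter> P) :: _ \<Rightarrow> real"
    have GP: "bborel ?PG" "bborel ?PC" using G(1)[of r] P(1) by auto
    have bd: "bborel (\<lambda>x. ?\<chi> x * ?d x)" by (intro bborel_mult bP bborel_sum bW)
    have bl: "bborel (\<lambda>x. 1 / 2 * ?PG x + (- ?n * C) * ?PC x)" by (intro bborel_lin GP)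
    have "0 \<le> ?F (\<lambda>x. ?\<chi> x * ?d x - (1 / 2 * ?PG x + (- ?n * C) * ?PC x))"
    proof (rule F.F_nonneg[OF pos bborel_diff[OF bd bl]])
      fix x
      have "- (?n * C) \<le> ?d x"
      proof -
        have "\<bar>?d x\<bar> \<le> (\<Sum>i\<in>(UNIV :: 'n set). C)" by (intro order_trans[OF sum_abs sum_mono] W(2))
        then show ?thesis by simp
      qed
      then show "0 \<le> ?\<chi> x * ?d x - (1 / 2 * ?PG x + (- ?n * C) * ?PC x)"
        using G(2)[of x r] by (auto simp: indicator_def)
      show "x \<notin> P \<Longrightarrow> ?\<chi> x * ?d x - (1 / 2 * ?PG x + (- ?n * C) * ?PC x) = 0" by (simp add: indicator_def)
    qed auto
    also have "?F (\<lambda>x. ?\<chi> x * ?d x - (1 / 2 * ?PG x + (- ?n * C) * ?PC x)) = ?F (\<lambda>x. ?\<chi> x * ?d x) - (1 / 2 * ?F ?PG + (- ?n * C) * ?F ?PC)"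
      unfolding F.F_diff[OF bd bl] F.lin[OF GP] ..
    also have "?F ?PG = measure \<mu> (G r)" using \<mu>(2)[OF G(1)] by simp
    also have "?F ?PC = measure \<mu> (- G r)" using \<mu>(2)[of "- G r"] G(1)[of r] by simp
    finally have 1: "0 \<le> ?F (\<lambda>x. ?\<chi> x * ?d x) - (1 / 2 * measure \<mu> (G r) + (- ?n * C) * measure \<mu> (- G r))" .
    have 2: "measure \<mu> UNIV \<le> measure \<mu> (G r) + measure \<mu> (- G r)"
      using measure_Un_le[of "G r" \<mu> "- G r"] G(1)[of r] \<mu>'(2) by (simp add: Compl_partition)
    have 3: "(\<Sum>m<k. s * E ?\<chi> (?\<pi>[m := W r (I m)])) = ?F (\<lambda>x. ?\<chi> x * ?d x)"
      using trace[of r] by (simp only: sum_distrib_left[symmetric])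
    show ?thesis unfolding 3 \<mu>U[symmetric] using 1 2 G(3)[of r] by (simp add: distrib_right)
  qed
  \<comment> \<open>The components of \<open>W r\<close> tend to 0 with Lipschitz constants at most
    nC, so in the limit a slot is constant.\<close>
  have "(\<lambda>r. E ?\<chi> (?\<pi>[m := W r (I m)])) \<longlonglongrightarrow> E ?\<chi> (?\<pi>[m := \<lambda>_. 0])" if m: "m < k" for m
  proof (rule E_continuous[where M = "max 1 (real CARD('n) * C)"])
    show "slots k (?\<pi>[m := \<lambda>_. 0])" "slots k (?\<pi>[m := W r (I m)])" for r by (intro slots_upd \<pi> lW lipschitz_const)+
    have len: "length ?\<pi> = k" using \<pi> by (simp add: slots_def)
    have Lc: "Lip (\<lambda>_ :: real ^ 'n. 0 :: real) \<le> 0" by (rule lipschitzI(2)) auto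
    fix l assume l: "l < k"
    show "Lip (?\<pi>[m := W r (I m)] ! l) \<le> max 1 (real CARD('n) * C)" for r
      using l m lW(2)[of r "I m"] Lip_coord[of "I l"] by (auto simp: nth_list_update len coords(2) le_max_iff_disj)
    show "Lip (?\<pi>[m := \<lambda>_. 0] ! l) \<le> max 1 (real CARD('n) * C)"
      using l m Lc Lip_coord[of "I l"] by (auto simp: nth_list_update len coords(2) le_max_iff_disj)
    show "(\<lambda>r. (?\<pi>[m := W r (I m)] ! l) x) \<longlonglongrightarrow> (?\<pi>[m := \<lambda>_. 0] ! l) x" for x
    proof (cases "l = m")
      case True
      have "(\<lambda>r. C * (1 / real (Suc r))) \<longlonglongrightarrow> C * 0" by (intro tendsto_intros LIMSEQ_Suc lim_1_over_n)
      then have "(\<lambda>r. C * (1 / real (Suc r))) \<longlonglongrightarrow> 0" by simp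
      then have "(\<lambda>r. W r (I m) x) \<longlonglongrightarrow> 0"
        by (rule Lim_null_comparison[OF always_eventually, rotated]) (use W(3) in \<open>auto simp only: real_norm_def\<close>)
      then show ?thesis using True l m by (simp add: len)
    qed (use l in \<open>simp add: len\<close>)
  qed (use bP in auto)
  then have "(\<lambda>r. \<Sum>m<k. s * E ?\<chi> (?\<pi>[m := W r (I m)])) \<longlonglongrightarrow> (\<Sum>m<k. s * E ?\<chi> (?\<pi>[m := \<lambda>_. 0]))"
    by (intro tendsto_intros) auto
  also have "(\<Sum>m<k. s * E ?\<chi> (?\<pi>[m := \<lambda>_. 0])) = 0" using E_slot_const[OF \<pi> _ bP] by simp
  finally have "1 / 4 * ?F ?\<chi> \<le> 0" by (rule LIMSEQ_le_const) (use lower in auto)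
  then have "?F ?\<chi> = 0" using pos[of P] P(1) by simp
  then show ?thesis using s by auto
qed

text \<open>A repeated coordinate is excluded by alternation. Otherwise \<open>I\<close> is a
  bijection, because there are as many slots as coordinates, and \<open>N\<close> splits into the
  two parts of a Hahn decomposition.\<close>

lemma E_null_coords:
  assumes kn: "k = CARD('n)" and N: "N \<in> sets borel" "emeasure lborel N = 0"
  shows "E (indicator N) (coords I) = 0"
proof (cases "inj_on I {..<k}")
  case False
  then obtain i j where ij: "i < k" "j < k" "i \<noteq> j" "I i = I j" by (auto simp: inj_on_def)
  then show ?thesis using N(1) by (intro E_alternating[OF coords(1) ij(1-3)]) (auto simp: coords(2))
next
  case True
  then have "card (I ` {..<k}) = CARD('n)" using kn by (simp add: card_image)
  then have "I ` {..<k} = UNIV" by (simp add: card_eq_UNIV_imp_eq_UNIV)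
  then have I: "bij_betw I {..<k} UNIV" using True by (simp add: bij_betw_def)
  interpret F: borel_functional "\<lambda>g. E g (coords I)" \<nu> "lip_prod (coords I)" by (rule E_functional[OF coords(1)])
  have sgn_zero: "E (indicator P) (coords I) = 0"
    if s: "s \<in> {1, - 1}" and P: "P \<in> sets borel" "P \<subseteq> N"
      and pos: "\<And>B. B \<in> sets borel \<Longrightarrow> B \<subseteq> P \<Longrightarrow> 0 \<le> s * E (indicator B) (coords I)" for s P
  proof -
    have nul: "emeasure lborel A = 0" if "A \<subseteq> P" for A
      using emeasure_mono[of A N lborel] that P(2) N by simp
    \<comment> \<open>The fields were constructed for bounded sets, so \<open>P\<close> is cut into
      countably many shells.\<close>
    have "\<bar>E (indicator P) (coords I)\<bar> \<le> 0 * (\<integral>x. \<bar>indicator P x\<bar> \<partial>\<nu>)"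
    proof (rule F.countable_partition_bound[where h = "\<lambda>x. \<lfloor>norm x\<rfloor>"])
      fix c :: int
      have "{x :: real ^ 'n \<in> space borel. \<lfloor>norm x\<rfloor> = c} \<in> sets borel" by measurable
      then show B: "{x :: real ^ 'n. \<lfloor>norm x\<rfloor> = c} \<in> sets borel" by simp
      let ?P = "P \<inter> {x. \<lfloor>norm x\<rfloor> = c}"
      have "norm x \<le> real_of_int c + 1" if "\<lfloor>norm x\<rfloor> = c" for x :: "real ^ 'n" using that by linarith
      then have "bounded ?P" by (auto simp: bounded_iff)
      then have "E (indicator ?P) (coords I) = 0"
        using P(1) B pos nul by (intro positive_singular_zero[OF kn I s]) auto
      moreover have "(\<lambda>x. indicator P x * indicator {x. \<lfloor>norm x\<rfloor> = c} x :: real) = indicator ?P" by (auto simp: indicator_def)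
      ultimately show "\<bar>E (\<lambda>x. indicator P x * indicator {x. \<lfloor>norm x\<rfloor> = c} x) (coords I)\<bar>
          \<le> 0 * (\<integral>x. \<bar>indicator P x\<bar> * indicator {x. \<lfloor>norm x\<rfloor> = c} x \<partial>\<nu>)" by simp
    qed (use P in auto)
    then show ?thesis by simp
  qed
  obtain Y where Y: "Y \<in> sets borel" "\<And>B. B \<in> sets borel \<Longrightarrow> B \<subseteq> Y \<Longrightarrow> 0 \<le> E (indicator B) (coords I)"
    "\<And>B. B \<in> sets borel \<Longrightarrow> B \<inter> Y = {} \<Longrightarrow> E (indicator B) (coords I) \<le> 0"
    using F.hahn by metis
  have 1: "E (indicator (N \<inter> Y)) (coords I) = 0" by (rule sgn_zero[of 1]) (use N Y in auto)
  have "E (indicator B) (coords I) \<le> 0" if "B \<in> sets borel" "B \<subseteq> N - Y" for B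
    using that by (intro Y(3)) auto
  then have 2: "E (indicator (N - Y)) (coords I) = 0" by (intro sgn_zero[of "- 1"]) (use N Y in auto)
  have "indicator N = (\<lambda>x. indicator (N \<inter> Y) x + indicator (N - Y) x :: real)" by (auto simp: indicator_def)
  then show ?thesis using F.F_add[of "indicator (N \<inter> Y)" "indicator (N - Y)"] 1 2 N Y by simp
qed

end

section \<open>Approximation of Lipschitz functions by functions with Lipschitz partial
  derivatives\<close>

lemma clip_diff:
  fixes a b a' b' d :: real
  assumes "\<bar>a - a'\<bar> \<le> d" "\<bar>b - b'\<bar> \<le> d"
  shows "\<bar>max (- b) (min b a) - max (- b') (min b' a')\<bar> \<le> d"
  using assms by (auto simp: max_def min_def)

text \<open>Clip \<open>u\<close> between \<open>- h\<close> and \<open>h\<close> for a cone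
  \<open>h\<close> of slope \<open>L\<close> that dominates |u| on the ball of radius
  \<open>R\<close>. Adding 1 to \<open>Lip u\<close> ensures that the slope is at least 1, so the
  cone has vanished at radius |u 0| + 2R whatever the Lipschitz constant.\<close>

lemma lipschitz_compact_approx:
  fixes u :: "'a::real_normed_vector \<Rightarrow> real"
  assumes u: "lipschitz u" and R: "0 \<le> R"
  defines "L \<equiv> Lip u + 1"
  obtains v where "\<And>x y. \<bar>v x - v y\<bar> \<le> L * dist x y" "\<And>x. norm x \<le> R \<Longrightarrow> v x = u x"
    "\<And>x. \<bar>u 0\<bar> + 2 * R \<le> norm x \<Longrightarrow> v x = 0"
proof -
  have L: "1 \<le> L" "Lip u \<le> L" using Lip_nonneg[OF u] by (simp_all add: L_def)
  define h where "h x = max 0 (\<bar>u 0\<bar> + L * (2 * R - norm x))" for x :: 'a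
  have h: "\<bar>h x - h y\<bar> \<le> L * dist x y" for x y
  proof -
    have "\<bar>h x - h y\<bar> \<le> \<bar>L * (2 * R - norm x) - L * (2 * R - norm y)\<bar>" unfolding h_def by (auto simp: max_def)
    also have "\<dots> = L * \<bar>norm x - norm y\<bar>" using L by (simp flip: right_diff_distrib add: abs_mult abs_minus_commute)
    also have "\<dots> \<le> L * dist x y" using L norm_triangle_ineq3[of x y] by (intro mult_left_mono) (auto simp: dist_norm)
    finally show ?thesis .
  qed
  show thesis
  proof (rule that[of "\<lambda>x. max (- h x) (min (h x) (u x))"])
    fix x y :: 'a
    have "\<bar>u x - u y\<bar> \<le> L * dist x y"
      using Lip_bound[OF u, of x y] mult_right_mono[OF L(2) zero_le_dist, of x y] by linarith
    then show "\<bar>max (- h x) (min (h x) (u x)) - max (- h y) (min (h y) (u y))\<bar> \<le> L * dist x y" by (intro clip_diff h)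
  next
    fix x :: 'a assume x: "norm x \<le> R"
    have "\<bar>u x - u 0\<bar> \<le> L * norm x"
      using Lip_bound[OF u, of x 0] mult_right_mono[OF L(2), of "norm x"] by simp
    also have "\<dots> \<le> L * R" using x L by (intro mult_left_mono) auto
    also have "L * R \<le> L * (2 * R - norm x)" using x L by (intro mult_left_mono) auto
    finally show "max (- h x) (min (h x) (u x)) = u x" unfolding h_def by (auto simp: max_def min_def)
  next
    fix x :: 'a assume x: "\<bar>u 0\<bar> + 2 * R \<le> norm x"
    have "1 * (norm x - 2 * R) \<le> L * (norm x - 2 * R)" using x L by (intro mult_right_mono) auto
    then have "h x = 0" using x by (simp add: h_def max_def right_diff_distrib)
    then show "max (- h x) (min (h x) (u x)) = 0" by simp
  qed
qed

text \<open>Truncate \<open>u\<close> outside a growing ball, sample it on a grid of mesh 1 / (i +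
  1) and interpolate by splines. Differences of the samples are bounded by \<open>L\<close>, hence
  so are the derivatives; the window reaches at most three cells, whence the error 3nL times the
  mesh.\<close>

lemma lipschitz_c11_approx:
  fixes u :: "real ^ 'n \<Rightarrow> real"
  assumes u: "lipschitz u"
  obtains w w' K where "\<And>i::nat. c11 (w i) (w' i)" "\<And>i. Lip (w i) \<le> K" "\<And>x. (\<lambda>i. w i x) \<longlonglongrightarrow> u x"
proof -
  define L where "L = Lip u + 1"
  have L: "0 \<le> L" using Lip_nonneg[OF u] by (simp add: L_def)
  define n where "n = real CARD('n)"
  have "\<exists>w w'. c11 w w' \<and> Lip w \<le> n * L \<and> (\<forall>x. norm x \<le> real (Suc i) \<longrightarrow> \<bar>w x - u x\<bar> \<le> 3 * n * L * (1 / real (Suc i)))" for i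
  proof -
    define \<delta> where "\<delta> = 1 / real (Suc i)"
    have \<delta>: "0 < \<delta>" by (simp add: \<delta>_def)
    obtain v where v: "\<And>x y. \<bar>v x - v y\<bar> \<le> L * dist x y" "\<And>x. norm x \<le> real (Suc i) \<Longrightarrow> v x = u x"
      "\<And>x. \<bar>u 0\<bar> + 2 * real (Suc i) \<le> norm x \<Longrightarrow> v x = 0"
      using lipschitz_compact_approx[OF u, of "real (Suc i)"] unfolding L_def by auto
    let ?p = "\<lambda>z :: int ^ 'n. (\<chi> k. \<delta> * real_of_int (z $ k)) :: real ^ 'n"
    define U where "U z = v (?p z) / \<delta>" for z
    have fin: "fsupp U"
    proof -
      define S where "S = (\<bar>u 0\<bar> + 2 * real (Suc i)) / \<delta>"
      have "{z. U z \<noteq> 0} \<subseteq> {z. \<forall>k. z $ k \<in> {- \<lceil>S\<rceil>..\<lceil>S\<rceil>}}"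
      proof clarify
        fix z k assume "U z \<noteq> 0"
        then have "norm (?p z) < \<bar>u 0\<bar> + 2 * real (Suc i)" using v(3)[of "?p z"] unfolding U_def by force
        then have "\<bar>\<delta> * real_of_int (z $ k)\<bar> < \<bar>u 0\<bar> + 2 * real (Suc i)"
          using component_le_norm_cart[of "?p z" k] by simp
        then have "\<bar>real_of_int (z $ k)\<bar> < S" using \<delta> by (simp add: S_def abs_mult pos_less_divide_eq mult.commute)
        then show "z $ k \<in> {- \<lceil>S\<rceil>..\<lceil>S\<rceil>}" by simp linarith
      qed
      then show ?thesis by (rule finite_subset) (rule card_vec_product(2), simp)
    qed
    have dU: "\<bar>fdiff j U z\<bar> \<le> L" for j z
    proof -
      have "?p (z + unit_step j) - ?p z = \<delta> *\<^sub>R axis j 1" by (simp add: vec_eq_iff axis_def algebra_simps)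
      then have "dist (?p (z + unit_step j)) (?p z) = \<delta>" using \<delta> by (simp add: dist_norm)
      then have "\<bar>v (?p (z + unit_step j)) - v (?p z)\<bar> \<le> L * \<delta>" using v(1)[of "?p (z + unit_step j)" "?p z"] by simp
      moreover have "fdiff j U z = (v (?p (z + unit_step j)) - v (?p z)) / \<delta>" by (simp only: fdiff_def U_def diff_divide_distrib)
      ultimately show ?thesis using \<delta> by (simp add: pos_divide_le_eq)
    qed
    let ?D = "\<lambda>_ :: 'n. 2 :: nat"
    define w where "w x = \<delta> * spl \<delta> ?D U x" for x
    define w' where "w' j = spl \<delta> (?D(j := ?D j - 1)) (fdiff j U)" for j
    have D: "?D k \<in> {1, 2}" for k by simp
    have c: "c11 w w'" "\<bar>w' j x\<bar> \<le> L" for j x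
      using c11_spl[OF fin \<delta> D dU] unfolding w_def[abs_def] w'_def[abs_def] by blast+
    have "\<bar>w x - v x\<bar> \<le> 3 * n * L * \<delta>" for x
    proof -
      have "\<bar>spl \<delta> ?D U x - v x / \<delta>\<bar> \<le> 3 * n * L"
      proof (rule spl_approx)
        fix z assume z: "z \<in> window \<delta> x"
        have "\<bar>(?p z - x) $ k\<bar> \<le> 3 * \<delta>" for k
        proof -
          have "z $ k \<in> {\<lfloor>x $ k / \<delta>\<rfloor>..\<lfloor>x $ k / \<delta>\<rfloor> + 3}" using z by (simp add: window_def)
          then have "\<bar>real_of_int (z $ k) - x $ k / \<delta>\<bar> \<le> 3" by simp linarith
          then have "\<delta> * \<bar>real_of_int (z $ k) - x $ k / \<delta>\<bar> \<le> \<delta> * 3" using \<delta> by (intro mult_left_mono) auto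
          moreover have "\<delta> * \<bar>real_of_int (z $ k) - x $ k / \<delta>\<bar> = \<bar>\<delta> * (real_of_int (z $ k) - x $ k / \<delta>)\<bar>"
            using \<delta> by (simp only: abs_mult abs_of_pos)
          moreover have "\<delta> * (real_of_int (z $ k) - x $ k / \<delta>) = (?p z - x) $ k" using \<delta> by (simp add: right_diff_distrib)
          ultimately show ?thesis by simp
        qed
        then have "norm (?p z - x) \<le> (\<Sum>k\<in>(UNIV :: 'n set). 3 * \<delta>)" by (intro order_trans[OF norm_le_l1_cart sum_mono])
        then have "dist (?p z) x \<le> n * (3 * \<delta>)" by (simp add: dist_norm n_def)
        then have "\<bar>v (?p z) - v x\<bar> \<le> L * (n * (3 * \<delta>))" using v(1)[of "?p z" x] mult_left_mono[OF _ L] by fastforce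
        moreover have "U z - v x / \<delta> = (v (?p z) - v x) / \<delta>" by (simp only: U_def diff_divide_distrib)
        ultimately show "\<bar>U z - v x / \<delta>\<bar> \<le> 3 * n * L" using \<delta> by (simp add: pos_divide_le_eq mult_ac)
      qed simp
      then have "\<delta> * \<bar>spl \<delta> ?D U x - v x / \<delta>\<bar> \<le> \<delta> * (3 * n * L)" using \<delta> by (intro mult_left_mono) auto
      moreover have "\<delta> * \<bar>spl \<delta> ?D U x - v x / \<delta>\<bar> = \<bar>\<delta> * (spl \<delta> ?D U x - v x / \<delta>)\<bar>"
        using \<delta> by (simp only: abs_mult abs_of_pos)
      moreover have "\<delta> * (spl \<delta> ?D U x - v x / \<delta>) = w x - v x" using \<delta> by (simp add: right_diff_distrib w_def)
      ultimately show ?thesis by (simp add: mult_ac)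
    qed
    then show ?thesis using c(1) c11_lipschitz(2)[OF c] v(2) unfolding \<delta>_def n_def by metis
  qed
  then obtain w w' where w: "\<And>i. c11 (w i) (w' i)" "\<And>i. Lip (w i) \<le> n * L"
    "\<And>i x. norm x \<le> real (Suc i) \<Longrightarrow> \<bar>w i x - u x\<bar> \<le> 3 * n * L * (1 / real (Suc i))"
    by metis
  have "(\<lambda>i. w i x) \<longlonglongrightarrow> u x" for x
  proof (rule LIM_zero_cancel, rule Lim_null_comparison)
    obtain i0 :: nat where i0: "norm x \<le> real i0" using real_arch_simple by blast
    show "\<forall>\<^sub>F i in sequentially. norm (w i x - u x) \<le> 3 * n * L * (1 / real (Suc i))"
    proof (rule eventually_sequentiallyI[of i0])
      fix i assume "i0 \<le> i"
      then have "norm x \<le> real (Suc i)" using i0 by simp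
      then show "norm (w i x - u x) \<le> 3 * n * L * (1 / real (Suc i))" using w(3) by (simp only: real_norm_def)
    qed
    have "(\<lambda>i. 3 * n * L * (1 / real (Suc i))) \<longlonglongrightarrow> 3 * n * L * 0" by (intro tendsto_intros LIMSEQ_Suc lim_1_over_n)
    then show "(\<lambda>i. 3 * n * L * (1 / real (Suc i))) \<longlonglongrightarrow> 0" by simp
  qed
  then show thesis using that w(1,2) by blast
qed

context euclidean_current
begin

text \<open>Induction on the number of leading slots that are not yet coordinate functions. A
  general slot is a limit of functions to which the chain rule applies; this puts coordinates there
  and bounded Borel weights on \<open>N\<close>, which is why the claim is proved for all null sets
  together.\<close>

lemma E_indicator_null:
  assumes kn: "k = CARD('n)" and M: "M \<le> k"
  shows "slots k \<pi> \<Longrightarrow> (\<And>m. M \<le> m \<Longrightarrow> m < k \<Longrightarrow> \<exists>j. \<pi> ! m = (\<lambda>x. x $ j)) \<Longrightarrow>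
    N \<in> sets borel \<Longrightarrow> emeasure lborel N = 0 \<Longrightarrow> E (indicator N) \<pi> = 0"
  using M
proof (induction M arbitrary: \<pi> N)
  case 0
  then have "\<forall>m. \<exists>j. m < k \<longrightarrow> \<pi> ! m = (\<lambda>x. x $ j)" by blast
  then obtain I where I: "\<And>m. m < k \<Longrightarrow> \<pi> ! m = (\<lambda>x. x $ I m)" by metis
  have "\<pi> = coords I"
    by (rule nth_equalityI) (use 0 I coords in \<open>auto simp: slots_def\<close>)
  then show ?case using E_null_coords[OF kn] 0 by simp
next
  case (Suc M)
  have M: "M < k" using Suc.prems by simp
  note \<pi> = Suc.prems(1) and N = Suc.prems(3,4)
  let ?u = "\<pi> ! M"
  have lu: "lipschitz ?u" by (rule slots_nth[OF \<pi> M])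
  obtain w w' K where w: "\<And>i::nat. c11 (w i) (w' i)" "\<And>i. Lip (w i) \<le> K" "\<And>x. (\<lambda>i. w i x) \<longlonglongrightarrow> ?u x"
    using lipschitz_c11_approx[OF lu] by metis
  have lw: "lipschitz (w i)" for i
  proof -
    obtain B where B: "\<And>j x. \<bar>w' i j x\<bar> \<le> B j" using w(1)[of i] unfolding c11_def by metis
    have "\<bar>w' i j x\<bar> \<le> Max (range B)" for j x by (rule order_trans[OF B Max_ge]) auto
    then show ?thesis by (rule c11_lipschitz(1)[OF w(1)])
  qed
  have bN: "bborel (indicator N)" using N by simp
  have s: "slots k (\<pi>[M := w i])" for i by (intro slots_upd \<pi> lw)
  have len: "length \<pi> = k" using \<pi> by (simp add: slots_def)
  have zero: "E (indicator N) (\<pi>[M := w i]) = 0" for i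
    unfolding chain_rule[OF \<pi> M bN w(1)]
  proof (intro sum.neutral ballI)
    fix j
    let ?\<rho> = "\<pi>[M := \<lambda>x. x $ j]"
    have \<rho>: "slots k ?\<rho>" by (intro slots_upd \<pi> lipschitz_coord)
    show "E (\<lambda>x. indicator N x * w' i j x) ?\<rho> = 0"
    proof (rule E_indicator_zero[OF \<rho> N(1)])
      fix B :: "(real ^ 'n) set" assume B: "B \<in> sets borel" "B \<subseteq> N"
      show "E (indicator B) ?\<rho> = 0"
      proof (rule Suc.IH[OF \<rho> _ B(1)])
        show "\<exists>i. ?\<rho> ! m = (\<lambda>x. x $ i)" if "M \<le> m" "m < k" for m
          using that Suc.prems(2)[of m] by (cases "m = M") (auto simp: len)
        show "emeasure lborel B = 0" using emeasure_mono[of B N lborel] B N by simp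
      qed (use M in simp)
    qed (rule bborel_mult[OF bN c11_bborel[OF w(1)]], simp)
  qed
  define A where "A = Max (insert K ((\<lambda>l. Lip (\<pi> ! l)) ` {..<k}))"
  have A: "K \<le> A" "l < k \<Longrightarrow> Lip (\<pi> ! l) \<le> A" for l unfolding A_def by (auto intro!: Max_ge)
  have "(\<lambda>i. E (indicator N) (\<pi>[M := w i])) \<longlonglongrightarrow> E (indicator N) \<pi>"
  proof (rule E_continuous[OF \<pi> s bN _ _ A(2)])
    show "0 \<le> A" using A(2)[OF M] Lip_nonneg[OF lu] by linarith
    fix m assume m: "m < k"
    show "Lip (\<pi>[M := w i] ! m) \<le> A" for i
      using m M A(2)[OF m] A(1) w(2)[of i] by (cases "m = M") (auto simp: len)
    show "(\<lambda>i. (\<pi>[M := w i] ! m) x) \<longlonglongrightarrow> (\<pi> ! m) x" for x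
      using m M w(3)[of x] by (cases "m = M") (auto simp: len)
  qed
  then show ?case unfolding zero by (simp add: LIMSEQ_const_iff)
qed

lemma E_null:
  assumes "k = CARD('n)" "slots k \<pi>" "N \<in> sets borel" "emeasure lborel N = 0" "bborel g" "\<And>x. x \<notin> N \<Longrightarrow> g x = 0"
  shows "E g \<pi> = 0"
proof (rule E_indicator_zero[OF assms(2,3) _ assms(5,6)])
  fix B :: "(real ^ 'n) set" assume B: "B \<in> sets borel" "B \<subseteq> N"
  have "emeasure lborel B = 0" using emeasure_mono[of B N lborel] B assms by simp
  then show "E (indicator B) \<pi> = 0" by (intro E_indicator_null[OF assms(1) order_refl assms(2)] B) auto
qed

end

subsection \<open>The mass measure\<close>

lemma sum_of_borel_finite:
  fixes \<nu> \<kappa> :: "'a::metric_space measure"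
  assumes \<nu>: "borel_finite \<nu>" and \<kappa>: "borel_finite \<kappa>"
  obtains \<rho> where "borel_finite \<rho>" "\<And>B. B \<in> sets borel \<Longrightarrow> measure \<rho> B = measure \<nu> B + measure \<kappa> B"
proof -
  interpret \<nu>: finite_measure \<nu> using \<nu> by (simp add: borel_finite_def)
  interpret \<kappa>: finite_measure \<kappa> using \<kappa> by (simp add: borel_finite_def)
  have s: "sets \<nu> = sets borel" "sets \<kappa> = sets borel" using \<nu> \<kappa> by (auto simp: borel_finite_def)
  define \<rho> where "\<rho> = measure_of UNIV (sets borel) (\<lambda>B. emeasure \<nu> B + emeasure \<kappa> B)"
  have s\<rho>: "sets \<rho> = sets borel" unfolding \<rho>_def by (simp add: sets.sigma_sets_eq[of borel, simplified])
  have e: "emeasure \<rho> B = emeasure \<nu> B + emeasure \<kappa> B" if "B \<in> sets borel" for B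
  proof (rule emeasure_measure_of[OF \<rho>_def])
    show "countably_additive (sets \<rho>) (\<lambda>B. emeasure \<nu> B + emeasure \<kappa> B)"
      unfolding countably_additive_def
    proof (intro allI impI)
      fix A :: "nat \<Rightarrow> 'a set" assume A: "range A \<subseteq> sets \<rho>" "disjoint_family A"
      then show "suminf (\<lambda>i. emeasure \<nu> (A i) + emeasure \<kappa> (A i)) = emeasure \<nu> (\<Union>i. A i) + emeasure \<kappa> (\<Union>i. A i)"
        using s s\<rho> by (subst suminf_add[symmetric]) (auto simp: suminf_emeasure)
    qed
  qed (use that s\<rho> in \<open>auto simp: positive_def\<close>)
  have sp: "space \<rho> = UNIV" by (simp add: \<rho>_def)
  have m: "emeasure \<rho> B = ennreal (measure \<nu> B + measure \<kappa> B)" if "B \<in> sets borel" for B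
    using e[OF that] by (simp add: \<nu>.emeasure_eq_measure \<kappa>.emeasure_eq_measure)
  have "finite_measure \<rho>" by (rule finite_measureI) (simp add: sp m)
  then have "borel_finite \<rho>" by (simp add: borel_finite_def s\<rho>)
  moreover have "measure \<rho> B = measure \<nu> B + measure \<kappa> B" if "B \<in> sets borel" for B
    by (rule measure_eq_emeasure_eq_ennreal[OF _ m[OF that]]) (simp add: measure_nonneg)
  ultimately show thesis using that by blast
qed

lemma integral_abs_mono_measure:
  assumes \<nu>: "borel_finite \<nu>" and \<rho>: "borel_finite \<rho>"
    and le: "\<And>B. B \<in> sets borel \<Longrightarrow> measure \<nu> B \<le> measure \<rho> B" and g: "bborel g"
  shows "(\<integral>x. \<bar>g x\<bar> \<partial>\<nu>) \<le> (\<integral>x. \<bar>g x\<bar> \<partial>\<rho>)"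
proof -
  interpret I: borel_functional "\<lambda>g. \<integral>x. g x \<partial>\<nu>" \<nu> 1
  proof
    fix f h :: "'a \<Rightarrow> real" and a b assume "bborel f" "bborel h"
    then show "(\<integral>x. a * f x + b * h x \<partial>\<nu>) = a * (\<integral>x. f x \<partial>\<nu>) + b * (\<integral>x. h x \<partial>\<nu>)"
      using bborel_integrable[OF \<nu>] by simp
  qed (use \<nu> integral_abs_bound in auto)
  have "\<bar>\<integral>x. \<bar>g x\<bar> \<partial>\<nu>\<bar> \<le> 1 * (\<integral>x. \<bar>\<bar>g x\<bar>\<bar> \<partial>\<rho>)"
    by (rule I.F_le_integral[OF \<rho> _ _ bborel_abs[OF g]])
       (use le in \<open>auto simp: space_borel_finite[OF \<nu>]\<close>)
  then show ?thesis by simp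
qed

context current
begin

text \<open>The extension was built from \<nu>, yet every admissible \<kappa> bounds it: Lipschitz
  approximants chosen in L^1 of the sum of both measures converge for both.\<close>

lemma E_indicator_mass_bound:
  assumes \<kappa>: "mass_bound k T \<kappa>" and \<pi>: "slots k \<pi>" and B: "B \<in> sets borel"
  shows "\<bar>E (indicator B) \<pi>\<bar> \<le> lip_prod \<pi> * measure \<kappa> B"
proof -
  have f\<kappa>: "borel_finite \<kappa>" using \<kappa> by (simp add: mass_bound_def borel_finite_def)
  interpret K: current k T \<kappa> by unfold_locales (rule multilinear continuous local \<kappa>)+
  obtain \<rho> where \<rho>: "borel_finite \<rho>" "\<And>B. B \<in> sets borel \<Longrightarrow> measure \<rho> B = measure \<nu> B + measure \<kappa> B"
    using sum_of_borel_finite[OF \<nu> f\<kappa>] by metis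
  let ?c = "lip_prod \<pi>" and ?i = "indicator B :: 'a \<Rightarrow> real"
  have c: "0 \<le> ?c" by (rule lip_prod_nonneg[OF \<pi>])
  have b: "bborel ?i" using B by simp
  have "\<bar>E ?i \<pi>\<bar> \<le> ?c * measure \<kappa> B + e" if e: "0 < e" for e
  proof -
    define \<epsilon> where "\<epsilon> = e / (2 * ?c + 1)"
    have \<epsilon>: "0 < \<epsilon>" using e c by (simp add: \<epsilon>_def)
    have "e / y * y = e" if "0 < y" for y :: real using that by simp
    from this[of "2 * ?c + 1"] have "\<epsilon> * (2 * ?c + 1) = e" using c unfolding \<epsilon>_def by linarith
    then have \<epsilon>c: "2 * (?c * \<epsilon>) \<le> e" using \<epsilon> by (simp add: algebra_simps)
    obtain f where f: "blip f" "(\<integral>x. \<bar>?i x - f x\<bar> \<partial>\<rho>) < \<epsilon>" using blip_dense[OF \<rho>(1) b \<epsilon>] by blast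
    have fb: "bborel f" "bborel (\<lambda>x. ?i x - f x)" by (intro blip_bborel f bborel_diff b)+
    have close: "(\<integral>x. \<bar>?i x - f x\<bar> \<partial>\<nu>) \<le> \<epsilon>" "(\<integral>x. \<bar>?i x - f x\<bar> \<partial>\<kappa>) \<le> \<epsilon>"
      using integral_abs_mono_measure[OF \<nu> \<rho>(1) _ fb(2)] integral_abs_mono_measure[OF f\<kappa> \<rho>(1) _ fb(2)] \<rho>(2) f(2) by fastforce+
    have "\<bar>T f \<pi> - E ?i \<pi>\<bar> \<le> ?c * (\<integral>x. \<bar>f x - ?i x\<bar> \<partial>\<nu>)"
      unfolding E_def by (rule l1_functional.ext_diff[OF l1[OF \<pi>] f(1) b])
    moreover have "(\<integral>x. \<bar>f x - ?i x\<bar> \<partial>\<nu>) \<le> \<epsilon>" using close(1) by (simp add: abs_minus_commute)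
    then have "?c * (\<integral>x. \<bar>f x - ?i x\<bar> \<partial>\<nu>) \<le> ?c * \<epsilon>" using c by (intro mult_left_mono)
    moreover have "\<bar>T f \<pi>\<bar> \<le> ?c * (\<integral>x. \<bar>f x\<bar> \<partial>\<kappa>)" by (rule l1_functional.bound[OF K.l1[OF \<pi>] f(1)])
    moreover have "(\<integral>x. \<bar>f x\<bar> \<partial>\<kappa>) \<le> measure \<kappa> B + \<epsilon>"
    proof -
      have "(\<integral>x. \<bar>f x\<bar> \<partial>\<kappa>) \<le> (\<integral>x. ?i x + \<bar>?i x - f x\<bar> \<partial>\<kappa>)"
        by (intro integral_mono bborel_integrable[OF f\<kappa>] bborel_abs bborel_add b fb) (auto simp: indicator_def)
      also have "\<dots> = (\<integral>x. ?i x \<partial>\<kappa>) + (\<integral>x. \<bar>?i x - f x\<bar> \<partial>\<kappa>)"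
        by (intro Bochner_Integration.integral_add bborel_integrable[OF f\<kappa>] bborel_abs b fb)
      finally show ?thesis using close(2) integral_indicator_borel[OF f\<kappa>, of B] by linarith
    qed
    then have "?c * (\<integral>x. \<bar>f x\<bar> \<partial>\<kappa>) \<le> ?c * measure \<kappa> B + ?c * \<epsilon>"
      using mult_left_mono[OF _ c] unfolding distrib_left[symmetric] by blast
    ultimately show ?thesis using \<epsilon>c by linarith
  qed
  then show ?thesis by (rule field_le_epsilon)
qed

text \<open>The total variation measure of one slice \<open>g \<mapsto> E g \<pi>\<close>, normalised by the Lipschitz
  constants, lies below every admissible measure and hence below their infimum.\<close>

lemma slice_variation:
  assumes \<pi>: "slots k \<pi>" and c: "0 < lip_prod \<pi>"
  obtains \<tau> where "borel_finite \<tau>" "\<And>\<kappa>. mass_bound k T \<kappa> \<Longrightarrow> \<tau> \<le> \<kappa>"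
    "\<And>B. B \<in> sets borel \<Longrightarrow> \<bar>E (indicator B) \<pi>\<bar> \<le> lip_prod \<pi> * measure \<tau> B"
proof -
  let ?c = "lip_prod \<pi>"
  interpret F: borel_functional "\<lambda>g. E g \<pi>" \<nu> ?c by (rule E_functional[OF \<pi>])
  obtain Y where Y: "Y \<in> sets borel" "\<And>B. B \<in> sets borel \<Longrightarrow> B \<subseteq> Y \<Longrightarrow> 0 \<le> E (indicator B) \<pi>"
    "\<And>B. B \<in> sets borel \<Longrightarrow> B \<inter> Y = {} \<Longrightarrow> E (indicator B) \<pi> \<le> 0"
    using F.hahn by metis
  \<comment> \<open>With \<open>Y\<close> the positive set, this is the total variation of the slice
    divided by the product of Lipschitz constants.\<close>
  define H where "H g = (1 / ?c) * (E (\<lambda>x. g x * indicator Y x) \<pi> - E (\<lambda>x. g x * indicator (- Y) x) \<pi>)" for g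
  have gY: "bborel (\<lambda>x. g x * indicator Y x)" "bborel (\<lambda>x. g x * indicator (- Y) x)" if "bborel g" for g
    using Y(1) by (intro bborel_mult that bborel_indicator; simp)+
  interpret H: borel_functional H \<nu> 1
  proof
    fix f h :: "'a \<Rightarrow> real" and a b assume f: "bborel f" and h: "bborel h"
    have "E (\<lambda>x. (a * f x + b * h x) * indicator Z x) \<pi> = a * E (\<lambda>x. f x * indicator Z x) \<pi> + b * E (\<lambda>x. h x * indicator Z x) \<pi>"
      if "Z \<in> {Y, - Y}" for Z
      using that F.lin[OF gY(1)[OF f] gY(1)[OF h], of a b] F.lin[OF gY(2)[OF f] gY(2)[OF h], of a b]
      by (auto simp: distrib_right mult.assoc)
    then show "H (\<lambda>x. a * f x + b * h x) = a * H f + b * H h" by (simp add: H_def algebra_simps)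
  next
    fix f :: "'a \<Rightarrow> real" assume f: "bborel f"
    have "\<bar>E (\<lambda>x. f x * indicator Y x) \<pi> - E (\<lambda>x. f x * indicator (- Y) x) \<pi>\<bar>
        \<le> ?c * (\<integral>x. \<bar>f x * indicator Y x\<bar> \<partial>\<nu>) + ?c * (\<integral>x. \<bar>f x * indicator (- Y) x\<bar> \<partial>\<nu>)"
      using F.bound[OF gY(1)[OF f]] F.bound[OF gY(2)[OF f]] by linarith
    also have "\<dots> = ?c * (\<integral>x. \<bar>f x * indicator Y x\<bar> + \<bar>f x * indicator (- Y) x\<bar> \<partial>\<nu>)"
      unfolding distrib_left[symmetric]
      by (subst Bochner_Integration.integral_add) (intro bborel_integrable[OF \<nu>] bborel_abs gY f refl)+
    also have "(\<integral>x. \<bar>f x * indicator Y x\<bar> + \<bar>f x * indicator (- Y) x\<bar> \<partial>\<nu>) = (\<integral>x. \<bar>f x\<bar> \<partial>\<nu>)"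
      by (intro Bochner_Integration.integral_cong) (auto simp: indicator_def)
    finally have "(1 / ?c) * \<bar>E (\<lambda>x. f x * indicator Y x) \<pi> - E (\<lambda>x. f x * indicator (- Y) x) \<pi>\<bar> \<le> (1 / ?c) * (?c * (\<integral>x. \<bar>f x\<bar> \<partial>\<nu>))"
      using c by (intro mult_left_mono) auto
    then show "\<bar>H f\<bar> \<le> 1 * (\<integral>x. \<bar>f x\<bar> \<partial>\<nu>)" using c by (simp add: H_def abs_mult)
  qed (use \<nu> in auto)
  have H_ind: "H (indicator B) = (1 / ?c) * (E (indicator (B \<inter> Y)) \<pi> - E (indicator (B - Y)) \<pi>)" for B
  proof -
    have "(\<lambda>x. indicator B x * indicator Y x :: real) = indicator (B \<inter> Y)"
      "(\<lambda>x. indicator B x * indicator (- Y) x :: real) = indicator (B - Y)" by (auto simp: indicator_def)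
    then show ?thesis by (simp add: H_def)
  qed
  have sgn: "0 \<le> E (indicator (B \<inter> Y)) \<pi>" "E (indicator (B - Y)) \<pi> \<le> 0" if "B \<in> sets borel" for B
    using that Y(1) by (auto intro!: Y)
  have "0 \<le> H (indicator B)" if "B \<in> sets borel" for B
    using sgn[OF that] c by (simp add: H_ind)
  then obtain \<tau> where \<tau>: "borel_finite \<tau>" "\<And>B. B \<in> sets borel \<Longrightarrow> measure \<tau> B = H (indicator (B \<inter> UNIV))"
    using H.positive_part_measure[of UNIV] by (metis space_borel sets.top)
  have \<tau>B: "?c * measure \<tau> B = E (indicator (B \<inter> Y)) \<pi> - E (indicator (B - Y)) \<pi>" if "B \<in> sets borel" for B
    using \<tau>(2)[OF that] c by (simp add: H_ind)
  show thesis
  proof (rule that[OF \<tau>(1)])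
    fix B :: "'a set" assume B: "B \<in> sets borel"
    have "indicator B = (\<lambda>x. indicator (B \<inter> Y) x + indicator (B - Y) x :: real)" by (auto simp: indicator_def)
    then have "E (indicator B) \<pi> = E (indicator (B \<inter> Y)) \<pi> + E (indicator (B - Y)) \<pi>"
      using F.F_add[of "indicator (B \<inter> Y)" "indicator (B - Y)"] B Y(1) by simp
    then show "\<bar>E (indicator B) \<pi>\<bar> \<le> ?c * measure \<tau> B" using \<tau>B[OF B] sgn[OF B] by linarith
  next
    fix \<kappa> assume \<kappa>: "mass_bound k T \<kappa>"
    then have f\<kappa>: "borel_finite \<kappa>" by (simp add: mass_bound_def borel_finite_def)
    interpret \<kappa>: finite_measure \<kappa> using f\<kappa> by (simp add: borel_finite_def)
    interpret \<tau>: finite_measure \<tau> using \<tau>(1) by (simp add: borel_finite_def)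
    have s: "sets \<tau> = sets borel" "sets \<kappa> = sets borel" using \<tau>(1) f\<kappa> by (auto simp: borel_finite_def)
    have "measure \<tau> B \<le> measure \<kappa> B" if B: "B \<in> sets borel" for B
    proof -
      have BY: "B \<inter> Y \<in> sets borel" "B - Y \<in> sets borel" using B Y(1) by auto
      have "?c * measure \<tau> B \<le> ?c * measure \<kappa> (B \<inter> Y) + ?c * measure \<kappa> (B - Y)"
        using \<tau>B[OF B] E_indicator_mass_bound[OF \<kappa> \<pi> BY(1)] E_indicator_mass_bound[OF \<kappa> \<pi> BY(2)] by linarith
      also have "\<dots> = ?c * (measure \<kappa> (B \<inter> Y) + measure \<kappa> (B - Y))" by (simp only: distrib_left)
      also have "measure \<kappa> (B \<inter> Y) + measure \<kappa> (B - Y) = measure \<kappa> ((B \<inter> Y) \<union> (B - Y))"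
        by (rule \<kappa>.finite_measure_Union[symmetric]) (use BY s in auto)
      also have "(B \<inter> Y) \<union> (B - Y) = B" by auto
      finally show ?thesis using c by simp
    qed
    then show "\<tau> \<le> \<kappa>" unfolding le_measure[of \<tau> \<kappa>, unfolded s, OF refl]
      by (auto simp: \<tau>.emeasure_eq_measure \<kappa>.emeasure_eq_measure)
  qed
qed

text \<open>This is the existence of the minimal measure. The infimum of measures is not the setwise
  infimum, so the bound cannot simply be passed to it; the normalised variation of each tuple is a
  lower bound of all admissible measures, hence lies below their infimum.\<close>

lemma mass_bound_Inf: "mass_bound k T (Inf {\<kappa>. mass_bound k T \<kappa>})"
proof -
  let ?m = "Inf {\<kappa>. mass_bound k T \<kappa>}"
  have s\<nu>: "sets \<nu> = sets borel" and fin: "finite_measure \<nu>" using \<nu> by (auto simp: borel_finite_def)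
  have m\<nu>: "?m \<le> \<nu>" by (rule Inf_lower) (simp add: mass)
  \<comment> \<open>The order on type \<open>measure\<close> compares spaces first, then
    sigma-algebras, then values. Trapping the infimum between the null measure and
    \<open>\<nu>\<close> shows that it is a Borel measure on the whole space.\<close>
  have 0: "null_measure borel \<le> ?m"
  proof (rule Inf_greatest)
    fix \<kappa> assume "\<kappa> \<in> {\<kappa>. mass_bound k T \<kappa>}"
    then have "sets \<kappa> = sets borel" by (simp add: mass_bound_def)
    then show "null_measure borel \<le> \<kappa>" by (subst le_measure) auto
  qed
  have sp\<nu>: "space \<nu> = UNIV" by (rule space_borel_finite[OF \<nu>])
  have sp: "space ?m = UNIV" using 0 by (auto simp: le_measure_iff split: if_splits)
  have sm: "sets ?m = sets borel"
    using 0 m\<nu> sp sp\<nu> s\<nu> by (auto simp: le_measure_iff split: if_splits)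
  have le: "emeasure ?m A \<le> emeasure \<nu> A" for A
    using m\<nu> le_measure[of ?m \<nu>] sm s\<nu> by (metis emeasure_notin_sets zero_le)
  have fm: "borel_finite ?m"
    unfolding borel_finite_def
  proof (intro conjI sm finite_measureI)
    show "emeasure ?m (space ?m) \<noteq> \<infinity>"
      using le[of "space ?m"] finite_measure.emeasure_finite[OF fin, of "space ?m"] by (auto simp: top_unique)
  qed
  show ?thesis
  proof (subst mass_bound_def, intro conjI ballI, goal_cases)
    case 1 show ?case by (rule sm)
    case 2 show ?case using fm by (simp add: borel_finite_def)
  next
    case (3 x)
    obtain f \<pi> where x: "x = (f, \<pi>)" by force
    have f: "blip f" and \<pi>: "slots k \<pi>" using 3 by (auto simp: x metric_forms_iff)
    have lp: "(\<Prod>m<k. Lip (\<pi> ! m)) = lip_prod \<pi>" using \<pi> by (simp add: lip_prod_def slots_def)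
    interpret F: borel_functional "\<lambda>g. E g \<pi>" \<nu> "lip_prod \<pi>" by (rule E_functional[OF \<pi>])
    have "\<bar>E (indicator B) \<pi>\<bar> \<le> lip_prod \<pi> * measure ?m B" if B: "B \<in> sets borel" for B
    \<comment> \<open>A tuple with a constant entry cannot be normalised, but there the bound by
      \<open>\<nu>\<close> already gives 0.\<close>
    proof (cases "lip_prod \<pi> = 0")
      case True
      then show ?thesis using F.F_indicator_bound[OF B] by simp
    next
      case False
      then have c: "0 < lip_prod \<pi>" using F.C by simp
      obtain \<tau> where \<tau>: "borel_finite \<tau>" "\<And>\<kappa>. mass_bound k T \<kappa> \<Longrightarrow> \<tau> \<le> \<kappa>"
        "\<And>B. B \<in> sets borel \<Longrightarrow> \<bar>E (indicator B) \<pi>\<bar> \<le> lip_prod \<pi> * measure \<tau> B"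
        using slice_variation[OF \<pi> c] by metis
      have "\<tau> \<le> ?m" by (rule Inf_greatest) (simp add: \<tau>(2))
      then have "emeasure \<tau> B \<le> emeasure ?m B"
        using le_measure[of \<tau> ?m] \<tau>(1) sm B by (simp add: borel_finite_def)
      then have "measure \<tau> B \<le> measure ?m B"
        using fm \<tau>(1) by (simp add: borel_finite_def finite_measure.emeasure_eq_measure)
      then have "lip_prod \<pi> * measure \<tau> B \<le> lip_prod \<pi> * measure ?m B" by (rule mult_left_mono) (rule F.C)
      then show ?thesis using \<tau>(3)[OF B] by linarith
    qed
    then have "\<bar>E f \<pi>\<bar> \<le> lip_prod \<pi> * (\<integral>x. \<bar>f x\<bar> \<partial>?m)"
      by (rule F.F_le_integral[OF fm _ F.C blip_bborel[OF f]])
    then show ?case by (simp add: x lp E_blip[OF \<pi> f])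
  qed
qed

lemma current_mass_eq_Inf: "current_mass k T = Inf {\<kappa>. mass_bound k T \<kappa>}"
  unfolding current_mass_def by (rule Least_equality, rule mass_bound_Inf, rule Inf_lower, simp)

end

theorem theorem6p1:
  fixes T :: "(real ^ 'n) metric_functional"
  assumes "metric_current CARD('n) T"
  shows "absolutely_continuous lborel (current_mass CARD('n) T)"
proof -
  let ?k = "CARD('n)" and ?\<nu> = "current_mass CARD('n) T"
  obtain \<nu>' where "euclidean_current ?k T \<nu>'"
    using assms unfolding metric_current_def euclidean_current_def current_def by blast
  then interpret c: euclidean_current ?k T \<nu>' .
  have mass: "mass_bound ?k T ?\<nu>" unfolding c.current_mass_eq_Inf by (rule c.mass_bound_Inf)
  \<comment> \<open>The extension is rebuilt from the mass itself, so that its L^1 bound involves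
    exactly the measure to be compared.\<close>
  interpret euclidean_current ?k T ?\<nu>
    by unfold_locales (rule c.multilinear c.continuous c.local mass)+
  have s: "sets ?\<nu> = sets borel" using \<nu> by (simp add: borel_finite_def)
  interpret finite_measure ?\<nu> using \<nu> by (simp add: borel_finite_def)
  have "emeasure ?\<nu> N = 0" if N: "N \<in> sets borel" "emeasure lborel N = 0" for N
  proof -
    \<comment> \<open>The mass restricted to the complement of \<open>N\<close>. It is admissible
      because the part of each form on \<open>N\<close> contributes nothing.\<close>
    let ?m = "density ?\<nu> (indicator (- N))"
    have NC: "- N \<in> sets ?\<nu>" using N(1) by (simp add: s)
    have em: "emeasure ?m B = emeasure ?\<nu> (- N \<inter> B)" if "B \<in> sets borel" for B
      using that NC by (intro emeasure_restricted) (simp_all add: s)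
    have "mass_bound ?k T ?m"
      unfolding mass_bound_def
    proof (intro conjI ballI, goal_cases)
      case 1 show ?case by (simp add: s)
      case 2 show ?case by (rule finite_measureI) (use em[of UNIV] in \<open>simp add: space_borel_finite[OF \<nu>]\<close>)
    next
      case (3 x)
      obtain f \<pi> where x: "x = (f, \<pi>)" by force
      have f: "blip f" and \<pi>: "slots ?k \<pi>" using 3 by (auto simp: x metric_forms_iff)
      have lp: "(\<Prod>m<?k. Lip (\<pi> ! m)) = lip_prod \<pi>" using \<pi> by (simp add: lip_prod_def slots_def)
      have b: "bborel (\<lambda>x. f x * indicator N x)" "bborel (\<lambda>x. f x * indicator (- N) x)"
        using N(1) by (intro bborel_mult blip_bborel f bborel_indicator; simp)+
      have "T f \<pi> = E f \<pi>" by (rule E_blip[OF \<pi> f, symmetric])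
      also have "\<dots> = E (\<lambda>x. f x * indicator N x + f x * indicator (- N) x) \<pi>"
        by (rule arg_cong[where f = "\<lambda>g. E g \<pi>"]) (auto simp: indicator_def)
      also have "\<dots> = E (\<lambda>x. f x * indicator N x) \<pi> + E (\<lambda>x. f x * indicator (- N) x) \<pi>"
        by (rule borel_functional.F_add[OF E_functional[OF \<pi>] b])
      also have "E (\<lambda>x. f x * indicator N x) \<pi> = 0" by (rule E_null[OF refl \<pi> N b(1)]) simp
      finally have "\<bar>T f \<pi>\<bar> \<le> lip_prod \<pi> * (\<integral>x. \<bar>f x * indicator (- N) x\<bar> \<partial>?\<nu>)"
        using E_bound[OF \<pi> b(2)] by simp
      also have "(\<integral>x. \<bar>f x * indicator (- N) x\<bar> \<partial>?\<nu>) = (\<integral>x. \<bar>f x\<bar> \<partial>density ?\<nu> (\<lambda>x. ennreal (indicator (- N) x)))"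
      proof (subst integral_density)
        show "(\<lambda>x. \<bar>f x\<bar>) \<in> borel_measurable ?\<nu>"
          by (intro borel_measurable_integrable bborel_integrable[OF \<nu>] bborel_abs blip_bborel f)
      qed (use NC in \<open>auto simp: abs_mult mult.commute\<close>)
      finally show ?case by (simp add: x lp ennreal_indicator)
    qed
    \<comment> \<open>Minimality reverses the obvious inequality, and the restricted measure
      vanishes on \<open>N\<close>.\<close>
    then have "?\<nu> \<le> ?m" unfolding c.current_mass_eq_Inf[symmetric] by (simp add: c.current_mass_eq_Inf Inf_lower)
    then have "emeasure ?\<nu> N \<le> emeasure ?m N" using le_measure[of ?\<nu> ?m] s N(1) by simp
    then show ?thesis using em[OF N(1)] by simp
  qed
  then show ?thesis unfolding absolutely_continuous_def null_sets_def s by auto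
qed

end
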